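(* Let $\rho\in C^1(\mathbb R)$ be a strictly positive probability density with finite kinetic energy, let $\gamma$ be the optimal transport plan for the problem with Coulomb cost and both marginals equal to $\rho$, let $u$ be its Kantorovich potential and assume that $u''\in L^\infty(\mathbb R)$. Let $V(x,y)=|x-y|^{-1}-u(x)-u(y)$. Then there exists a sequence $\psi_\varepsilon\in H^1(\mathbb R^2)$ such that $\int|\psi_\varepsilon|^2=1$, $|\psi_\varepsilon|^2\rightharpoonup\gamma$ as $\varepsilon\to0$, $|\psi_\varepsilon|^2$ has the same marginals as $\gamma$, and $$\limsup_{\varepsilon\to0}\int_{\mathbb R^2}\Big(\varepsilon^{1/2}\frac{|\nabla\psi_\varepsilon|^2}{2}+\varepsilon^{-1/2}V|\psi_\varepsilon|^2\Big)dx\ \le\ \frac12\int_{\mathbb R^2}\operatorname{tr}\big(\sqrt{D^2V}\big)\,d\gamma .$$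
   Context: The kinetic energy of a density $\rho$ is $\operatorname{KE}(\rho)=\frac12\int|\nabla\sqrt{\rho}|^2$. The optimal plan $\gamma$ is the minimizer of $\int_{\mathbb R^2}|x-y|^{-1}\,d\gamma(x,y)$ among probability measures on $\mathbb R^2$ with both marginals equal to $\rho$; it is unique and of the form $(\mathrm{Id},T)_\#\rho$, where, $m$ being the median of $\rho$, $T$ is defined by $\int_x^{T(x)}\rho=\frac12$ for $x<m$ and $\int_{T(x)}^{x}\rho=\frac12$ for $x>m$. The Kantorovich potential is the function $u:\mathbb R\to\mathbb R$ with $u(x)+u(y)\le|x-y|^{-1}$ for all $x\ne y$, with equality if and only if $y=T(x)$. $\sqrt{D^2V}$ is the positive semidefinite square root of the Hessian of $V$, which is defined and positive semidefinite $\gamma$-a.e. The symbol $\rightharpoonup$ denotes weak convergence of measures. *)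

theory Defs
  imports "HOL-Probability.Probability"
begin

text \<open>The plane is represented by the type \<^typ>\<open>real \<times> real\<close>, so that plans are measures
  on a product and their marginals are the push-forwards under the two projections.\<close>

section \<open>Weak derivatives and Sobolev functions\<close>

definition dir_deriv :: "'a::euclidean_space \<Rightarrow> ('a \<Rightarrow> real) \<Rightarrow> 'a \<Rightarrow> real" where
  "dir_deriv b f x = frechet_derivative f (at x) b"

primrec Ck :: "nat \<Rightarrow> ('a::euclidean_space \<Rightarrow> real) \<Rightarrow> bool" where
  "Ck 0 f \<longleftrightarrow> continuous_on UNIV f"
| "Ck (Suc k) f \<longleftrightarrow> (\<forall>x. f differentiable (at x)) \<and> (\<forall>b\<in>Basis. Ck k (dir_deriv b f))"

definition test_function :: "('a::euclidean_space \<Rightarrow> real) \<Rightarrow> bool" where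
  "test_function \<phi> \<longleftrightarrow> (\<forall>k. Ck k \<phi>) \<and> compact (closure {x. \<phi> x \<noteq> 0})"

definition loc_integrable :: "('a::euclidean_space \<Rightarrow> real) \<Rightarrow> bool" where
  "loc_integrable f \<longleftrightarrow> (\<forall>K. compact K \<longrightarrow> set_integrable lborel K f)"

definition has_weak_partial ::
    "'a::euclidean_space \<Rightarrow> ('a \<Rightarrow> real) \<Rightarrow> ('a \<Rightarrow> real) \<Rightarrow> bool" where
  "has_weak_partial b f g \<longleftrightarrow> loc_integrable f \<and> loc_integrable g \<and>
     (\<forall>\<phi>. test_function \<phi> \<longrightarrow>
        (LINT x|lborel. f x * dir_deriv b \<phi> x) = - (LINT x|lborel. g x * \<phi> x))"

text \<open>\<open>f\<close> belongs to the Sobolev space of square-integrable functions with square-integrable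
  weak gradient, and \<open>G\<close> is its weak gradient (which is unique up to null sets).\<close>

definition H1_with_gradient :: "('a::euclidean_space \<Rightarrow> real) \<Rightarrow> ('a \<Rightarrow> 'a) \<Rightarrow> bool" where
  "H1_with_gradient f G \<longleftrightarrow>
     f \<in> borel_measurable borel \<and> integrable lborel (\<lambda>x. (f x)\<^sup>2) \<and>
     G \<in> borel_measurable borel \<and> integrable lborel (\<lambda>x. (norm (G x))\<^sup>2) \<and>
     (\<forall>b\<in>Basis. has_weak_partial b f (\<lambda>x. G x \<bullet> b))"

definition ess_bounded :: "('a::euclidean_space \<Rightarrow> real) \<Rightarrow> bool" where
  "ess_bounded g \<longleftrightarrow> g \<in> borel_measurable borel \<and> (\<exists>C. AE x in lborel. \<bar>g x\<bar> \<le> C)"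

text \<open>The second derivative of \<open>u\<close>, in the sense of distributions on the line, is an
  essentially bounded function.\<close>

definition second_deriv_Linfty :: "(real \<Rightarrow> real) \<Rightarrow> bool" where
  "second_deriv_Linfty u \<longleftrightarrow>
     (\<exists>v g. has_weak_partial 1 u v \<and> has_weak_partial 1 v g \<and> ess_bounded g)"

section \<open>Densities and optimal plans\<close>

definition density_measure :: "('a::euclidean_space \<Rightarrow> real) \<Rightarrow> 'a measure" where
  "density_measure \<rho> = density lborel (\<lambda>x. ennreal (\<rho> x))"

text \<open>The classical derivative is used: the square root of a strictly positive
  continuously differentiable density is continuously differentiable.\<close>

definition KE :: "(real \<Rightarrow> real) \<Rightarrow> ennreal" where
  "KE \<rho> = ennreal (1/2) * (\<integral>\<^sup>+x. ennreal ((deriv (\<lambda>y. sqrt (\<rho> y)) x)\<^sup>2) \<partial>lborel)"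

definition is_plan :: "(real \<Rightarrow> real) \<Rightarrow> (real \<times> real) measure \<Rightarrow> bool" where
  "is_plan \<rho> \<gamma> \<longleftrightarrow> prob_space \<gamma> \<and> sets \<gamma> = sets borel \<and>
     distr \<gamma> borel fst = density_measure \<rho> \<and> distr \<gamma> borel snd = density_measure \<rho>"

text \<open>Division in \<^typ>\<open>ennreal\<close>: the cost is infinite on the diagonal.\<close>

definition coulomb_cost :: "(real \<times> real) measure \<Rightarrow> ennreal" where
  "coulomb_cost \<gamma> = (\<integral>\<^sup>+p. 1 / ennreal \<bar>fst p - snd p\<bar> \<partial>\<gamma>)"

definition is_optimal_plan :: "(real \<Rightarrow> real) \<Rightarrow> (real \<times> real) measure \<Rightarrow> bool" where
  "is_optimal_plan \<rho> \<gamma> \<longleftrightarrow>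
     is_plan \<rho> \<gamma> \<and> (\<forall>\<gamma>'. is_plan \<rho> \<gamma>' \<longrightarrow> coulomb_cost \<gamma> \<le> coulomb_cost \<gamma>')"

definition is_median :: "(real \<Rightarrow> real) \<Rightarrow> real \<Rightarrow> bool" where
  "is_median \<rho> m \<longleftrightarrow> (LINT x:{..m}|lborel. \<rho> x) = 1/2"

text \<open>The value of the map at the median itself is left unspecified.\<close>

definition is_optimal_map :: "(real \<Rightarrow> real) \<Rightarrow> real \<Rightarrow> (real \<Rightarrow> real) \<Rightarrow> bool" where
  "is_optimal_map \<rho> m T \<longleftrightarrow>
     (\<forall>x<m. (LINT t:{x..T x}|lborel. \<rho> t) = 1/2) \<and>
     (\<forall>x>m. (LINT t:{T x..x}|lborel. \<rho> t) = 1/2)"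

text \<open>There is no point \<open>T m\<close> (the map escapes to infinity at the median \<open>m\<close>), so for \<open>x = m\<close>
  the condition \<open>y = T x\<close> holds for no \<open>y\<close> and the inequality is strict.\<close>

definition is_kantorovich_potential ::
    "real \<Rightarrow> (real \<Rightarrow> real) \<Rightarrow> (real \<Rightarrow> real) \<Rightarrow> bool" where
  "is_kantorovich_potential m T u \<longleftrightarrow>
     (\<forall>x y. x \<noteq> y \<longrightarrow> u x + u y \<le> 1 / \<bar>x - y\<bar> \<and>
        (u x + u y = 1 / \<bar>x - y\<bar> \<longleftrightarrow> x \<noteq> m \<and> y = T x))"

text \<open>On the diagonal, a set that is null for Lebesgue measure and for every plan of finite cost,
  the real-valued function below has an irrelevant value (division by zero).\<close>

definition potential_V :: "(real \<Rightarrow> real) \<Rightarrow> real \<times> real \<Rightarrow> real" where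
  "potential_V u p = 1 / \<bar>fst p - snd p\<bar> - u (fst p) - u (snd p)"

section \<open>The trace of the square root of the Hessian\<close>

definition plane_axis :: "2 \<Rightarrow> real \<times> real" where
  "plane_axis i = (if i = 1 then (1, 0) else (0, 1))"

definition hessian :: "(real \<times> real \<Rightarrow> real) \<Rightarrow> real \<times> real \<Rightarrow> real^2^2" where
  "hessian f p = (\<chi> i j. dir_deriv (plane_axis i) (dir_deriv (plane_axis j) f) p)"

definition psd :: "real^'n^'n \<Rightarrow> bool" where
  "psd A \<longleftrightarrow> transpose A = A \<and> (\<forall>x. 0 \<le> x \<bullet> (A *v x))"

definition psd_sqrt :: "real^'n^'n \<Rightarrow> real^'n^'n" where
  "psd_sqrt A = (THE S. psd S \<and> S ** S = A)"

section \<open>Weak convergence and the energy\<close>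

definition weakly_converges ::
    "('i \<Rightarrow> 'a::topological_space measure) \<Rightarrow> 'a measure \<Rightarrow> 'i filter \<Rightarrow> bool" where
  "weakly_converges \<mu> \<nu> F \<longleftrightarrow>
     (\<forall>f :: 'a \<Rightarrow> real. continuous_on UNIV f \<and> bounded (range f) \<longrightarrow>
        ((\<lambda>i. integral\<^sup>L (\<mu> i) f) \<longlongrightarrow> integral\<^sup>L \<nu> f) F)"

text \<open>For a Kantorovich potential \<open>u\<close> the integrand is nonnegative off the diagonal, so the
  integral is well defined with values in \<open>[0, \<infinity>]\<close>.  The argument \<open>G\<close> is the gradient
  of \<open>\<psi>\<close>.\<close>

definition energy ::
    "(real \<Rightarrow> real) \<Rightarrow> real \<Rightarrow> (real \<times> real \<Rightarrow> real) \<Rightarrow> (real \<times> real \<Rightarrow> real \<times> real) \<Rightarrow> ennreal" where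
  "energy u \<epsilon> \<psi> G =
     (\<integral>\<^sup>+p. ennreal (\<epsilon> powr (1/2) * ((norm (G p))\<^sup>2 / 2)
        + \<epsilon> powr (-1/2) * (potential_V u p * (\<psi> p)\<^sup>2)) \<partial>lborel)"

end

theory Submission
  imports Defs "HOL-Real_Asymp.Real_Asymp"
begin

text \<open>In the quantile coordinates \<open>s = F x\<close>, \<open>t = F y\<close> on the circle \<open>[0, 1)\<close> the optimal plan is the uniform
  measure on the line \<open>t = s + 1/2\<close>. It is smeared out into a mixture, over a profile variable \<open>\<xi>\<close> of law
  \<open>\<theta>\<^sup>2\<close> with \<open>\<theta>\<close> even and supported in \<open>[-1, 1]\<close>, of the uniform measures in \<open>t\<close> on the curves \<open>t = s + 1/2 + \<xi> w(s)\<close>,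
  where \<open>w = \<delta> p\<close> and \<open>\<epsilon> = \<delta>\<^sup>4\<close>. On each curve the \<open>s\<close>-density is \<open>1 + \<xi> w'(s)\<close>, which averages to \<open>1\<close> over the even law
  of \<open>\<xi>\<close>, so both marginals are exact.

  As \<open>\<delta> \<rightarrow> 0\<close> the energy density at \<open>s\<close> tends to \<open>a / p\<^sup>2 + b p\<^sup>2\<close>, where \<open>a\<close> is the kinetic factor
  \<open>\<integral>\<theta>'\<^sup>2\<close> times \<open>(\<rho>(x)\<^sup>2 + \<rho>(T x)\<^sup>2) / 2\<close>, and \<open>b\<close> is \<open>\<integral>\<xi>\<^sup>2 \<theta>\<^sup>2\<close> times the coefficient in \<open>V = B \<tau>\<^sup>2 + o(\<tau>\<^sup>2)\<close>, with \<open>\<tau>\<close> the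
  distance to the line. Dominated convergence applies because the bound on \<open>u''\<close> yields \<open>V \<le> C \<tau>\<^sup>2\<close> uniformly
  up to the median. The choice \<open>p \<approx> (a/b)\<^sup>1\<^sup>/\<^sup>4\<close> gives \<open>2 \<surd>(a b)\<close>, and for a nearly Gaussian \<open>\<theta>\<close> this is
  half the trace of the square root of the Hessian, which is singular on the graph of \<open>T\<close>, because \<open>V \<ge> 0\<close> vanishes there.
  A diagonal argument over the accuracy of these approximations concludes.\<close>

section \<open>Test functions on the line\<close>

text \<open>Balancing a kinetic energy of order \<epsilon>^(1/2) / w^2 against a potential energy of
  order w^2 / \<epsilon>^(1/2) dictates widths w of order \<epsilon>^(1/4). The marginals must be
  exact for every \<epsilon>, so mollifying the plan is not enough; in quantile coordinates both
  become integrals with a closed form. The second one telescopes around the circle, hence the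
  condition \<open>poly p 0 = poly p 1\<close>. The support of \<theta> is compact so that the
  smeared plan avoids the diagonal, where V is unbounded; this excludes the Gaussian, the equality
  case of the Heisenberg inequality, so optimality is reached only in the limit. The amplitude
  contains sqrt (1 + \<xi> w'), so its gradient needs w'', while the optimal width need be neither
  smooth nor bounded; polynomials positive on [0, 1] replace it. Finite kinetic energy acts twice:
  it bounds \<rho>, which separates x from T x, and it makes the gradient of sqrt \<rho> a
  negligible error. The bound V \<le> C \<tau>^2 must survive where \<rho> decays; there the partner
  point is near the median, and the symmetry of V exchanges the roles.\<close>

lemma dir_deriv_real:
  assumes "(f has_real_derivative D) (at x)"
  shows "dir_deriv 1 f x = D"
proof -
  have "(*) D = frechet_derivative f (at x)"
    using assms unfolding has_field_derivative_def by (rule frechet_derivative_at)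
  from fun_cong[OF this, of 1] show ?thesis by (simp add: dir_deriv_def)
qed

lemma Ck_SucI:
  fixes f f' :: "real \<Rightarrow> real"
  assumes "\<And>x. (f has_real_derivative f' x) (at x)" "Ck k f'"
  shows "Ck (Suc k) f"
proof -
  have "dir_deriv 1 f = f'" using dir_deriv_real[OF assms(1)] by auto
  then show ?thesis using assms real_differentiable_def by (auto simp: real_differentiable_def)
qed

lemma Ck_SucD:
  fixes f :: "real \<Rightarrow> real"
  assumes "Ck (Suc k) f"
  shows "(f has_real_derivative dir_deriv 1 f x) (at x)" "Ck k (dir_deriv 1 f)"
proof -
  have "f differentiable at x" using assms by simp
  then obtain D where "(f has_real_derivative D) (at x)" by (auto simp: real_differentiable_def)
  then show "(f has_real_derivative dir_deriv 1 f x) (at x)" using dir_deriv_real by metis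
qed (use assms in simp)

lemma Ck_le_Suc: "Ck (Suc k) f \<Longrightarrow> Ck k f"
proof (induction k arbitrary: f)
  case 0
  then show ?case by (auto intro!: continuous_at_imp_continuous_on differentiable_imp_continuous_within)
next
  case (Suc k)
  then show ?case by simp
qed

lemma Ck_const: "Ck k (\<lambda>x::real. c::real)"
proof (induction k arbitrary: c)
  case (Suc k)
  show ?case by (rule Ck_SucI[of _ "\<lambda>_. 0"]) (auto intro: Suc derivative_eq_intros)
qed simp

lemma Ck_add: "Ck k f \<Longrightarrow> Ck k g \<Longrightarrow> Ck k (\<lambda>x::real. f x + g x :: real)"
proof (induction k arbitrary: f g)
  case (Suc k)
  note d = Ck_SucD[OF Suc.prems(1)] Ck_SucD[OF Suc.prems(2)]
  show ?case
    by (rule Ck_SucI[OF DERIV_add[OF d(1) d(3)]]) (rule Suc.IH[OF d(2) d(4)])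
qed (auto intro: continuous_intros)

lemma Ck_mult: "Ck k f \<Longrightarrow> Ck k g \<Longrightarrow> Ck k (\<lambda>x::real. f x * g x :: real)"
proof (induction k arbitrary: f g)
  case (Suc k)
  note d = Ck_SucD[OF Suc.prems(1)] Ck_SucD[OF Suc.prems(2)]
  show ?case
    by (rule Ck_SucI[OF DERIV_mult[OF d(1) d(3)]])
      (intro Ck_add Suc.IH d Ck_le_Suc[OF Suc.prems(1)] Ck_le_Suc[OF Suc.prems(2)])
qed (auto intro: continuous_intros)

lemma Ck_affine: "Ck k f \<Longrightarrow> Ck k (\<lambda>x::real. f (c * x + d) :: real)"
proof (induction k arbitrary: f)
  case 0
  have "continuous_on UNIV (\<lambda>x. f (c * x + d))"
    by (rule continuous_on_compose2[of UNIV f]) (use 0 in \<open>auto intro!: continuous_intros\<close>)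
  then show ?case by simp
next
  case (Suc k)
  note d = Ck_SucD[OF Suc.prems]
  have "((\<lambda>x. f (c * x + d)) has_real_derivative dir_deriv 1 f (c * x + d) * c) (at x)" for x
  proof (rule DERIV_chain2[OF d(1)])
    show "((\<lambda>x. c * x + d) has_real_derivative c) (at x)"
      by (auto intro!: derivative_eq_intros)
  qed
  then show ?case
    by (rule Ck_SucI) (rule Ck_mult[OF Suc.IH[OF d(2)] Ck_const])
qed

text \<open>A class of functions that is closed under differentiation, so that one derivative lemma
  gives smoothness of every order, including at 0.\<close>

definition flat_exp :: "real poly \<Rightarrow> real \<Rightarrow> real" where
  "flat_exp p x = (if x > 0 then poly p (1/x) * exp (- (1/x)) else 0)"

lemma tendsto_poly_exp_neg: "((\<lambda>z::real. poly p z * exp (- z)) \<longlongrightarrow> 0) at_top"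
proof -
  have "((\<lambda>z::real. \<Sum>i\<le>degree p. coeff p i * (z ^ i / exp z)) \<longlongrightarrow> 0) at_top"
    by (intro tendsto_null_sum tendsto_mult_right_zero tendsto_power_div_exp_0)
  then show ?thesis
    by (simp add: poly_altdef sum_divide_distrib exp_minus field_simps)
qed

text \<open>With z = 1/x one has d/dx = - z^2 d/dz, and d/dz turns p e^(-z) into (p' - p) e^(-z);
  the polynomial \<open>[:0,0,1:]\<close> is the factor z^2.\<close>

lemma flat_exp_deriv:
  "(flat_exp p has_real_derivative flat_exp ([:0,0,1:] * (p - pderiv p)) x) (at x)"
proof -
  consider "x > 0" | "x < 0" | "x = 0" by linarith
  then show ?thesis
  proof cases
    case 1
    have "((\<lambda>x. poly p (1/x) * exp (- (1/x))) has_real_derivative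
        flat_exp ([:0,0,1:] * (p - pderiv p)) x) (at x)"
    proof -
      have d: "((\<lambda>x. 1/x) has_real_derivative - (1/x\<^sup>2)) (at x)"
        using 1 by (auto intro!: derivative_eq_intros simp: power2_eq_square)
      have "((\<lambda>x. poly p (1/x) * exp (- (1/x))) has_real_derivative
          poly (pderiv p) (1/x) * - (1/x\<^sup>2) * exp (- (1/x)) +
          exp (- (1/x)) * - (- (1/x\<^sup>2)) * poly p (1/x)) (at x)"
        by (intro DERIV_mult DERIV_chain2[OF poly_DERIV d] DERIV_fun_exp DERIV_minus d)
      moreover have "poly (pderiv p) (1/x) * - (1/x\<^sup>2) * exp (- (1/x)) +
          exp (- (1/x)) * - (- (1/x\<^sup>2)) * poly p (1/x) = flat_exp ([:0,0,1:] * (p - pderiv p)) x"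
        using 1 by (simp add: flat_exp_def power2_eq_square algebra_simps)
      ultimately show ?thesis by simp
    qed
    then show ?thesis
      by (rule has_field_derivative_transform_within_open[of _ _ _ "{0<..}"])
        (use 1 in \<open>auto simp: flat_exp_def\<close>)
  next
    case 2
    have "((\<lambda>x. 0) has_real_derivative flat_exp ([:0,0,1:] * (p - pderiv p)) x) (at x)"
      using 2 by (auto simp: flat_exp_def)
    then show ?thesis
      by (rule has_field_derivative_transform_within_open[of _ _ _ "{..<0}"])
        (use 2 in \<open>auto simp: flat_exp_def\<close>)
  next
    case 3
    \<comment> \<open>With z = 1/h the difference quotient is z p(z) e^(-z), and the exponential
      wins.\<close>
    have "((\<lambda>h. flat_exp p h / h) \<longlongrightarrow> 0) (at_right 0)"
    proof -
      have "((\<lambda>h::real. poly ([:0,1:] * p) (inverse h) * exp (- inverse h)) \<longlongrightarrow> 0) (at_right 0)"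
        by (rule filterlim_compose[OF tendsto_poly_exp_neg filterlim_inverse_at_top_right])
      moreover have "eventually (\<lambda>h. poly ([:0,1:] * p) (inverse h) * exp (- inverse h)
          = flat_exp p h / h) (at_right (0::real))"
        by (rule eventually_mono[OF eventually_at_right_less]) (simp add: flat_exp_def field_simps)
      ultimately show ?thesis by (rule Lim_transform_eventually)
    qed
    moreover have "((\<lambda>h. flat_exp p h / h) \<longlongrightarrow> 0) (at_left 0)"
      by (rule Lim_transform_eventually[of "\<lambda>_. 0"])
        (auto simp: flat_exp_def eventually_at_filter)
    ultimately have "((\<lambda>h. flat_exp p h / h) \<longlongrightarrow> 0) (at 0)"
      by (simp add: filterlim_split_at)
    then show ?thesis using 3 by (simp add: has_field_derivative_iff flat_exp_def)
  qed
qed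

lemma Ck_flat_exp: "Ck k (flat_exp p)"
proof (induction k arbitrary: p)
  case 0
  show ?case
    using flat_exp_deriv by (auto intro!: continuous_at_imp_continuous_on DERIV_isCont)
next
  case (Suc k)
  show ?case by (rule Ck_SucI[OF flat_exp_deriv Suc])
qed

lemma test_function_bump:
  fixes a b :: real
  assumes "a < b"
  obtains \<phi> where "test_function \<phi>" "\<And>x. 0 \<le> \<phi> x" "\<And>x. \<phi> x > 0 \<longleftrightarrow> x \<in> {a<..<b}"
proof
  \<comment> \<open>Both arguments are written as \<open>c * x + d\<close> to match
    \<open>Ck_affine\<close>.\<close>
  let ?\<phi> = "\<lambda>x. flat_exp 1 (1 * x + (- a)) * flat_exp 1 ((-1) * x + b)"
  show "?\<phi> x \<ge> 0" for x by (auto simp: flat_exp_def)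
  show pos: "?\<phi> x > 0 \<longleftrightarrow> x \<in> {a<..<b}" for x by (auto simp: flat_exp_def)
  have "closure {x. ?\<phi> x \<noteq> 0} \<subseteq> {a..b}"
    by (rule closure_minimal) (auto simp: flat_exp_def)
  then have "compact (closure {x. ?\<phi> x \<noteq> 0})"
    by (meson bounded_closed_interval bounded_subset closed_closure compact_eq_bounded_closed)
  then show "test_function ?\<phi>"
    unfolding test_function_def by (intro conjI allI Ck_mult Ck_affine Ck_flat_exp)
qed

text \<open>Off the closed support the function is locally zero, so differentiation does not enlarge
  the support.\<close>

lemma test_function_dir_deriv:
  fixes \<phi> :: "real \<Rightarrow> real"
  assumes "test_function \<phi>"
  shows "test_function (dir_deriv 1 \<phi>)"
proof -
  have ck: "Ck (Suc k) \<phi>" for k using assms by (simp only: test_function_def)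
  have "{x. dir_deriv 1 \<phi> x \<noteq> 0} \<subseteq> closure {x. \<phi> x \<noteq> 0}"
  proof
    fix x assume x: "x \<in> {x. dir_deriv 1 \<phi> x \<noteq> 0}"
    show "x \<in> closure {x. \<phi> x \<noteq> 0}"
    proof (rule ccontr)
      assume n: "x \<notin> closure {x. \<phi> x \<noteq> 0}"
      have "((\<lambda>_. 0) has_real_derivative 0) (at x)" by simp
      then have "(\<phi> has_real_derivative 0) (at x)"
        by (rule has_field_derivative_transform_within_open[of _ _ _ "- closure {x. \<phi> x \<noteq> 0}"])
          (use n closure_subset[of "{x. \<phi> x \<noteq> 0}"] in auto)
      then show False using x dir_deriv_real by auto
    qed
  qed
  then have "closure {x. dir_deriv 1 \<phi> x \<noteq> 0} \<subseteq> closure {x. \<phi> x \<noteq> 0}"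
    by (simp add: closure_minimal)
  moreover have "compact (closure {x. \<phi> x \<noteq> 0})" using assms by (simp add: test_function_def)
  ultimately have "compact (closure {x. dir_deriv 1 \<phi> x \<noteq> 0})"
    by (meson bounded_subset closed_closure compact_eq_bounded_closed)
  then show ?thesis using Ck_SucD(2)[OF ck] by (simp add: test_function_def)
qed

section \<open>Nearly Gaussian profiles\<close>

text \<open>This is the Euler beta value B(1/2, k + 1); only its recursion in k is used.\<close>

definition beta_int :: "nat \<Rightarrow> real" where
  "beta_int k = integral {-1..1} (\<lambda>x. (1 - x\<^sup>2) ^ k)"

lemma beta_int_has_integral: "((\<lambda>x. (1 - x\<^sup>2) ^ k) has_integral beta_int k) {-1..1::real}"
  unfolding beta_int_def
  by (intro integrable_integral integrable_continuous_interval continuous_intros)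

text \<open>The integrand is the derivative of x (1 - x^2)^(k+1), which vanishes at both ends, once
  x^2 is written as 1 - (1 - x^2).\<close>

lemma beta_int_Suc: "(2 * real k + 3) * beta_int (Suc k) = 2 * (real k + 1) * beta_int k"
proof -
  have "((\<lambda>x. (2 * real k + 3) * (1 - x\<^sup>2) ^ Suc k - 2 * (real k + 1) * (1 - x\<^sup>2) ^ k) has_integral
      (1 * (1 - 1\<^sup>2) ^ Suc k - (-1) * (1 - (-1)\<^sup>2) ^ Suc k)) {-1..1::real}"
  proof (rule fundamental_theorem_of_calculus)
    fix x :: real
    have d: "((\<lambda>x. 1 - x\<^sup>2) has_real_derivative - 2 * x) (at x)"
      by (auto intro!: derivative_eq_intros)
    have "1 * (1 - x\<^sup>2) ^ Suc k + (1 + real k) * (- 2 * x * (1 - x\<^sup>2) ^ k) * x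
        = (2 * real k + 3) * (1 - x\<^sup>2) ^ Suc k - 2 * (real k + 1) * (1 - x\<^sup>2) ^ k"
      by (simp add: algebra_simps power2_eq_square)
    then have "((\<lambda>x. x * (1 - x\<^sup>2) ^ Suc k) has_real_derivative
       (2 * real k + 3) * (1 - x\<^sup>2) ^ Suc k - 2 * (real k + 1) * (1 - x\<^sup>2) ^ k) (at x)"
      by (rule DERIV_cong[OF DERIV_mult[OF DERIV_ident DERIV_power_Suc[OF d]]])
    then show "((\<lambda>x. x * (1 - x\<^sup>2) ^ Suc k) has_vector_derivative
       (2 * real k + 3) * (1 - x\<^sup>2) ^ Suc k - 2 * (real k + 1) * (1 - x\<^sup>2) ^ k) (at x within {-1..1})"
      by (simp add: has_real_derivative_iff_has_vector_derivative has_vector_derivative_at_within)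
  qed simp
  moreover have "((\<lambda>x. (2 * real k + 3) * (1 - x\<^sup>2) ^ Suc k - 2 * (real k + 1) * (1 - x\<^sup>2) ^ k) has_integral
      ((2 * real k + 3) * beta_int (Suc k) - 2 * (real k + 1) * beta_int k)) {-1..1::real}"
    by (intro has_integral_diff has_integral_mult_right beta_int_has_integral)
  ultimately show ?thesis by (auto dest: has_integral_unique)
qed

text \<open>An exponent of at least 2 makes the truncated power continuously differentiable across
  0; this is what allows the profile to be cut off at 1 and -1.\<close>

lemma DERIV_pos_part_power:
  fixes y :: real
  assumes "2 \<le> n"
  shows "((\<lambda>y. max 0 y ^ n) has_real_derivative real n * max 0 y ^ (n - 1)) (at y)"
proof -
  have n0: "n \<noteq> 0" "n - 1 \<noteq> 0" using assms by auto
  consider "y > 0" | "y < 0" | "y = 0" by linarith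
  then show ?thesis
  proof cases
    case 1
    have "((\<lambda>y. y ^ n) has_real_derivative real n * y ^ (n - 1)) (at y)"
      by (auto intro!: derivative_eq_intros)
    then have "((\<lambda>y. max 0 y ^ n) has_real_derivative real n * y ^ (n - 1)) (at y)"
      by (rule has_field_derivative_transform_within_open[of _ _ _ "{0<..}"]) (use 1 in auto)
    then show ?thesis using 1 by simp
  next
    case 2
    have "((\<lambda>y. 0) has_real_derivative 0) (at y)" by simp
    then have "((\<lambda>y. max 0 y ^ n) has_real_derivative 0) (at y)"
      by (rule has_field_derivative_transform_within_open[of _ _ _ "{..<0}"]) (use 2 n0 in auto)
    moreover have "real n * max 0 y ^ (n - 1) = 0"
      using 2 n0(2) by (simp add: max_absorb1)
    ultimately show ?thesis by (simp only:)
  next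
    case 3
    have "((\<lambda>h. max 0 h ^ n / h) \<longlongrightarrow> 0) (at (0::real))"
    proof (rule Lim_null_comparison)
      show "eventually (\<lambda>h. norm (max 0 h ^ n / h) \<le> \<bar>h\<bar>) (at (0::real))"
        unfolding eventually_at
      proof (intro exI conjI ballI impI)
        fix h :: real assume h: "h \<noteq> 0 \<and> dist h 0 < 1"
        show "norm (max 0 h ^ n / h) \<le> \<bar>h\<bar>"
        proof (cases "h > 0")
          case True
          have "h ^ n \<le> h ^ 2" using True h assms by (intro power_decreasing) auto
          then show ?thesis using True by (simp add: field_simps power2_eq_square)
        next
          case False
          then have "max 0 h = 0" by simp
          then show ?thesis using n0 by (simp only: power_0_left if_False div_0 norm_zero abs_ge_zero)
        qed
      qed simp
      show "((\<lambda>h. \<bar>h\<bar>) \<longlongrightarrow> 0) (at (0::real))" by (auto intro!: tendsto_eq_intros)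
    qed
    moreover have "real n * max 0 (0::real) ^ (n - 1) = 0" "max 0 (0::real) ^ n = 0"
      using n0 by (simp_all only: max.idem power_0_left if_False mult_zero_right)
    ultimately show ?thesis unfolding 3 has_field_derivative_iff by (simp only: diff_zero add_0)
  qed
qed

lemma beta_int_pos: "beta_int k > 0"
proof (induction k)
  case 0
  show ?case by (simp add: beta_int_def)
next
  case (Suc k)
  then have "(2 * real k + 3) * beta_int (Suc k) > 0" by (simp add: beta_int_Suc)
  then show ?case by (simp add: zero_less_mult_iff)
qed

text \<open>The profile is \<open>c (1 - x\<^sup>2)\<^sup>n\<close>, which after rescaling approaches a Gaussian; the bound \<open>1/4\<close> is
  the Heisenberg uncertainty constant.\<close>

lemma profile_exists:
  fixes \<eta> :: real
  assumes "\<eta> > 0"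
  obtains \<theta> \<theta>' :: "real \<Rightarrow> real" where
    "\<And>x. (\<theta> has_real_derivative \<theta>' x) (at x)" "continuous_on UNIV \<theta>'"
    "\<And>x. \<theta> (- x) = \<theta> x" "\<And>x. 1 \<le> \<bar>x\<bar> \<Longrightarrow> \<theta> x = 0" "\<And>x. 1 \<le> \<bar>x\<bar> \<Longrightarrow> \<theta>' x = 0"
    "integral {-1..1} (\<lambda>x. (\<theta> x)\<^sup>2) = 1"
    "0 < integral {-1..1} (\<lambda>x. (\<theta>' x)\<^sup>2)" "0 < integral {-1..1} (\<lambda>x. x\<^sup>2 * (\<theta> x)\<^sup>2)"
    "integral {-1..1} (\<lambda>x. (\<theta>' x)\<^sup>2) * integral {-1..1} (\<lambda>x. x\<^sup>2 * (\<theta> x)\<^sup>2) \<le> 1/4 + \<eta>"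
proof -
  \<comment> \<open>The sequence is the product of the two moments computed below in
    \<open>i3\<close> and \<open>i2\<close>.\<close>
  have "(\<lambda>n. real n * (4 * real n + 1) / ((4 * real n - 2) * (4 * real n + 3))) \<longlonglongrightarrow> 1/4"
    by real_asymp
  then have "eventually (\<lambda>n. real n * (4 * real n + 1) / ((4 * real n - 2) * (4 * real n + 3)) < 1/4 + \<eta>) sequentially"
    by (rule order_tendstoD) (use assms in simp)
  then have "eventually (\<lambda>n. n \<ge> 2 \<and> real n * (4 * real n + 1) / ((4 * real n - 2) * (4 * real n + 3)) < 1/4 + \<eta>) sequentially"
    using eventually_ge_at_top eventually_conj by blast
  then obtain n where n: "n \<ge> 2" and le: "real n * (4 * real n + 1) / ((4 * real n - 2) * (4 * real n + 3)) < 1/4 + \<eta>"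
    by (auto simp: eventually_sequentially)
  \<comment> \<open>Normalisation: on [-1, 1] the square of the profile is c^2 (1 -
    x^2)^(2n).\<close>
  define c where "c = 1 / sqrt (beta_int (2*n))"
  have c2: "c\<^sup>2 = 1 / beta_int (2*n)" using beta_int_pos[of "2*n"] by (simp add: c_def power_divide)
  define \<theta> where "\<theta> = (\<lambda>x::real. c * max 0 (1 - x\<^sup>2) ^ n)"
  define \<theta>' where "\<theta>' = (\<lambda>x::real. - 2 * c * real n * x * max 0 (1 - x\<^sup>2) ^ (n - 1))"
  have n0: "n - 1 \<noteq> 0" "n \<noteq> 0" using n by auto
  have ge1: "1 - x\<^sup>2 \<le> 0" if "1 \<le> \<bar>x\<bar>" for x :: real
    using that by (metis abs_le_square_iff abs_one diff_le_0_iff_le one_power2)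
  have le1: "max 0 (1 - x\<^sup>2) = 1 - x\<^sup>2" if "x \<in> {-1..1}" for x :: real
    using that by (simp add: abs_square_le_1 max_def abs_le_iff)
  have der: "(\<theta> has_real_derivative \<theta>' x) (at x)" for x
  proof -
    have d: "((\<lambda>x. 1 - x\<^sup>2) has_real_derivative - 2 * x) (at x)"
      by (auto intro!: derivative_eq_intros)
    have "(\<theta> has_real_derivative c * (real n * max 0 (1 - x\<^sup>2) ^ (n - 1) * (- 2 * x))) (at x)"
      unfolding \<theta>_def by (intro DERIV_cmult DERIV_chain2[OF DERIV_pos_part_power d] n)
    then show ?thesis by (simp add: \<theta>'_def mult_ac)
  qed
  have c1: "continuous_on UNIV \<theta>'"
    unfolding \<theta>'_def by (intro continuous_intros)
  have i1: "((\<lambda>x. (\<theta> x)\<^sup>2) has_integral 1) {-1..1}"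
  proof -
    have "((\<lambda>x. c\<^sup>2 * (1 - x\<^sup>2) ^ (2*n)) has_integral c\<^sup>2 * beta_int (2*n)) {-1..1::real}"
      by (intro has_integral_mult_right beta_int_has_integral)
    moreover have "c\<^sup>2 * beta_int (2*n) = 1" using c2 beta_int_pos[of "2*n"] by simp
    moreover have "(\<theta> x)\<^sup>2 = c\<^sup>2 * (1 - x\<^sup>2) ^ (2*n)" if "x \<in> {-1..1}" for x
      by (simp only: \<theta>_def le1[OF that] power_mult_distrib power_even_eq)
    ultimately show ?thesis
      by (subst has_integral_cong) (assumption, simp only:)
  qed
  obtain k where k: "n = Suc k" using n0 not0_implies_Suc by blast
  let ?J = "beta_int (2*n)"
  \<comment> \<open>The neighbouring beta integrals are all multiples of \<open>?J\<close>, so that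
    the factor c^2 = 1 / \<open>?J\<close> cancels.\<close>
  have J1: "beta_int (2*n+1) = (4*real n + 2) / (4 * real n + 3) * ?J"
    using beta_int_Suc[of "2*n"] by (simp add: field_simps)
  have J2: "beta_int (2*n-1) = (4*real n + 1) / (4 * real n) * ?J"
    using beta_int_Suc[of "2*k+1"] by (simp add: field_simps k)
  have J3: "beta_int (2*n-2) = (4*real n - 1) / (4 * real n - 2) * beta_int (2*n-1)"
    using beta_int_Suc[of "2*k"] by (simp add: field_simps k)
  \<comment> \<open>Here and in \<open>i3\<close> the substitution x^2 = 1 - (1 - x^2) reduces the
    moment to a difference of two beta integrals.\<close>
  have i2: "((\<lambda>x. x\<^sup>2 * (\<theta> x)\<^sup>2) has_integral 1 / (4 * real n + 3)) {-1..1}"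
  proof -
    have "((\<lambda>x. c\<^sup>2 * ((1 - x\<^sup>2) ^ (2*n) - (1 - x\<^sup>2) ^ (2*n+1))) has_integral c\<^sup>2 * (?J - beta_int (2*n+1))) {-1..1::real}"
      by (intro has_integral_mult_right has_integral_diff beta_int_has_integral)
    moreover have "c\<^sup>2 * (?J - beta_int (2*n+1)) = 1 / (4 * real n + 3)"
      unfolding c2 J1 using beta_int_pos[of "2*n"] by (simp add: field_simps)
    moreover have "x\<^sup>2 * (\<theta> x)\<^sup>2 = c\<^sup>2 * ((1 - x\<^sup>2) ^ (2*n) - (1 - x\<^sup>2) ^ (2*n+1))" if "x \<in> {-1..1}" for x
      unfolding \<theta>_def le1[OF that] by (simp add: power_mult_distrib power_mult[symmetric] algebra_simps)
    ultimately show ?thesis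
      by (subst has_integral_cong) (assumption, simp only:)
  qed
  have i3: "((\<lambda>x. (\<theta>' x)\<^sup>2) has_integral real n * (4 * real n + 1) / (4 * real n - 2)) {-1..1}"
  proof -
    have "((\<lambda>x. 4 * (real n)\<^sup>2 * c\<^sup>2 * ((1 - x\<^sup>2) ^ (2*n-2) - (1 - x\<^sup>2) ^ (2*n-1))) has_integral
        4 * (real n)\<^sup>2 * c\<^sup>2 * (beta_int (2*n-2) - beta_int (2*n-1))) {-1..1::real}"
      by (intro has_integral_mult_right has_integral_diff beta_int_has_integral)
    moreover have "4 * (real n)\<^sup>2 * c\<^sup>2 * (beta_int (2*n-2) - beta_int (2*n-1)) = real n * (4 * real n + 1) / (4 * real n - 2)"
    proof -
      have "4 * real n - 2 \<noteq> 0" "real n \<noteq> 0" using n by auto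
      then show ?thesis
        unfolding c2 J3 J2 using beta_int_pos[of "2*n"] by (simp add: field_simps power2_eq_square)
    qed
    moreover have "(\<theta>' x)\<^sup>2 = 4 * (real n)\<^sup>2 * c\<^sup>2 * ((1 - x\<^sup>2) ^ (2*n-2) - (1 - x\<^sup>2) ^ (2*n-1))" if "x \<in> {-1..1}" for x
    proof -
      have "(1 - x\<^sup>2) ^ (2*n-2) = ((1 - x\<^sup>2) ^ (n-1))\<^sup>2"
        by (simp add: k power_even_eq)
      moreover have "(1 - x\<^sup>2) ^ (2*n-1) = ((1 - x\<^sup>2) ^ (n-1))\<^sup>2 * (1 - x\<^sup>2)"
        by (simp add: k power_even_eq)
      moreover have "(\<theta>' x)\<^sup>2 = 4 * (real n)\<^sup>2 * c\<^sup>2 * (x\<^sup>2 * ((1 - x\<^sup>2) ^ (n-1))\<^sup>2)"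
        unfolding \<theta>'_def le1[OF that] by (simp add: power_mult_distrib)
      ultimately show ?thesis by (simp only:) (simp add: algebra_simps)
    qed
    ultimately show ?thesis
      by (subst has_integral_cong) (assumption, simp only:)
  qed
  show ?thesis
  proof (rule that[OF der c1])
    show "\<theta> (- x) = \<theta> x" for x by (simp add: \<theta>_def)
    show "1 \<le> \<bar>x\<bar> \<Longrightarrow> \<theta> x = 0" "1 \<le> \<bar>x\<bar> \<Longrightarrow> \<theta>' x = 0" for x
      using ge1[of x] n0 by (auto simp: \<theta>_def \<theta>'_def max_def)
    show "integral {-1..1} (\<lambda>x. (\<theta> x)\<^sup>2) = 1" using i1 by (rule integral_unique)
    show "0 < integral {-1..1} (\<lambda>x. (\<theta>' x)\<^sup>2)" "0 < integral {-1..1} (\<lambda>x. x\<^sup>2 * (\<theta> x)\<^sup>2)"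
      using n by (auto simp: integral_unique[OF i2] integral_unique[OF i3])
    show "integral {-1..1} (\<lambda>x. (\<theta>' x)\<^sup>2) * integral {-1..1} (\<lambda>x. x\<^sup>2 * (\<theta> x)\<^sup>2) \<le> 1/4 + \<eta>"
      using le by (simp add: integral_unique[OF i2] integral_unique[OF i3])
  qed
qed

section \<open>Polynomial widths\<close>

definition clamp_unit :: "real \<Rightarrow> real" where
  "clamp_unit z = max 0 (min 1 z)"

text \<open>Without clamping the two summands are equal and give the minimum 2 sqrt(a b). Where the
  clamp is active, the summand that dominates is b / K^2 (lower clamp) or a / K^2 (upper clamp),
  hence at most M / K^2, and the other one is smaller.\<close>

lemma clamped_weight:
  fixes a b M K :: real
  assumes "0 < a" "0 < b" "a \<le> M" "b \<le> M" "K \<ge> 1"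
  defines "W \<equiv> max (1/K) (min K (root 4 (a/b)))"
  shows "a / W\<^sup>2 + b * W\<^sup>2 \<le> 2 * sqrt (a * b) + 2 * M / K\<^sup>2"
proof -
  define r where "r = sqrt (a/b)"
  have r: "r > 0" "r\<^sup>2 = a/b" using assms by (auto simp: r_def)
  have root2: "(root 4 (a/b))\<^sup>2 = r"
  proof -
    have "root 4 (a/b) = sqrt r"
      using real_root_mult_exp[of 2 2 "a/b"] by (simp add: r_def sqrt_def)
    then show ?thesis using r by simp
  qed
  have K: "K > 0" "1/K \<le> K"
  proof -
    show "K > 0" using assms by simp
    have "1/K \<le> 1/1" by (rule divide_left_mono) (use assms in auto)
    then show "1/K \<le> K" using assms by linarith
  qed
  have rt: "root 4 (a/b) > 0" using assms by simp
  have M0: "2 * M / K\<^sup>2 \<ge> 0" "sqrt (a*b) \<ge> 0" using assms by auto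
  consider "root 4 (a/b) < 1/K" | "root 4 (a/b) > K" | "1/K \<le> root 4 (a/b)" "root 4 (a/b) \<le> K"
    by linarith
  then show ?thesis
  proof cases
    case 1
    then have W: "W = 1/K" using K by (simp add: W_def)
    have "r < (1/K)\<^sup>2" unfolding root2[symmetric] using 1 rt by (intro power_strict_mono) auto
    then have "r\<^sup>2 \<le> ((1/K)\<^sup>2)\<^sup>2" using r by (intro power_mono) auto
    then have "a \<le> b * ((1/K)\<^sup>2)\<^sup>2" using r assms by (simp add: field_simps)
    then have "a * K\<^sup>2 \<le> b * ((1/K)\<^sup>2)\<^sup>2 * K\<^sup>2" by (intro mult_right_mono) auto
    also have "\<dots> = b / K\<^sup>2" using K by (simp add: power2_eq_square)
    finally have "a / W\<^sup>2 + b * W\<^sup>2 \<le> 2 * (b / K\<^sup>2)" using K by (simp add: W power_divide)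
    also have "\<dots> \<le> 2 * (M / K\<^sup>2)" using assms by (intro mult_left_mono divide_right_mono) auto
    finally show ?thesis using M0 by linarith
  next
    case 2
    then have W: "W = K" using K by (simp add: W_def)
    have "K\<^sup>2 < r" unfolding root2[symmetric] using 2 rt K by (intro power_strict_mono) auto
    then have "(K\<^sup>2)\<^sup>2 \<le> r\<^sup>2" using r by (intro power_mono) auto
    then have "b * (K\<^sup>2)\<^sup>2 \<le> a" using r assms by (simp add: field_simps)
    then have "b * K\<^sup>2 \<le> a / K\<^sup>2" using K by (simp add: field_simps power2_eq_square)
    then have "a / W\<^sup>2 + b * W\<^sup>2 \<le> 2 * (a / K\<^sup>2)" by (simp add: W)
    also have "\<dots> \<le> 2 * (M / K\<^sup>2)" using assms by (intro mult_left_mono divide_right_mono) auto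
    finally show ?thesis using M0 by linarith
  next
    case 3
    then have W: "W\<^sup>2 = r" using root2 by (simp add: W_def)
    have "sqrt (a*b) = b * r"
    proof (rule real_sqrt_unique)
      show "(b * r)\<^sup>2 = a * b"
        unfolding power_mult_distrib r(2) using assms by (simp add: power2_eq_square)
      show "b * r \<ge> 0" using r assms by simp
    qed
    moreover have "a / r = b * r"
    proof -
      have "a = b * r * r" using r assms by (simp add: power2_eq_square mult.assoc)
      then show ?thesis using r(1) by (metis nonzero_mult_div_cancel_right less_irrefl)
    qed
    ultimately show ?thesis using M0 by (simp add: W)
  qed
qed

text \<open>Stone-Weierstrass does not preserve the equality of the end values. With tolerance e/3
  the end values differ by at most 2e/3, and subtracting a linear function repairs this within the
  remaining error.\<close>

lemma polynomial_approx:
  fixes f :: "real \<Rightarrow> real"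
  assumes "continuous_on {0..1} f" "f 0 = f 1" "e > 0"
  obtains p :: "real poly" where "poly p 0 = poly p 1" "\<And>s. s \<in> {0..1} \<Longrightarrow> \<bar>poly p s - f s\<bar> \<le> e"
proof -
  obtain g where g: "real_polynomial_function g" "\<And>s. s \<in> {0..1} \<Longrightarrow> \<bar>f s - g s\<bar> < e/3"
    using Stone_Weierstrass_real_polynomial_function[OF compact_Icc assms(1), of "e/3"] assms(3) by auto
  then obtain a n where an: "g = (\<lambda>x. \<Sum>i\<le>n. a i * x ^ i)"
    unfolding real_polynomial_function_iff_sum by blast
  define q where "q = (\<Sum>i\<le>n. monom (a i) i)"
  have q: "poly q = g" by (simp add: q_def an poly_sum poly_monom fun_eq_iff)
  define p where "p = q + [:0, poly q 0 - poly q 1:]"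
  have p: "poly p s = g s + s * (g 0 - g 1)" for s by (simp add: p_def q)
  show ?thesis
  proof
    show "poly p 0 = poly p 1" by (simp add: p)
    fix s :: real assume s: "s \<in> {0..1}"
    have "\<bar>g 0 - g 1\<bar> \<le> \<bar>f 0 - g 0\<bar> + \<bar>f 1 - g 1\<bar>" using assms(2) by linarith
    also have "\<dots> \<le> e/3 + e/3" using g(2)[of 0] g(2)[of 1] by (intro add_mono) auto
    finally have "\<bar>g 0 - g 1\<bar> \<le> 2 * e/3" by simp
    then have "\<bar>s * (g 0 - g 1)\<bar> \<le> 1 * (2 * e/3)"
      unfolding abs_mult using s by (intro mult_mono) auto
    then show "\<bar>poly p s - f s\<bar> \<le> e" using g(2)[OF s] unfolding p by linarith
  qed
qed

text \<open>The pointwise minimiser \<open>(a/b) powr (1/4)\<close> of the integrand is clamped away from \<open>0\<close> and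
  \<open>\<infinity>\<close>, deformed to \<open>1\<close> near the three exceptional points, and then approximated by polynomials.\<close>

lemma weight_exists:
  fixes a b :: "real \<Rightarrow> real" and M \<eta> :: real
  defines "S \<equiv> {0<..<1} - {1/2}"
  assumes cont: "continuous_on S a" "continuous_on S b"
    and bds: "\<And>s. s \<in> S \<Longrightarrow> 0 < a s \<and> a s \<le> M \<and> 0 < b s \<and> b s \<le> M"
    and \<eta>: "\<eta> > 0"
  obtains p :: "real poly" where "\<And>s. s \<in> {0..1} \<Longrightarrow> poly p s > 0" "poly p 0 = poly p 1"
    "(\<integral>\<^sup>+s. ennreal (a s / (poly p s)\<^sup>2 + b s * (poly p s)\<^sup>2) * indicator S s \<partial>lborel)
      \<le> (\<integral>\<^sup>+s. ennreal (2 * sqrt (a s * b s)) * indicator S s \<partial>lborel) + ennreal \<eta>"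
proof -
  have "1/4 \<in> S" by (simp add: S_def)
  with bds have M: "M > 0" by force
  \<comment> \<open>Any K at least max 1 (4M/\<eta>) works, since then K^2 \<ge> K; this makes the
    clamping error of \<open>clamped_weight\<close> at most \<eta>/2.\<close>
  obtain K where K: "K \<ge> 1" "2 * M / K\<^sup>2 \<le> \<eta>/2"
  proof
    show "max 1 (4 * M / \<eta>) \<ge> (1::real)" by simp
    have "4 * M / \<eta> \<le> max 1 (4 * M / \<eta>) * 1" by simp
    also have "\<dots> \<le> (max 1 (4 * M / \<eta>))\<^sup>2" unfolding power2_eq_square by (intro mult_left_mono) auto
    finally show "2 * M / (max 1 (4 * M / \<eta>))\<^sup>2 \<le> \<eta>/2" using \<eta> M
      by (simp add: field_simps)
  qed
  define W where "W s = max (1/K) (min K (root 4 (a s / b s)))" for s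
  \<comment> \<open>The product of the three factors vanishes exactly at 0, 1/2 and 1 within the
    unit interval. So the cutoff is 0 near these points, and at any other fixed s it equals 1 for
    large j.\<close>
  define \<zeta> where "\<zeta> j s = clamp_unit (real j * (s * \<bar>s - 1/2\<bar> * (1 - s)) - 1)" for j s
  define \<omega> where "\<omega> j s = (if s \<in> S then (1 - \<zeta> j s) + \<zeta> j s * W s else 1)" for j s
  have \<zeta>01: "0 \<le> \<zeta> j s" "\<zeta> j s \<le> 1" for j s by (auto simp: \<zeta>_def clamp_unit_def)
  have K': "0 < 1/K" "1/K \<le> 1" "K > 0" using K by auto
  have Wb: "1/K \<le> W s" "W s \<le> K" for s using order_trans[OF K'(2) K(1)] by (auto simp: W_def)
  have \<omega>b: "1/K \<le> \<omega> j s \<and> \<omega> j s \<le> K" for j s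
  proof (cases "s \<in> S")
    case True
    have "(1 - \<zeta> j s) * (1/K) + \<zeta> j s * (1/K) \<le> (1 - \<zeta> j s) * 1 + \<zeta> j s * W s"
      using \<zeta>01[of j s] Wb[of s] K' by (intro add_mono mult_left_mono) auto
    moreover have "(1 - \<zeta> j s) * 1 + \<zeta> j s * W s \<le> (1 - \<zeta> j s) * K + \<zeta> j s * K"
      using \<zeta>01[of j s] Wb[of s] K(1) by (intro add_mono mult_left_mono) auto
    ultimately show ?thesis using True by (simp add: \<omega>_def algebra_simps)
  qed (use K K' in \<open>simp add: \<omega>_def\<close>)
  have Scont: "continuous_on S W"
    unfolding W_def using cont bds by (intro continuous_intros) force+
  \<comment> \<open>Pasting of two closed sets: where the cutoff argument is nonnegative the point
    lies in \<open>S\<close> and the formula with \<open>W\<close> is continuous; where it is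
    nonpositive the function is the constant 1, so no continuity of \<open>W\<close> at the
    exceptional points enters.\<close>
  have \<omega>cont: "continuous_on {0..1} (\<omega> j)" for j
  proof -
    let ?f = "\<lambda>s::real. real j * (s * \<bar>s - 1/2\<bar> * (1 - s)) - 1"
    have fc: "continuous_on A ?f" for A by (intro continuous_intros)
    have sub: "{0..1} \<inter> ?f -` {0..} \<subseteq> S"
    proof
      fix s assume "s \<in> {0..1} \<inter> ?f -` {0..}"
      then have s: "s \<in> {0..1}" "real j * (s * \<bar>s - 1/2\<bar> * (1 - s)) \<ge> 1" by auto
      have "s * \<bar>s - 1/2\<bar> * (1 - s) \<noteq> 0" using s(2) by force
      then have "s \<noteq> 0" "s \<noteq> 1" "s \<noteq> 1/2" by auto
      then show "s \<in> S" using s(1) by (simp add: S_def)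
    qed
    have cl: "closed ({0..1} \<inter> ?f -` {0..})" "closed ({0..1} \<inter> ?f -` {..0})"
      by (intro continuous_closed_preimage fc; simp)+
    have un: "{0..1} = ({0..1} \<inter> ?f -` {0..}) \<union> ({0..1} \<inter> ?f -` {..0})" by auto
    have "continuous_on (({0..1} \<inter> ?f -` {0..}) \<union> ({0..1} \<inter> ?f -` {..0})) (\<omega> j)"
    proof (rule continuous_on_closed_Un[OF cl])
      have "continuous_on ({0..1} \<inter> ?f -` {0..}) (\<lambda>s. (1 - \<zeta> j s) + \<zeta> j s * W s)"
        unfolding \<zeta>_def clamp_unit_def
        by (intro continuous_intros continuous_on_subset[OF Scont sub])
      then show "continuous_on ({0..1} \<inter> ?f -` {0..}) (\<omega> j)"
        by (rule continuous_on_eq) (use sub in \<open>auto simp: \<omega>_def\<close>)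
      have "continuous_on ({0..1} \<inter> ?f -` {..0}) (\<lambda>s. 1::real)" by (intro continuous_intros)
      then show "continuous_on ({0..1} \<inter> ?f -` {..0}) (\<omega> j)"
        by (rule continuous_on_eq) (auto simp: \<omega>_def \<zeta>_def clamp_unit_def)
    qed
    then show ?thesis by (simp only: un[symmetric])
  qed
  \<comment> \<open>The tolerance never exceeds half of the lower bound 1/K, so the polynomial stays
    above 1/(2K), and it tends to 0 with j.\<close>
  have "\<exists>p. poly p 0 = poly p 1 \<and> (\<forall>s\<in>{0..1}. \<bar>poly p s - \<omega> j s\<bar> \<le> 1 / (2 * K * (real j + 1)))" for j
  proof -
    have "0 \<notin> S" "1 \<notin> S" by (auto simp: S_def)
    then have "\<omega> j 0 = \<omega> j 1" by (simp add: \<omega>_def)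
    moreover have "1 / (2 * K * (real j + 1)) > 0" using K' by simp
    ultimately show ?thesis using polynomial_approx[OF \<omega>cont] by metis
  qed
  then obtain P where P: "\<And>j. poly (P j) 0 = poly (P j) 1"
    "\<And>j s. s \<in> {0..1} \<Longrightarrow> \<bar>poly (P j) s - \<omega> j s\<bar> \<le> 1 / (2 * K * (real j + 1))" by metis
  have Pb: "1/(2*K) \<le> poly (P j) s \<and> poly (P j) s \<le> 2 * K" if "s \<in> {0..1}" for j s
  proof -
    have "1 / (2 * K * (real j + 1)) \<le> 1 / (2*K)" using K' by (intro divide_left_mono) (auto intro: mult_pos_pos)
    moreover have "1/K = 1/(2*K) + 1/(2*K)" by (simp add: field_simps)
    moreover have "1/(2*K) \<le> K"
    proof -
      have "1/(2*K) \<le> 1/1" by (rule divide_left_mono) (use K in auto)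
      then show ?thesis using K by linarith
    qed
    ultimately show ?thesis using P(2)[OF that, of j] \<omega>b[of j s] by linarith
  qed
  have lim: "(\<lambda>j. poly (P j) s) \<longlonglongrightarrow> W s" if s: "s \<in> S" for s
  proof -
    have s01: "s \<in> {0..1}" using s by (auto simp: S_def)
    have c: "s * \<bar>s - 1/2\<bar> * (1 - s) > 0" using s by (auto simp: S_def)
    have "filterlim (\<lambda>j. real j * (s * \<bar>s - 1/2\<bar> * (1 - s))) at_top sequentially"
      using c by (intro filterlim_at_top_mult_tendsto_pos[OF tendsto_const] filterlim_real_sequentially) auto
    then have "eventually (\<lambda>j. real j * (s * \<bar>s - 1/2\<bar> * (1 - s)) \<ge> 2) sequentially"
      by (simp add: filterlim_at_top)
    then have ev: "eventually (\<lambda>j. \<omega> j s = W s) sequentially"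
      by eventually_elim (use s in \<open>auto simp: \<omega>_def \<zeta>_def clamp_unit_def\<close>)
    have "(\<lambda>j. 1 / (2 * K * (real j + 1))) \<longlonglongrightarrow> 0" using K' by real_asymp
    moreover have "eventually (\<lambda>j. norm (poly (P j) s - W s) \<le> 1 / (2 * K * (real j + 1))) sequentially"
      using ev by eventually_elim (use P(2)[OF s01] in \<open>metis real_norm_def\<close>)
    ultimately have "(\<lambda>j. poly (P j) s - W s) \<longlonglongrightarrow> 0" by (rule Lim_null_comparison[rotated])
    then show ?thesis by (simp add: LIM_zero_iff)
  qed
  have meas: "(\<lambda>s. a s * indicator S s) \<in> borel_measurable borel" "(\<lambda>s. b s * indicator S s) \<in> borel_measurable borel"
    using borel_measurable_continuous_on_indicator[OF _ cont(1)]
      borel_measurable_continuous_on_indicator[OF _ cont(2)] by (simp_all add: S_def mult.commute)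
  define h where "h w s = ennreal (a s / w\<^sup>2 + b s * w\<^sup>2) * indicator S s" for w s
  have h_eq: "h w s = ennreal ((a s * indicator S s) / w\<^sup>2 + (b s * indicator S s) * w\<^sup>2)" for w s
    by (auto simp: h_def indicator_def)
  have Sm: "S \<in> sets borel" by (simp add: S_def)
  have mP: "poly (P j) \<in> borel_measurable borel" for j
    by (intro borel_measurable_continuous_onI continuous_on_poly continuous_on_id)
  have mW: "(\<lambda>s. W s * indicator S s) \<in> borel_measurable borel"
    using borel_measurable_continuous_on_indicator[OF Sm Scont] by (simp add: mult.commute)
  \<comment> \<open>Dominated convergence in j, with a majorant from 1/(2K) \<le> p \<le> 2K. The
    width \<open>W\<close> is multiplied by the indicator because only then is it known to be Borel;
    outside \<open>S\<close> the function \<open>h\<close> is zero anyway.\<close>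
  have "(\<lambda>j. \<integral>\<^sup>+s. h (poly (P j) s) s \<partial>lborel) \<longlonglongrightarrow> (\<integral>\<^sup>+s. h (W s * indicator S s) s \<partial>lborel)"
  proof (rule nn_integral_dominated_convergence[where w = "\<lambda>s. ennreal (M * (4 * K\<^sup>2) + M * (4 * K\<^sup>2)) * indicator S s"])
    show "(\<lambda>s. h (poly (P j) s) s) \<in> borel_measurable lborel" for j
      unfolding h_eq using meas mP[of j] by measurable
    show "(\<lambda>s. h (W s * indicator S s) s) \<in> borel_measurable lborel"
      unfolding h_eq using meas mW by measurable
    show "(\<lambda>s. ennreal (M * (4 * K\<^sup>2) + M * (4 * K\<^sup>2)) * indicator S s) \<in> borel_measurable lborel"
      using Sm by measurable
    show "AE s in lborel. h (poly (P j) s) s \<le> ennreal (M * (4 * K\<^sup>2) + M * (4 * K\<^sup>2)) * indicator S s" for j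
    proof (intro AE_I2)
      fix s
      show "h (poly (P j) s) s \<le> ennreal (M * (4 * K\<^sup>2) + M * (4 * K\<^sup>2)) * indicator S s"
      proof (cases "s \<in> S")
        case True
        then have s01: "s \<in> {0..1}" by (auto simp: S_def)
        note pb = Pb[OF s01, of j] bds[OF True]
        have w0: "poly (P j) s > 0" "1/(2*K) > 0" using pb K' by (auto intro: less_le_trans[of 0 "1/(2*K)"])
        have "a s / (poly (P j) s)\<^sup>2 \<le> M / (1/(2*K))\<^sup>2"
          using pb w0 by (intro frac_le power_mono) auto
        also have "M / (1/(2*K))\<^sup>2 = M * (4 * K\<^sup>2)" by (simp add: power2_eq_square)
        finally have 1: "a s / (poly (P j) s)\<^sup>2 \<le> M * (4 * K\<^sup>2)" .
        have "b s * (poly (P j) s)\<^sup>2 \<le> M * (2 * K)\<^sup>2"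
          using pb w0 M by (intro mult_mono power_mono less_imp_le[OF w0(1)]) auto
        then have 2: "b s * (poly (P j) s)\<^sup>2 \<le> M * (4 * K\<^sup>2)" by (simp add: power_mult_distrib)
        show ?thesis unfolding h_def using 1 2 by (intro mult_right_mono ennreal_leI) auto
      qed (simp add: h_def)
    qed
    have "(\<integral>\<^sup>+s. ennreal (M * (4 * K\<^sup>2) + M * (4 * K\<^sup>2)) * indicator S s \<partial>lborel)
        \<le> (\<integral>\<^sup>+s. ennreal (M * (4 * K\<^sup>2) + M * (4 * K\<^sup>2)) * indicator {0..1::real} s \<partial>lborel)"
      by (intro nn_integral_mono mult_left_mono) (auto simp: indicator_def S_def)
    also have "\<dots> < \<infinity>" by (simp add: nn_integral_cmult ennreal_mult_less_top)
    finally show "(\<integral>\<^sup>+s. ennreal (M * (4 * K\<^sup>2) + M * (4 * K\<^sup>2)) * indicator S s \<partial>lborel) < \<infinity>" .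
    show "AE s in lborel. (\<lambda>j. h (poly (P j) s) s) \<longlonglongrightarrow> h (W s * indicator S s) s"
    proof (intro AE_I2)
      fix s
      show "(\<lambda>j. h (poly (P j) s) s) \<longlonglongrightarrow> h (W s * indicator S s) s"
      proof (cases "s \<in> S")
        case True
        have "W s \<noteq> 0" using Wb[of s] K' by linarith
        then have "(\<lambda>j. ennreal (a s / (poly (P j) s)\<^sup>2 + b s * (poly (P j) s)\<^sup>2))
            \<longlonglongrightarrow> ennreal (a s / (W s)\<^sup>2 + b s * (W s)\<^sup>2)"
          by (intro tendsto_ennrealI tendsto_intros lim True) auto
        then show ?thesis using True by (simp add: h_def)
      qed (simp add: h_def)
    qed
  qed
  moreover have "(\<integral>\<^sup>+s. h (W s * indicator S s) s \<partial>lborel)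
      \<le> (\<integral>\<^sup>+s. ennreal (2 * sqrt (a s * b s)) * indicator S s \<partial>lborel) + ennreal (\<eta>/2)"
  proof -
    have "(\<integral>\<^sup>+s. h (W s * indicator S s) s \<partial>lborel)
       \<le> (\<integral>\<^sup>+s. ennreal (2 * sqrt (a s * b s)) * indicator S s + ennreal (\<eta>/2) * indicator {0..1::real} s \<partial>lborel)"
    proof (rule nn_integral_mono)
      fix s
      show "h (W s * indicator S s) s \<le> ennreal (2 * sqrt (a s * b s)) * indicator S s + ennreal (\<eta>/2) * indicator {0..1::real} s"
      proof (cases "s \<in> S")
        case True
        then have "s \<in> {0..1}" by (auto simp: S_def)
        have "a s / (W s)\<^sup>2 + b s * (W s)\<^sup>2 \<le> 2 * sqrt (a s * b s) + 2 * M / K\<^sup>2"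
          unfolding W_def using bds[OF True] K by (intro clamped_weight) auto
        then have "a s / (W s)\<^sup>2 + b s * (W s)\<^sup>2 \<le> 2 * sqrt (a s * b s) + \<eta>/2" using K by linarith
        then have "ennreal (a s / (W s)\<^sup>2 + b s * (W s)\<^sup>2) \<le> ennreal (2 * sqrt (a s * b s)) + ennreal (\<eta>/2)"
          using \<eta> bds[OF True] by (subst ennreal_plus[symmetric]) (auto intro: ennreal_leI simp del: ennreal_plus)
        then show ?thesis using True \<open>s \<in> {0..1}\<close> by (simp add: h_def)
      qed (simp add: h_def)
    qed
    also have "\<dots> = (\<integral>\<^sup>+s. ennreal (2 * sqrt (a s * b s)) * indicator S s \<partial>lborel) + ennreal (\<eta>/2)"
    proof -
      have e: "ennreal (2 * sqrt (a s * b s)) * indicator S s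
          = ennreal (2 * sqrt ((a s * indicator S s) * (b s * indicator S s)))" for s
        by (auto simp: indicator_def)
      have "(\<lambda>s. ennreal (2 * sqrt (a s * b s)) * indicator S s) \<in> borel_measurable lborel"
        unfolding e using meas by measurable
      then show ?thesis by (subst nn_integral_add) (auto simp: nn_integral_cmult)
    qed
    finally show ?thesis .
  qed
  \<comment> \<open>Finiteness is needed because adding \<eta>/2 and adding \<eta> can be compared
    strictly in \<open>ennreal\<close> only below infinity.\<close>
  moreover have "(\<integral>\<^sup>+s. ennreal (2 * sqrt (a s * b s)) * indicator S s \<partial>lborel) < \<infinity>"
  proof -
    have "(\<integral>\<^sup>+s. ennreal (2 * sqrt (a s * b s)) * indicator S s \<partial>lborel) \<le> (\<integral>\<^sup>+s. ennreal (2 * M) * indicator {0..1::real} s \<partial>lborel)"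
    proof (rule nn_integral_mono)
      fix s
      show "ennreal (2 * sqrt (a s * b s)) * indicator S s \<le> ennreal (2 * M) * indicator {0..1::real} s"
      proof (cases "s \<in> S")
        case True
        have "sqrt (a s * b s) \<le> sqrt (M * M)"
          using bds[OF True] M by (intro real_sqrt_le_mono mult_mono) auto
        then have "sqrt (a s * b s) \<le> M" using M by simp
        then show ?thesis using True by (auto simp: S_def intro: ennreal_leI)
      qed simp
    qed
    also have "\<dots> < \<infinity>" by (simp add: nn_integral_cmult ennreal_mult_less_top)
    finally show ?thesis .
  qed
  ultimately have "eventually (\<lambda>j. (\<integral>\<^sup>+s. h (poly (P j) s) s \<partial>lborel)
      < (\<integral>\<^sup>+s. ennreal (2 * sqrt (a s * b s)) * indicator S s \<partial>lborel) + ennreal \<eta>) sequentially"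
  proof -
    assume l: "(\<lambda>j. \<integral>\<^sup>+s. h (poly (P j) s) s \<partial>lborel) \<longlonglongrightarrow> (\<integral>\<^sup>+s. h (W s * indicator S s) s \<partial>lborel)"
      and le: "(\<integral>\<^sup>+s. h (W s * indicator S s) s \<partial>lborel)
      \<le> (\<integral>\<^sup>+s. ennreal (2 * sqrt (a s * b s)) * indicator S s \<partial>lborel) + ennreal (\<eta>/2)"
      and fin: "(\<integral>\<^sup>+s. ennreal (2 * sqrt (a s * b s)) * indicator S s \<partial>lborel) < \<infinity>"
    have "(\<integral>\<^sup>+s. ennreal (2 * sqrt (a s * b s)) * indicator S s \<partial>lborel) + ennreal (\<eta>/2)
      < (\<integral>\<^sup>+s. ennreal (2 * sqrt (a s * b s)) * indicator S s \<partial>lborel) + ennreal \<eta>"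
      using fin \<eta> by (subst ennreal_add_left_cancel_less) (auto simp: ennreal_less_iff)
    with le have "(\<integral>\<^sup>+s. h (W s * indicator S s) s \<partial>lborel)
      < (\<integral>\<^sup>+s. ennreal (2 * sqrt (a s * b s)) * indicator S s \<partial>lborel) + ennreal \<eta>" by (rule le_less_trans)
    with l show ?thesis by (rule order_tendstoD)
  qed
  then obtain j where j: "(\<integral>\<^sup>+s. h (poly (P j) s) s \<partial>lborel)
      < (\<integral>\<^sup>+s. ennreal (2 * sqrt (a s * b s)) * indicator S s \<partial>lborel) + ennreal \<eta>"
    by (auto simp: eventually_sequentially)
  show ?thesis
  proof (rule that[of "P j"])
    show "poly (P j) s > 0" if "s \<in> {0..1}" for s
      using Pb[OF that, of j] K' by (auto intro: less_le_trans[of 0 "1/(2*K)"])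
    show "(\<integral>\<^sup>+s. ennreal (a s / (poly (P j) s)\<^sup>2 + b s * (poly (P j) s)\<^sup>2) * indicator S s \<partial>lborel)
      \<le> (\<integral>\<^sup>+s. ennreal (2 * sqrt (a s * b s)) * indicator S s \<partial>lborel) + ennreal \<eta>"
      using j by (simp add: h_def less_imp_le)
  qed (rule P(1))
qed

section \<open>Quantile coordinates\<close>

locale positive_density =
  fixes \<rho> :: "real \<Rightarrow> real"
  assumes C1: "\<rho> C1_differentiable_on UNIV"
    and pos: "\<And>x. \<rho> x > 0"
    and prob: "prob_space (density_measure \<rho>)"
    and KE_finite: "KE \<rho> < \<infinity>"
begin

definition F :: "real \<Rightarrow> real" where
  "F x = (LINT t:{..x}|lborel. \<rho> t)"

text \<open>The quantile function. Outside (0, 1) the inverse of \<open>F\<close> is unspecified;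
  the default 0 makes \<open>Q\<close> Borel measurable on the whole line.\<close>

definition Q :: "real \<Rightarrow> real" where
  "Q s = (if 0 < s \<and> s < 1 then inv F s else 0)"

lemma rho_nonneg [simp]: "0 \<le> \<rho> x" using pos[of x] by simp

lemma rho_deriv: "(\<rho> has_real_derivative deriv \<rho> x) (at x)"
  and cont_deriv_rho: "continuous_on UNIV (deriv \<rho>)"
proof -
  obtain D where D: "\<And>x. (\<rho> has_vector_derivative D x) (at x)" "continuous_on UNIV D"
    using C1 by (auto simp: C1_differentiable_on_def)
  then have d: "(\<rho> has_real_derivative D x) (at x)" for x
    by (simp add: has_real_derivative_iff_has_vector_derivative)
  then have "deriv \<rho> = D" by (auto intro: DERIV_imp_deriv)
  then show "(\<rho> has_real_derivative deriv \<rho> x) (at x)" "continuous_on UNIV (deriv \<rho>)"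
    using d D by auto
qed

lemma rho_cont: "isCont \<rho> x"
  using rho_deriv by (rule DERIV_isCont)

lemma rho_cont_on: "continuous_on A \<rho>"
  by (simp add: continuous_at_imp_continuous_on rho_cont)

lemma rho_meas [measurable]: "\<rho> \<in> borel_measurable borel"
  by (rule borel_measurable_continuous_onI[OF rho_cont_on])

lemma nn_rho: "(\<integral>\<^sup>+x. ennreal (\<rho> x) \<partial>lborel) = 1"
  using prob_space.emeasure_space_1[OF prob]
  by (simp add: density_measure_def emeasure_density)

lemma rho_integrable: "integrable lborel \<rho>"
  by (rule integrableI_nonneg) (simp_all add: nn_rho)

lemma rho_set_integrable: "A \<in> sets borel \<Longrightarrow> set_integrable lborel A \<rho>"
  unfolding set_integrable_def by (intro integrable_mult_indicator) (simp_all add: rho_integrable)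

lemma F_diff:
  assumes "a \<le> b"
  shows "F b - F a = (LINT t:{a<..b}|lborel. \<rho> t)" "F b - F a = integral {a..b} \<rho>"
proof -
  have "{..b} = {..a} \<union> {a<..b}" using assms by auto
  then have "F b = F a + (LINT t:{a<..b}|lborel. \<rho> t)"
    unfolding F_def by (simp only:) (rule set_integral_Un; auto intro: rho_set_integrable)
  then show *: "F b - F a = (LINT t:{a<..b}|lborel. \<rho> t)" by simp
  have "integral {a<..b} \<rho> = integral {a..b} \<rho>"
    by (rule integral_spike_set; rule negligible_subset[of "{a}"]) auto
  with * show "F b - F a = integral {a..b} \<rho>"
    by (simp add: set_borel_integral_eq_integral(2)[OF rho_set_integrable])
qed

lemma F_diff_Icc: "a \<le> b \<Longrightarrow> F b - F a = (LINT t:{a..b}|lborel. \<rho> t)"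
  by (simp add: F_diff(2) set_borel_integral_eq_integral(2)[OF rho_set_integrable])

lemma F_deriv: "(F has_real_derivative \<rho> x) (at x)"
proof -
  have "((\<lambda>y. F (x - 1) + integral {x - 1..y} \<rho>) has_real_derivative 0 + \<rho> x) (at x within {x - 1..x + 1})"
    by (intro DERIV_add DERIV_const integral_has_real_derivative rho_cont_on) auto
  then have "((\<lambda>y. F (x - 1) + integral {x - 1..y} \<rho>) has_real_derivative \<rho> x) (at x)"
    by (simp add: at_within_Icc_at)
  then show ?thesis
  proof (rule has_field_derivative_transform_within_open[of _ _ _ "{x - 1<..<x + 1}"])
    show "F (x - 1) + integral {x - 1..y} \<rho> = F y" if "y \<in> {x - 1<..<x + 1}" for y
      using F_diff(2)[of "x - 1" y] that by simp
  qed auto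
qed

lemma F_cont: "isCont F x"
  using F_deriv by (rule DERIV_isCont)

lemma F_cont_on: "continuous_on A F"
  by (simp add: continuous_at_imp_continuous_on F_cont)

lemma F_meas [measurable]: "F \<in> borel_measurable borel"
  by (rule borel_measurable_continuous_onI[OF F_cont_on])

lemma F_strict_mono: "x < y \<Longrightarrow> F x < F y"
  by (rule DERIV_pos_imp_increasing) (use F_deriv pos in auto)

lemma F_less_iff [simp]: "F x < F y \<longleftrightarrow> x < y"
  using F_strict_mono by (metis less_asym linorder_neqE)

lemma F_le_iff [simp]: "F x \<le> F y \<longleftrightarrow> x \<le> y"
  using F_less_iff by (metis linorder_not_less)

lemma F_eq_iff [simp]: "F x = F y \<longleftrightarrow> x = y"
  by (metis F_less_iff linorder_neqE order_less_irrefl)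

lemma real_distribution_rho: "real_distribution (density_measure \<rho>)"
  using prob by (simp add: real_distribution_def real_distribution_axioms_def density_measure_def)

lemma emeasure_density_rho:
  "A \<in> sets borel \<Longrightarrow> emeasure (density_measure \<rho>) A = (\<integral>\<^sup>+x. ennreal (\<rho> x) * indicator A x \<partial>lborel)"
  by (simp add: density_measure_def emeasure_density)

text \<open>Links \<open>F\<close> with the distribution function of the library, from which its
  limits and range follow.\<close>

lemma cdf_rho: "cdf (density_measure \<rho>) x = F x"
proof -
  have "emeasure (density_measure \<rho>) {..x} = (\<integral>\<^sup>+t. ennreal (indicator {..x} t * \<rho> t) \<partial>lborel)"
    by (subst emeasure_density_rho) (auto intro!: nn_integral_cong simp: indicator_def)
  also have "\<dots> = ennreal (LINT t|lborel. indicator {..x} t * \<rho> t)"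
    by (rule nn_integral_eq_integral)
      (use rho_set_integrable[of "{..x}"] in \<open>auto simp: set_integrable_def\<close>)
  finally show ?thesis
    unfolding cdf_def measure_def F_def set_lebesgue_integral_def
    by (simp add: enn2real_ennreal)
qed

lemma F_at_top: "(F \<longlongrightarrow> 1) at_top" and F_at_bot: "(F \<longlongrightarrow> 0) at_bot"
proof -
  interpret real_distribution "density_measure \<rho>" by (rule real_distribution_rho)
  show "(F \<longlongrightarrow> 1) at_top" using cdf_lim_at_top_prob by (simp add: cdf_rho[abs_def])
  show "(F \<longlongrightarrow> 0) at_bot" using cdf_lim_at_bot by (simp add: cdf_rho[abs_def])
qed

lemma F_range [simp]: "0 < F x" "F x < 1"
proof -
  interpret real_distribution "density_measure \<rho>" by (rule real_distribution_rho)
  have "0 \<le> F (x - 1)" using cdf_nonneg[of "x - 1"] by (simp add: cdf_rho)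
  then show "0 < F x" using F_strict_mono[of "x - 1" x] by linarith
  have "F (x + 1) \<le> 1" using cdf_bounded_prob[of "x + 1"] by (simp add: cdf_rho)
  then show "F x < 1" using F_strict_mono[of x "x + 1"] by linarith
qed

lemma F_surj:
  assumes "0 < s" "s < 1"
  obtains x where "F x = s"
proof -
  have "eventually (\<lambda>x. F x < s) at_bot" using F_at_bot assms by (intro order_tendstoD)
  then obtain a where a: "F a < s" by (auto simp: eventually_at_bot_linorder)
  have "eventually (\<lambda>x. F x > s) at_top" using F_at_top assms by (intro order_tendstoD)
  then obtain b where b: "F b > s" by (auto simp: eventually_at_top_linorder)
  have "a \<le> b" using a b F_less_iff[of a b] by linarith
  then show ?thesis using IVT'[of F a s b] a b F_cont_on that by force
qed

lemma F_Q [simp]: "0 < s \<Longrightarrow> s < 1 \<Longrightarrow> F (Q s) = s"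
  unfolding Q_def by (auto intro: F_surj f_inv_into_f)

lemma Q_F [simp]: "Q (F x) = x"
  by (metis F_Q F_eq_iff F_range)

lemma Q_le_iff: "s \<in> {0<..<1} \<Longrightarrow> t \<in> {0<..<1} \<Longrightarrow> Q s \<le> Q t \<longleftrightarrow> s \<le> t"
  using F_le_iff[of "Q s" "Q t"] by simp

lemma Q_cont:
  assumes "0 < s" "s < 1"
  shows "isCont Q s"
proof -
  let ?x = "Q s"
  have "isCont Q (F ?x)"
    by (rule isCont_inverse_function[of 1]) (auto simp: F_cont)
  then show ?thesis using assms by simp
qed

lemma Q_cont_on: "A \<subseteq> {0<..<1} \<Longrightarrow> continuous_on A Q"
  by (auto intro!: continuous_at_imp_continuous_on Q_cont)

lemma Q_deriv:
  assumes "0 < s" "s < 1"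
  shows "(Q has_real_derivative inverse (\<rho> (Q s))) (at s)"
  by (rule DERIV_inverse_function[where f = F and a = 0 and b = 1])
    (use assms F_deriv pos[of "Q s"] Q_cont in auto)

lemma Q_meas [measurable]: "Q \<in> borel_measurable borel"
proof -
  have "(\<lambda>s. indicator {0<..<1} s *\<^sub>R Q s) \<in> borel_measurable borel"
    by (rule borel_measurable_continuous_on_indicator) (auto intro: Q_cont_on)
  moreover have "(\<lambda>s. indicator {0<..<1} s *\<^sub>R Q s) = Q"
    by (auto simp: Q_def indicator_def fun_eq_iff)
  ultimately show ?thesis by simp
qed

text \<open>The probability integral transform. Two laws on the line agree if their distribution
  functions do; values outside (0, 1) are separate cases, since \<open>Q\<close> carries no
  information there.\<close>

lemma distr_F: "distr (density_measure \<rho>) borel F = uniform_measure lborel {0..<1}"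
proof (rule cdf_unique)
  interpret R: real_distribution "density_measure \<rho>" by (rule real_distribution_rho)
  have sp: "space (density_measure \<rho>) = UNIV" by (simp add: density_measure_def)
  have Fm: "F \<in> measurable (density_measure \<rho>) borel" by (simp add: density_measure_def)
  have "prob_space (distr (density_measure \<rho>) borel F)" by (rule R.prob_space_distr[OF Fm])
  then show "real_distribution (distr (density_measure \<rho>) borel F)"
    by (simp add: real_distribution_def real_distribution_axioms_def)
  have "prob_space (uniform_measure lborel {0..<1::real})"
    by (rule prob_space_uniform_measure) auto
  then show "real_distribution (uniform_measure lborel {0..<1})"
    by (simp add: real_distribution_def real_distribution_axioms_def)
  show "cdf (distr (density_measure \<rho>) borel F) = cdf (uniform_measure lborel {0..<1})"
  proof
    fix s :: real
    have l: "cdf (distr (density_measure \<rho>) borel F) s = measure (density_measure \<rho>) {x. F x \<le> s}"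
      unfolding cdf_def using Fm by (subst measure_distr) (auto simp: sp vimage_def)
    consider "s \<le> 0" | "s \<ge> 1" | "0 < s" "s < 1" by linarith
    then show "cdf (distr (density_measure \<rho>) borel F) s = cdf (uniform_measure lborel {0..<1}) s"
    proof cases
      case 1
      have "{x. F x \<le> s} = {}" using 1 F_range(1) by (auto simp: not_le intro: le_less_trans)
      moreover have "{0..<1} \<inter> {..s} = {} \<or> {0..<1} \<inter> {..s} = {0}" using 1 by auto
      then have "measure lborel ({0..<1} \<inter> {..s}) = 0" by (elim disjE) simp_all
      ultimately show ?thesis unfolding l by (simp add: cdf_def)
    next
      case 2
      then have "{x. F x \<le> s} = UNIV" using less_le_trans[OF F_range(2) 2] by (auto intro: less_imp_le)
      moreover have "{0..<1} \<inter> {..s} = {0..<1}" using 2 by auto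
      ultimately show ?thesis unfolding l using R.prob_space by (simp add: cdf_def sp)
    next
      case 3
      then have "{x. F x \<le> s} = {..Q s}" using F_le_iff[of _ "Q s"] by auto
      then have "measure (density_measure \<rho>) {x. F x \<le> s} = s"
        using cdf_rho[of "Q s"] 3 by (simp add: cdf_def)
      moreover have "{0..<1} \<inter> {..s} = {0..s}" using 3 by auto
      ultimately show ?thesis unfolding l using 3 by (simp add: cdf_def)
    qed
  qed
qed

text \<open>The substitution s = F x, by which every integral against \<rho> is moved to the
  circle.\<close>

lemma nn_integral_F:
  assumes [measurable]: "h \<in> borel_measurable borel"
  shows "(\<integral>\<^sup>+x. ennreal (\<rho> x) * h (F x) \<partial>lborel) = (\<integral>\<^sup>+s. h s * indicator {0..<1} s \<partial>lborel)"
proof -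
  have "(\<integral>\<^sup>+x. ennreal (\<rho> x) * h (F x) \<partial>lborel) = (\<integral>\<^sup>+x. h (F x) \<partial>density_measure \<rho>)"
    by (simp add: density_measure_def nn_integral_density)
  also have "\<dots> = (\<integral>\<^sup>+s. h s \<partial>distr (density_measure \<rho>) borel F)"
    by (subst nn_integral_distr) (simp_all add: density_measure_def)
  also have "\<dots> = (\<integral>\<^sup>+s. h s * indicator {0..<1} s \<partial>lborel)"
    unfolding distr_F by (subst nn_integral_uniform_measure) (auto simp: divide_ennreal_def)
  finally show ?thesis .
qed

section \<open>The square root of the density, and boundedness of the density\<close>

definition sqrt_deriv :: "real \<Rightarrow> real" where
  "sqrt_deriv x = deriv \<rho> x / (2 * sqrt (\<rho> x))"

lemma sqrt_rho_deriv: "((\<lambda>y. sqrt (\<rho> y)) has_real_derivative sqrt_deriv x) (at x)"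
  using pos[of x] unfolding sqrt_deriv_def
  by (auto intro!: derivative_eq_intros rho_deriv simp: field_simps)

lemma sqrt_deriv_cont: "continuous_on UNIV sqrt_deriv"
  unfolding sqrt_deriv_def
  by (intro continuous_intros cont_deriv_rho rho_cont_on) (use pos in \<open>auto simp: less_imp_neq[symmetric]\<close>)

lemma sqrt_deriv_meas [measurable]: "sqrt_deriv \<in> borel_measurable borel"
  by (rule borel_measurable_continuous_onI[OF sqrt_deriv_cont])

lemma nn_sqrt_deriv_finite: "(\<integral>\<^sup>+x. ennreal ((sqrt_deriv x)\<^sup>2) \<partial>lborel) < \<infinity>"
proof -
  have "deriv (\<lambda>y. sqrt (\<rho> y)) x = sqrt_deriv x" for x
    using sqrt_rho_deriv by (rule DERIV_imp_deriv)
  then have "ennreal (1/2) * (\<integral>\<^sup>+x. ennreal ((sqrt_deriv x)\<^sup>2) \<partial>lborel) < \<infinity>"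
    using KE_finite by (simp add: KE_def)
  then show ?thesis
    by (auto simp: ennreal_mult_less_top)
qed

text \<open>Since \<rho>' = 2 sqrt \<rho> (sqrt \<rho>)', its modulus is at most \<rho> + ((sqrt
  \<rho>)')^2, which is integrable by the finite kinetic energy. So \<rho> has finite total
  variation.\<close>

lemma rho_bounded_ex: "\<exists>C>0. \<forall>x. \<rho> x \<le> C"
proof -
  let ?g = "\<lambda>x. \<rho> x + (sqrt_deriv x)\<^sup>2"
  have int2: "integrable lborel (\<lambda>x. (sqrt_deriv x)\<^sup>2)"
    by (rule integrableI_nonneg) (use nn_sqrt_deriv_finite in auto)
  have intg: "integrable lborel ?g" using rho_integrable int2 by simp
  have gc: "continuous_on A ?g" for A
    by (intro continuous_intros rho_cont_on continuous_on_subset[OF sqrt_deriv_cont]) auto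
  have bd: "\<bar>\<rho> b - \<rho> a\<bar> \<le> (LINT x|lborel. ?g x)" if "a \<le> b" for a b
  proof -
    have "(deriv \<rho> has_integral \<rho> b - \<rho> a) {a..b}"
      using that rho_deriv
      by (intro fundamental_theorem_of_calculus)
        (auto simp: has_real_derivative_iff_has_vector_derivative intro: has_vector_derivative_at_within)
    moreover have "(?g has_integral integral {a..b} ?g) {a..b}"
      by (intro integrable_integral integrable_continuous_interval gc)
    moreover have "norm (deriv \<rho> x) \<le> ?g x" for x
    proof -
      have "deriv \<rho> x = 2 * (sqrt (\<rho> x) * sqrt_deriv x)"
        using pos[of x] by (simp add: sqrt_deriv_def)
      moreover have "2 * \<bar>sqrt (\<rho> x) * sqrt_deriv x\<bar> \<le> (sqrt (\<rho> x))\<^sup>2 + (sqrt_deriv x)\<^sup>2"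
        using sum_squares_bound[of "\<bar>sqrt (\<rho> x)\<bar>" "\<bar>sqrt_deriv x\<bar>"] by (simp add: abs_mult mult.assoc)
      ultimately show ?thesis by simp
    qed
    ultimately have "norm (\<rho> b - \<rho> a) \<le> integral {a..b} ?g"
      using integral_norm_bound_integral[of "deriv \<rho>" "{a..b}" ?g] by (auto simp: has_integral_iff)
    also have "\<dots> = (LINT x:{a..b}|lborel. ?g x)"
    proof (rule set_borel_integral_eq_integral(2)[symmetric])
      show "set_integrable lborel {a..b} ?g"
        unfolding set_integrable_def by (intro integrable_mult_indicator intg) simp
    qed
    also have "\<dots> \<le> (LINT x|lborel. ?g x)"
      unfolding set_lebesgue_integral_def using intg
      by (intro integral_mono integrable_mult_indicator) (auto simp: indicator_def)
    finally show ?thesis by simp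
  qed
  have "\<rho> x \<le> \<rho> 0 + (LINT x|lborel. ?g x)" for x
    using bd[of 0 x] bd[of x 0] by (cases "x \<ge> 0") auto
  moreover have "\<rho> 0 + (LINT x|lborel. ?g x) > 0"
    using pos[of 0] bd[of 0 0] by linarith
  ultimately show ?thesis by blast
qed

definition rmax :: real where
  "rmax = (SOME C. C > 0 \<and> (\<forall>x. \<rho> x \<le> C))"

lemma rmax: "rmax > 0" "\<rho> x \<le> rmax"
  unfolding rmax_def using someI_ex[of "\<lambda>C. C > 0 \<and> (\<forall>x. \<rho> x \<le> C)"] rho_bounded_ex by auto

lemma F_lipschitz: "\<bar>F x - F y\<bar> \<le> rmax * \<bar>x - y\<bar>"
proof -
  have *: "\<bar>F x - F y\<bar> \<le> rmax * \<bar>x - y\<bar>" if xy: "y < x" for x y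
  proof -
    obtain z where "F x - F y = (x - y) * \<rho> z"
      using MVT2[OF xy, of F \<rho>] F_deriv by auto
    then show ?thesis using xy rmax(2)[of z] by (simp add: abs_mult mult.commute mult_right_mono)
  qed
  consider "x < y" | "y < x" | "x = y" by linarith
  then show ?thesis by cases (use *[of x y] *[of y x] in \<open>auto simp: abs_minus_commute\<close>)
qed

end

section \<open>The Kantorovich potential\<close>

text \<open>The half turn of the circle [0, 1). It sends 1/2 to 0, a value that \<open>F\<close>
  does not attain: this is the escape of T at the median.\<close>

definition opp :: "real \<Rightarrow> real" where
  "opp s = (if s < 1/2 then s + 1/2 else s - 1/2)"

lemma opp_opp [simp]: "0 \<le> s \<Longrightarrow> s < 1 \<Longrightarrow> opp (opp s) = s"
  by (auto simp: opp_def)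

lemma opp_range: "0 < s \<Longrightarrow> s < 1 \<Longrightarrow> s \<noteq> 1/2 \<Longrightarrow> 0 < opp s \<and> opp s < 1 \<and> opp s \<noteq> 1/2"
  by (auto simp: opp_def)

locale coulomb_potential = positive_density \<rho> for \<rho> :: "real \<Rightarrow> real" +
  fixes u T :: "real \<Rightarrow> real" and m :: real
  assumes median: "is_median \<rho> m"
    and opt_map: "is_optimal_map \<rho> m T"
    and kant: "is_kantorovich_potential m T u"
    and u''_bounded: "second_deriv_Linfty u"
begin

section \<open>The optimal map in quantile coordinates\<close>

lemma F_m [simp]: "F m = 1/2"
  using median by (simp add: is_median_def F_def)

lemma F_half_iff: "F x < 1/2 \<longleftrightarrow> x < m" "F x = 1/2 \<longleftrightarrow> x = m" "1/2 < F x \<longleftrightarrow> m < x"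
  using F_less_iff[of x m] F_eq_iff[of x m] F_less_iff[of m x] by auto

text \<open>A reversed or degenerate interval would have integral 0 instead of 1/2, so the defining
  equation itself forces the order of x and T x.\<close>

lemma T_left: "x < m \<Longrightarrow> x < T x \<and> F (T x) = F x + 1/2"
proof -
  assume x: "x < m"
  then have i: "(LINT t:{x..T x}|lborel. \<rho> t) = 1/2"
    using opt_map by (auto simp: is_optimal_map_def)
  have "x < T x"
  proof (rule ccontr)
    assume "\<not> x < T x"
    then have "integral {x..T x} \<rho> = 0" by (cases "x = T x") auto
    then show False using i by (simp add: set_borel_integral_eq_integral(2)[OF rho_set_integrable])
  qed
  then show ?thesis using F_diff_Icc[of x "T x"] i by simp
qed

lemma T_right: "m < x \<Longrightarrow> T x < x \<and> F (T x) = F x - 1/2"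
proof -
  assume x: "m < x"
  then have i: "(LINT t:{T x..x}|lborel. \<rho> t) = 1/2"
    using opt_map by (auto simp: is_optimal_map_def)
  have "T x < x"
  proof (rule ccontr)
    assume "\<not> T x < x"
    then have "integral {T x..x} \<rho> = 0" by (cases "x = T x") auto
    then show False using i by (simp add: set_borel_integral_eq_integral(2)[OF rho_set_integrable])
  qed
  then show ?thesis using F_diff_Icc[of "T x" x] i by simp
qed

lemma F_T: "x \<noteq> m \<Longrightarrow> F (T x) = opp (F x)"
  using T_left[of x] T_right[of x] F_half_iff[of x] by (cases "x < m") (auto simp: opp_def)

lemma T_eq: "x \<noteq> m \<Longrightarrow> T x = Q (opp (F x))"
  using F_T[of x] Q_F[of "T x"] by simp

lemma T_neq_m: "x \<noteq> m \<Longrightarrow> T x \<noteq> m"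
  using F_T[of x] F_range[of x] F_half_iff(2)[of "T x"] opp_range[of "F x"] F_half_iff(2)[of x]
  by auto

lemma T_neq: "x \<noteq> m \<Longrightarrow> T x \<noteq> x"
  using T_left[of x] T_right[of x] by (cases "x < m") auto

lemma T_T: "x \<noteq> m \<Longrightarrow> T (T x) = x"
  using T_eq[OF T_neq_m] F_T[of x] opp_opp[OF less_imp_le[OF F_range(1)] F_range(2)] by simp

lemma T_side: "x \<noteq> m \<Longrightarrow> T x < m \<longleftrightarrow> m < x"
  using F_T[of x] F_half_iff[of x] F_half_iff[of "T x"] F_range[of x] by (auto simp: opp_def split: if_splits)

text \<open>A lower bound for the distance of x and T x: the mass between them is 1/2 and the
  density is at most \<open>rmax\<close>.\<close>

definition gap :: real where "gap = 1 / (2 * rmax)"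

lemma gap_pos: "gap > 0" using rmax(1) by (simp add: gap_def)

lemma F_gap: "\<bar>F x - F y\<bar> \<ge> c \<Longrightarrow> \<bar>x - y\<bar> \<ge> 2 * c * gap"
  using F_lipschitz[of x y] rmax(1) by (simp add: gap_def field_simps)

lemma T_gap: "x \<noteq> m \<Longrightarrow> \<bar>x - T x\<bar> \<ge> gap"
  using F_gap[of "1/2" x "T x"] F_T[of x] by (auto simp: opp_def split: if_splits)

text \<open>On each side of the median \<open>opp\<close> is a translation by a constant, so T is
  locally the composition of \<open>Q\<close>, a shift and \<open>F\<close>.\<close>

lemma T_deriv:
  assumes x: "x \<noteq> m"
  shows "(T has_real_derivative \<rho> x / \<rho> (T x)) (at x)"
proof -
  have r: "0 < opp (F x)" "opp (F x) < 1" using opp_range[of "F x"] F_half_iff(2)[of x] x by auto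
  define c where "c = opp (F x) - F x"
  have o: "opp (F x) = F x + c" by (simp add: c_def)
  have "((\<lambda>z. Q (F z + c)) has_real_derivative inverse (\<rho> (Q (F x + c))) * (\<rho> x + 0)) (at x)"
    by (intro DERIV_chain2[OF Q_deriv] DERIV_add F_deriv DERIV_const) (use r o in auto)
  then have d: "((\<lambda>z. Q (F z + c)) has_real_derivative \<rho> x / \<rho> (T x)) (at x)"
    by (simp add: T_eq[OF x] o divide_inverse mult.commute)
  have "open (if x < m then {..<m} else {m<..})" by simp
  moreover have "x \<in> (if x < m then {..<m} else {m<..})" using x by auto
  moreover have "Q (F z + c) = T z" if "z \<in> (if x < m then {..<m} else {m<..})" for z
    using that x T_eq[of z] F_half_iff[of x] F_half_iff[of z]
    by (auto simp: c_def opp_def split: if_splits)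
  ultimately show ?thesis by (rule has_field_derivative_transform_within_open[OF d])
qed

lemma T_cont: "x \<noteq> m \<Longrightarrow> isCont T x"
  using T_deriv by (rule DERIV_isCont)

section \<open>Differentiability of the potential away from the median\<close>

lemma kant_le: "x \<noteq> y \<Longrightarrow> u x + u y \<le> 1 / \<bar>x - y\<bar>"
  using kant by (simp add: is_kantorovich_potential_def)

lemma kant_eq: "x \<noteq> m \<Longrightarrow> u x + u (T x) = 1 / \<bar>x - T x\<bar>"
  using kant T_neq[of x] by (auto simp: is_kantorovich_potential_def)

lemma kant_eqD: "x \<noteq> y \<Longrightarrow> u x + u y = 1 / \<bar>x - y\<bar> \<Longrightarrow> x \<noteq> m \<and> y = T x"
  using kant by (auto simp: is_kantorovich_potential_def)

lemma V_nonneg: "x \<noteq> y \<Longrightarrow> 0 \<le> potential_V u (x, y)"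
  using kant_le[of x y] by (simp add: potential_V_def)

lemma V_T: "x \<noteq> m \<Longrightarrow> potential_V u (x, T x) = 0"
  using kant_eq[of x] by (simp add: potential_V_def)

lemma V_sym: "potential_V u (x, y) = potential_V u (y, x)"
  by (simp add: potential_V_def abs_minus_commute)

text \<open>Equality holds at (x, T x) and the inequality at (z, T x); subtracting eliminates u (T
  x). All regularity of u off the median comes from this estimate.\<close>

lemma u_diff_le:
  assumes "x \<noteq> m" "z \<noteq> T x"
  shows "u z - u x \<le> 1 / \<bar>z - T x\<bar> - 1 / \<bar>x - T x\<bar>"
  using kant_eq[OF assms(1)] kant_le[OF assms(2)] by linarith

definition sg :: "real \<Rightarrow> real" where "sg x = (if x < m then 1 else -1)"

text \<open>The envelope formula: the derivative at x of the Coulomb kernel with the partner T x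
  frozen. The sign records on which side the partner lies.\<close>

definition u1 :: "real \<Rightarrow> real" where "u1 x = sg x / (x - T x)\<^sup>2"

text \<open>The derivative of \<open>u1\<close>; the factor 1 - \<rho> x / \<rho> (T x) is 1 -
  T'.\<close>

definition u2 :: "real \<Rightarrow> real" where "u2 x = 2 * (1 - \<rho> x / \<rho> (T x)) / \<bar>x - T x\<bar> ^ 3"

lemma inverse_abs_diff:
  fixes z x y s :: real
  assumes "0 < s * (y - z)" "0 < s * (y - x)" "s = 1 \<or> s = -1"
  shows "1 / \<bar>z - y\<bar> - 1 / \<bar>x - y\<bar> = s * (z - x) / (\<bar>z - y\<bar> * \<bar>x - y\<bar>)"
proof -
  have a: "\<bar>z - y\<bar> = s * (y - z)" "\<bar>x - y\<bar> = s * (y - x)" using assms by auto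
  have nz: "s * (y - z) \<noteq> 0" "s * (y - x) \<noteq> 0" using assms by auto
  show ?thesis unfolding a using nz by (simp add: field_simps)
qed

text \<open>Applying \<open>u_diff_le\<close> from x to z and from z to x squeezes the difference
  quotient between \<open>A z\<close> (partner of z) and \<open>B z\<close> (partner of x). Both
  tend to \<open>u1 x\<close>, because T is continuous at x.\<close>

lemma u_deriv:
  assumes x: "x \<noteq> m"
  shows "(u has_real_derivative u1 x) (at x)"
proof -
  define s where "s = sg x"
  have s: "s = 1 \<or> s = -1" by (simp add: s_def sg_def)
  have sx: "0 < s * (T x - x)" using x T_left[of x] T_right[of x] by (auto simp: s_def sg_def)
  define A where "A z = s / (\<bar>z - T z\<bar> * \<bar>x - T z\<bar>)" for z
  define B where "B z = s / (\<bar>z - T x\<bar> * \<bar>x - T x\<bar>)" for z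
  have nz: "\<bar>x - T x\<bar> * \<bar>x - T x\<bar> \<noteq> 0" using T_neq[OF x] by simp
  have sq: "\<bar>x - T x\<bar> * \<bar>x - T x\<bar> = (x - T x)\<^sup>2" by (simp add: power2_eq_square)
  have "(A \<longlongrightarrow> s / (\<bar>x - T x\<bar> * \<bar>x - T x\<bar>)) (at x)"
    unfolding A_def by (intro tendsto_intros isContD[OF T_cont[OF x]] nz)
  then have "(A \<longlongrightarrow> u1 x) (at x)" by (simp only: u1_def sq s_def)
  then have A: "((\<lambda>z. \<bar>A z - u1 x\<bar>) \<longlongrightarrow> 0) (at x)"
    by (intro tendsto_rabs_zero LIM_zero)
  have "(B \<longlongrightarrow> s / (\<bar>x - T x\<bar> * \<bar>x - T x\<bar>)) (at x)"
    unfolding B_def by (intro tendsto_intros nz)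
  then have "(B \<longlongrightarrow> u1 x) (at x)" by (simp only: u1_def sq s_def)
  then have B: "((\<lambda>z. \<bar>B z - u1 x\<bar>) \<longlongrightarrow> 0) (at x)"
    by (intro tendsto_rabs_zero LIM_zero)
  \<comment> \<open>Near x the points x and z lie on the same side of T x and of T z, as
    \<open>inverse_abs_diff\<close> requires.\<close>
  have ev: "eventually (\<lambda>z. z \<noteq> m \<and> 0 < s * (T x - z) \<and> 0 < s * (T z - x) \<and> 0 < s * (T z - z) \<and> z \<noteq> x) (at x)"
  proof (intro eventually_conj)
    show "eventually (\<lambda>z. z \<noteq> m) (at x)"
      using tendsto_imp_eventually_ne[OF tendsto_ident_at x] .
    have "((\<lambda>z. s * (T x - z)) \<longlongrightarrow> s * (T x - x)) (at x)" by (intro tendsto_intros)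
    then show "eventually (\<lambda>z. 0 < s * (T x - z)) (at x)" using sx by (rule order_tendstoD)
    have "((\<lambda>z. s * (T z - x)) \<longlongrightarrow> s * (T x - x)) (at x)" by (intro tendsto_intros isContD[OF T_cont[OF x]])
    then show "eventually (\<lambda>z. 0 < s * (T z - x)) (at x)" using sx by (rule order_tendstoD)
    have "((\<lambda>z. s * (T z - z)) \<longlongrightarrow> s * (T x - x)) (at x)" by (intro tendsto_intros isContD[OF T_cont[OF x]])
    then show "eventually (\<lambda>z. 0 < s * (T z - z)) (at x)" using sx by (rule order_tendstoD)
    show "eventually (\<lambda>z. z \<noteq> x) (at x)" by (simp add: eventually_at_filter)
  qed
  have "((\<lambda>z. (u z - u x) / (z - x) - u1 x) \<longlongrightarrow> 0) (at x)"
  proof (rule Lim_null_comparison)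
    show "((\<lambda>z. \<bar>A z - u1 x\<bar> + \<bar>B z - u1 x\<bar>) \<longlongrightarrow> 0) (at x)"
      using tendsto_add[OF A B] by simp
    show "eventually (\<lambda>z. norm ((u z - u x) / (z - x) - u1 x) \<le> \<bar>A z - u1 x\<bar> + \<bar>B z - u1 x\<bar>) (at x)"
      using ev
    proof eventually_elim
      fix z assume z: "z \<noteq> m \<and> 0 < s * (T x - z) \<and> 0 < s * (T z - x) \<and> 0 < s * (T z - z) \<and> z \<noteq> x"
      have ne: "z \<noteq> T x" "x \<noteq> T z" using z by auto
      have up: "u z - u x \<le> B z * (z - x)"
        using u_diff_le[OF x ne(1)] inverse_abs_diff[of s "T x" z x] z sx s by (simp add: B_def)
      have lo: "A z * (z - x) \<le> u z - u x"
        using u_diff_le[of z x] ne z inverse_abs_diff[of s "T z" z x] s by (simp add: A_def)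
      have "z - x > 0 \<or> z - x < 0" using z by auto
      then show "norm ((u z - u x) / (z - x) - u1 x) \<le> \<bar>A z - u1 x\<bar> + \<bar>B z - u1 x\<bar>"
      proof
        assume p: "z - x > 0"
        have "A z \<le> (u z - u x) / (z - x)" "(u z - u x) / (z - x) \<le> B z"
          using up lo p by (simp_all add: pos_le_divide_eq pos_divide_le_eq)
        then show ?thesis unfolding real_norm_def by linarith
      next
        assume p: "z - x < 0"
        have "(u z - u x) / (z - x) \<le> A z" "B z \<le> (u z - u x) / (z - x)"
          using up lo p by (simp_all add: neg_le_divide_eq neg_divide_le_eq)
        then show ?thesis unfolding real_norm_def by linarith
      qed
    qed
  qed
  then show ?thesis by (simp add: has_field_derivative_iff LIM_zero_iff)
qed

lemma u1_deriv:
  assumes x: "x \<noteq> m"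
  shows "(u1 has_real_derivative u2 x) (at x)"
proof -
  have nz: "x - T x \<noteq> 0" using T_neq[OF x] by simp
  have r: "\<bar>x - T x\<bar> = - sg x * (x - T x)" using x T_left[of x] T_right[of x] by (auto simp: sg_def)
  have s: "sg x * sg x = 1" by (simp add: sg_def)
  have s3: "sg x ^ 3 = sg x" using s by (simp add: power3_eq_cube)
  have "((\<lambda>z. sg x / (z - T z)\<^sup>2) has_real_derivative
      - (sg x * (2 * (x - T x) * (1 - \<rho> x / \<rho> (T x)))) / ((x - T x)\<^sup>2 * (x - T x)\<^sup>2)) (at x)"
    using nz by (auto intro!: derivative_eq_intros T_deriv[OF x])
  moreover have "- (sg x * (2 * (x - T x) * (1 - \<rho> x / \<rho> (T x)))) / ((x - T x)\<^sup>2 * (x - T x)\<^sup>2) = u2 x"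
  proof -
    have "\<bar>x - T x\<bar> ^ 3 = - sg x * (x - T x) ^ 3" unfolding r power_mult_distrib by (simp add: s3)
    then have "u2 x = - (2 * (1 - \<rho> x / \<rho> (T x)) / (sg x * (x - T x) ^ 3))" by (simp add: u2_def)
    also have "\<dots> = - (sg x * (2 * (1 - \<rho> x / \<rho> (T x)) / (x - T x) ^ 3))"
      by (cases "x < m") (auto simp: sg_def diff_divide_distrib)
    also have "\<dots> = - (sg x * (2 * (x - T x) * (1 - \<rho> x / \<rho> (T x)))) / ((x - T x)\<^sup>2 * (x - T x)\<^sup>2)"
    proof -
      have "- (s * (2 * c / d ^ 3)) = - (s * (2 * d * c)) / (d\<^sup>2 * d\<^sup>2)" if "d \<noteq> 0" for s c d :: real
        using that by (simp add: field_simps power2_eq_square power3_eq_cube)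
      from this[OF nz] show ?thesis .
    qed
    finally show ?thesis by simp
  qed
  ultimately have d: "((\<lambda>z. sg x / (z - T z)\<^sup>2) has_real_derivative u2 x) (at x)" by simp
  have "open (if x < m then {..<m} else {m<..})" by simp
  moreover have "x \<in> (if x < m then {..<m} else {m<..})" using x by auto
  moreover have "sg x / (z - T z)\<^sup>2 = u1 z" if "z \<in> (if x < m then {..<m} else {m<..})" for z
    using that x by (auto simp: u1_def sg_def split: if_splits)
  ultimately show ?thesis by (rule has_field_derivative_transform_within_open[OF d])
qed

lemma u2_cont:
  assumes "x \<noteq> m"
  shows "isCont u2 x"
proof -
  have t: "(T \<longlongrightarrow> T x) (at x)" "(\<rho> \<longlongrightarrow> \<rho> x) (at x)" using isContD[OF T_cont[OF assms]] isContD[OF rho_cont] by auto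
  have "((\<lambda>z. \<rho> (T z)) \<longlongrightarrow> \<rho> (T x)) (at x)"
    using isCont_tendsto_compose[OF rho_cont t(1)] .
  then show ?thesis unfolding isCont_def u2_def
    using T_neq[OF assms] pos[of "T x"] by (intro tendsto_intros t) auto
qed

text \<open>The derivative of T is nonnegative and the distance to T x is at least
  \<open>gap\<close>. The bound from below is the one for which the assumption on u'' is
  invoked.\<close>

lemma u2_upper: "x \<noteq> m \<Longrightarrow> u2 x \<le> 2 / gap ^ 3"
proof -
  assume x: "x \<noteq> m"
  have "0 \<le> \<rho> x / \<rho> (T x)" by simp
  then have "u2 x \<le> 2 / \<bar>x - T x\<bar> ^ 3" unfolding u2_def by (intro divide_right_mono) auto
  also have "\<dots> \<le> 2 / gap ^ 3"
    using T_gap[OF x] gap_pos by (intro divide_left_mono power_mono mult_pos_pos) auto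
  finally show ?thesis .
qed

text \<open>The distributional bound is transferred to the classical second derivative by testing
  against a bump function supported away from the median.\<close>

lemma u2_lower: "\<exists>C. \<forall>x. x \<noteq> m \<longrightarrow> - C \<le> u2 x"
proof -
  obtain v g C where w: "has_weak_partial 1 u v" "has_weak_partial 1 v g"
    and gm: "g \<in> borel_measurable borel" and gC: "AE x in lborel. \<bar>g x\<bar> \<le> C"
    using u''_bounded by (auto simp: second_deriv_Linfty_def ess_bounded_def)
  show ?thesis
  proof (rule exI, intro allI impI, rule ccontr)
    fix x0 assume x0: "x0 \<noteq> m" and "\<not> - (C + 1) \<le> u2 x0"
    then have "u2 x0 < - (C + 1)" by simp
    then have "eventually (\<lambda>x. u2 x < - (C + 1)) (nhds x0)"
      using order_tendstoD(2)[OF isContD[OF u2_cont[OF x0]]] by (simp add: eventually_nhds_conv_at)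
    moreover have "eventually (\<lambda>x. x \<noteq> m) (nhds x0)"
      using x0 by (intro t1_space_nhds)
    ultimately have "eventually (\<lambda>x. u2 x < - (C + 1) \<and> x \<noteq> m) (nhds x0)" by (rule eventually_conj)
    then obtain d where d: "d > 0" "\<And>x. dist x x0 < d \<Longrightarrow> u2 x < - (C + 1) \<and> x \<noteq> m"
      by (auto simp: eventually_nhds_metric)
    \<comment> \<open>The bump will be supported within d/4 of x0, strictly inside the interval, so
      that no boundary terms arise.\<close>
    define a where "a = x0 - d/2"
    define b where "b = x0 + d/2"
    have ab: "a < b" using d by (simp add: a_def b_def)
    have near: "u2 x < - (C + 1)" "x \<noteq> m" if "x \<in> {a..b}" for x
    proof -
      have "x0 - d/2 \<le> x" "x \<le> x0 + d/2" using that by (auto simp: a_def b_def)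
      then have "dist x x0 < d" using d(1) unfolding dist_real_def by linarith
      from d(2)[OF this] show "u2 x < - (C + 1)" "x \<noteq> m" by auto
    qed
    obtain \<phi> where \<phi>: "test_function \<phi>" "\<And>x. 0 \<le> \<phi> x" "\<And>x. \<phi> x > 0 \<longleftrightarrow> x \<in> {x0 - d/4<..<x0 + d/4}"
      using test_function_bump[of "x0 - d/4" "x0 + d/4"] d by auto
    define \<phi>1 where "\<phi>1 = dir_deriv 1 \<phi>"
    define \<phi>2 where "\<phi>2 = dir_deriv 1 \<phi>1"
    have t1: "test_function \<phi>1" unfolding \<phi>1_def by (rule test_function_dir_deriv[OF \<phi>(1)])
    have t2: "test_function \<phi>2" unfolding \<phi>2_def by (rule test_function_dir_deriv[OF t1])
    have d1: "(\<phi> has_real_derivative \<phi>1 x) (at x)" for x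
      unfolding \<phi>1_def by (rule Ck_SucD(1)[of 0]) (use \<phi>(1) in \<open>simp only: test_function_def\<close>)
    have d2: "(\<phi>1 has_real_derivative \<phi>2 x) (at x)" for x
      unfolding \<phi>2_def by (rule Ck_SucD(1)[of 0]) (use t1 in \<open>simp only: test_function_def\<close>)
    have cont: "continuous_on A \<phi>" "continuous_on A \<phi>2" for A
      using \<phi>(1) t2 continuous_on_subset[of UNIV _ A] by (auto simp: test_function_def dest!: spec[of _ 0])
    have z: "\<phi> x = 0" if "x \<notin> {x0 - d/4<..<x0 + d/4}" for x
      using \<phi>(2)[of x] \<phi>(3)[of x] that by auto
    have loc0: "f' = 0" if "(f has_real_derivative f') (at x)" "x \<notin> {x0 - d/4..x0 + d/4}"
      "\<And>y. y \<notin> {x0 - d/4..x0 + d/4} \<Longrightarrow> f y = 0" for f :: "real \<Rightarrow> real" and f' x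
    proof -
      have "((\<lambda>_. 0) has_real_derivative 0) (at x)" by simp
      then have "(f has_real_derivative 0) (at x)"
        by (rule has_field_derivative_transform_within_open[of _ _ _ "- {x0 - d/4..x0 + d/4}"])
          (use that(2,3) in auto)
      then show ?thesis using that(1) DERIV_unique by blast
    qed
    have zc: "\<phi> y = 0" if "y \<notin> {x0 - d/4..x0 + d/4}" for y
      by (rule z) (use that in auto)
    have z1: "\<phi>1 x = 0" if "x \<notin> {x0 - d/4..x0 + d/4}" for x
      by (rule loc0[OF d1 that zc])
    have z2: "\<phi>2 x = 0" if "x \<notin> {x0 - d/4..x0 + d/4}" for x
      by (rule loc0[OF d2 that z1])
    have "(LINT x|lborel. u x * \<phi>2 x) = - (LINT x|lborel. v x * \<phi>1 x)"
      unfolding \<phi>2_def using w(1) t1 by (auto simp: has_weak_partial_def)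
    also have "(LINT x|lborel. v x * \<phi>1 x) = - (LINT x|lborel. g x * \<phi> x)"
      unfolding \<phi>1_def using w(2) \<phi>(1) by (auto simp: has_weak_partial_def)
    finally have e1: "(LINT x|lborel. u x * \<phi>2 x) = (LINT x|lborel. g x * \<phi> x)" by simp
    have sub: "x \<in> {a..b}" if "x \<in> {x0 - d/4..x0 + d/4}" for x using that d(1) by (auto simp: a_def b_def)
    have uc: "continuous_on {a..b} u" "continuous_on {a..b} u2"
      by (intro continuous_at_imp_continuous_on ballI DERIV_isCont[OF u_deriv[OF near(2)]] u2_cont near(2); assumption)+
    have s1: "set_integrable lborel {a..b} (\<lambda>x. u x * \<phi>2 x)"
      "set_integrable lborel {a..b} (\<lambda>x. u2 x * \<phi> x)"
      by (intro borel_integrable_atLeastAtMost' continuous_intros uc cont)+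
    \<comment> \<open>Green's identity: u \<phi>'' - u'' \<phi> is the derivative of u \<phi>' - u'
      \<phi>.\<close>
    have i1: "integral {a..b} (\<lambda>x. u x * \<phi>2 x - u2 x * \<phi> x) = 0"
    proof (rule integral_unique)
      have "((\<lambda>x. u x * \<phi>2 x - u2 x * \<phi> x) has_integral (u b * \<phi>1 b - u1 b * \<phi> b) - (u a * \<phi>1 a - u1 a * \<phi> a)) {a..b}"
      proof (rule fundamental_theorem_of_calculus)
        fix x assume x: "x \<in> {a..b}"
        have "((\<lambda>x. u x * \<phi>1 x - u1 x * \<phi> x) has_real_derivative
           (u1 x * \<phi>1 x + \<phi>2 x * u x) - (u2 x * \<phi> x + \<phi>1 x * u1 x)) (at x)"
          by (intro DERIV_diff DERIV_mult u_deriv u1_deriv near(2)[OF x] d1 d2)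
        then have "((\<lambda>x. u x * \<phi>1 x - u1 x * \<phi> x) has_real_derivative (u x * \<phi>2 x - u2 x * \<phi> x)) (at x)"
          by (simp add: algebra_simps)
        then show "((\<lambda>x. u x * \<phi>1 x - u1 x * \<phi> x) has_vector_derivative (u x * \<phi>2 x - u2 x * \<phi> x)) (at x within {a..b})"
          by (simp add: has_real_derivative_iff_has_vector_derivative has_vector_derivative_at_within)
      qed (use ab in simp)
      moreover have "a \<notin> {x0 - d/4..x0 + d/4}" "b \<notin> {x0 - d/4..x0 + d/4}" using d(1) by (auto simp: a_def b_def)
      ultimately show "((\<lambda>x. u x * \<phi>2 x - u2 x * \<phi> x) has_integral 0) {a..b}"
        using z z1 by auto
    qed
    have e2: "(LINT x|lborel. u x * \<phi>2 x) = (LINT x:{a..b}|lborel. u2 x * \<phi> x)"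
    proof -
      have "(LINT x|lborel. u x * \<phi>2 x) = (LINT x:{a..b}|lborel. u x * \<phi>2 x)"
        unfolding set_lebesgue_integral_def
        by (intro Bochner_Integration.integral_cong) (use z2 sub in \<open>auto simp: indicator_def\<close>)
      also have "\<dots> = (LINT x:{a..b}|lborel. u2 x * \<phi> x)"
        using i1 s1 by (simp add: set_borel_integral_eq_integral integral_diff)
      finally show ?thesis .
    qed
    have intg: "set_integrable lborel {a..b} (\<lambda>x. g x * \<phi> x)"
    proof -
      have li: "loc_integrable g" using w(2) by (simp add: has_weak_partial_def)
      then have gi: "set_integrable lborel {a..b} g" by (simp add: loc_integrable_def)
      obtain K where K: "\<And>x. x \<in> {a..b} \<Longrightarrow> \<bar>\<phi> x\<bar> \<le> K"
        using compact_imp_bounded[OF compact_continuous_image[OF cont(1) compact_Icc]]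
        unfolding bounded_iff by (metis imageI real_norm_def)
      have "\<bar>\<phi> a\<bar> \<le> K" using K[of a] ab by simp
      then have K0: "K \<ge> 0" by linarith
      show ?thesis
        unfolding set_integrable_def
      proof (rule Bochner_Integration.integrable_bound)
        show "integrable lborel (\<lambda>x. K * (indicator {a..b} x *\<^sub>R g x))"
          using gi by (simp add: set_integrable_def)
        have "\<phi> \<in> borel_measurable borel" by (rule borel_measurable_continuous_onI[OF cont(1)])
        then show "(\<lambda>x. indicator {a..b} x *\<^sub>R (g x * \<phi> x)) \<in> borel_measurable lborel"
          using gm by simp
        show "AE x in lborel. norm (indicator {a..b} x *\<^sub>R (g x * \<phi> x)) \<le> norm (K * (indicator {a..b} x *\<^sub>R g x))"
        proof (intro AE_I2)
          fix x
          show "norm (indicator {a..b} x *\<^sub>R (g x * \<phi> x)) \<le> norm (K * (indicator {a..b} x *\<^sub>R g x))"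
            using K[of x] K0 by (auto simp: indicator_def abs_mult mult.commute intro!: mult_right_mono)
        qed
      qed
    qed
    have e3: "(LINT x|lborel. g x * \<phi> x) = (LINT x:{a..b}|lborel. g x * \<phi> x)"
      unfolding set_lebesgue_integral_def
    proof (intro Bochner_Integration.integral_cong refl)
      fix x
      have "x \<notin> {a..b} \<Longrightarrow> \<phi> x = 0" using zc sub by blast
      then show "g x * \<phi> x = indicator {a..b} x *\<^sub>R (g x * \<phi> x)" by (auto simp: indicator_def)
    qed
    have si: "set_integrable lborel {a..b} \<phi>" by (intro borel_integrable_atLeastAtMost' cont)
    \<comment> \<open>The margin 1 in C + 1 gives 1 \<le> g - u2 almost everywhere on the interval,
      while the weak and the classical derivative have the same integral against \<phi>. So the
      integral of \<phi> would be at most 0.\<close>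
    have "(LINT x:{a..b}|lborel. \<phi> x) \<le> (LINT x:{a..b}|lborel. g x * \<phi> x - u2 x * \<phi> x)"
    proof (rule set_integral_mono_AE[OF si set_integral_diff(1)[OF intg s1(2)]])
      show "AE x\<in>{a..b} in lborel. \<phi> x \<le> g x * \<phi> x - u2 x * \<phi> x"
        using gC
      proof eventually_elim
        fix x assume gx: "\<bar>g x\<bar> \<le> C"
        show "x \<in> {a..b} \<longrightarrow> \<phi> x \<le> g x * \<phi> x - u2 x * \<phi> x"
        proof
          assume "x \<in> {a..b}"
          then have "1 \<le> g x - u2 x" using near(1)[of x] gx by linarith
          then have "1 * \<phi> x \<le> (g x - u2 x) * \<phi> x" using \<phi>(2) by (intro mult_right_mono)
          then show "\<phi> x \<le> g x * \<phi> x - u2 x * \<phi> x" by (simp add: algebra_simps)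
        qed
      qed
    qed
    also have "\<dots> = 0" using set_integral_diff(2)[OF intg s1(2)] e1 e2 e3 by simp
    finally have le0: "integral {a..b} \<phi> \<le> 0" by (simp add: set_borel_integral_eq_integral(2)[OF si])
    have "integral {a..b} \<phi> > 0"
    proof -
      have "\<phi> x0 > 0" using \<phi>(3) d(1) by auto
      moreover have "x0 \<in> {a..b}" using d(1) by (auto simp: a_def b_def)
      moreover have "integral {a..b} \<phi> \<ge> 0" using \<phi>(2) by (intro integral_nonneg integrable_continuous_interval cont) auto
      ultimately show ?thesis
        using integral_eq_0_iff[OF cont(1)[of "{a..b}"] ab] \<phi>(2) by force
    qed
    with le0 show False by simp
  qed
qed

definition L2 :: real where "L2 = (SOME C. C \<ge> 0 \<and> (\<forall>x. x \<noteq> m \<longrightarrow> \<bar>u2 x\<bar> \<le> C))"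

lemma L2: "L2 \<ge> 0" "x \<noteq> m \<Longrightarrow> \<bar>u2 x\<bar> \<le> L2"
proof -
  obtain C where C: "\<And>x. x \<noteq> m \<Longrightarrow> - C \<le> u2 x" using u2_lower by auto
  have "\<bar>u2 x\<bar> \<le> \<bar>C\<bar> + 2 / gap ^ 3" if "x \<noteq> m" for x
  proof -
    have "0 < 2 / gap ^ 3" using gap_pos by simp
    then show ?thesis using C[OF that] u2_upper[OF that] by (intro abs_leI) linarith+
  qed
  moreover have "\<bar>C\<bar> + 2 / gap ^ 3 \<ge> 0" using gap_pos by simp
  ultimately have "\<exists>C\<ge>0. \<forall>x. x \<noteq> m \<longrightarrow> \<bar>u2 x\<bar> \<le> C" by blast
  from someI_ex[OF this] show "L2 \<ge> 0" "x \<noteq> m \<Longrightarrow> \<bar>u2 x\<bar> \<le> L2" unfolding L2_def by auto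
qed

end

text \<open>A mean value inequality with one exceptional point, in applications the median;
  continuity there is enough for the fundamental theorem. The minima and maxima leave the order of a
  and b free.\<close>

lemma increment_bound_off_point:
  fixes f f' :: "real \<Rightarrow> real"
  assumes cont: "continuous_on {min a b..max a b} f" and B: "B \<ge> 0"
    and der: "\<And>x. x \<in> {min a b..max a b} \<Longrightarrow> x \<noteq> c \<Longrightarrow> (f has_real_derivative f' x) (at x) \<and> \<bar>f' x\<bar> \<le> B"
  shows "\<bar>f b - f a\<bar> \<le> B * \<bar>b - a\<bar>"
proof -
  let ?l = "min a b" and ?r = "max a b"
  have "(f' has_integral (f ?r - f ?l)) {?l..?r}"
    by (rule fundamental_theorem_of_calculus_interior_strong[of "{c}"])
      (use cont der in \<open>auto simp: has_real_derivative_iff_has_vector_derivative\<close>)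
  then have "norm (f ?r - f ?l) \<le> B * measure lborel (cbox ?l ?r)"
    by (intro has_integral_bound_spike_finite[of B "{c}" f']) (use B der in auto)
  moreover have "measure lborel (cbox ?l ?r) = \<bar>b - a\<bar>" by (simp add: min_def max_def)
  moreover have "norm (f ?r - f ?l) = \<bar>f b - f a\<bar>" by (simp add: min_def max_def abs_minus_commute)
  ultimately show ?thesis by simp
qed

section \<open>The potential and its derivative across the median\<close>

context coulomb_potential
begin

text \<open>The value \<open>0\<close> at the median is the right one, since \<open>\<bar>x - T x\<bar> \<rightarrow> \<infinity>\<close> as \<open>x \<rightarrow> m\<close>.\<close>

definition U1 :: "real \<Rightarrow> real" where "U1 x = (if x = m then 0 else u1 x)"

text \<open>As x tends to m, F (T x) tends to 0 or 1, so T x leaves every bounded interval around m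
  while x stays within distance 1 of m.\<close>

lemma T_escapes: "filterlim (\<lambda>x. \<bar>x - T x\<bar>) at_top (at m)"
  unfolding filterlim_at_top
proof
  fix Z :: real
  have "eventually (\<lambda>x. F x > F (m + 1 + \<bar>Z\<bar>) - 1/2) (at m)"
    using isContD[OF F_cont[of m]] F_range[of "m + 1 + \<bar>Z\<bar>"] by (intro order_tendstoD(1)[of F "1/2"]) auto
  moreover have "eventually (\<lambda>x. F x < F (m - 1 - \<bar>Z\<bar>) + 1/2) (at m)"
    using isContD[OF F_cont[of m]] F_range[of "m - 1 - \<bar>Z\<bar>"] by (intro order_tendstoD(2)[of F "1/2"]) auto
  moreover have "eventually (\<lambda>x. dist x m < 1) (at m)"
    by (metis eventually_at zero_less_one)
  moreover have "eventually (\<lambda>x. x \<noteq> m) (at m)" by (simp add: eventually_at_filter)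
  ultimately show "eventually (\<lambda>x. Z \<le> \<bar>x - T x\<bar>) (at m)"
  proof eventually_elim
    fix x assume a: "F (m + 1 + \<bar>Z\<bar>) - 1/2 < F x" "F x < F (m - 1 - \<bar>Z\<bar>) + 1/2" "dist x m < 1" "x \<noteq> m"
    show "Z \<le> \<bar>x - T x\<bar>"
    proof (cases "x < m")
      case True
      then have "F (m + 1 + \<bar>Z\<bar>) < F (T x)" using T_left a by auto
      then show ?thesis using a(3) True by (auto simp: dist_real_def)
    next
      case False
      then have "F (T x) < F (m - 1 - \<bar>Z\<bar>)" using T_right a by auto
      then show ?thesis using a(3) False by (auto simp: dist_real_def)
    qed
  qed
qed

lemma U1_deriv:
  assumes "x \<noteq> m"
  shows "(U1 has_real_derivative u2 x) (at x)"
  by (rule has_field_derivative_transform_within_open[OF u1_deriv[OF assms], of "- {m}"])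
    (use assms in \<open>auto simp: U1_def\<close>)

lemma U1_cont: "isCont U1 x"
proof (cases "x = m")
  case False
  then show ?thesis by (rule DERIV_isCont[OF U1_deriv])
next
  case True
  have "((\<lambda>x. inverse (\<bar>x - T x\<bar>)) \<longlongrightarrow> 0) (at m)"
    by (rule tendsto_inverse_0_at_top[OF T_escapes])
  then have "((\<lambda>x. (inverse (\<bar>x - T x\<bar>))\<^sup>2) \<longlongrightarrow> 0\<^sup>2) (at m)" by (rule tendsto_power)
  then have l: "((\<lambda>x. (inverse (\<bar>x - T x\<bar>))\<^sup>2) \<longlongrightarrow> 0) (at m)" by simp
  have "(U1 \<longlongrightarrow> 0) (at m)"
    by (rule Lim_null_comparison[OF _ l])
      (auto simp: U1_def u1_def sg_def eventually_at_filter abs_mult power_inverse divide_inverse)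
  then show ?thesis using True by (simp add: isCont_def U1_def)
qed

text \<open>The bound on u'' holds only off the median; continuity of \<open>U1\<close> there
  carries the Lipschitz estimate across.\<close>

lemma U1_lipschitz: "\<bar>U1 b - U1 a\<bar> \<le> L2 * \<bar>b - a\<bar>"
proof (rule increment_bound_off_point[where c = m and f' = u2])
  show "continuous_on {min a b..max a b} U1"
    by (simp add: continuous_at_imp_continuous_on U1_cont)
  fix x assume "x \<noteq> m"
  show "(U1 has_real_derivative u2 x) (at x) \<and> \<bar>u2 x\<bar> \<le> L2"
    using U1_deriv L2 \<open>x \<noteq> m\<close> by auto
qed (rule L2)

text \<open>Two uses of \<open>u_diff_le\<close>; a step of at most \<open>gap / 2\<close> keeps z
  at distance \<open>gap / 2\<close> from T x, so the constant does not depend on x.\<close>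

lemma u_locally_lipschitz:
  assumes "x \<noteq> m" "z \<noteq> m" "\<bar>z - x\<bar> \<le> gap / 2"
  shows "\<bar>u z - u x\<bar> \<le> 2 / gap\<^sup>2 * \<bar>z - x\<bar>"
proof -
  have *: "u z - u x \<le> 2 / gap\<^sup>2 * \<bar>z - x\<bar>" if x: "x \<noteq> m" and d: "\<bar>z - x\<bar> \<le> gap / 2" for x z
  proof -
    have g: "\<bar>x - T x\<bar> \<ge> gap" by (rule T_gap[OF x])
    then have g2: "\<bar>z - T x\<bar> \<ge> gap / 2" using d by linarith
    then have ne: "z \<noteq> T x" using gap_pos by auto
    have "u z - u x \<le> 1 / \<bar>z - T x\<bar> - 1 / \<bar>x - T x\<bar>" by (rule u_diff_le[OF x ne])
    also have "\<dots> = (\<bar>x - T x\<bar> - \<bar>z - T x\<bar>) / (\<bar>z - T x\<bar> * \<bar>x - T x\<bar>)"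
    proof -
      have "1 / a - 1 / b = (b - a) / (a * b)" if "a \<noteq> 0" "b \<noteq> 0" for a b :: real
        using that by (simp add: field_simps)
      moreover have "\<bar>z - T x\<bar> \<noteq> 0" "\<bar>x - T x\<bar> \<noteq> 0" using g g2 gap_pos by linarith+
      ultimately show ?thesis by blast
    qed
    also have "\<dots> \<le> \<bar>z - x\<bar> / (gap / 2 * gap)"
      using g g2 gap_pos by (intro frac_le mult_mono) auto
    finally show ?thesis by (simp add: power2_eq_square field_simps)
  qed
  show ?thesis
    using *[of x z] *[of z x] assms by (simp add: abs_le_iff abs_minus_commute)
qed

text \<open>The potential is constrained at m only by strict inequalities, so it may jump there.
  Estimates that integrate across the median use this continuous function instead.\<close>

lemma u_extension:
  obtains w where "continuous_on UNIV w" "\<And>x. x \<noteq> m \<Longrightarrow> w x = u x"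
    "\<And>x. x \<noteq> m \<Longrightarrow> (w has_real_derivative U1 x) (at x)"
proof -
  have "uniformly_continuous_on (- {m}) u"
    unfolding uniformly_continuous_on_def
  proof (intro allI impI)
    fix e :: real assume e: "e > 0"
    show "\<exists>d>0. \<forall>x\<in>- {m}. \<forall>x'\<in>- {m}. dist x' x < d \<longrightarrow> dist (u x') (u x) < e"
    proof (intro exI[of _ "min (gap/2) (e * gap\<^sup>2 / 4)"] conjI ballI impI)
      show "0 < min (gap/2) (e * gap\<^sup>2 / 4)" using gap_pos e by simp
      fix x x' assume a: "x \<in> - {m}" "x' \<in> - {m}" "dist x' x < min (gap/2) (e * gap\<^sup>2 / 4)"
      then have "\<bar>u x' - u x\<bar> \<le> 2 / gap\<^sup>2 * \<bar>x' - x\<bar>"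
        by (intro u_locally_lipschitz) (auto simp: dist_real_def)
      also have "\<dots> \<le> 2 / gap\<^sup>2 * (e * gap\<^sup>2 / 4)"
        using a(3) gap_pos by (intro mult_left_mono) (auto simp: dist_real_def)
      also have "\<dots> < e" using gap_pos e by simp
      finally show "dist (u x') (u x) < e" by (simp add: dist_real_def)
    qed
  qed
  then obtain w where w: "uniformly_continuous_on (closure (- {m})) w" "\<And>x. x \<in> - {m} \<Longrightarrow> u x = w x"
    by (rule uniformly_continuous_on_extension_on_closure) auto
  have "closure (- {m}) = UNIV" by (simp add: closure_complement)
  then have c: "continuous_on UNIV w" using w(1) by (simp add: uniformly_continuous_imp_continuous)
  show ?thesis
  proof (rule that[OF c])
    show "w x = u x" if "x \<noteq> m" for x using w(2) that by simp
    fix x assume x: "x \<noteq> m"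
    have "(u has_real_derivative U1 x) (at x)" using u_deriv[OF x] x by (simp add: U1_def)
    then show "(w has_real_derivative U1 x) (at x)"
      by (rule has_field_derivative_transform_within_open[of _ _ _ "- {m}"]) (use x w(2) in auto)
  qed
qed

text \<open>On the middle half of the mass the continuous extension is bounded by compactness. Any
  other point has its partner in that half, and u x + u (T x) lies between 0 and 1 /
  \<open>gap\<close>.\<close>

lemma u_bounded: "\<exists>C. \<forall>x. \<bar>u x\<bar> \<le> C"
proof -
  obtain w where w: "continuous_on UNIV w" "\<And>x. x \<noteq> m \<Longrightarrow> w x = u x" by (rule u_extension) auto
  have "bounded (w ` {Q (1/4)..Q (3/4)})"
    by (intro compact_imp_bounded compact_continuous_image continuous_on_subset[OF w(1)]) auto
  then obtain C where C: "\<And>x. x \<in> {Q (1/4)..Q (3/4)} \<Longrightarrow> \<bar>w x\<bar> \<le> C"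
    unfolding bounded_iff by (metis imageI real_norm_def)
  have C0: "C \<ge> 0" using C[of "Q (1/4)"] Q_le_iff[of "1/4" "3/4"] by auto
  have mid: "x \<in> {Q (1/4)..Q (3/4)} \<longleftrightarrow> 1/4 \<le> F x \<and> F x \<le> 3/4" for x
    using F_le_iff[of x "Q (3/4)"] F_le_iff[of "Q (1/4)" x] by simp
  have "\<bar>u x\<bar> \<le> C + 1 / gap + \<bar>u m\<bar>" for x
  proof (cases "x = m")
    case True
    then show ?thesis using C0 gap_pos by (simp add: add_nonneg_nonneg)
  next
    case x: False
    have g: "0 < 1 / gap" using gap_pos by simp
    show ?thesis
    proof (cases "x \<in> {Q (1/4)..Q (3/4)}")
      case True
      then have "\<bar>u x\<bar> \<le> C" using C w(2)[OF x] by metis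
      then show ?thesis using g by linarith
    next
      case False
      then have "T x \<in> {Q (1/4)..Q (3/4)}"
      proof -
        have "F x < 1/4 \<or> F x > 3/4" using False unfolding mid by linarith
        then show ?thesis
        proof
          assume a: "F x < 1/4"
          then have "F (T x) = F x + 1/2" using F_T[OF x] by (simp add: opp_def)
          then show ?thesis unfolding mid using a F_range(1)[of x] by linarith
        next
          assume a: "F x > 3/4"
          then have "F (T x) = F x - 1/2" using F_T[OF x] by (simp add: opp_def)
          then show ?thesis unfolding mid using a F_range(2)[of x] by linarith
        qed
      qed
      then have "\<bar>u (T x)\<bar> \<le> C" using C w(2)[OF T_neq_m[OF x]] by metis
      moreover have "u x + u (T x) = 1 / \<bar>x - T x\<bar>" by (rule kant_eq[OF x])
      moreover have "1 / \<bar>x - T x\<bar> \<le> 1 / gap" using T_gap[OF x] gap_pos by (intro divide_left_mono) auto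
      moreover have "1 / \<bar>x - T x\<bar> \<ge> 0" by simp
      ultimately show ?thesis by linarith
    qed
  qed
  then show ?thesis by blast
qed

section \<open>Quadratic upper bound and second-order expansion of V\<close>

definition c1 :: "real \<Rightarrow> real" where "c1 z = - sgn z / z\<^sup>2"

lemma c1_deriv:
  assumes "z \<noteq> 0"
  shows "((\<lambda>z. 1 / \<bar>z\<bar>) has_real_derivative c1 z) (at z)" "(c1 has_real_derivative 2 / \<bar>z\<bar> ^ 3) (at z)"
proof -
  define s where "s = sgn z"
  have s: "s = 1 \<or> s = -1" using assms by (auto simp: s_def sgn_if)
  have az: "\<bar>z\<bar> = s * z" by (simp add: s_def abs_sgn mult.commute)
  have o: "open {y. 0 < s * y}" by (intro open_Collect_less continuous_intros)
  have zi: "z \<in> {y. 0 < s * y}" using assms az by auto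
  have c1z: "c1 z = - s / z\<^sup>2" by (simp add: c1_def s_def)
  have "((\<lambda>y. 1 / (s * y)) has_real_derivative c1 z) (at z)"
    using s
  proof
    assume "s = 1"
    then show ?thesis using assms unfolding c1z
      by (auto intro!: derivative_eq_intros simp: power2_eq_square)
  next
    assume "s = -1"
    then show ?thesis using assms unfolding c1z
      by (auto intro!: derivative_eq_intros simp: power2_eq_square)
  qed
  then show "((\<lambda>z. 1 / \<bar>z\<bar>) has_real_derivative c1 z) (at z)"
    by (rule has_field_derivative_transform_within_open[OF _ o zi]) (use s in auto)
  have "((\<lambda>y. - s / y\<^sup>2) has_real_derivative 2 / \<bar>z\<bar> ^ 3) (at z)"
    using s
  proof
    assume "s = 1"
    then show ?thesis using assms unfolding az
      by (auto intro!: derivative_eq_intros simp: power2_eq_square power3_eq_cube)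
  next
    assume "s = -1"
    then show ?thesis using assms unfolding az
      by (auto intro!: derivative_eq_intros simp: power2_eq_square power3_eq_cube)
  qed
  then show "(c1 has_real_derivative 2 / \<bar>z\<bar> ^ 3) (at z)"
    by (rule has_field_derivative_transform_within_open[OF _ o zi]) (use s in \<open>auto simp: c1_def sgn_if\<close>)
qed

lemma c1_shift:
  assumes "t - y \<noteq> 0"
  shows "((\<lambda>z. 1 / \<bar>z - y\<bar>) has_real_derivative c1 (t - y)) (at t)"
    "((\<lambda>z. c1 (z - y)) has_real_derivative 2 / \<bar>t - y\<bar> ^ 3) (at t)"
proof -
  have d: "((\<lambda>z. z - y) has_real_derivative 1) (at t)" by (auto intro!: derivative_eq_intros)
  show "((\<lambda>z. 1 / \<bar>z - y\<bar>) has_real_derivative c1 (t - y)) (at t)"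
    using DERIV_chain2[where g = "\<lambda>z. z - y", OF c1_deriv(1)[OF assms] d] by simp
  show "((\<lambda>z. c1 (z - y)) has_real_derivative 2 / \<bar>t - y\<bar> ^ 3) (at t)"
    using DERIV_chain2[where g = "\<lambda>z. z - y", OF c1_deriv(2)[OF assms] d] by simp
qed

text \<open>First-order optimality: for fixed y, V is stationary in its first argument at T
  y.\<close>

lemma c1_U1: "y \<noteq> m \<Longrightarrow> c1 (T y - y) = U1 (T y)"
  using T_neq_m[of y] T_T[of y] T_side[of y] T_left[of y] T_right[of y]
  by (cases "y < m") (auto simp: c1_def U1_def u1_def sg_def power2_commute)

definition Lq :: real where "Lq = 16 / gap ^ 3 + L2"

lemma Lq_nonneg: "Lq \<ge> 0" using L2(1) gap_pos by (simp add: Lq_def)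

text \<open>Taylor's bound at (T y, y), where V and its derivative in the first argument vanish.
  That derivative is Lipschitz on the segment with constant \<open>Lq\<close>: the Coulomb part
  contributes 2 / (gap/2)^3, the potential part \<open>L2\<close>. The assumption \<open>far\<close>
  keeps the segment off the diagonal; crossing the median is harmless.\<close>

lemma V_le_sqr:
  assumes x: "x \<noteq> m" and y: "y \<noteq> m"
    and far: "\<And>z. z \<in> {min x (T y)..max x (T y)} \<Longrightarrow> \<bar>z - y\<bar> \<ge> gap / 2"
  shows "potential_V u (x, y) \<le> Lq * (x - T y)\<^sup>2"
proof -
  obtain w where w: "continuous_on UNIV w" "\<And>x. x \<noteq> m \<Longrightarrow> w x = u x"
    "\<And>x. x \<noteq> m \<Longrightarrow> (w has_real_derivative U1 x) (at x)" by (rule u_extension) auto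
  let ?S = "{min x (T y)..max x (T y)}"
  have nz: "z - y \<noteq> 0" if "z \<in> ?S" for z using far[OF that] gap_pos by auto
  have c1_lip: "\<bar>c1 (z - y) - c1 (T y - y)\<bar> \<le> 16 / gap ^ 3 * \<bar>z - T y\<bar>" if z: "z \<in> ?S" for z
  proof -
    have sub: "{min (T y) z..max (T y) z} \<subseteq> ?S" using z by auto
    note d = c1_shift(2)[OF nz]
    show ?thesis
    proof (rule increment_bound_off_point[where f = "\<lambda>z. c1 (z - y)" and f' = "\<lambda>t. 2 / \<bar>t - y\<bar> ^ 3" and c = y])
      show "continuous_on {min (T y) z..max (T y) z} (\<lambda>z. c1 (z - y))"
        using sub d by (intro continuous_at_imp_continuous_on ballI DERIV_isCont) blast
      show "0 \<le> 16 / gap ^ 3" using gap_pos by simp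
      fix t assume "t \<in> {min (T y) z..max (T y) z}"
      then have t: "t \<in> ?S" using sub by auto
      have "2 / \<bar>t - y\<bar> ^ 3 \<le> 2 / (gap / 2) ^ 3"
        using far[OF t] gap_pos nz[OF t] by (intro divide_left_mono power_mono mult_pos_pos) auto
      then have "\<bar>2 / \<bar>t - y\<bar> ^ 3\<bar> \<le> 16 / gap ^ 3" by (simp add: power_divide)
      with d[OF t] show "((\<lambda>z. c1 (z - y)) has_real_derivative 2 / \<bar>t - y\<bar> ^ 3) (at t) \<and> \<bar>2 / \<bar>t - y\<bar> ^ 3\<bar> \<le> 16 / gap ^ 3" by blast
    qed
  qed
  have Ty: "T y \<noteq> m" by (rule T_neq_m[OF y])
  let ?f = "\<lambda>z. 1 / \<bar>z - y\<bar> - w z"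
  note cd = c1_shift(1)[OF nz]
  have "\<bar>?f x - ?f (T y)\<bar> \<le> (Lq * \<bar>x - T y\<bar>) * \<bar>x - T y\<bar>"
  proof (rule increment_bound_off_point[where f' = "\<lambda>z. c1 (z - y) - U1 z" and c = m])
    have S: "{min (T y) x..max (T y) x} = ?S" by (simp add: min.commute max.commute)
    show "continuous_on {min (T y) x..max (T y) x} ?f"
      unfolding S using nz
      by (intro continuous_intros continuous_on_subset[OF w(1)]) auto
    show "0 \<le> Lq * \<bar>x - T y\<bar>" using Lq_nonneg by simp
    fix z assume "z \<in> {min (T y) x..max (T y) x}" "z \<noteq> m"
    then have z: "z \<in> ?S" "z \<noteq> m" using S by auto
    have "\<bar>c1 (z - y) - U1 z\<bar> \<le> \<bar>c1 (z - y) - c1 (T y - y)\<bar> + \<bar>U1 z - U1 (T y)\<bar>"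
      using c1_U1[OF y] by linarith
    also have "\<dots> \<le> 16 / gap ^ 3 * \<bar>z - T y\<bar> + L2 * \<bar>z - T y\<bar>"
      by (intro add_mono c1_lip z U1_lipschitz)
    also have "\<dots> = Lq * \<bar>z - T y\<bar>" by (simp add: Lq_def algebra_simps)
    also have "\<dots> \<le> Lq * \<bar>x - T y\<bar>" using z Lq_nonneg by (intro mult_left_mono) auto
    finally show "(?f has_real_derivative c1 (z - y) - U1 z) (at z) \<and> \<bar>c1 (z - y) - U1 z\<bar> \<le> Lq * \<bar>x - T y\<bar>"
      using DERIV_diff[OF cd[OF z(1)] w(3)[OF z(2)]] by blast
  qed
  moreover have "?f x - u y = potential_V u (x, y)" using w(2)[OF x] by (simp add: potential_V_def)
  moreover have "?f (T y) - u y = 0" using w(2)[OF Ty] kant_eq[OF y] by (simp add: abs_minus_commute)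
  ultimately show ?thesis by (simp add: power2_eq_square mult.assoc)
qed

text \<open>Passing from a distance on the line to the mass \<tau> costs a lower bound of \<rho>,
  which holds only on a compact interval. If F x lies outside [1/8, 7/8], then F y lies inside, and
  V is symmetric, so x and y exchange roles.\<close>

lemma V_le_tau_sqr: "\<exists>C. \<forall>x y \<tau>. x \<noteq> m \<longrightarrow> y \<noteq> m \<longrightarrow> \<bar>\<tau>\<bar> \<le> 1/16 \<longrightarrow>
    F y = F x + 1/2 + \<tau> \<or> F y = F x - 1/2 + \<tau> \<longrightarrow> potential_V u (x, y) \<le> C * \<tau>\<^sup>2"
proof -
  let ?K = "{Q (1/16)..Q (15/16)}"
  have ne: "?K \<noteq> {}" using Q_le_iff[of "1/16" "15/16"] by auto
  obtain x0 where x0: "x0 \<in> ?K" "\<And>x. x \<in> ?K \<Longrightarrow> \<rho> x0 \<le> \<rho> x"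
    using continuous_attains_inf[OF compact_Icc ne rho_cont_on] by blast
  define c where "c = \<rho> x0"
  have c: "c > 0" by (simp add: c_def pos)
  have inK: "x \<in> ?K \<longleftrightarrow> 1/16 \<le> F x \<and> F x \<le> 15/16" for x
    using F_le_iff[of x "Q (15/16)"] F_le_iff[of "Q (1/16)" x] by simp
  have inv_lip: "c * \<bar>x - y\<bar> \<le> \<bar>F x - F y\<bar>" if "x \<in> ?K" "y \<in> ?K" for x y
  proof -
    have *: "c * (b - a) \<le> F b - F a" if ab: "a < b" "a \<in> ?K" "b \<in> ?K" for a b
    proof -
      obtain z where z: "z > a" "z < b" "F b - F a = (b - a) * \<rho> z"
        using MVT2[OF ab(1), of F \<rho>] F_deriv by auto
      then have "c \<le> \<rho> z" unfolding c_def using ab by (intro x0(2)) auto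
      then show ?thesis using z ab(1) by (simp add: mult.commute mult_left_mono)
    qed
    consider "x < y" | "y < x" | "x = y" by linarith
    then show ?thesis
    proof cases
      case 1
      then show ?thesis using *[of x y] that by (simp add: abs_if)
    next
      case 2
      then show ?thesis using *[of y x] that by (simp add: abs_if)
    qed simp
  qed
  have main: "potential_V u (x, y) \<le> Lq / c\<^sup>2 * \<tau>\<^sup>2"
    if xm: "x \<noteq> m" and ym: "y \<noteq> m" and \<tau>: "\<bar>\<tau>\<bar> \<le> 1/16" and Fx: "1/8 \<le> F x" "F x \<le> 7/8"
      and Fy: "F y = F x + 1/2 + \<tau> \<or> F y = F x - 1/2 + \<tau>" for x y \<tau>
  proof -
    have FT: "F (T y) = F x + \<tau>"
      unfolding F_T[OF ym] opp_def using Fy Fx \<tau> F_range[of y] by (auto split: if_splits)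
    have TK: "T y \<in> ?K" "x \<in> ?K" unfolding inK using FT Fx \<tau> by auto
    have hy: "F y = F (T y) + 1/2 \<or> F y = F (T y) - 1/2" using FT Fy by auto
    have "potential_V u (x, y) \<le> Lq * (x - T y)\<^sup>2"
    proof (rule V_le_sqr[OF xm ym])
      fix z assume "z \<in> {min x (T y)..max x (T y)}"
      then have "(F x \<le> F z \<and> F z \<le> F (T y)) \<or> (F (T y) \<le> F z \<and> F z \<le> F x)"
        by (cases "x \<le> T y") auto
      \<comment> \<open>The points y and T y are half the mass apart, and z is at most 1/16 from T
        y, so at least 1/4 of the mass remains between z and y; \<open>F_gap\<close> turns this into
        \<open>gap / 2\<close>.\<close>
      then have "\<bar>F z - F (T y)\<bar> \<le> 1/16" using FT \<tau> by linarith
      then have "\<bar>F z - F y\<bar> \<ge> 1/4" using hy by linarith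
      from F_gap[OF this] show "gap / 2 \<le> \<bar>z - y\<bar>" by simp
    qed
    also have "\<dots> \<le> Lq * (\<tau> / c)\<^sup>2"
    proof (intro mult_left_mono Lq_nonneg)
      have "c * \<bar>x - T y\<bar> \<le> \<bar>\<tau>\<bar>" using inv_lip[OF TK(2,1)] FT by simp
      then have "\<bar>x - T y\<bar> \<le> \<bar>\<tau> / c\<bar>" using c by (simp add: field_simps)
      then show "(x - T y)\<^sup>2 \<le> (\<tau> / c)\<^sup>2" by (simp only: abs_le_square_iff)
    qed
    finally show ?thesis by (simp add: power_divide)
  qed
  show ?thesis
  proof (rule exI[of _ "Lq / c\<^sup>2"], intro allI impI)
    fix x y \<tau> assume a: "x \<noteq> m" "y \<noteq> m" "\<bar>\<tau>\<bar> \<le> 1/16" "F y = F x + 1/2 + \<tau> \<or> F y = F x - 1/2 + \<tau>"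
    show "potential_V u (x, y) \<le> Lq / c\<^sup>2 * \<tau>\<^sup>2"
    proof (cases "1/8 \<le> F x \<and> F x \<le> 7/8")
      case True
      then show ?thesis using main a by blast
    next
      case False
      have "1/8 \<le> F y" "F y \<le> 7/8" using False a(3,4) F_range[of x] F_range[of y] by linarith+
      moreover have "F x = F y + 1/2 + (- \<tau>) \<or> F x = F y - 1/2 + (- \<tau>)" using a(4) by auto
      ultimately have "potential_V u (y, x) \<le> Lq / c\<^sup>2 * (- \<tau>)\<^sup>2" using main[of y x "- \<tau>"] a by auto
      then show ?thesis by (simp add: V_sym)
    qed
  qed
qed

definition B :: "real \<Rightarrow> real" where
  "B x = 1 / (\<bar>x - T x\<bar> ^ 3 * \<rho> x * \<rho> (T x))"

lemma B_pos: "x \<noteq> m \<Longrightarrow> B x > 0"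
  using pos T_neq[of x] by (auto simp: B_def intro!: mult_pos_pos)

text \<open>One application of l'Hopital's rule, as V and its y-derivative vanish at T x and
  \<open>u1\<close> is differentiable there. In the second derivative the terms without density
  cancel: \<open>u2\<close> at T x contains 1 - \<rho> (T x) / \<rho> x because T is an
  involution.\<close>

lemma V_second_order:
  assumes x: "x \<noteq> m"
  shows "((\<lambda>y. potential_V u (x, y) / (y - T x)\<^sup>2) \<longlongrightarrow> \<rho> (T x) / (\<rho> x * \<bar>x - T x\<bar> ^ 3)) (at (T x))"
proof -
  let ?y = "T x"
  have ym: "?y \<noteq> m" by (rule T_neq_m[OF x])
  have yx: "?y - x \<noteq> 0" using T_neq[OF x] by simp
  let ?f = "\<lambda>y. potential_V u (x, y)"
  let ?f' = "\<lambda>y. c1 (y - x) - u1 y"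
  have d: "(?f has_real_derivative ?f' y) (at y)" if "y \<noteq> m" "y - x \<noteq> 0" for y
  proof -
    have "((\<lambda>y. 1 / \<bar>y - x\<bar>) has_real_derivative c1 (y - x)) (at y)" by (rule c1_shift(1)[OF that(2)])
    then have "((\<lambda>y. 1 / \<bar>y - x\<bar> - u x - u y) has_real_derivative c1 (y - x) - 0 - u1 y) (at y)"
      by (intro DERIV_diff DERIV_const u_deriv that)
    then show ?thesis by (simp add: potential_V_def abs_minus_commute)
  qed
  have d2: "(?f' has_real_derivative 2 / \<bar>?y - x\<bar> ^ 3 - u2 ?y) (at ?y)"
    by (intro DERIV_diff u1_deriv ym c1_shift yx)
  have f'0: "?f' ?y = 0" using c1_U1[OF x] ym by (simp add: U1_def)
  have val: "(2 / \<bar>?y - x\<bar> ^ 3 - u2 ?y) / 2 = \<rho> (T x) / (\<rho> x * \<bar>x - T x\<bar> ^ 3)"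
  proof -
    have "u2 ?y = 2 * (1 - \<rho> ?y / \<rho> x) / \<bar>?y - x\<bar> ^ 3" by (simp add: u2_def T_T[OF x])
    then have "2 / \<bar>?y - x\<bar> ^ 3 - u2 ?y = 2 * (\<rho> ?y / \<rho> x) / \<bar>?y - x\<bar> ^ 3"
      by (simp add: diff_divide_distrib[symmetric] algebra_simps)
    then show ?thesis by (simp add: abs_minus_commute)
  qed
  have ne: "eventually (\<lambda>y. y \<noteq> m \<and> y - x \<noteq> 0) (at ?y)"
  proof (intro eventually_conj)
    show "eventually (\<lambda>y. y \<noteq> m) (at ?y)" using tendsto_imp_eventually_ne[OF tendsto_ident_at ym] .
    have "((\<lambda>y. y - x) \<longlongrightarrow> ?y - x) (at ?y)" by (intro tendsto_intros)
    then show "eventually (\<lambda>y. y - x \<noteq> 0) (at ?y)" using yx by (rule tendsto_imp_eventually_ne)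
  qed
  have "((\<lambda>y. ?f' y / (2 * (y - ?y))) \<longlongrightarrow> \<rho> (T x) / (\<rho> x * \<bar>x - T x\<bar> ^ 3)) (at ?y)"
  proof -
    have "((\<lambda>y. (?f' y - ?f' ?y) / (y - ?y)) \<longlongrightarrow> 2 / \<bar>?y - x\<bar> ^ 3 - u2 ?y) (at ?y)"
      using d2 by (simp add: has_field_derivative_iff)
    then have "((\<lambda>y. (?f' y - ?f' ?y) / (y - ?y) / 2) \<longlongrightarrow> (2 / \<bar>?y - x\<bar> ^ 3 - u2 ?y) / 2) (at ?y)"
      by (intro tendsto_divide tendsto_const) auto
    then show ?thesis unfolding val f'0 by (simp add: mult.commute)
  qed
  then show ?thesis
  proof (rule lhopital[rotated 6])
    have "isCont ?f ?y" by (rule DERIV_isCont[OF d[OF ym yx]])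
    then show "(?f \<longlongrightarrow> 0) (at ?y)" using V_T[OF x] by (simp add: isCont_def)
    show "((\<lambda>y. (y - ?y)\<^sup>2) \<longlongrightarrow> 0) (at ?y)" by (auto intro!: tendsto_eq_intros)
    show "eventually (\<lambda>y. (y - ?y)\<^sup>2 \<noteq> 0) (at ?y)" by (simp add: eventually_at_filter)
    show "eventually (\<lambda>y. 2 * (y - ?y) \<noteq> 0) (at ?y)" by (simp add: eventually_at_filter)
    show "eventually (\<lambda>y. (?f has_real_derivative ?f' y) (at y)) (at ?y)"
      using ne by eventually_elim (use d in auto)
    show "eventually (\<lambda>y. ((\<lambda>y. (y - ?y)\<^sup>2) has_real_derivative 2 * (y - ?y)) (at y)) (at ?y)"
      by (intro always_eventually allI) (auto intro!: derivative_eq_intros)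
  qed
qed

text \<open>\<open>V_second_order\<close> in the quantile variable: (y - T x) / \<tau> tends to 1 /
  \<rho> (T x), the derivative of \<open>Q\<close>. This limit is nonzero, so the intermediate
  division by (y - T x)^2 is legitimate near 0.\<close>

lemma V_limit:
  assumes x: "x \<noteq> m"
  shows "((\<lambda>\<tau>. potential_V u (x, Q (opp (F x) + \<tau>)) / \<tau>\<^sup>2) \<longlongrightarrow> B x) (at 0)"
proof -
  have r: "0 < opp (F x)" "opp (F x) < 1" using opp_range[of "F x"] F_half_iff(2)[of x] x by auto
  let ?Y = "\<lambda>\<tau>. Q (opp (F x) + \<tau>)"
  have Y0: "?Y 0 = T x" using T_eq[OF x] by simp
  have "(?Y has_real_derivative inverse (\<rho> (Q (opp (F x) + 0))) * 1) (at 0)"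
    by (rule DERIV_chain2[OF Q_deriv]) (use r in \<open>auto intro!: derivative_eq_intros\<close>)
  then have dY: "(?Y has_real_derivative inverse (\<rho> (T x))) (at 0)" using T_eq[OF x] by simp
  then have q: "((\<lambda>\<tau>. (?Y \<tau> - T x) / \<tau>) \<longlongrightarrow> inverse (\<rho> (T x))) (at 0)"
    by (simp add: has_field_derivative_iff T_eq[OF x])
  have yl: "(?Y \<longlongrightarrow> T x) (at 0)" using DERIV_isCont[OF dY] Y0 by (simp add: isCont_def)
  have nz: "eventually (\<lambda>\<tau>. ?Y \<tau> \<noteq> T x) (at 0)"
  proof -
    have "eventually (\<lambda>\<tau>. (?Y \<tau> - T x) / \<tau> \<noteq> 0) (at 0)"
      using q pos[of "T x"] by (intro tendsto_imp_eventually_ne) auto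
    then show ?thesis by eventually_elim auto
  qed
  have "((\<lambda>\<tau>. potential_V u (x, ?Y \<tau>) / (?Y \<tau> - T x)\<^sup>2) \<longlongrightarrow> \<rho> (T x) / (\<rho> x * \<bar>x - T x\<bar> ^ 3)) (at 0)"
    by (rule filterlim_compose[OF V_second_order[OF x]])
      (use yl nz in \<open>simp add: filterlim_at\<close>)
  then have "((\<lambda>\<tau>. potential_V u (x, ?Y \<tau>) / (?Y \<tau> - T x)\<^sup>2 * ((?Y \<tau> - T x) / \<tau>)\<^sup>2) \<longlongrightarrow>
      \<rho> (T x) / (\<rho> x * \<bar>x - T x\<bar> ^ 3) * (inverse (\<rho> (T x)))\<^sup>2) (at 0)"
    by (intro tendsto_mult tendsto_power q)
  moreover have "\<rho> (T x) / (\<rho> x * \<bar>x - T x\<bar> ^ 3) * (inverse (\<rho> (T x)))\<^sup>2 = B x"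
    using pos[of "T x"] by (simp add: B_def power2_eq_square field_simps)
  ultimately have "((\<lambda>\<tau>. potential_V u (x, ?Y \<tau>) / (?Y \<tau> - T x)\<^sup>2 * ((?Y \<tau> - T x) / \<tau>)\<^sup>2) \<longlongrightarrow> B x) (at 0)"
    by simp
  then show ?thesis
    by (rule Lim_transform_eventually) (use nz in \<open>eventually_elim, simp add: power_divide\<close>)
qed

end

section \<open>The Hessian and the optimal plan\<close>

text \<open>For a singular A with trace t^2 > 0, Cayley-Hamilton gives A^2 = t^2 A, so A / t is a
  root. Conversely a root R has (det R)^2 = det A = 0, hence R^2 = (tr R) R and (tr R)^2 = tr A;
  since tr R \<ge> 0 this determines R.\<close>

lemma psd_sqrt_singular:
  fixes A :: "real^2^2"
  assumes A: "A$1$1 = a" "A$1$2 = b" "A$2$1 = b" "A$2$2 = d"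
    and nonneg: "0 \<le> a" "0 \<le> d" "0 < a + d" and det: "a * d = b\<^sup>2"
  shows "trace (psd_sqrt A) = sqrt (a + d)"
proof -
  define t where "t = sqrt (a + d)"
  have t: "t > 0" "t * t = a + d" using nonneg by (auto simp: t_def)
  define S where "S = (\<chi> i j. A$i$j / t)"
  have S: "S$1$1 = a/t" "S$1$2 = b/t" "S$2$1 = b/t" "S$2$2 = d/t" by (auto simp: S_def A)
  have quad: "x \<bullet> (M *v x) = M$1$1 * (x$1)\<^sup>2 + (M$1$2 + M$2$1) * (x$1 * x$2) + M$2$2 * (x$2)\<^sup>2"
    for M :: "real^2^2" and x :: "real^2"
    by (simp add: inner_vec_def matrix_vector_mult_def sum_2 power2_eq_square algebra_simps)
  have psdS: "psd S"
    unfolding psd_def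
  proof (intro conjI allI)
    show "transpose S = S" by (simp add: transpose_def vec_eq_iff forall_2 S)
    fix x :: "real^2"
    have "(a * (x$1)\<^sup>2 + (b + b) * (x$1 * x$2) + d * (x$2)\<^sup>2) * (a + d)
      = (a * x$1 + b * x$2)\<^sup>2 + (b * x$1 + d * x$2)\<^sup>2 + (a * d - b\<^sup>2) * ((x$1)\<^sup>2 + (x$2)\<^sup>2)"
      by (simp add: power2_eq_square algebra_simps)
    also have "\<dots> \<ge> 0" using det by simp
    finally have "a * (x$1)\<^sup>2 + (b + b) * (x$1 * x$2) + d * (x$2)\<^sup>2 \<ge> 0"
      using nonneg(3) by (simp add: zero_le_mult_iff)
    then have "(a * (x$1)\<^sup>2 + (b + b) * (x$1 * x$2) + d * (x$2)\<^sup>2) / t \<ge> 0" using t by simp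
    also have "(a * (x$1)\<^sup>2 + (b + b) * (x$1 * x$2) + d * (x$2)\<^sup>2) / t = x \<bullet> (S *v x)"
      unfolding quad S by (simp add: add_divide_distrib)
    finally show "0 \<le> x \<bullet> (S *v x)" .
  qed
  have SS: "S ** S = A"
  proof -
    have "a * a + b * b = a * (t * t)" "b * b + d * d = d * (t * t)"
      "a * b + b * d = b * (t * t)" "b * a + d * b = b * (t * t)"
    proof -
      have bb: "b * b = a * d" using det by (simp add: power2_eq_square)
      show "a * a + b * b = a * (t * t)" "b * b + d * d = d * (t * t)"
        unfolding t(2) bb by (simp_all add: distrib_left mult.commute)
      show "a * b + b * d = b * (t * t)" "b * a + d * b = b * (t * t)"
        unfolding t(2) by (simp_all add: distrib_left mult.commute)
    qed
    then have "(a * a + b * b) / (t * t) = a" "(b * b + d * d) / (t * t) = d"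
      "(a * b + b * d) / (t * t) = b" "(b * a + d * b) / (t * t) = b"
      using t(1) by simp_all
    then show ?thesis
      by (simp add: vec_eq_iff forall_2 matrix_matrix_mult_def sum_2 S A add_divide_distrib)
  qed
  have unique: "R = S" if R: "psd R" "R ** R = A" for R
  proof -
    define p where "p = R$1$1"
    define q where "q = R$1$2"
    define r where "r = R$2$2"
    have "transpose R $ 1 $ 2 = R $ 1 $ 2" using R(1) by (simp add: psd_def)
    then have q': "R$2$1 = q" by (simp add: transpose_def q_def)
    have e: "p * p + q * q = a" "q * q + r * r = d" "p * q + q * r = b"
      using R(2) q' by (auto simp: A[symmetric] matrix_matrix_mult_def sum_2 p_def q_def r_def)
    have form: "0 \<le> p * x\<^sup>2 + (q + q) * (x * y) + r * y\<^sup>2" for x y :: real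
    proof -
      have "0 \<le> (vector [x, y] :: real^2) \<bullet> (R *v vector [x, y])" using R(1) by (simp add: psd_def)
      then show ?thesis unfolding quad by (simp add: p_def q_def r_def q'[unfolded q_def])
    qed
    have p0: "p \<ge> 0" and r0: "r \<ge> 0" using form[of 1 0] form[of 0 1] by auto
    have "(p * r - q * q)\<^sup>2 = a * d - b\<^sup>2"
      unfolding e[symmetric] by (simp add: power2_eq_square algebra_simps)
    then have pr: "p * r = q * q" using det by simp
    have "(p + r)\<^sup>2 = a + d" unfolding e[symmetric] using pr by (simp add: power2_eq_square algebra_simps)
    then have tp: "t = p + r" using p0 r0 by (simp add: t_def real_sqrt_unique)
    have "a = p * t" "b = q * t" "d = r * t"
      unfolding tp e[symmetric] pr[symmetric] by (simp_all add: distrib_left mult.commute)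
    then have "p = a/t" "q = b/t" "r = d/t" using t by auto
    then show "R = S" using q' by (simp add: vec_eq_iff forall_2 S p_def q_def r_def)
  qed
  have "psd_sqrt A = S"
    unfolding psd_sqrt_def by (rule the_equality) (use psdS SS unique in blast)+
  then have "trace (psd_sqrt A) = (a + d) / t" by (simp add: trace_def sum_2 S add_divide_distrib)
  also have "\<dots> = t" using t by (simp add: field_simps)
  finally show ?thesis by (simp add: t_def)
qed

lemma borel_measurable_fst_snd [measurable]:
  "(fst :: real \<times> real \<Rightarrow> real) \<in> borel_measurable borel"
  "(snd :: real \<times> real \<Rightarrow> real) \<in> borel_measurable borel"
  by (auto intro!: borel_measurable_continuous_onI continuous_intros)

lemma dir_derivI: "(f has_derivative f') (at x) \<Longrightarrow> dir_deriv b f x = f' b"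
  unfolding dir_deriv_def by (drule frechet_derivative_at) simp

text \<open>Rotation invariance on the circle: the two half intervals are exchanged by
  translations.\<close>

lemma nn_integral_opp:
  assumes [measurable]: "f \<in> borel_measurable borel"
  shows "(\<integral>\<^sup>+s. f (opp s) * indicator {0..<1} s \<partial>lborel) = (\<integral>\<^sup>+s. f s * indicator {0..<1} s \<partial>lborel)"
proof -
  have [measurable]: "opp \<in> borel_measurable borel" unfolding opp_def by measurable
  have "(\<integral>\<^sup>+s. f (opp s) * indicator {0..<1} s \<partial>lborel)
    = (\<integral>\<^sup>+s. f (1/2 + s) * indicator {0..<1/2} s + f (-1/2 + s) * indicator {1/2..<1} s \<partial>lborel)"
    by (intro nn_integral_cong) (auto simp: opp_def indicator_def add.commute)
  also have "\<dots> = (\<integral>\<^sup>+s. f (1/2 + s) * indicator {0..<1/2} s \<partial>lborel) + (\<integral>\<^sup>+s. f (-1/2 + s) * indicator {1/2..<1} s \<partial>lborel)"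
    by (rule nn_integral_add) auto
  also have "(\<integral>\<^sup>+s. f (1/2 + s) * indicator {0..<1/2} s \<partial>lborel) = (\<integral>\<^sup>+s. f s * indicator {1/2..<1} s \<partial>lborel)"
    by (subst nn_integral_real_affine[where c = 1 and t = "1/2", of "\<lambda>s. f s * indicator {1/2..<1} s"])
      (auto intro!: nn_integral_cong simp: indicator_def)
  also have "(\<integral>\<^sup>+s. f (-1/2 + s) * indicator {1/2..<1} s \<partial>lborel) = (\<integral>\<^sup>+s. f s * indicator {0..<1/2} s \<partial>lborel)"
    by (subst nn_integral_real_affine[where c = 1 and t = "-1/2", of "\<lambda>s. f s * indicator {0..<1/2} s"])
      (auto intro!: nn_integral_cong simp: indicator_def)
  also have "(\<integral>\<^sup>+s. f s * indicator {1/2..<1} s \<partial>lborel) + (\<integral>\<^sup>+s. f s * indicator {0..<1/2} s \<partial>lborel)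
     = (\<integral>\<^sup>+s. f s * indicator {1/2..<1} s + f s * indicator {0..<1/2} s \<partial>lborel)"
    by (rule nn_integral_add[symmetric]) auto
  also have "\<dots> = (\<integral>\<^sup>+s. f s * indicator {0..<1} s \<partial>lborel)"
    by (intro nn_integral_cong) (auto simp: indicator_def)
  finally show ?thesis .
qed

context coulomb_potential
begin

text \<open>With r the distance of x and T x and a = \<rho> x / \<rho> (T x), the entries are
  2a/r^3, -2/r^3 and 2/(a r^3), so the determinant is 0 and \<open>psd_sqrt_singular\<close>
  applies.\<close>

lemma trace_hessian:
  assumes x: "x \<noteq> m"
  shows "trace (psd_sqrt (hessian (potential_V u) (x, T x))) = sqrt (2 * ((\<rho> x)\<^sup>2 + (\<rho> (T x))\<^sup>2) * B x)"
proof -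
  let ?V = "potential_V u"
  \<comment> \<open>The second derivatives at one point require the first-derivative formulas on a
    whole neighbourhood; this open set provides it.\<close>
  let ?O = "{p :: real \<times> real. fst p \<noteq> m} \<inter> {p. snd p \<noteq> m} \<inter> {p. fst p \<noteq> snd p}"
  have O: "open ?O" by (intro open_Int open_Collect_neq continuous_intros)
  have comp: "((\<lambda>p. f (g p)) has_derivative (\<lambda>h. D * g' h)) (at p)"
    if "(f has_real_derivative D) (at (g p))" "(g has_derivative g') (at p)"
    for f :: "real \<Rightarrow> real" and g g' :: "real \<times> real \<Rightarrow> real" and D p
    using has_derivative_compose[OF that(2) that(1)[unfolded has_field_derivative_def]] by simp
  have df: "(fst has_derivative fst) (at p)" "(snd has_derivative snd) (at p)"
    "((\<lambda>p. fst p - snd p) has_derivative (\<lambda>h. fst h - snd h)) (at p)" for p :: "real \<times> real"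
    by (auto intro!: derivative_eq_intros)
  have dV: "(?V has_derivative (\<lambda>h. c1 (fst p - snd p) * (fst h - snd h) - u1 (fst p) * fst h - u1 (snd p) * snd h)) (at p)"
    if "p \<in> ?O" for p
    unfolding potential_V_def
    by (intro has_derivative_diff comp[OF c1_deriv(1) df(3)] comp[OF u_deriv df(1)] comp[OF u_deriv df(2)])
      (use that in auto)
  have d1: "dir_deriv (1, 0) ?V p = c1 (fst p - snd p) - u1 (fst p)" if "p \<in> ?O" for p
    using dir_derivI[OF dV[OF that]] by simp
  have d2: "dir_deriv (0, 1) ?V p = - c1 (fst p - snd p) - u1 (snd p)" if "p \<in> ?O" for p
    using dir_derivI[OF dV[OF that]] by simp
  let ?p = "(x, T x)"
  have p: "?p \<in> ?O" using x T_neq_m[OF x] T_neq[OF x] by (simp add: eq_commute)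
  define r where "r = \<bar>x - T x\<bar>"
  have r: "r > 0" using T_neq[OF x] by (simp add: r_def)
  have nz: "fst ?p - snd ?p \<noteq> 0" "fst ?p \<noteq> m" "snd ?p \<noteq> m" using p by auto
  have "((\<lambda>p. c1 (fst p - snd p) - u1 (fst p)) has_derivative
      (\<lambda>h. 2 / \<bar>fst ?p - snd ?p\<bar> ^ 3 * (fst h - snd h) - u2 (fst ?p) * fst h)) (at ?p)"
    by (intro has_derivative_diff comp[OF c1_deriv(2) df(3)] comp[OF u1_deriv df(1)] nz)
  then have "(dir_deriv (1, 0) ?V has_derivative
      (\<lambda>h. 2 / \<bar>fst ?p - snd ?p\<bar> ^ 3 * (fst h - snd h) - u2 (fst ?p) * fst h)) (at ?p)"
    by (rule has_derivative_transform_within_open[OF _ O p]) (simp add: d1)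
  note e1 = dir_derivI[OF this, folded r_def]
  have "((\<lambda>p. - c1 (fst p - snd p) - u1 (snd p)) has_derivative
      (\<lambda>h. - (2 / \<bar>fst ?p - snd ?p\<bar> ^ 3 * (fst h - snd h)) - u2 (snd ?p) * snd h)) (at ?p)"
    by (intro has_derivative_diff has_derivative_minus comp[OF c1_deriv(2) df(3)] comp[OF u1_deriv df(2)] nz)
  then have "(dir_deriv (0, 1) ?V has_derivative
      (\<lambda>h. - (2 / \<bar>fst ?p - snd ?p\<bar> ^ 3 * (fst h - snd h)) - u2 (snd ?p) * snd h)) (at ?p)"
    by (rule has_derivative_transform_within_open[OF _ O p]) (simp add: d2)
  note e2 = dir_derivI[OF this]
  define a where "a = \<rho> x / \<rho> (T x)"
  have a: "a > 0" by (simp add: a_def pos)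
  have u2x: "u2 x = 2 * (1 - a) / r ^ 3" by (simp add: u2_def a_def r_def)
  have u2T: "u2 (T x) = 2 * (1 - 1 / a) / r ^ 3"
    by (simp add: u2_def a_def r_def T_T[OF x] abs_minus_commute)
  have ax: "plane_axis 1 = (1, 0)" "plane_axis 2 = (0, 1)" by (simp_all add: plane_axis_def)
  let ?H = "hessian ?V ?p"
  have H: "?H$1$1 = 2 * a / r ^ 3" "?H$1$2 = - 2 / r ^ 3" "?H$2$1 = - 2 / r ^ 3" "?H$2$2 = 2 * (1 / a) / r ^ 3"
    unfolding hessian_def
    by (simp_all add: ax e1 e2 u2x u2T r_def[symmetric] diff_divide_distrib right_diff_distrib)
  have "trace (psd_sqrt ?H) = sqrt (2 * a / r ^ 3 + 2 * (1 / a) / r ^ 3)"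
    by (rule psd_sqrt_singular[OF H]) (use a r in \<open>auto simp: power2_eq_square intro!: add_pos_pos\<close>)
  also have "2 * a / r ^ 3 + 2 * (1 / a) / r ^ 3 = 2 * ((\<rho> x)\<^sup>2 + (\<rho> (T x))\<^sup>2) * B x"
    using r pos[of x] pos[of "T x"]
    by (simp add: a_def B_def r_def[symmetric] power2_eq_square field_simps)
  finally show ?thesis .
qed

section \<open>Concentration of the optimal plan on the graph of T\<close>

lemma AE_neq_m: "AE x in lborel. x \<noteq> m"
  using AE_lborel_singleton[of m] .

lemma opp_meas [measurable]: "opp \<in> borel_measurable borel"
  unfolding opp_def by measurable

lemma AE_density_neq_m: "AE x in density_measure \<rho>. x \<noteq> m"
  unfolding density_measure_def using AE_neq_m by (auto simp: AE_density elim: eventually_mono)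

lemma T_meas [measurable]: "T \<in> borel_measurable borel"
proof -
  have "T = (\<lambda>x. if x = m then T m else Q (opp (F x)))" using T_eq by auto
  also have "\<dots> \<in> borel_measurable borel" by measurable
  finally show ?thesis .
qed

lemma u_meas [measurable]: "u \<in> borel_measurable borel"
proof -
  obtain w where w: "continuous_on UNIV w" "\<And>x. x \<noteq> m \<Longrightarrow> w x = u x" by (rule u_extension) auto
  have [measurable]: "w \<in> borel_measurable borel" by (rule borel_measurable_continuous_onI[OF w(1)])
  have "u = (\<lambda>x. if x = m then u m else w x)" using w(2) by auto
  also have "\<dots> \<in> borel_measurable borel" by measurable
  finally show ?thesis .
qed

lemma nn_integral_T:
  assumes [measurable]: "h \<in> borel_measurable borel"
  shows "(\<integral>\<^sup>+x. ennreal (\<rho> x) * h (T x) \<partial>lborel) = (\<integral>\<^sup>+x. ennreal (\<rho> x) * h x \<partial>lborel)"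
proof -
  have "(\<integral>\<^sup>+x. ennreal (\<rho> x) * h (T x) \<partial>lborel) = (\<integral>\<^sup>+x. ennreal (\<rho> x) * h (Q (opp (F x))) \<partial>lborel)"
    using AE_neq_m by (intro nn_integral_cong_AE) (auto simp: T_eq elim!: eventually_mono)
  also have "\<dots> = (\<integral>\<^sup>+s. h (Q (opp s)) * indicator {0..<1} s \<partial>lborel)"
    by (rule nn_integral_F) measurable
  also have "\<dots> = (\<integral>\<^sup>+s. h (Q s) * indicator {0..<1} s \<partial>lborel)"
    by (rule nn_integral_opp[where f = "\<lambda>s. h (Q s)"]) measurable
  also have "\<dots> = (\<integral>\<^sup>+x. ennreal (\<rho> x) * h (Q (F x)) \<partial>lborel)"
    by (rule nn_integral_F[symmetric]) measurable
  finally show ?thesis by simp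
qed

lemma distr_T: "distr (density_measure \<rho>) borel T = density_measure \<rho>"
proof (rule measure_eqI)
  fix A assume "A \<in> sets (distr (density_measure \<rho>) borel T)"
  then have A [measurable]: "A \<in> sets borel" by simp
  have "emeasure (distr (density_measure \<rho>) borel T) A = (\<integral>\<^sup>+x. ennreal (\<rho> x) * indicator A (T x) \<partial>lborel)"
    by (subst emeasure_distr)
      (auto simp: density_measure_def emeasure_density indicator_def vimage_def intro!: nn_integral_cong)
  also have "\<dots> = emeasure (density_measure \<rho>) A"
    by (subst nn_integral_T) (auto simp: emeasure_density_rho)
  finally show "emeasure (distr (density_measure \<rho>) borel T) A = emeasure (density_measure \<rho>) A" .
qed (simp add: density_measure_def)

definition graph_plan :: "(real \<times> real) measure" where
  "graph_plan = distr (density_measure \<rho>) borel (\<lambda>x. (x, T x))"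

lemma sets_density [simp]: "sets (density_measure \<rho>) = sets borel" "space (density_measure \<rho>) = UNIV"
  by (simp_all add: density_measure_def)

lemma graph_meas [measurable]: "(\<lambda>x. (x, T x)) \<in> measurable borel borel"
  by measurable

lemma measurable_density [simp]: "measurable (density_measure \<rho>) N = measurable borel N"
  by (rule measurable_cong_sets) simp_all

lemma graph_plan_is_plan: "is_plan \<rho> graph_plan"
proof -
  interpret prob_space "density_measure \<rho>" by (rule prob)
  have "prob_space graph_plan" unfolding graph_plan_def by (rule prob_space_distr) simp
  moreover have "distr graph_plan borel fst = density_measure \<rho>"
    unfolding graph_plan_def by (subst distr_distr) (auto simp: comp_def intro!: distr_id2)
  moreover have "distr graph_plan borel snd = density_measure \<rho>"
    unfolding graph_plan_def by (subst distr_distr) (auto simp: comp_def distr_T)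
  ultimately show ?thesis by (simp add: is_plan_def graph_plan_def)
qed

lemma u_integrable: "integrable (density_measure \<rho>) u"
proof -
  interpret prob_space "density_measure \<rho>" by (rule prob)
  obtain C where C: "\<And>x. \<bar>u x\<bar> \<le> C" using u_bounded by auto
  show ?thesis by (rule integrable_const_bound[of _ C]) (auto simp: C)
qed

text \<open>Duality: since the marginals are fixed, the integral of V against the plan is its cost
  minus twice the integral of u against \<rho>, and this is at most the corresponding value 0 for
  the graph plan. As V \<ge> 0 off the diagonal, V = 0 almost everywhere, and the equality clause of
  the potential identifies the graph.\<close>

lemma optimal_plan_AE:
  assumes opt: "is_optimal_plan \<rho> \<gamma>"
  shows "AE p in \<gamma>. fst p \<noteq> m \<and> snd p = T (fst p)"
proof -
  have plan: "is_plan \<rho> \<gamma>" and le: "coulomb_cost \<gamma> \<le> coulomb_cost graph_plan"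
    using opt graph_plan_is_plan by (auto simp: is_optimal_plan_def)
  have sg: "sets \<gamma> = sets borel" and d1: "distr \<gamma> borel fst = density_measure \<rho>"
    and d2: "distr \<gamma> borel snd = density_measure \<rho>" using plan by (auto simp: is_plan_def)
  interpret G: prob_space \<gamma> using plan by (simp add: is_plan_def)
  interpret R: prob_space "density_measure \<rho>" by (rule prob)
  have ms [simp]: "measurable \<gamma> N = measurable borel N" for N :: "'a measure"
    by (rule measurable_cong_sets) (simp_all add: sg)
  let ?I = "LINT x|density_measure \<rho>. u x"
  have uT: "integrable (density_measure \<rho>) (\<lambda>x. u (T x))" "(LINT x|density_measure \<rho>. u (T x)) = ?I"
    using u_integrable integrable_distr[of T "density_measure \<rho>" borel u] integral_distr[of T "density_measure \<rho>" borel u]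
    by (simp_all add: distr_T)
  have "coulomb_cost graph_plan = (\<integral>\<^sup>+x. 1 / ennreal \<bar>x - T x\<bar> \<partial>density_measure \<rho>)"
    unfolding coulomb_cost_def graph_plan_def by (subst nn_integral_distr) auto
  also have "\<dots> = (\<integral>\<^sup>+x. ennreal (u x + u (T x)) \<partial>density_measure \<rho>)"
  proof (rule nn_integral_cong_AE)
    show "AE x in density_measure \<rho>. 1 / ennreal \<bar>x - T x\<bar> = ennreal (u x + u (T x))"
      using AE_density_neq_m
    proof eventually_elim
      fix x assume x: "x \<noteq> m"
      have "\<bar>x - T x\<bar> > 0" using T_neq[OF x] by simp
      then show "1 / ennreal \<bar>x - T x\<bar> = ennreal (u x + u (T x))"
        unfolding kant_eq[OF x] by (simp add: divide_ennreal flip: ennreal_1)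
    qed
  qed
  also have "\<dots> = ennreal (LINT x|density_measure \<rho>. u x + u (T x))"
  proof (rule nn_integral_eq_integral)
    show "integrable (density_measure \<rho>) (\<lambda>x. u x + u (T x))" using u_integrable uT by simp
    show "AE x in density_measure \<rho>. 0 \<le> u x + u (T x)"
      using AE_density_neq_m
      by eventually_elim (simp add: kant_eq)
  qed
  also have "(LINT x|density_measure \<rho>. u x + u (T x)) = 2 * ?I" using u_integrable uT by simp
  finally have cost: "coulomb_cost \<gamma> \<le> ennreal (2 * ?I)" using le by simp
  \<comment> \<open>The cost is infinite on the diagonal, so finite cost makes the diagonal a null
    set.\<close>
  have ne: "AE p in \<gamma>. fst p \<noteq> snd p"
  proof -
    have "coulomb_cost \<gamma> < \<infinity>" using cost by (rule le_less_trans) simp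
    then have "AE p in \<gamma>. 1 / ennreal \<bar>fst p - snd p\<bar> \<noteq> \<infinity>"
      unfolding coulomb_cost_def by (intro nn_integral_PInf_AE) auto
    then show ?thesis by eventually_elim auto
  qed
  let ?c = "\<lambda>p::real \<times> real. 1 / \<bar>fst p - snd p\<bar>"
  have cc: "(\<integral>\<^sup>+p. ennreal (?c p) \<partial>\<gamma>) = coulomb_cost \<gamma>"
    unfolding coulomb_cost_def
  proof (rule nn_integral_cong_AE)
    show "AE p in \<gamma>. ennreal (?c p) = 1 / ennreal \<bar>fst p - snd p\<bar>"
      using ne by eventually_elim (simp add: divide_ennreal flip: ennreal_1)
  qed
  have ci: "integrable \<gamma> ?c"
    by (rule integrableI_nonneg) (use cost in \<open>auto simp: cc intro: le_less_trans\<close>)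
  have le2: "ennreal (LINT p|\<gamma>. ?c p) \<le> ennreal (2 * ?I)"
    using cost by (subst nn_integral_eq_integral[OF ci, symmetric]) (auto simp: cc)
  \<comment> \<open>Needed to read the comparison in \<open>ennreal\<close> as a comparison of real
    numbers.\<close>
  have I0: "0 \<le> 2 * ?I"
  proof -
    have "0 \<le> (LINT x|density_measure \<rho>. u x + u (T x))"
    proof (rule integral_nonneg_AE)
      show "AE x in density_measure \<rho>. 0 \<le> u x + u (T x)"
      using AE_density_neq_m
        by eventually_elim (simp add: kant_eq)
    qed
    then show ?thesis using u_integrable uT by simp
  qed
  with le2 have ci2: "(LINT p|\<gamma>. ?c p) \<le> 2 * ?I" by simp
  have ui: "integrable \<gamma> (\<lambda>p. u (fst p))" "(LINT p|\<gamma>. u (fst p)) = ?I"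
    using integrable_distr[of fst \<gamma> borel u] integral_distr[of fst \<gamma> borel u] u_integrable by (simp_all add: d1)
  have ui2: "integrable \<gamma> (\<lambda>p. u (snd p))" "(LINT p|\<gamma>. u (snd p)) = ?I"
    using integrable_distr[of snd \<gamma> borel u] integral_distr[of snd \<gamma> borel u] u_integrable by (simp_all add: d2)
  have Vi: "integrable \<gamma> (potential_V u)" unfolding potential_V_def using ci ui(1) ui2(1) by simp
  have "(LINT p|\<gamma>. potential_V u p) = (LINT p|\<gamma>. ?c p) - ?I - ?I"
    unfolding potential_V_def using ci ui ui2 by simp
  then have V0: "(LINT p|\<gamma>. potential_V u p) \<le> 0" using ci2 by simp
  have Vn: "AE p in \<gamma>. 0 \<le> potential_V u p"
    using ne by eventually_elim (use V_nonneg in \<open>auto simp: case_prod_beta\<close>)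
  have "(LINT p|\<gamma>. potential_V u p) = 0" using V0 integral_nonneg_AE[OF Vn] by simp
  then have "AE p in \<gamma>. potential_V u p = 0"
    using integral_nonneg_eq_0_iff_AE[OF Vi Vn] by simp
  with ne show ?thesis
  proof eventually_elim
    fix p :: "real \<times> real" assume p: "fst p \<noteq> snd p" "potential_V u p = 0"
    have "u (fst p) + u (snd p) = 1 / \<bar>fst p - snd p\<bar>" using p(2) by (simp add: potential_V_def)
    then show "fst p \<noteq> m \<and> snd p = T (fst p)" by (rule kant_eqD[OF p(1)])
  qed
qed

text \<open>A measure concentrated on a graph is determined by its first marginal.\<close>

lemma optimal_plan_eq:
  assumes opt: "is_optimal_plan \<rho> \<gamma>"
  shows "\<gamma> = graph_plan"
proof (rule measure_eqI)
  have plan: "is_plan \<rho> \<gamma>" using opt by (simp add: is_optimal_plan_def)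
  have sg: "sets \<gamma> = sets borel" and d1: "distr \<gamma> borel fst = density_measure \<rho>"
    using plan by (auto simp: is_plan_def)
  have sp: "space \<gamma> = UNIV" using sets_eq_imp_space_eq[OF sg] by simp
  have ms: "measurable \<gamma> N = measurable borel N" for N :: "'a measure"
    by (rule measurable_cong_sets) (simp_all add: sg)
  show "sets \<gamma> = sets graph_plan" by (simp add: sg graph_plan_def)
  fix A assume "A \<in> sets \<gamma>"
  then have A [measurable]: "A \<in> sets borel" by (simp add: sg)
  have P: "{x. (x, T x) \<in> A} \<in> sets borel"
    using measurable_sets[OF graph_meas A] by (simp add: vimage_def)
  have P2: "{p. (fst p, T (fst p)) \<in> A} \<in> sets (borel :: (real \<times> real) measure)"
    using measurable_sets[OF measurable_compose[OF borel_measurable_fst_snd(1) graph_meas] A]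
    by (simp add: vimage_def)
  have "emeasure \<gamma> A = emeasure \<gamma> {p. (fst p, T (fst p)) \<in> A}"
  proof (rule emeasure_eq_AE)
    show "AE p in \<gamma>. (p \<in> A) = (p \<in> {p. (fst p, T (fst p)) \<in> A})"
      using optimal_plan_AE[OF opt] by eventually_elim (auto simp: prod_eq_iff[symmetric] simp flip: prod.collapse)
  qed (use P2 in \<open>auto simp: sg\<close>)
  also have "\<dots> = emeasure (distr \<gamma> borel fst) {x. (x, T x) \<in> A}"
    by (subst emeasure_distr) (use P in \<open>auto simp: sp ms vimage_def\<close>)
  also have "\<dots> = emeasure graph_plan A"
    unfolding d1 graph_plan_def by (subst emeasure_distr) (auto simp: vimage_def)
  finally show "emeasure \<gamma> A = emeasure graph_plan A" .
qed

lemma nn_integral_trace: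
  assumes opt: "is_optimal_plan \<rho> \<gamma>"
  shows "(\<integral>\<^sup>+p. ennreal (trace (psd_sqrt (hessian (potential_V u) p))) \<partial>\<gamma>)
    = (\<integral>\<^sup>+x. ennreal (\<rho> x) * ennreal (sqrt (2 * ((\<rho> x)\<^sup>2 + (\<rho> (T x))\<^sup>2) * B x)) \<partial>lborel)"
proof -
  let ?f = "\<lambda>x. ennreal (sqrt (2 * ((\<rho> x)\<^sup>2 + (\<rho> (T x))\<^sup>2) * B x))"
  have [measurable]: "B \<in> borel_measurable borel" unfolding B_def[abs_def] by measurable
  have [measurable]: "?f \<in> borel_measurable borel" by measurable
  have "(\<integral>\<^sup>+p. ennreal (trace (psd_sqrt (hessian (potential_V u) p))) \<partial>\<gamma>) = (\<integral>\<^sup>+p. ?f (fst p) \<partial>\<gamma>)"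
  proof (rule nn_integral_cong_AE)
    show "AE p in \<gamma>. ennreal (trace (psd_sqrt (hessian (potential_V u) p))) = ?f (fst p)"
      using optimal_plan_AE[OF opt]
    proof eventually_elim
      fix p :: "real \<times> real" assume "fst p \<noteq> m \<and> snd p = T (fst p)"
      then show "ennreal (trace (psd_sqrt (hessian (potential_V u) p))) = ?f (fst p)"
        using trace_hessian[of "fst p"] by (cases p) simp
    qed
  qed
  also have "\<dots> = (\<integral>\<^sup>+x. ?f x \<partial>density_measure \<rho>)"
    unfolding optimal_plan_eq[OF opt] graph_plan_def by (subst nn_integral_distr) simp_all
  also have "\<dots> = (\<integral>\<^sup>+x. ennreal (\<rho> x) * ?f x \<partial>lborel)"
    unfolding density_measure_def by (subst nn_integral_density) simp_all
  finally show ?thesis .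
qed

end

section \<open>The kernel on the circle\<close>

lemma nn_integral_Icc:
  fixes f :: "real \<Rightarrow> real"
  assumes "continuous_on {a..b} f" "\<And>x. x \<in> {a..b} \<Longrightarrow> 0 \<le> f x"
  shows "(\<integral>\<^sup>+x. ennreal (f x) * indicator {a..b} x \<partial>lborel) = ennreal (integral {a..b} f)"
proof -
  have si: "set_integrable lborel {a..b} f" by (rule borel_integrable_atLeastAtMost'[OF assms(1)])
  have "(\<integral>\<^sup>+x. ennreal (f x) * indicator {a..b} x \<partial>lborel) = (\<integral>\<^sup>+x. ennreal (indicator {a..b} x *\<^sub>R f x) \<partial>lborel)"
    by (intro nn_integral_cong) (auto simp: indicator_def)
  also have "\<dots> = ennreal (LINT x|lborel. indicator {a..b} x *\<^sub>R f x)"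
    by (rule nn_integral_eq_integral) (use si assms(2) in \<open>auto simp: set_integrable_def indicator_def\<close>)
  finally show ?thesis
    using set_borel_integral_eq_integral(2)[OF si] by (simp add: set_lebesgue_integral_def)
qed

text \<open>Integration of a function that is concentrated near the shifted diagonal \<open>t = s + 1/2\<close> of the
  circle \<open>[0, 1)\<close>, in the rescaled transversal variable.\<close>

lemma nn_integral_circle:
  fixes h :: "real \<Rightarrow> real \<Rightarrow> ennreal"
  assumes [measurable]: "case_prod h \<in> borel_measurable (borel \<Otimes>\<^sub>M borel)"
    and supp: "\<And>t \<xi>. 1 \<le> \<bar>\<xi>\<bar> \<Longrightarrow> h t \<xi> = 0"
    and s: "0 \<le> s" "s < 1" and w: "0 < w" "w \<le> 1/2"
  shows "(\<integral>\<^sup>+t. ennreal (1 / w) * (h t ((t - s - 1/2) / w) + h t ((t - s + 1/2) / w)) * indicator {0..<1} t \<partial>lborel)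
    = (\<integral>\<^sup>+\<xi>. h (frac (s + 1/2 + w * \<xi>)) \<xi> \<partial>lborel)"
proof -
  have h2 [measurable]: "(\<lambda>x. h (f x) (g x)) \<in> borel_measurable borel"
    if "f \<in> borel_measurable borel" "g \<in> borel_measurable borel" for f g :: "real \<Rightarrow> real"
    using measurable_compose[OF measurable_Pair[OF that] assms(1)] by simp
  \<comment> \<open>The substitution t = c + w \<xi>, to be used for the two branches c = s + 1/2
    and c = s - 1/2.\<close>
  have aff: "(\<integral>\<^sup>+t. ennreal (1 / w) * h t ((t - c) / w) * indicator {0..<1} t \<partial>lborel)
      = (\<integral>\<^sup>+\<xi>. h (c + w * \<xi>) \<xi> * indicator {0..<1} (c + w * \<xi>) \<partial>lborel)" for c
  proof -
    have "(\<integral>\<^sup>+t. ennreal (1 / w) * h t ((t - c) / w) * indicator {0..<1} t \<partial>lborel)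
      = ennreal \<bar>w\<bar> * (\<integral>\<^sup>+\<xi>. ennreal (1 / w) * h (c + w * \<xi>) ((c + w * \<xi> - c) / w) * indicator {0..<1} (c + w * \<xi>) \<partial>lborel)"
      using w by (intro nn_integral_real_affine) auto
    also have "\<dots> = (\<integral>\<^sup>+\<xi>. ennreal \<bar>w\<bar> * (ennreal (1 / w) * h (c + w * \<xi>) ((c + w * \<xi> - c) / w) * indicator {0..<1} (c + w * \<xi>)) \<partial>lborel)"
      by (rule nn_integral_cmult[symmetric]) measurable
    also have "\<dots> = (\<integral>\<^sup>+\<xi>. h (c + w * \<xi>) \<xi> * indicator {0..<1} (c + w * \<xi>) \<partial>lborel)"
    proof (intro nn_integral_cong)
      fix \<xi> :: real
      have "ennreal \<bar>w\<bar> * ennreal (1 / w) = 1" using w by (simp add: ennreal_mult[symmetric])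
      then show "ennreal \<bar>w\<bar> * (ennreal (1 / w) * h (c + w * \<xi>) ((c + w * \<xi> - c) / w) * indicator {0..<1} (c + w * \<xi>))
          = h (c + w * \<xi>) \<xi> * indicator {0..<1} (c + w * \<xi>)"
        using w by (simp add: mult.assoc[symmetric])
    qed
    finally show ?thesis .
  qed
  have "(\<integral>\<^sup>+t. ennreal (1 / w) * (h t ((t - s - 1/2) / w) + h t ((t - s + 1/2) / w)) * indicator {0..<1} t \<partial>lborel)
    = (\<integral>\<^sup>+t. ennreal (1 / w) * h t ((t - (s + 1/2)) / w) * indicator {0..<1} t
        + ennreal (1 / w) * h t ((t - (s - 1/2)) / w) * indicator {0..<1} t \<partial>lborel)"
    by (intro nn_integral_cong) (simp add: algebra_simps)
  also have "\<dots> = (\<integral>\<^sup>+t. ennreal (1 / w) * h t ((t - (s + 1/2)) / w) * indicator {0..<1} t \<partial>lborel)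
        + (\<integral>\<^sup>+t. ennreal (1 / w) * h t ((t - (s - 1/2)) / w) * indicator {0..<1} t \<partial>lborel)"
    by (rule nn_integral_add) measurable
  also have "\<dots> = (\<integral>\<^sup>+\<xi>. h (s + 1/2 + w * \<xi>) \<xi> * indicator {0..<1} (s + 1/2 + w * \<xi>)
       + h (s - 1/2 + w * \<xi>) \<xi> * indicator {0..<1} (s - 1/2 + w * \<xi>) \<partial>lborel)"
    unfolding aff by (rule nn_integral_add[symmetric]) measurable
  also have "\<dots> = (\<integral>\<^sup>+\<xi>. h (frac (s + 1/2 + w * \<xi>)) \<xi> \<partial>lborel)"
  proof (rule nn_integral_cong)
    fix \<xi> :: real
    show "h (s + 1/2 + w * \<xi>) \<xi> * indicator {0..<1} (s + 1/2 + w * \<xi>)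
       + h (s - 1/2 + w * \<xi>) \<xi> * indicator {0..<1} (s - 1/2 + w * \<xi>) = h (frac (s + 1/2 + w * \<xi>)) \<xi>"
    proof (cases "1 \<le> \<bar>\<xi>\<bar>")
      case True
      then show ?thesis by (simp add: supp)
    next
      case False
      \<comment> \<open>For w \<le> 1/2 the point s + 1/2 + w \<xi> lies in [0, 2), so exactly one
        branch lands in [0, 1), and it lands at the fractional part.\<close>
      have "\<bar>w * \<xi>\<bar> \<le> 1/2 * 1" unfolding abs_mult using False w by (intro mult_mono) auto
      then have z: "0 \<le> s + 1/2 + w * \<xi>" "s + 1/2 + w * \<xi> < 2" using s by linarith+
      show ?thesis
      proof (cases "s + 1/2 + w * \<xi> < 1")
        case True
        then have "frac (s + 1/2 + w * \<xi>) = s + 1/2 + w * \<xi>" using z by (simp add: frac_eq)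
        then show ?thesis using True z by simp
      next
        case False
        have "s + 1/2 + w * \<xi> = (s - 1/2 + w * \<xi>) + 1" by simp
        then have "frac (s + 1/2 + w * \<xi>) = frac (s - 1/2 + w * \<xi>)"
          by (simp only: frac_1_eq)
        also have "\<dots> = s - 1/2 + w * \<xi>" using False z by (simp add: frac_eq)
        finally have "frac (s + 1/2 + w * \<xi>) = s - 1/2 + w * \<xi>" .
        then show ?thesis using False z by simp
      qed
    qed
  qed
  finally show ?thesis .
qed

section \<open>The profile and its weighted amplitude\<close>

locale profile =
  fixes \<theta> \<theta>' :: "real \<Rightarrow> real"
  assumes \<theta>_deriv: "\<And>x. (\<theta> has_real_derivative \<theta>' x) (at x)"
    and \<theta>'_cont: "continuous_on UNIV \<theta>'"
    and \<theta>_even: "\<And>x. \<theta> (- x) = \<theta> x"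
    and \<theta>_0: "\<And>x. 1 \<le> \<bar>x\<bar> \<Longrightarrow> \<theta> x = 0"
    and \<theta>'_0: "\<And>x. 1 \<le> \<bar>x\<bar> \<Longrightarrow> \<theta>' x = 0"
    and \<theta>_norm: "integral {-1..1} (\<lambda>x. (\<theta> x)\<^sup>2) = 1"
begin

lemma \<theta>_cont: "continuous_on A \<theta>"
  using \<theta>_deriv by (intro continuous_at_imp_continuous_on ballI DERIV_isCont) blast

lemma \<theta>_meas [measurable]: "\<theta> \<in> borel_measurable borel" "\<theta>' \<in> borel_measurable borel"
  using \<theta>_cont \<theta>'_cont by (auto intro: borel_measurable_continuous_onI)

lemma \<theta>_bound_ex: "\<exists>M>0. \<forall>x. \<bar>\<theta> x\<bar> \<le> M \<and> \<bar>\<theta>' x\<bar> \<le> M"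
proof -
  have "bounded (\<theta> ` {-1..1})" "bounded (\<theta>' ` {-1..1})"
    by (intro compact_imp_bounded compact_continuous_image \<theta>_cont continuous_on_subset[OF \<theta>'_cont]; simp)+
  then obtain M1 M2 where M: "\<And>x. x \<in> {-1..1} \<Longrightarrow> \<bar>\<theta> x\<bar> \<le> M1" "\<And>x. x \<in> {-1..1} \<Longrightarrow> \<bar>\<theta>' x\<bar> \<le> M2"
    unfolding bounded_iff by (metis imageI real_norm_def)
  have "\<bar>\<theta> x\<bar> \<le> \<bar>M1\<bar> + \<bar>M2\<bar> + 1 \<and> \<bar>\<theta>' x\<bar> \<le> \<bar>M1\<bar> + \<bar>M2\<bar> + 1" for x
  proof (cases "x \<in> {-1..1}")
    case True
    then show ?thesis using M[of x] by linarith
  next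
    case False
    then have "1 \<le> \<bar>x\<bar>" by auto
    then show ?thesis by (simp add: \<theta>_0 \<theta>'_0)
  qed
  then show ?thesis by (intro exI[of _ "\<bar>M1\<bar> + \<bar>M2\<bar> + 1"]) auto
qed

definition M\<theta> :: real where "M\<theta> = (SOME M. M > 0 \<and> (\<forall>x. \<bar>\<theta> x\<bar> \<le> M \<and> \<bar>\<theta>' x\<bar> \<le> M))"

lemma M\<theta>: "M\<theta> > 0" "\<bar>\<theta> x\<bar> \<le> M\<theta>" "\<bar>\<theta>' x\<bar> \<le> M\<theta>"
  using someI_ex[OF \<theta>_bound_ex] unfolding M\<theta>_def by auto

text \<open>The linear term vanishes because \<theta> is even. The bound on b keeps the weight
  nonnegative on the support; elsewhere \<open>ennreal\<close> would cut it off.\<close>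

lemma nn_integral_\<theta>:
  assumes b: "\<bar>b\<bar> \<le> 1"
  shows "(\<integral>\<^sup>+x. ennreal ((\<theta> x)\<^sup>2 * (1 + x * b)) \<partial>lborel) = 1"
proof -
  have c: "continuous_on A (\<lambda>x. (\<theta> x)\<^sup>2)" "continuous_on A (\<lambda>x. x * (\<theta> x)\<^sup>2)" for A
    by (intro continuous_intros \<theta>_cont)+
  have "integral {-1..1} (\<lambda>x. - x * (\<theta> (- x))\<^sup>2) = integral {-1..1} (\<lambda>x. x * (\<theta> x)\<^sup>2)"
    using Henstock_Kurzweil_Integration.integral_reflect_real[of 1 "-1" "\<lambda>x. x * (\<theta> x)\<^sup>2"] by simp
  then have odd: "integral {-1..1} (\<lambda>x. x * (\<theta> x)\<^sup>2) = 0" by (simp add: \<theta>_even)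
  have "(\<integral>\<^sup>+x. ennreal ((\<theta> x)\<^sup>2 * (1 + x * b)) \<partial>lborel)
      = (\<integral>\<^sup>+x. ennreal ((\<theta> x)\<^sup>2 + b * (x * (\<theta> x)\<^sup>2)) * indicator {-1..1} x \<partial>lborel)"
    using \<theta>_0 by (intro nn_integral_cong) (auto simp: indicator_def algebra_simps)
  also have "\<dots> = ennreal (integral {-1..1} (\<lambda>x. (\<theta> x)\<^sup>2 + b * (x * (\<theta> x)\<^sup>2)))"
  proof (rule nn_integral_Icc)
    show "continuous_on {-1..1} (\<lambda>x. (\<theta> x)\<^sup>2 + b * (x * (\<theta> x)\<^sup>2))" by (intro continuous_intros \<theta>_cont)
    fix x :: real assume "x \<in> {-1..1}"
    then have "\<bar>x * b\<bar> \<le> 1 * 1" unfolding abs_mult using b by (intro mult_mono) auto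
    then have "0 \<le> (\<theta> x)\<^sup>2 * (1 + x * b)" by (intro mult_nonneg_nonneg) auto
    then show "0 \<le> (\<theta> x)\<^sup>2 + b * (x * (\<theta> x)\<^sup>2)" by (simp add: algebra_simps)
  qed
  also have "integral {-1..1} (\<lambda>x. (\<theta> x)\<^sup>2 + b * (x * (\<theta> x)\<^sup>2))
      = integral {-1..1} (\<lambda>x. (\<theta> x)\<^sup>2) + b * integral {-1..1} (\<lambda>x. x * (\<theta> x)\<^sup>2)"
    by (subst integral_add) (auto intro!: integrable_continuous_interval continuous_intros \<theta>_cont)
  finally show ?thesis by (simp add: odd \<theta>_norm)
qed

text \<open>\<open>\<eta>\<close> is the amplitude whose square is the profile with the weight \<open>1 + \<xi> w'(s)\<close>; \<open>\<eta>x\<close> and \<open>\<eta>b\<close> are its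
  partial derivatives.\<close>

definition \<eta> :: "real \<Rightarrow> real \<Rightarrow> real" where
  "\<eta> x b = \<theta> x * sqrt (1 + x * b)"

definition \<eta>x :: "real \<Rightarrow> real \<Rightarrow> real" where
  "\<eta>x x b = \<theta>' x * sqrt (1 + x * b) + \<theta> x * (b / (2 * sqrt (1 + x * b)))"

definition \<eta>b :: "real \<Rightarrow> real \<Rightarrow> real" where
  "\<eta>b x b = \<theta> x * (x / (2 * sqrt (1 + x * b)))"

lemma \<eta>_0: "1 \<le> \<bar>x\<bar> \<Longrightarrow> \<eta> x b = 0" "1 \<le> \<bar>x\<bar> \<Longrightarrow> \<eta>x x b = 0" "1 \<le> \<bar>x\<bar> \<Longrightarrow> \<eta>b x b = 0"
  by (auto simp: \<eta>_def \<eta>x_def \<eta>b_def \<theta>_0 \<theta>'_0)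

lemma xb_bound:
  fixes x b \<kappa> :: real
  assumes "\<bar>x\<bar> \<le> 1" "\<bar>b\<bar> \<le> \<kappa>"
  shows "\<bar>x * b\<bar> \<le> \<kappa>"
  using mult_mono[of "\<bar>x\<bar>" 1 "\<bar>b\<bar>" \<kappa>] assms by (simp add: abs_mult)

lemma \<eta>_sq: "\<bar>b\<bar> \<le> 1 \<Longrightarrow> (\<eta> x b)\<^sup>2 = (\<theta> x)\<^sup>2 * (1 + x * b)"
  using xb_bound[of x b 1] by (cases "1 \<le> \<bar>x\<bar>") (auto simp: \<eta>_0 \<theta>_0 \<eta>_def power_mult_distrib)

text \<open>Inside the support the argument of the root is at least 1/2. Outside, where the argument
  may be negative, the amplitude is locally zero and both sides vanish.\<close>

lemma \<eta>_deriv: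
  assumes X: "(X has_real_derivative X') (at z)" and \<beta>: "(\<beta> has_real_derivative \<beta>') (at z)"
    and b: "\<bar>\<beta> z\<bar> \<le> 1/2"
  shows "((\<lambda>z. \<eta> (X z) (\<beta> z)) has_real_derivative \<eta>x (X z) (\<beta> z) * X' + \<eta>b (X z) (\<beta> z) * \<beta>') (at z)"
proof (cases "\<bar>X z\<bar> \<le> 1")
  case True
  then have "\<bar>X z * \<beta> z\<bar> \<le> 1/2" using b by (intro xb_bound)
  then have p: "0 < 1 + X z * \<beta> z" by linarith
  have s: "((\<lambda>z. sqrt (1 + X z * \<beta> z)) has_real_derivative
      inverse (sqrt (1 + X z * \<beta> z)) / 2 * (0 + (X' * \<beta> z + \<beta>' * X z))) (at z)"
    by (rule DERIV_chain2[where f = sqrt and g = "\<lambda>z. 1 + X z * \<beta> z", OF DERIV_real_sqrt[OF p]]) (intro DERIV_add DERIV_const DERIV_mult X \<beta>)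
  have "((\<lambda>z. \<theta> (X z) * sqrt (1 + X z * \<beta> z)) has_real_derivative
      \<theta>' (X z) * X' * sqrt (1 + X z * \<beta> z)
      + inverse (sqrt (1 + X z * \<beta> z)) / 2 * (0 + (X' * \<beta> z + \<beta>' * X z)) * \<theta> (X z)) (at z)"
    by (rule DERIV_mult[OF DERIV_chain2[OF \<theta>_deriv X] s])
  moreover have "\<theta>' (X z) * X' * sqrt (1 + X z * \<beta> z)
      + inverse (sqrt (1 + X z * \<beta> z)) / 2 * (0 + (X' * \<beta> z + \<beta>' * X z)) * \<theta> (X z)
      = \<eta>x (X z) (\<beta> z) * X' + \<eta>b (X z) (\<beta> z) * \<beta>'"
  proof -
    have "a' * x' * r + inverse r / 2 * (0 + (x' * b + b' * x)) * a
        = (a' * r + a * (b / (2 * r))) * x' + a * (x / (2 * r)) * b'" if "r \<noteq> 0" for a a' x x' b b' r :: real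
      using that by (simp add: field_simps)
    from this[of "sqrt (1 + X z * \<beta> z)"] p show ?thesis by (simp add: \<eta>x_def \<eta>b_def)
  qed
  ultimately show ?thesis unfolding \<eta>_def[abs_def] by simp
next
  case False
  have "((\<lambda>z. \<bar>X z\<bar>) \<longlongrightarrow> \<bar>X z\<bar>) (nhds z)"
    using DERIV_isCont[OF X] unfolding isCont_def tendsto_at_iff_tendsto_nhds by (rule tendsto_rabs)
  then have "eventually (\<lambda>y. 1 < \<bar>X y\<bar>) (nhds z)" using False by (intro order_tendstoD) auto
  then have "eventually (\<lambda>y. \<eta> (X y) (\<beta> y) = 0) (nhds z)" by eventually_elim (simp add: \<eta>_0)
  then have "((\<lambda>z. \<eta> (X z) (\<beta> z)) has_real_derivative 0) (at z) \<longleftrightarrow> ((\<lambda>z. 0) has_real_derivative 0) (at z)"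
    by (intro DERIV_cong_ev) auto
  then show ?thesis using False by (simp add: \<eta>_0)
qed

lemma sqrt_one_plus_bounds:
  fixes y :: real
  assumes "\<bar>y\<bar> \<le> \<kappa>" "\<kappa> \<le> 1/2"
  shows "sqrt (1 + y) \<le> 1 + \<kappa>" "1 / (2 * sqrt (1 + y)) \<le> 1" "0 < sqrt (1 + y)"
proof -
  have "\<kappa> \<ge> 0" using assms by linarith
  moreover have "0 \<le> \<kappa> * \<kappa>" by simp
  ultimately have "y \<le> \<kappa> + \<kappa> + \<kappa> * \<kappa>" using assms(1) by linarith
  then have "1 + y \<le> (1 + \<kappa>)\<^sup>2" by (simp add: power2_eq_square algebra_simps)
  then show "sqrt (1 + y) \<le> 1 + \<kappa>" using assms by (intro real_le_lsqrt) auto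
  have "(1/2)\<^sup>2 \<le> 1 + y" using assms by (simp add: power2_eq_square)
  then have "1/2 \<le> sqrt (1 + y)" by (rule real_le_rsqrt)
  then have "0 < sqrt (1 + y)" "1 \<le> 2 * sqrt (1 + y)" by linarith+
  then show "1 / (2 * sqrt (1 + y)) \<le> 1" "0 < sqrt (1 + y)" by (simp_all add: pos_divide_le_eq)
qed

lemma \<eta>_bounds:
  assumes b: "\<bar>b\<bar> \<le> \<kappa>" "\<kappa> \<le> 1/16"
  shows "\<bar>\<eta> x b\<bar> \<le> 2 * M\<theta>" "\<bar>\<eta>x x b\<bar> \<le> \<bar>\<theta>' x\<bar> * (1 + \<kappa>) + M\<theta> * \<kappa>" "\<bar>\<eta>b x b\<bar> \<le> M\<theta>"
proof -
  have \<kappa>: "\<kappa> \<ge> 0" using b by linarith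
  have M: "M\<theta> \<ge> 0" using M\<theta> by simp
  have "\<bar>\<eta> x b\<bar> \<le> 2 * M\<theta> \<and> \<bar>\<eta>x x b\<bar> \<le> \<bar>\<theta>' x\<bar> * (1 + \<kappa>) + M\<theta> * \<kappa> \<and> \<bar>\<eta>b x b\<bar> \<le> M\<theta>"
  proof (cases "1 \<le> \<bar>x\<bar>")
    case True
    then show ?thesis using \<kappa> M by (simp add: \<eta>_0)
  next
    case False
    have x: "\<bar>x\<bar> \<le> 1" using False by simp
    define r where "r = sqrt (1 + x * b)"
    have r: "r \<le> 1 + \<kappa>" "1 / (2 * r) \<le> 1" "0 < r"
      unfolding r_def using sqrt_one_plus_bounds[OF xb_bound[OF x b(1)]] b by auto
    have "\<bar>\<eta> x b\<bar> = \<bar>\<theta> x\<bar> * r" using r by (simp add: \<eta>_def r_def[symmetric] abs_mult)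
    also have "\<dots> \<le> M\<theta> * 2" using M\<theta>(2) r b M by (intro mult_mono) auto
    finally have 1: "\<bar>\<eta> x b\<bar> \<le> 2 * M\<theta>" by simp
    have "\<bar>\<eta>x x b\<bar> \<le> \<bar>\<theta>' x\<bar> * r + \<bar>\<theta> x\<bar> * (\<bar>b\<bar> * (1 / (2 * r)))"
      unfolding \<eta>x_def r_def[symmetric] using r(3) by (intro order_trans[OF abs_triangle_ineq]) (simp add: abs_mult)
    also have "\<dots> \<le> \<bar>\<theta>' x\<bar> * (1 + \<kappa>) + M\<theta> * (\<kappa> * 1)"
      using M\<theta>(2)[of x] r b M \<kappa> by (intro add_mono mult_mono mult_left_mono mult_nonneg_nonneg) auto
    finally have 2: "\<bar>\<eta>x x b\<bar> \<le> \<bar>\<theta>' x\<bar> * (1 + \<kappa>) + M\<theta> * \<kappa>" by simp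
    have "\<bar>\<eta>b x b\<bar> = \<bar>\<theta> x\<bar> * (\<bar>x\<bar> * (1 / (2 * r)))"
      unfolding \<eta>b_def r_def[symmetric] using r(3) by (simp add: abs_mult)
    also have "\<dots> \<le> M\<theta> * (1 * 1)" using M\<theta>(2)[of x] r x M by (intro mult_mono) auto
    finally show ?thesis using 1 2 by simp
  qed
  then show "\<bar>\<eta> x b\<bar> \<le> 2 * M\<theta>" "\<bar>\<eta>x x b\<bar> \<le> \<bar>\<theta>' x\<bar> * (1 + \<kappa>) + M\<theta> * \<kappa>" "\<bar>\<eta>b x b\<bar> \<le> M\<theta>" by auto
qed

text \<open>A common majorant of the profile parts of both partial derivatives of the kernel.\<close>

definition env :: "real \<Rightarrow> real \<Rightarrow> real" where
  "env \<kappa> x = (if \<bar>x\<bar> < 1 then \<bar>\<theta>' x\<bar> + 6 * M\<theta> * \<kappa> else 0)"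

lemma env_meas [measurable]: "env \<kappa> \<in> borel_measurable borel"
  unfolding env_def by measurable

lemma env_0: "1 \<le> \<bar>x\<bar> \<Longrightarrow> env \<kappa> x = 0" by (simp add: env_def)

lemma \<eta>x_env:
  assumes b: "\<bar>b\<bar> \<le> \<kappa>" "\<kappa> \<le> 1/16"
  shows "\<bar>\<eta>x x b\<bar> \<le> env \<kappa> x"
proof (cases "1 \<le> \<bar>x\<bar>")
  case False
  have "\<bar>\<theta>' x\<bar> * \<kappa> \<le> M\<theta> * \<kappa>" using M\<theta>(3)[of x] b by (intro mult_right_mono) auto
  moreover have "0 \<le> M\<theta> * \<kappa>" using M\<theta>(1) b by (intro mult_nonneg_nonneg) auto
  ultimately show ?thesis using \<eta>_bounds(2)[OF b, of x] False by (simp add: env_def algebra_simps)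
qed (simp add: \<eta>_0 env_0)

text \<open>The left side is the branch expression \<open>Ks1\<close> in the s-derivative of the
  kernel. Its leading term is minus that of the t-derivative, so both share one majorant; collecting
  the corrections gives 4 \<kappa> + 3 \<kappa>^2, absorbed by the 6 \<kappa> in
  \<open>env\<close>.\<close>

lemma \<eta>s_env:
  assumes b: "\<bar>b\<bar> \<le> \<kappa>" "\<kappa> \<le> 1/16" and c: "\<bar>c\<bar> \<le> \<kappa>\<^sup>2"
  shows "\<bar>- (1 + x * b) * \<eta>x x b + c * \<eta>b x b - b / 2 * \<eta> x b\<bar> \<le> env \<kappa> x"
proof (cases "1 \<le> \<bar>x\<bar>")
  case False
  have x: "\<bar>x\<bar> \<le> 1" using False by simp
  have \<kappa>: "\<kappa> \<ge> 0" using b by linarith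
  have xb: "\<bar>1 + x * b\<bar> \<le> 1 + \<kappa>" using xb_bound[OF x b(1)] by linarith
  have \<kappa>2: "\<kappa>\<^sup>2 \<le> \<kappa> / 16" unfolding power2_eq_square using mult_left_mono[OF b(2) \<kappa>] by simp
  have "\<bar>- (1 + x * b) * \<eta>x x b + c * \<eta>b x b - b / 2 * \<eta> x b\<bar>
      \<le> \<bar>1 + x * b\<bar> * \<bar>\<eta>x x b\<bar> + \<bar>c\<bar> * \<bar>\<eta>b x b\<bar> + \<bar>b\<bar> / 2 * \<bar>\<eta> x b\<bar>"
  proof -
    have "\<bar>- A * p + c * q - d / 2 * r\<bar> \<le> \<bar>A\<bar> * \<bar>p\<bar> + \<bar>c\<bar> * \<bar>q\<bar> + \<bar>d\<bar> / 2 * \<bar>r\<bar>" for A p q d r :: real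
    proof -
      have "\<bar>- X + Y - Z\<bar> \<le> \<bar>X\<bar> + \<bar>Y\<bar> + \<bar>Z\<bar>" for X Y Z :: real by linarith
      from this[of "A * p" "c * q" "d / 2 * r"] show ?thesis by (simp add: abs_mult)
    qed
    then show ?thesis .
  qed
  also have "\<dots> \<le> (1 + \<kappa>) * (\<bar>\<theta>' x\<bar> * (1 + \<kappa>) + M\<theta> * \<kappa>) + \<kappa>\<^sup>2 * M\<theta> + \<kappa> / 2 * (2 * M\<theta>)"
  proof (intro add_mono)
    show "\<bar>1 + x * b\<bar> * \<bar>\<eta>x x b\<bar> \<le> (1 + \<kappa>) * (\<bar>\<theta>' x\<bar> * (1 + \<kappa>) + M\<theta> * \<kappa>)"
      using \<kappa> by (intro mult_mono xb \<eta>_bounds(2)[OF b]) auto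
    show "\<bar>c\<bar> * \<bar>\<eta>b x b\<bar> \<le> \<kappa>\<^sup>2 * M\<theta>" by (intro mult_mono c \<eta>_bounds(3)[OF b]) auto
    show "\<bar>b\<bar> / 2 * \<bar>\<eta> x b\<bar> \<le> \<kappa> / 2 * (2 * M\<theta>)"
      using b(1) \<kappa> by (intro mult_mono \<eta>_bounds(1)[OF b]) auto
  qed
  also have "\<dots> = \<bar>\<theta>' x\<bar> + \<bar>\<theta>' x\<bar> * (2 * \<kappa> + \<kappa>\<^sup>2) + M\<theta> * (2 * \<kappa> + 2 * \<kappa>\<^sup>2)"
    by (simp add: power2_eq_square algebra_simps)
  also have "\<dots> \<le> \<bar>\<theta>' x\<bar> + M\<theta> * (2 * \<kappa> + \<kappa>\<^sup>2) + M\<theta> * (2 * \<kappa> + 2 * \<kappa>\<^sup>2)"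
    using M\<theta>(3)[of x] \<kappa> by (intro add_mono mult_right_mono) auto
  also have "\<dots> = \<bar>\<theta>' x\<bar> + M\<theta> * (4 * \<kappa> + 3 * \<kappa>\<^sup>2)" by (simp add: algebra_simps)
  also have "\<dots> \<le> \<bar>\<theta>' x\<bar> + M\<theta> * (6 * \<kappa>)" using M\<theta>(1) \<kappa> \<kappa>2 by (intro add_mono mult_left_mono) auto
  finally show ?thesis using False by (simp add: env_def mult_ac)
qed (simp add: \<eta>_0 env_0)

end

section \<open>The smeared kernel\<close>

lemma borel_measurable_poly [measurable]: "poly q \<in> borel_measurable borel" for q :: "real poly"
  by (intro borel_measurable_continuous_onI continuous_on_poly continuous_on_id)

text \<open>The constant \<open>\<Omega>\<close> controls p and two derivatives because the
  s-derivative of the amplitude contains w''. The smallness condition makes w at most 1/16, which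
  separates the branches, and keeps the modulus of w' below 1/2, so 1 + \<xi> w' is positive on the
  support.\<close>

locale kernel = profile \<theta> \<theta>' for \<theta> \<theta>' :: "real \<Rightarrow> real" +
  fixes p :: "real poly" and \<delta> \<Omega> :: real
  assumes p_pos: "\<And>s. s \<in> {0..1} \<Longrightarrow> 0 < poly p s"
    and p_per: "poly p 0 = poly p 1"
    and p_bound: "\<And>s. s \<in> {0..1} \<Longrightarrow> poly p s \<le> \<Omega>"
      "\<And>s. s \<in> {0..1} \<Longrightarrow> \<bar>poly (pderiv p) s\<bar> \<le> \<Omega>"
      "\<And>s. s \<in> {0..1} \<Longrightarrow> \<bar>poly (pderiv (pderiv p)) s\<bar> \<le> \<Omega>"
    and \<delta>_pos: "0 < \<delta>" and \<delta>_small: "\<delta> * \<Omega> \<le> 1/16"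
begin

definition w :: "real \<Rightarrow> real" where "w s = \<delta> * poly p s"
definition b :: "real \<Rightarrow> real" where "b s = \<delta> * poly (pderiv p) s"
definition c :: "real \<Rightarrow> real" where "c s = \<delta> * poly (pderiv (pderiv p)) s"

lemma w_b_deriv: "(w has_real_derivative b s) (at s)" "(b has_real_derivative c s) (at s)"
  unfolding w_def[abs_def] b_def[abs_def] c_def by (intro DERIV_cmult poly_DERIV)+

lemma w_meas [measurable]: "w \<in> borel_measurable borel" "b \<in> borel_measurable borel" "c \<in> borel_measurable borel"
  unfolding w_def[abs_def] b_def[abs_def] c_def[abs_def] by measurable

lemma \<Omega>_pos: "\<Omega> > 0" using p_pos[of 0] p_bound(1)[of 0] by simp

lemma \<kappa>_nonneg: "0 \<le> \<delta> * \<Omega>" using \<Omega>_pos \<delta>_pos by simp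

lemma w_bounds:
  assumes s: "s \<in> {0..1}"
  shows "0 < w s" "w s \<le> \<delta> * \<Omega>" "w s \<le> 1/16" "\<bar>b s\<bar> \<le> \<delta> * \<Omega>" "\<bar>b s\<bar> \<le> 1/2" "\<bar>b s\<bar> \<le> 1" "\<bar>w s * c s\<bar> \<le> (\<delta> * \<Omega>)\<^sup>2"
proof -
  show 0: "0 < w s" using p_pos[OF s] \<delta>_pos by (simp add: w_def)
  show 1: "w s \<le> \<delta> * \<Omega>" using p_bound(1)[OF s] \<delta>_pos by (simp add: w_def)
  then show "w s \<le> 1/16" using \<delta>_small by simp
  show 2: "\<bar>b s\<bar> \<le> \<delta> * \<Omega>" using p_bound(2)[OF s] \<delta>_pos by (simp add: b_def abs_mult)
  then show "\<bar>b s\<bar> \<le> 1/2" "\<bar>b s\<bar> \<le> 1" using \<delta>_small by linarith+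
  have 3: "\<bar>c s\<bar> \<le> \<delta> * \<Omega>" using p_bound(3)[OF s] \<delta>_pos by (simp add: c_def abs_mult)
  show "\<bar>w s * c s\<bar> \<le> (\<delta> * \<Omega>)\<^sup>2"
    unfolding abs_mult power2_eq_square using 0 1 3 by (intro mult_mono) auto
qed

text \<open>\<open>\<xi>p\<close> and \<open>\<xi>m\<close> are the profile variable on the two branches \<open>t = s \<plusminus> 1/2\<close> of the line on the circle; \<open>K\<^sup>2\<close> is
  the density of the smeared plan, \<open>Kt\<close> and \<open>Ks\<close> are the partial derivatives of \<open>K\<close>.\<close>

definition \<xi>p :: "real \<Rightarrow> real \<Rightarrow> real" where "\<xi>p s t = (t - s - 1/2) / w s"
definition \<xi>m :: "real \<Rightarrow> real \<Rightarrow> real" where "\<xi>m s t = (t - s + 1/2) / w s"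

definition K :: "real \<Rightarrow> real \<Rightarrow> real" where
  "K s t = (\<eta> (\<xi>p s t) (b s) + \<eta> (\<xi>m s t) (b s)) / sqrt (w s)"

definition Kt :: "real \<Rightarrow> real \<Rightarrow> real" where
  "Kt s t = (\<eta>x (\<xi>p s t) (b s) + \<eta>x (\<xi>m s t) (b s)) / (w s * sqrt (w s))"

text \<open>One branch of the s-derivative, multiplied by w sqrt w. The three terms come from \<xi>'
  = - (1 + \<xi> b) / w, from b' = c, and from differentiating 1 / sqrt w.\<close>

definition Ks1 :: "real \<Rightarrow> real \<Rightarrow> real" where
  "Ks1 s x = - (1 + x * b s) * \<eta>x x (b s) + (w s * c s) * \<eta>b x (b s) - b s / 2 * \<eta> x (b s)"

definition Ks :: "real \<Rightarrow> real \<Rightarrow> real" where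
  "Ks s t = (Ks1 s (\<xi>p s t) + Ks1 s (\<xi>m s t)) / (w s * sqrt (w s))"

lemma Ks1_0: "1 \<le> \<bar>x\<bar> \<Longrightarrow> Ks1 s x = 0" by (simp add: Ks1_def \<eta>_0)

text \<open>The two branch variables differ by 1 / w, which is at least 2, so at most one of them is
  inside the support of the profile. Squares of sums over the branches therefore split.\<close>

lemma \<xi>_disjoint: "s \<in> {0..1} \<Longrightarrow> 1 \<le> \<bar>\<xi>p s t\<bar> \<or> 1 \<le> \<bar>\<xi>m s t\<bar>"
proof -
  assume s: "s \<in> {0..1}"
  note w = w_bounds[OF s]
  have "\<xi>m s t - \<xi>p s t = 1 / w s" by (simp add: \<xi>m_def \<xi>p_def diff_divide_distrib[symmetric])
  moreover have "1 / w s \<ge> 2" using w by (simp add: pos_le_divide_eq)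
  ultimately show ?thesis by linarith
qed

lemma sum_sq: "x = 0 \<or> y = 0 \<Longrightarrow> (x + y)\<^sup>2 = x\<^sup>2 + y\<^sup>2" for x y :: real
  by auto

lemma K_sq:
  assumes s: "s \<in> {0..1}"
  shows "(K s t)\<^sup>2 = 1 / w s * ((\<theta> (\<xi>p s t))\<^sup>2 * (1 + \<xi>p s t * b s) + (\<theta> (\<xi>m s t))\<^sup>2 * (1 + \<xi>m s t * b s))"
proof -
  have "(\<eta> (\<xi>p s t) (b s) + \<eta> (\<xi>m s t) (b s))\<^sup>2 = (\<eta> (\<xi>p s t) (b s))\<^sup>2 + (\<eta> (\<xi>m s t) (b s))\<^sup>2"
    using \<xi>_disjoint[OF s, of t] by (intro sum_sq) (auto simp: \<eta>_0)
  then show ?thesis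
    using w_bounds[OF s] by (simp add: K_def power_divide \<eta>_sq)
qed

lemma K_eq_0: "1 \<le> \<bar>\<xi>p s t\<bar> \<Longrightarrow> 1 \<le> \<bar>\<xi>m s t\<bar> \<Longrightarrow> K s t = 0"
  by (simp add: K_def \<eta>_0)

lemma sq_over_w32:
  assumes "s \<in> {0..1}" "x = 0 \<or> y = 0" "\<bar>x\<bar> \<le> X" "\<bar>y\<bar> \<le> Y"
  shows "((x + y) / (w s * sqrt (w s)))\<^sup>2 \<le> 1 / (w s) ^ 3 * (X\<^sup>2 + Y\<^sup>2)"
proof -
  have w: "0 < w s" using w_bounds assms by blast
  have "((x + y) / (w s * sqrt (w s)))\<^sup>2 = (x\<^sup>2 + y\<^sup>2) / (w s) ^ 3"
  proof -
    have "(w s * sqrt (w s))\<^sup>2 = (w s) ^ 3"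
      using w by (simp add: power_mult_distrib power2_eq_square power3_eq_cube)
    then show ?thesis by (simp only: power_divide sum_sq[OF assms(2)])
  qed
  also have "\<dots> \<le> (X\<^sup>2 + Y\<^sup>2) / (w s) ^ 3"
    using assms w by (intro divide_right_mono add_mono) (auto simp: abs_le_square_iff[symmetric])
  finally show ?thesis by simp
qed

lemma Kt_sq:
  assumes s: "s \<in> {0..1}"
  shows "(Kt s t)\<^sup>2 \<le> 1 / (w s) ^ 3 * ((env (\<delta> * \<Omega>) (\<xi>p s t))\<^sup>2 + (env (\<delta> * \<Omega>) (\<xi>m s t))\<^sup>2)"
  unfolding Kt_def using \<xi>_disjoint[OF s, of t]
  by (intro sq_over_w32 s \<eta>x_env w_bounds \<delta>_small) (auto simp: \<eta>_0)

lemma Ks1_env: "s \<in> {0..1} \<Longrightarrow> \<bar>Ks1 s x\<bar> \<le> env (\<delta> * \<Omega>) x"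
  unfolding Ks1_def by (rule \<eta>s_env[OF w_bounds(4) \<delta>_small w_bounds(7)])

lemma Ks_sq:
  assumes s: "s \<in> {0..1}"
  shows "(Ks s t)\<^sup>2 \<le> 1 / (w s) ^ 3 * ((env (\<delta> * \<Omega>) (\<xi>p s t))\<^sup>2 + (env (\<delta> * \<Omega>) (\<xi>m s t))\<^sup>2)"
  unfolding Ks_def using \<xi>_disjoint[OF s, of t]
  by (intro sq_over_w32 s Ks1_env) (auto simp: Ks1_0)

lemma \<xi>_deriv_t: "(\<xi>p s has_real_derivative 1 / w s) (at t)" "(\<xi>m s has_real_derivative 1 / w s) (at t)"
  unfolding \<xi>p_def[abs_def] \<xi>m_def[abs_def]
  by (intro DERIV_cdivide; auto intro!: derivative_eq_intros)+

lemma K_deriv_t: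
  assumes s: "s \<in> {0..1}"
  shows "(K s has_real_derivative Kt s t) (at t)"
proof -
  note w = w_bounds[OF s]
  have "((\<lambda>t. (\<eta> (\<xi>p s t) (b s) + \<eta> (\<xi>m s t) (b s)) / sqrt (w s)) has_real_derivative
    ((\<eta>x (\<xi>p s t) (b s) * (1 / w s) + \<eta>b (\<xi>p s t) (b s) * 0)
      + (\<eta>x (\<xi>m s t) (b s) * (1 / w s) + \<eta>b (\<xi>m s t) (b s) * 0)) / sqrt (w s)) (at t)"
    by (intro DERIV_cdivide DERIV_add \<eta>_deriv \<xi>_deriv_t DERIV_const w)
  then show ?thesis
    unfolding K_def[abs_def] Kt_def by (simp add: add_divide_distrib)
qed

lemma \<xi>_deriv_s:
  assumes s: "s \<in> {0..1}"
  shows "((\<lambda>s. \<xi>p s t) has_real_derivative - (1 + \<xi>p s t * b s) / w s) (at s)"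
    "((\<lambda>s. \<xi>m s t) has_real_derivative - (1 + \<xi>m s t * b s) / w s) (at s)"
proof -
  have w: "w s \<noteq> 0" using w_bounds(1)[OF s] by simp
  have "((\<lambda>s. (t - s + a) / w s) has_real_derivative - (1 + (t - s + a) / w s * b s) / w s) (at s)" for a
  proof -
    have "((\<lambda>s. (t - s + a) / w s) has_real_derivative ((-1) * w s - (t - s + a) * b s) / (w s * w s)) (at s)"
      by (rule DERIV_divide[OF _ w_b_deriv(1) w]) (auto intro!: derivative_eq_intros)
    moreover have "((-1) * k - n * d) / (k * k) = - (1 + n / k * d) / k" if "k \<noteq> 0" for n k d :: real
      using that by (simp add: field_simps)
    note this[OF w]
    ultimately show ?thesis by (simp only:)
  qed
  from this[of "-1/2"] this[of "1/2"] show "((\<lambda>s. \<xi>p s t) has_real_derivative - (1 + \<xi>p s t * b s) / w s) (at s)"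
    "((\<lambda>s. \<xi>m s t) has_real_derivative - (1 + \<xi>m s t * b s) / w s) (at s)"
    unfolding \<xi>p_def \<xi>m_def by simp_all
qed

lemma K_deriv_s:
  assumes s: "s \<in> {0..1}"
  shows "((\<lambda>s. K s t) has_real_derivative Ks s t) (at s)"
proof -
  note w = w_bounds[OF s]
  define r where "r = sqrt (w s)"
  have r: "r > 0" "w s = r * r" using w by (auto simp: r_def)
  have sq: "((\<lambda>s. sqrt (w s)) has_real_derivative inverse (sqrt (w s)) / 2 * b s) (at s)"
    by (rule DERIV_chain2[where f = sqrt and g = w, OF DERIV_real_sqrt[OF w(1)] w_b_deriv(1)])
  let ?E = "\<eta> (\<xi>p s t) (b s) + \<eta> (\<xi>m s t) (b s)"
  let ?E' = "(\<eta>x (\<xi>p s t) (b s) * (- (1 + \<xi>p s t * b s) / w s) + \<eta>b (\<xi>p s t) (b s) * c s)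
      + (\<eta>x (\<xi>m s t) (b s) * (- (1 + \<xi>m s t * b s) / w s) + \<eta>b (\<xi>m s t) (b s) * c s)"
  have "((\<lambda>s. K s t) has_real_derivative
    (?E' * sqrt (w s) - ?E * (inverse (sqrt (w s)) / 2 * b s)) / (sqrt (w s) * sqrt (w s))) (at s)"
    unfolding K_def
    by (rule DERIV_divide[OF DERIV_add[OF
          \<eta>_deriv[OF \<xi>_deriv_s(1)[OF s] w_b_deriv(2) w(5)]
          \<eta>_deriv[OF \<xi>_deriv_s(2)[OF s] w_b_deriv(2) w(5)]] sq]) (use w in simp)
  moreover have "(?E' * sqrt (w s) - ?E * (inverse (sqrt (w s)) / 2 * b s)) / (sqrt (w s) * sqrt (w s)) = Ks s t"
  proof -
    have "(((x1 * (- a1 / (r * r)) + y1 * k) + (x2 * (- a2 / (r * r)) + y2 * k)) * r - (z1 + z2) * (inverse r / 2 * d)) / (r * r)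
      = ((- a1 * x1 + (r * r * k) * y1 - d / 2 * z1) + (- a2 * x2 + (r * r * k) * y2 - d / 2 * z2)) / (r * r * r)"
      for x1 x2 y1 y2 z1 z2 a1 a2 k d :: real
      using r(1) by (simp add: field_simps)
    then show ?thesis
      unfolding Ks_def Ks1_def r_def[symmetric] unfolding r(2) .
  qed
  ultimately show ?thesis by simp
qed

lemma K_meas [measurable]:
  "case_prod K \<in> borel_measurable (borel \<Otimes>\<^sub>M borel)"
  "case_prod Kt \<in> borel_measurable (borel \<Otimes>\<^sub>M borel)"
  "case_prod Ks \<in> borel_measurable (borel \<Otimes>\<^sub>M borel)"
  unfolding K_def Kt_def Ks_def Ks1_def \<eta>_def \<eta>x_def \<eta>b_def \<xi>p_def \<xi>m_def
  by measurable

section \<open>Marginals of the kernel\<close>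

lemma \<theta>_term_nonneg: "\<bar>d\<bar> \<le> 1 \<Longrightarrow> 0 \<le> (\<theta> x)\<^sup>2 * (1 + x * d)"
  using xb_bound[of x d 1] by (cases "1 \<le> \<bar>x\<bar>") (auto simp: \<theta>_0 intro!: mult_nonneg_nonneg)

lemma nn_integral_K_t:
  assumes s: "0 \<le> s" "s < 1"
  shows "(\<integral>\<^sup>+t. ennreal ((K s t)\<^sup>2) * indicator {0..<1} t \<partial>lborel) = 1"
proof -
  have s': "s \<in> {0..1}" using s by simp
  note w = w_bounds[OF s']
  let ?h = "\<lambda>(t::real) x. ennreal ((\<theta> x)\<^sup>2 * (1 + x * b s))"
  have "ennreal ((K s t)\<^sup>2) = ennreal (1 / w s) * (?h t ((t - s - 1/2) / w s) + ?h t ((t - s + 1/2) / w s))" for t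
  proof -
    have "ennreal (k * (A + B)) = ennreal k * (ennreal A + ennreal B)" if "0 \<le> k" "0 \<le> A" "0 \<le> B" for k A B
      using that by (simp add: ennreal_mult ennreal_plus)
    note this[of "1 / w s"]
    then show ?thesis
      unfolding K_sq[OF s'] \<xi>p_def \<xi>m_def using w(1) \<theta>_term_nonneg[OF w(6)] by (metis less_imp_le zero_le_divide_1_iff)
  qed
  then have "(\<integral>\<^sup>+t. ennreal ((K s t)\<^sup>2) * indicator {0..<1} t \<partial>lborel)
    = (\<integral>\<^sup>+t. ennreal (1 / w s) * (?h t ((t - s - 1/2) / w s) + ?h t ((t - s + 1/2) / w s)) * indicator {0..<1} t \<partial>lborel)"
    by simp
  also have "\<dots> = (\<integral>\<^sup>+x. ?h (frac (s + 1/2 + w s * x)) x \<partial>lborel)"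
    by (rule nn_integral_circle) (use s w \<theta>_0 in \<open>auto\<close>)
  also have "\<dots> = 1" by (rule nn_integral_\<theta>[OF w(6)])
  finally show ?thesis .
qed

text \<open>The weight 1 + \<xi> w' is -w times the s-derivative of \<xi>, so the square of
  \<open>K\<close> is the s-derivative of minus the cumulative function of \<theta>^2 on both
  branches. The boundary terms telescope: as w 0 = w 1, the branch \<open>\<xi>m\<close> at s = 1
  continues \<open>\<xi>p\<close> at s = 0, and the two outer ends contribute 1 and 0.\<close>

lemma nn_integral_K_s:
  assumes t: "0 \<le> t" "t < 1"
  shows "(\<integral>\<^sup>+s. ennreal ((K s t)\<^sup>2) * indicator {0..<1} s \<partial>lborel) = 1"
proof -
  have "compact (w ` {0..1})" "w ` {0..1} \<noteq> {}"
    using w_b_deriv(1) by (auto intro!: compact_continuous_image continuous_at_imp_continuous_on DERIV_isCont)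
  then obtain w0 where w0: "w0 \<in> w ` {0..1}" "\<And>y. y \<in> w ` {0..1} \<Longrightarrow> w0 \<le> y"
    using compact_attains_inf by metis
  have w0p: "w0 > 0" using w0(1) w_bounds(1) by auto
  \<comment> \<open>For s and t in the unit interval both branch variables are at most 2 / w0 in
    modulus; the extra 2 makes them interior points of [-X, X], where the cumulative function is
    differentiable.\<close>
  define X where "X = 2 / w0 + 2"
  have X: "X \<ge> 1" using w0p by (simp add: X_def)
  define \<Phi> where "\<Phi> x = integral {-X..x} (\<lambda>x. (\<theta> x)\<^sup>2)" for x
  have cont: "continuous_on A (\<lambda>x. (\<theta> x)\<^sup>2)" for A by (intro continuous_intros \<theta>_cont)
  have \<Phi>_deriv: "(\<Phi> has_real_derivative (\<theta> x)\<^sup>2) (at x)" if "\<bar>x\<bar> < X" for x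
  proof -
    have "(\<Phi> has_real_derivative (\<theta> x)\<^sup>2) (at x within {-X..X})"
      unfolding \<Phi>_def[abs_def] by (rule integral_has_real_derivative[OF cont]) (use that in auto)
    then show ?thesis using that by (simp add: at_within_Icc_at)
  qed
  have \<Phi>0: "\<Phi> x = 0" if "x \<le> -1" for x
  proof -
    have "\<Phi> x = integral {-X..x} (\<lambda>x. 0)"
      unfolding \<Phi>_def by (rule Henstock_Kurzweil_Integration.integral_cong) (use that \<theta>_0 in auto)
    then show ?thesis by simp
  qed
  have \<Phi>1: "\<Phi> x = 1" if "x \<ge> 1" for x
  proof -
    have int: "(\<lambda>x. (\<theta> x)\<^sup>2) integrable_on {a..b}" for a b by (rule integrable_continuous_interval[OF cont])
    have "\<Phi> x = integral {-X..-1} (\<lambda>x. (\<theta> x)\<^sup>2) + integral {-1..x} (\<lambda>x. (\<theta> x)\<^sup>2)"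
      unfolding \<Phi>_def using X that by (intro Henstock_Kurzweil_Integration.integral_combine[symmetric] int) auto
    also have "integral {-1..x} (\<lambda>x. (\<theta> x)\<^sup>2) = integral {-1..1} (\<lambda>x. (\<theta> x)\<^sup>2) + integral {1..x} (\<lambda>x. (\<theta> x)\<^sup>2)"
      using that by (intro Henstock_Kurzweil_Integration.integral_combine[symmetric] int) auto
    also have "integral {1..x} (\<lambda>x. (\<theta> x)\<^sup>2) = integral {1..x} (\<lambda>x. 0)"
      by (rule Henstock_Kurzweil_Integration.integral_cong) (use \<theta>_0 in auto)
    also have "integral {-X..-1} (\<lambda>x. (\<theta> x)\<^sup>2) = integral {-X..-1} (\<lambda>x. 0)"
      by (rule Henstock_Kurzweil_Integration.integral_cong) (use \<theta>_0 in auto)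
    finally show ?thesis by (simp add: \<theta>_norm)
  qed
  let ?G = "\<lambda>s. - \<Phi> (\<xi>p s t) - \<Phi> (\<xi>m s t)"
  have range: "\<bar>\<xi>p s t\<bar> < X \<and> \<bar>\<xi>m s t\<bar> < X" if s: "s \<in> {0..1}" for s
  proof -
    have w: "w0 \<le> w s" "0 < w s" using w0(2) w_bounds(1) s by auto
    have "\<bar>(t - s + a) / w s\<bar> \<le> 2 / w0" if "\<bar>a\<bar> \<le> 1/2" for a
    proof -
      have "\<bar>t - s + a\<bar> \<le> 2" using t s that by auto
      then show ?thesis unfolding abs_divide using w w0p by (intro frac_le) auto
    qed
    from this[of "-1/2"] this[of "1/2"] show ?thesis by (simp add: \<xi>p_def \<xi>m_def X_def)
  qed
  have "(\<integral>\<^sup>+s. ennreal ((K s t)\<^sup>2) * indicator {0..<1} s \<partial>lborel) = (\<integral>\<^sup>+s. ennreal ((K s t)\<^sup>2) * indicator {0..1} s \<partial>lborel)"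
    by (intro nn_integral_cong_AE eventually_mono[OF AE_lborel_singleton[of 1]]) (auto simp: indicator_def)
  also have "\<dots> = ennreal (?G 1 - ?G 0)"
  proof (rule nn_integral_FTC_Icc)
    show "(\<lambda>s. (K s t)\<^sup>2) \<in> borel_measurable borel" by measurable
    fix s :: real assume s': "s \<in> {0..1}"
    have "(?G has_real_derivative - ((\<theta> (\<xi>p s t))\<^sup>2 * (- (1 + \<xi>p s t * b s) / w s)) - (\<theta> (\<xi>m s t))\<^sup>2 * (- (1 + \<xi>m s t * b s) / w s)) (at s)"
      using range[OF s'] \<xi>_deriv_s[OF s', of t]
      by (intro DERIV_diff DERIV_minus DERIV_chain2[where f = \<Phi> and g = "\<lambda>s. \<xi>p s t"]
          DERIV_chain2[where f = \<Phi> and g = "\<lambda>s. \<xi>m s t"] \<Phi>_deriv) auto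
    moreover have "- (A * (- a / k)) - D * (- d / k) = 1 / k * (A * a + D * d)" for A a D d k :: real
      by (simp add: add_divide_distrib)
    ultimately show "(?G has_real_derivative (K s t)\<^sup>2) (at s)"
      unfolding K_sq[OF s'] by (simp only:)
  qed auto
  also have "?G 1 - ?G 0 = 1"
  proof -
    have w1: "w 1 = w 0" by (simp add: w_def p_per)
    note w = w_bounds[of 0]
    have "\<xi>m 1 t = \<xi>p 0 t" by (simp add: \<xi>m_def \<xi>p_def w1)
    moreover have "\<Phi> (\<xi>p 1 t) = 0"
      using t w by (intro \<Phi>0) (simp add: \<xi>p_def w1 pos_divide_le_eq)
    moreover have "\<Phi> (\<xi>m 0 t) = 1"
      using t w by (intro \<Phi>1) (simp add: \<xi>m_def pos_le_divide_eq)
    ultimately show ?thesis by simp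
  qed
  finally show ?thesis by simp
qed

end

section \<open>Weak derivatives in the plane\<close>

lemma has_derivative_slice:
  fixes f :: "real \<times> real \<Rightarrow> real"
  assumes "f differentiable (at (x, y))"
  shows "((\<lambda>x. f (x, y)) has_real_derivative dir_deriv (1, 0) f (x, y)) (at x)"
    "((\<lambda>y. f (x, y)) has_real_derivative dir_deriv (0, 1) f (x, y)) (at y)"
proof -
  let ?D = "frechet_derivative f (at (x, y))"
  have D: "(f has_derivative ?D) (at (x, y))" using assms by (simp add: frechet_derivative_works)
  interpret linear ?D using has_derivative_linear[OF D] .
  have s: "?D (h, 0) = ?D (1, 0) * h" "?D (0, h) = ?D (0, 1) * h" for h
    using scale[of h "(1, 0)"] scale[of h "(0, 1)"] by (simp_all add: mult.commute)
  have "((\<lambda>x. f (x, y)) has_derivative (\<lambda>h. ?D (h, 0))) (at x)"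
    by (rule has_derivative_compose[where f = "\<lambda>x. (x, y)" and g = f, OF _ D]) (auto intro!: derivative_eq_intros)
  moreover have "(\<lambda>h. ?D (h, 0)) = (*) (?D (1, 0))" by (rule ext) (rule s(1))
  ultimately show "((\<lambda>x. f (x, y)) has_real_derivative dir_deriv (1, 0) f (x, y)) (at x)"
    by (simp only: has_field_derivative_def dir_deriv_def)
  have "((\<lambda>y. f (x, y)) has_derivative (\<lambda>h. ?D (0, h))) (at y)"
    by (rule has_derivative_compose[where f = "\<lambda>y. (x, y)" and g = f, OF _ D]) (auto intro!: derivative_eq_intros)
  moreover have "(\<lambda>h. ?D (0, h)) = (*) (?D (0, 1))" by (rule ext) (rule s(2))
  ultimately show "((\<lambda>y. f (x, y)) has_real_derivative dir_deriv (0, 1) f (x, y)) (at y)"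
    by (simp only: has_field_derivative_def dir_deriv_def)
qed

lemma test_function_plane:
  fixes \<phi> :: "real \<times> real \<Rightarrow> real"
  assumes \<phi>: "test_function \<phi>" and b: "b \<in> Basis"
  obtains R where "R > 0" "\<And>p. R \<le> \<bar>fst p\<bar> \<or> R \<le> \<bar>snd p\<bar> \<Longrightarrow> \<phi> p = 0 \<and> dir_deriv b \<phi> p = 0"
    "continuous_on UNIV \<phi>" "continuous_on UNIV (dir_deriv b \<phi>)" "\<And>p. \<phi> differentiable (at p)"
proof -
  have ck: "Ck k \<phi>" for k using \<phi> by (simp add: test_function_def)
  let ?S = "closure {x. \<phi> x \<noteq> 0}"
  have "bounded ?S" using \<phi> by (auto simp: test_function_def intro: compact_imp_bounded)
  then obtain R where R: "R > 0" "\<And>p. p \<in> ?S \<Longrightarrow> norm p < R"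
    by (metis bounded_pos_less)
  show ?thesis
  proof (rule that[OF R(1)])
    show "continuous_on UNIV \<phi>" using ck[of 0] by simp
    show "continuous_on UNIV (dir_deriv b \<phi>)" using ck[of 1] b by simp
    show "\<phi> differentiable (at p)" for p using ck[of "Suc 0"] by (simp only: Ck.simps)
    fix p :: "real \<times> real" assume "R \<le> \<bar>fst p\<bar> \<or> R \<le> \<bar>snd p\<bar>"
    then have "R \<le> norm p" using norm_fst_le[of "fst p" "snd p"] norm_snd_le[of "snd p" "fst p"] by auto
    then have p: "p \<notin> ?S" using R(2)[of p] by linarith
    then have "\<phi> p = 0" using closure_subset[of "{x. \<phi> x \<noteq> 0}"] by auto
    moreover have "(\<phi> has_derivative (\<lambda>_. 0)) (at p)"
      by (rule has_derivative_transform_within_open[of "\<lambda>_. 0" _ _ _ "- ?S"])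
        (use p closure_subset[of "{x. \<phi> x \<noteq> 0}"] in auto)
    ultimately show "\<phi> p = 0 \<and> dir_deriv b \<phi> p = 0" using dir_derivI by auto
  qed
qed

text \<open>The integrand is the derivative of f \<phi>, which vanishes at both ends of
  [-R, R].\<close>

lemma integral_slice_zero:
  fixes f g \<phi> \<phi>1 :: "real \<Rightarrow> real"
  assumes f: "\<And>x. (f has_real_derivative g x) (at x)" and \<phi>: "\<And>x. (\<phi> has_real_derivative \<phi>1 x) (at x)"
    and R: "R > 0" "\<And>x. R \<le> \<bar>x\<bar> \<Longrightarrow> \<phi> x = 0 \<and> \<phi>1 x = 0"
    and int: "integrable lborel (\<lambda>x. f x * \<phi>1 x + g x * \<phi> x)"
  shows "(LINT x|lborel. f x * \<phi>1 x + g x * \<phi> x) = 0"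
proof -
  let ?h = "\<lambda>x. f x * \<phi>1 x + g x * \<phi> x"
  have "(?h has_integral f R * \<phi> R - f (-R) * \<phi> (-R)) {-R..R}"
  proof (rule fundamental_theorem_of_calculus)
    fix x
    have "((\<lambda>x. f x * \<phi> x) has_real_derivative g x * \<phi> x + \<phi>1 x * f x) (at x)"
      by (rule DERIV_mult[OF f \<phi>])
    then show "((\<lambda>x. f x * \<phi> x) has_vector_derivative ?h x) (at x within {-R..R})"
      by (simp add: has_real_derivative_iff_has_vector_derivative has_vector_derivative_at_within
          add.commute mult.commute)
  qed (use R in simp)
  then have "integral {-R..R} ?h = 0" using R by (auto intro: integral_unique)
  moreover have "set_integrable lborel {-R..R} ?h"
    unfolding set_integrable_def by (rule integrable_mult_indicator[OF _ int]) simp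
  ultimately have "(LINT x:{-R..R}|lborel. ?h x) = 0"
    by (simp add: set_borel_integral_eq_integral(2))
  moreover have "(LINT x:{-R..R}|lborel. ?h x) = (LINT x|lborel. ?h x)"
    unfolding set_lebesgue_integral_def
  proof (intro Bochner_Integration.integral_cong refl)
    fix x
    show "indicator {-R..R} x *\<^sub>R ?h x = ?h x"
    proof (cases "R \<le> \<bar>x\<bar>")
      case True
      then show ?thesis using R(2)[OF True] by simp
    next
      case False
      then have "x \<in> {-R..R}" by auto
      then show ?thesis by simp
    qed
  qed
  ultimately show ?thesis by simp
qed

lemma integrable_bounded_support:
  fixes h :: "'a::euclidean_space \<Rightarrow> real"
  assumes [measurable]: "h \<in> borel_measurable borel" and "compact S"
    and "\<And>p. p \<in> S \<Longrightarrow> \<bar>h p\<bar> \<le> C" "\<And>p. p \<notin> S \<Longrightarrow> h p = 0"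
  shows "integrable lborel h"
proof -
  have "integrable lborel (\<lambda>p. indicator S p *\<^sub>R h p)"
    using assms(2,3) emeasure_compact_finite[OF assms(2)]
    by (intro integrableI_bounded_set_indicator[of S _ _ C])
      (auto simp: compact_imp_closed intro!: AE_I2)
  moreover have "(\<lambda>p. indicator S p *\<^sub>R h p) = h" by (auto simp: indicator_def fun_eq_iff assms(4))
  ultimately show ?thesis by simp
qed

definition locally_bounded :: "(real \<times> real \<Rightarrow> real) \<Rightarrow> bool" where
  "locally_bounded f \<longleftrightarrow> (\<forall>R. \<exists>C. \<forall>p\<in>{-R..R} \<times> {-R..R}. \<bar>f p\<bar> \<le> C)"

lemma loc_integrable_plane:
  assumes [measurable]: "f \<in> borel_measurable borel" and lb: "locally_bounded f"
  shows "loc_integrable f"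
  unfolding loc_integrable_def
proof (intro allI impI)
  fix S :: "(real \<times> real) set" assume S: "compact S"
  then have "bounded S" by (rule compact_imp_bounded)
  then obtain R where R: "\<And>p. p \<in> S \<Longrightarrow> norm p \<le> R" by (auto simp: bounded_iff)
  obtain C where C: "\<And>p. p \<in> {-R..R} \<times> {-R..R} \<Longrightarrow> \<bar>f p\<bar> \<le> C" using lb unfolding locally_bounded_def by blast
  have "\<bar>f p\<bar> \<le> C" if "p \<in> S" for p
  proof (rule C)
    have "\<bar>fst p\<bar> \<le> R" "\<bar>snd p\<bar> \<le> R"
      using R[OF that] norm_fst_le[of "fst p" "snd p"] norm_snd_le[of "snd p" "fst p"] by auto
    then show "p \<in> {-R..R} \<times> {-R..R}" by (auto simp: mem_Times_iff)
  qed
  then show "set_integrable lborel S f"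
    unfolding set_integrable_def
    by (intro integrableI_bounded_set_indicator[of S _ _ C])
      (use S emeasure_compact_finite[OF S] in \<open>auto simp: compact_imp_closed intro!: AE_I2\<close>)
qed

lemma weak_partial_aux:
  fixes f g \<phi> \<phi>1 :: "real \<times> real \<Rightarrow> real"
  assumes meas [measurable]: "f \<in> borel_measurable borel" and lb: "locally_bounded f"
    and \<phi>: "continuous_on UNIV \<phi>" and R: "R > 0" "\<And>p. R \<le> \<bar>fst p\<bar> \<or> R \<le> \<bar>snd p\<bar> \<Longrightarrow> \<phi> p = 0"
  shows "integrable lborel (\<lambda>p. f p * \<phi> p)"
proof -
  let ?S = "{-R..R} \<times> {-R..R}"
  have S: "compact ?S" by (intro compact_Times compact_Icc)
  have [measurable]: "\<phi> \<in> borel_measurable borel" by (rule borel_measurable_continuous_onI[OF \<phi>])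
  obtain C where C: "\<And>p. p \<in> ?S \<Longrightarrow> \<bar>f p\<bar> \<le> C" using lb unfolding locally_bounded_def by blast
  have "bounded (\<phi> ` ?S)"
    by (intro compact_imp_bounded compact_continuous_image S continuous_on_subset[OF \<phi>]) simp
  then obtain D where D: "\<And>p. p \<in> ?S \<Longrightarrow> \<bar>\<phi> p\<bar> \<le> D"
    unfolding bounded_iff by (metis imageI real_norm_def)
  show ?thesis
  proof (rule integrable_bounded_support[OF _ S])
    show "\<bar>f p * \<phi> p\<bar> \<le> C * D" if "p \<in> ?S" for p
      unfolding abs_mult using C[OF that] D[OF that] by (intro mult_mono) auto
    show "f p * \<phi> p = 0" if "p \<notin> ?S" for p
    proof -
      have "R \<le> \<bar>fst p\<bar> \<or> R \<le> \<bar>snd p\<bar>" using that by (auto simp: mem_Times_iff)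
      then show ?thesis using R(2) by simp
    qed
  qed measurable
qed

text \<open>Fubini reduces the integration by parts to single lines, where
  \<open>integral_slice_zero\<close> applies. It asks only for classical derivatives along lines
  with local bounds, the form in which the gradient of the trial functions is available.\<close>

lemma has_weak_partial_plane:
  fixes f gx gy :: "real \<times> real \<Rightarrow> real"
  assumes meas [measurable]: "f \<in> borel_measurable borel" "gx \<in> borel_measurable borel" "gy \<in> borel_measurable borel"
    and lb: "locally_bounded f" "locally_bounded gx" "locally_bounded gy"
    and dx: "\<And>x y. ((\<lambda>x. f (x, y)) has_real_derivative gx (x, y)) (at x)"
    and dy: "\<And>x y. ((\<lambda>y. f (x, y)) has_real_derivative gy (x, y)) (at y)"
  shows "has_weak_partial (1, 0) f gx" "has_weak_partial (0, 1) f gy"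
proof -
  have B: "(1, 0) \<in> (Basis :: (real \<times> real) set)" "(0, 1) \<in> (Basis :: (real \<times> real) set)" by (auto simp: Basis_prod_def Basis_real_def)
  show "has_weak_partial (1, 0) f gx"
    unfolding has_weak_partial_def
  proof (intro conjI allI impI loc_integrable_plane meas lb)
    fix \<phi> :: "real \<times> real \<Rightarrow> real" assume "test_function \<phi>"
    then obtain R where R: "R > 0" "\<And>p. R \<le> \<bar>fst p\<bar> \<or> R \<le> \<bar>snd p\<bar> \<Longrightarrow> \<phi> p = 0 \<and> dir_deriv (1, 0) \<phi> p = 0"
      and c: "continuous_on UNIV \<phi>" "continuous_on UNIV (dir_deriv (1, 0) \<phi>)" and d: "\<And>p. \<phi> differentiable (at p)"
      using test_function_plane[OF _ B(1)] by metis
    let ?H = "\<lambda>p. f p * dir_deriv (1, 0) \<phi> p + gx p * \<phi> p"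
    have i: "integrable lborel (\<lambda>p. f p * dir_deriv (1, 0) \<phi> p)" "integrable lborel (\<lambda>p. gx p * \<phi> p)"
      by (rule weak_partial_aux[OF _ _ _ R(1)]; use meas lb c R in blast)+
    have hH: "(\<lambda>(x, y). ?H (x, y)) = ?H" by (auto simp: fun_eq_iff)
    have iH: "integrable (lborel \<Otimes>\<^sub>M lborel) (\<lambda>(x, y). ?H (x, y))"
      using Bochner_Integration.integrable_add[OF i] by (simp only: lborel_prod hH)
    have "(LINT p|lborel. ?H p) = (LINT y|lborel. (LINT x|lborel. ?H (x, y)))"
      using lborel_pair.integral_snd[OF iH] by (simp only: lborel_prod hH)
    also have "\<dots> = 0"
    proof (rule integral_eq_zero_AE)
      have "AE y in lborel. integrable lborel (\<lambda>x. ?H (x, y))"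
        using lborel_pair.AE_integrable_snd[OF iH] by simp
      then show "AE y in lborel. (LINT x|lborel. ?H (x, y)) = 0"
      proof eventually_elim
        fix y assume "integrable lborel (\<lambda>x. ?H (x, y))"
        then show "(LINT x|lborel. ?H (x, y)) = 0"
          by (intro integral_slice_zero[OF dx has_derivative_slice(1)[OF d] R(1)]) (use R(2) in auto)
      qed
    qed
    finally have "(LINT p|lborel. ?H p) = 0" .
    then show "(LINT p|lborel. f p * dir_deriv (1, 0) \<phi> p) = - (LINT p|lborel. gx p * \<phi> p)"
      using Bochner_Integration.integral_add[OF i] by simp
  qed
  show "has_weak_partial (0, 1) f gy"
    unfolding has_weak_partial_def
  proof (intro conjI allI impI loc_integrable_plane meas lb)
    fix \<phi> :: "real \<times> real \<Rightarrow> real" assume "test_function \<phi>"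
    then obtain R where R: "R > 0" "\<And>p. R \<le> \<bar>fst p\<bar> \<or> R \<le> \<bar>snd p\<bar> \<Longrightarrow> \<phi> p = 0 \<and> dir_deriv (0, 1) \<phi> p = 0"
      and c: "continuous_on UNIV \<phi>" "continuous_on UNIV (dir_deriv (0, 1) \<phi>)" and d: "\<And>p. \<phi> differentiable (at p)"
      using test_function_plane[OF _ B(2)] by metis
    let ?H = "\<lambda>p. f p * dir_deriv (0, 1) \<phi> p + gy p * \<phi> p"
    have i: "integrable lborel (\<lambda>p. f p * dir_deriv (0, 1) \<phi> p)" "integrable lborel (\<lambda>p. gy p * \<phi> p)"
      by (rule weak_partial_aux[OF _ _ _ R(1)]; use meas lb c R in blast)+
    have hH: "(\<lambda>(x, y). ?H (x, y)) = ?H" by (auto simp: fun_eq_iff)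
    have iH: "integrable (lborel \<Otimes>\<^sub>M lborel) (\<lambda>(x, y). ?H (x, y))"
      using Bochner_Integration.integrable_add[OF i] by (simp only: lborel_prod hH)
    have "(LINT p|lborel. ?H p) = (LINT x|lborel. (LINT y|lborel. ?H (x, y)))"
      using lborel_pair.integral_fst[OF iH] by (simp only: lborel_prod hH)
    also have "\<dots> = 0"
    proof (rule integral_eq_zero_AE)
      have "AE x in lborel. integrable lborel (\<lambda>y. ?H (x, y))"
        using lborel_pair.AE_integrable_fst[OF iH] by simp
      then show "AE x in lborel. (LINT y|lborel. ?H (x, y)) = 0"
      proof eventually_elim
        fix x assume "integrable lborel (\<lambda>y. ?H (x, y))"
        then show "(LINT y|lborel. ?H (x, y)) = 0"
          by (intro integral_slice_zero[OF dy has_derivative_slice(2)[OF d] R(1)]) (use R(2) in auto)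
      qed
    qed
    finally have "(LINT p|lborel. ?H p) = 0" .
    then show "(LINT p|lborel. f p * dir_deriv (0, 1) \<phi> p) = - (LINT p|lborel. gy p * \<phi> p)"
      using Bochner_Integration.integral_add[OF i] by simp
  qed
qed

lemma locally_bounded_mult:
  "locally_bounded f \<Longrightarrow> locally_bounded g \<Longrightarrow> locally_bounded (\<lambda>p. f p * g p)"
  unfolding locally_bounded_def
proof
  fix R assume "\<forall>R. \<exists>C. \<forall>p\<in>{-R..R} \<times> {-R..R}. \<bar>f p\<bar> \<le> C" "\<forall>R. \<exists>C. \<forall>p\<in>{-R..R} \<times> {-R..R}. \<bar>g p\<bar> \<le> C"
  then obtain C D where "\<forall>p\<in>{-R..R} \<times> {-R..R}. \<bar>f p\<bar> \<le> C" "\<forall>p\<in>{-R..R} \<times> {-R..R}. \<bar>g p\<bar> \<le> D" by metis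
  then have "\<bar>f p * g p\<bar> \<le> \<bar>C\<bar> * \<bar>D\<bar>" if "p \<in> {-R..R} \<times> {-R..R}" for p
    unfolding abs_mult using that by (intro mult_mono) force+
  then show "\<exists>C. \<forall>p\<in>{-R..R} \<times> {-R..R}. \<bar>f p * g p\<bar> \<le> C" by blast
qed

lemma locally_bounded_add:
  "locally_bounded f \<Longrightarrow> locally_bounded g \<Longrightarrow> locally_bounded (\<lambda>p. f p + g p)"
  unfolding locally_bounded_def
proof
  fix R assume "\<forall>R. \<exists>C. \<forall>p\<in>{-R..R} \<times> {-R..R}. \<bar>f p\<bar> \<le> C" "\<forall>R. \<exists>C. \<forall>p\<in>{-R..R} \<times> {-R..R}. \<bar>g p\<bar> \<le> C"
  then obtain C D where "\<forall>p\<in>{-R..R} \<times> {-R..R}. \<bar>f p\<bar> \<le> C" "\<forall>p\<in>{-R..R} \<times> {-R..R}. \<bar>g p\<bar> \<le> D" by metis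
  then have "\<bar>f p + g p\<bar> \<le> C + D" if "p \<in> {-R..R} \<times> {-R..R}" for p
    using that by (intro order_trans[OF abs_triangle_ineq] add_mono) auto
  then show "\<exists>C. \<forall>p\<in>{-R..R} \<times> {-R..R}. \<bar>f p + g p\<bar> \<le> C" by blast
qed

lemma locally_bounded_continuous:
  assumes "continuous_on UNIV f"
  shows "locally_bounded f"
  unfolding locally_bounded_def
proof
  fix R :: real
  have "bounded (f ` ({-R..R} \<times> {-R..R}))"
    by (intro compact_imp_bounded compact_continuous_image compact_Times compact_Icc continuous_on_subset[OF assms]) simp
  then show "\<exists>C. \<forall>p\<in>{-R..R} \<times> {-R..R}. \<bar>f p\<bar> \<le> C"
    unfolding bounded_iff by (metis imageI real_norm_def)
qed

context kernel
begin

lemma K_bounded: "\<exists>C. \<forall>s t. s \<in> {0..1} \<longrightarrow> \<bar>K s t\<bar> \<le> C \<and> (Kt s t)\<^sup>2 \<le> C \<and> (Ks s t)\<^sup>2 \<le> C"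
proof -
  have "compact (w ` {0..1})" "w ` {0..1} \<noteq> {}"
    using w_b_deriv(1) by (auto intro!: compact_continuous_image continuous_at_imp_continuous_on DERIV_isCont)
  then obtain w0 where w0: "w0 \<in> w ` {0..1}" "\<And>y. y \<in> w ` {0..1} \<Longrightarrow> w0 \<le> y"
    using compact_attains_inf by metis
  have w0p: "w0 > 0" using w0(1) w_bounds(1) by auto
  define E where "E = M\<theta> + 6 * M\<theta> * (\<delta> * \<Omega>)"
  have M0: "0 \<le> M\<theta> * (\<delta> * \<Omega>)" by (rule mult_nonneg_nonneg[OF less_imp_le[OF M\<theta>(1)] \<kappa>_nonneg])
  then have E0: "E \<ge> 0" using M\<theta>(1) unfolding E_def by linarith
  have env: "0 \<le> env (\<delta> * \<Omega>) x \<and> env (\<delta> * \<Omega>) x \<le> E" for x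
    
  proof -
    have "6 * M\<theta> * (\<delta> * \<Omega>) = 6 * (M\<theta> * (\<delta> * \<Omega>))" by simp
    then have "0 \<le> \<bar>\<theta>' x\<bar> + 6 * M\<theta> * (\<delta> * \<Omega>)" "\<bar>\<theta>' x\<bar> + 6 * M\<theta> * (\<delta> * \<Omega>) \<le> E"
      using M0 M\<theta>(3)[of x] unfolding E_def by linarith+
    then show ?thesis using E0 by (simp add: env_def)
  qed
  have "\<bar>K s t\<bar> \<le> (2 * M\<theta> + 2 * M\<theta>) / sqrt w0 + 1 / w0 ^ 3 * (E\<^sup>2 + E\<^sup>2) \<and>
      (Kt s t)\<^sup>2 \<le> (2 * M\<theta> + 2 * M\<theta>) / sqrt w0 + 1 / w0 ^ 3 * (E\<^sup>2 + E\<^sup>2) \<and>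
      (Ks s t)\<^sup>2 \<le> (2 * M\<theta> + 2 * M\<theta>) / sqrt w0 + 1 / w0 ^ 3 * (E\<^sup>2 + E\<^sup>2)"
    if s: "s \<in> {0..1}" for s t
  proof -
    have w: "w0 \<le> w s" "0 < w s" using w0(2) w_bounds(1) s by auto
    have "\<bar>K s t\<bar> \<le> (2 * M\<theta> + 2 * M\<theta>) / sqrt w0"
    proof -
      have "\<bar>\<eta> (\<xi>p s t) (b s) + \<eta> (\<xi>m s t) (b s)\<bar> \<le> 2 * M\<theta> + 2 * M\<theta>"
        using \<eta>_bounds(1)[OF w_bounds(4)[OF s] \<delta>_small]
        by (intro order_trans[OF abs_triangle_ineq] add_mono) auto
      moreover have "sqrt w0 \<le> \<bar>sqrt (w s)\<bar>" using w by simp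
      ultimately show ?thesis unfolding K_def abs_divide using w0p by (intro frac_le) auto
    qed
    moreover have "1 / (w s) ^ 3 * ((env (\<delta> * \<Omega>) x)\<^sup>2 + (env (\<delta> * \<Omega>) y)\<^sup>2) \<le> 1 / w0 ^ 3 * (E\<^sup>2 + E\<^sup>2)" for x y
    proof (intro mult_mono add_mono)
      show "1 / (w s) ^ 3 \<le> 1 / w0 ^ 3" using w w0p by (intro divide_left_mono power_mono mult_pos_pos) auto
      show "(env (\<delta> * \<Omega>) x)\<^sup>2 \<le> E\<^sup>2" "(env (\<delta> * \<Omega>) y)\<^sup>2 \<le> E\<^sup>2" using env by (auto intro: power_mono)
    qed (use w0p in auto)
    then have "(Kt s t)\<^sup>2 \<le> 1 / w0 ^ 3 * (E\<^sup>2 + E\<^sup>2)" "(Ks s t)\<^sup>2 \<le> 1 / w0 ^ 3 * (E\<^sup>2 + E\<^sup>2)"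
      using Kt_sq[OF s, of t] Ks_sq[OF s, of t] by (blast intro: order_trans)+
    moreover have "0 \<le> 1 / w0 ^ 3 * (E\<^sup>2 + E\<^sup>2)" "0 \<le> (2 * M\<theta> + 2 * M\<theta>) / sqrt w0" using w0p M\<theta>(1) by auto
    ultimately show ?thesis by linarith
  qed
  then show ?thesis by blast
qed

end

section \<open>The trial functions and their energy\<close>

text \<open>\<open>ennreal\<close> sends negative numbers to 0, so subadditivity holds for all
  signs. This matters because \<open>potential_V\<close> may be negative on the diagonal.\<close>

lemma ennreal_add_le: "ennreal (a + b) \<le> ennreal a + ennreal b"
proof (cases "0 \<le> a \<and> 0 \<le> b")
  case False
  then have "ennreal (a + b) \<le> ennreal a \<or> ennreal (a + b) \<le> ennreal b"
    by (auto intro: ennreal_leI)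
  then show ?thesis by (auto intro: order_trans add_increasing add_increasing2)
qed (simp add: ennreal_plus)

lemma ennreal_mult_add_le:
  assumes "0 \<le> a" "0 \<le> b" "0 \<le> c"
  shows "ennreal (a * (b * (c * (d + e)))) \<le> ennreal a * (ennreal b * (ennreal c * (ennreal d + ennreal e)))"
  unfolding ennreal_mult'[OF assms(1)] ennreal_mult'[OF assms(2)] ennreal_mult'[OF assms(3)]
  by (intro mult_left_mono ennreal_add_le) auto

text \<open>Young's inequality with weight \<delta>. The coefficient of a^2 tends to 0, while b^2
  keeps its factor \<delta>^2 up to 1 + \<delta>; below, a carries the derivative of sqrt \<rho> and
  b the large derivative of the kernel.\<close>

lemma sq_add_le:
  fixes a b \<delta> :: real
  assumes "\<delta> > 0"
  shows "\<delta>\<^sup>2 * (a + b)\<^sup>2 \<le> (\<delta>\<^sup>2 + \<delta>) * a\<^sup>2 + (1 + \<delta>) * \<delta>\<^sup>2 * b\<^sup>2"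
proof -
  have "0 \<le> \<delta> * (a - \<delta> * b)\<^sup>2" using assms by simp
  then show ?thesis by (simp add: power2_eq_square algebra_simps)
qed

lemma real_pair_integral:
  fixes f :: "real \<times> real \<Rightarrow> ennreal"
  assumes [measurable]: "f \<in> borel_measurable borel"
  shows "(\<integral>\<^sup>+p. f p \<partial>lborel) = (\<integral>\<^sup>+x. \<integral>\<^sup>+y. f (x, y) \<partial>lborel \<partial>lborel)"
    "(\<integral>\<^sup>+p. f p \<partial>lborel) = (\<integral>\<^sup>+y. \<integral>\<^sup>+x. f (x, y) \<partial>lborel \<partial>lborel)"
proof -
  have m: "f \<in> borel_measurable (lborel \<Otimes>\<^sub>M lborel)" by (simp add: lborel_prod)
  show "(\<integral>\<^sup>+p. f p \<partial>lborel) = (\<integral>\<^sup>+x. \<integral>\<^sup>+y. f (x, y) \<partial>lborel \<partial>lborel)"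
    using lborel.nn_integral_fst[OF m] by (simp add: lborel_prod)
  have m': "case_prod (\<lambda>x y. f (x, y)) \<in> borel_measurable (lborel \<Otimes>\<^sub>M lborel)" using m by simp
  show "(\<integral>\<^sup>+p. f p \<partial>lborel) = (\<integral>\<^sup>+y. \<integral>\<^sup>+x. f (x, y) \<partial>lborel \<partial>lborel)"
    using lborel_pair.nn_integral_snd[OF m'] by (simp add: lborel_prod)
qed

locale potential_profile = coulomb_potential \<rho> u T m + profile \<theta> \<theta>'
  for \<rho> u T :: "real \<Rightarrow> real" and m :: real and \<theta> \<theta>' :: "real \<Rightarrow> real"
begin

text \<open>\<open>dens\<close> is the energy density after the substitution \<open>y = partner p \<delta> x \<xi>\<close>, with the gradient of \<open>K\<close> replaced by
  its majorant \<open>env\<close> and the cross terms with the gradient of \<open>\<surd>\<rho>\<close> split off, with weight \<open>\<delta>\<close>, into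
  \<open>error_energy\<close>.\<close>

definition dens :: "real poly \<Rightarrow> real \<Rightarrow> real \<Rightarrow> real \<Rightarrow> real \<Rightarrow> real \<Rightarrow> real" where
  "dens p \<Omega> \<delta> x y \<xi> = (1 + \<delta>) / 2 * ((\<rho> x)\<^sup>2 + (\<rho> y)\<^sup>2) * (env (\<delta> * \<Omega>) \<xi>)\<^sup>2 / (poly p (F x))\<^sup>2
     + 1 / \<delta>\<^sup>2 * potential_V u (x, y) * ((\<theta> \<xi>)\<^sup>2 * (1 + \<xi> * (\<delta> * poly (pderiv p) (F x))))"

definition partner :: "real poly \<Rightarrow> real \<Rightarrow> real \<Rightarrow> real \<Rightarrow> real" where
  "partner p \<delta> x \<xi> = Q (frac (F x + 1/2 + \<delta> * poly p (F x) * \<xi>))"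

definition main_energy :: "real poly \<Rightarrow> real \<Rightarrow> real \<Rightarrow> ennreal" where
  "main_energy p \<Omega> \<delta> = (\<integral>\<^sup>+x. ennreal (\<rho> x) * (\<integral>\<^sup>+\<xi>. ennreal (dens p \<Omega> \<delta> x (partner p \<delta> x \<xi>) \<xi>) \<partial>lborel) \<partial>lborel)"

definition error_energy :: "real \<Rightarrow> ennreal" where
  "error_energy \<delta> = ennreal (\<delta>\<^sup>2 + \<delta>) * (\<integral>\<^sup>+x. ennreal ((sqrt_deriv x)\<^sup>2) \<partial>lborel)"

lemma V_meas [measurable]: "potential_V u \<in> borel_measurable borel"
  unfolding potential_V_def[abs_def] by measurable

lemma dens_meas [measurable]:
  assumes [measurable]: "f \<in> borel_measurable M" "g \<in> borel_measurable M" "h \<in> borel_measurable M"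
  shows "(\<lambda>z. dens p \<Omega> \<delta> (f z) (g z) (h z)) \<in> borel_measurable M"
proof -
  have [measurable]: "(\<lambda>z. potential_V u (f z, g z)) \<in> borel_measurable M"
    using measurable_compose[OF borel_measurable_Pair[OF assms(1,2)] V_meas] .
  show ?thesis unfolding dens_def by measurable
qed

end

locale trial = potential_profile \<rho> u T m \<theta> \<theta>' + kernel \<theta> \<theta>' p \<delta> \<Omega>
  for \<rho> u T :: "real \<Rightarrow> real" and m :: real and \<theta> \<theta>' :: "real \<Rightarrow> real" and p :: "real poly" and \<delta> \<Omega> :: real
begin

text \<open>The square is the density of the kernel measure pulled back under (x, y) to (F x, F y);
  the factors \<rho> are the Jacobian.\<close>

definition \<psi> :: "real \<times> real \<Rightarrow> real" where
  "\<psi> z = sqrt (\<rho> (fst z)) * sqrt (\<rho> (snd z)) * K (F (fst z)) (F (snd z))"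

definition Gx :: "real \<times> real \<Rightarrow> real" where
  "Gx z = sqrt_deriv (fst z) * (sqrt (\<rho> (snd z)) * K (F (fst z)) (F (snd z)))
     + sqrt (\<rho> (fst z)) * (sqrt (\<rho> (snd z)) * (Ks (F (fst z)) (F (snd z)) * \<rho> (fst z)))"

definition Gy :: "real \<times> real \<Rightarrow> real" where
  "Gy z = sqrt_deriv (snd z) * (sqrt (\<rho> (fst z)) * K (F (fst z)) (F (snd z)))
     + sqrt (\<rho> (snd z)) * (sqrt (\<rho> (fst z)) * (Kt (F (fst z)) (F (snd z)) * \<rho> (snd z)))"

definition G :: "real \<times> real \<Rightarrow> real \<times> real" where "G z = (Gx z, Gy z)"

lemma Fx01: "F x \<in> {0..1}" using F_range[of x] by (auto intro: less_imp_le)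

lemma \<psi>_deriv_x: "((\<lambda>x. \<psi> (x, y)) has_real_derivative Gx (x, y)) (at x)"
proof -
  have k: "((\<lambda>x. K (F x) (F y)) has_real_derivative Ks (F x) (F y) * \<rho> x) (at x)"
    by (rule DERIV_chain2[where f = "\<lambda>s. K s (F y)" and g = F, OF K_deriv_s[OF Fx01] F_deriv])
  have "((\<lambda>x. sqrt (\<rho> x) * (sqrt (\<rho> y) * K (F x) (F y))) has_real_derivative
      sqrt_deriv x * (sqrt (\<rho> y) * K (F x) (F y)) + sqrt (\<rho> y) * (Ks (F x) (F y) * \<rho> x) * sqrt (\<rho> x)) (at x)"
    by (intro DERIV_mult sqrt_rho_deriv DERIV_cmult k)
  then show ?thesis by (simp add: \<psi>_def Gx_def mult_ac)
qed

lemma \<psi>_deriv_y: "((\<lambda>y. \<psi> (x, y)) has_real_derivative Gy (x, y)) (at y)"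
proof -
  have k: "((\<lambda>y. K (F x) (F y)) has_real_derivative Kt (F x) (F y) * \<rho> y) (at y)"
    by (rule DERIV_chain2[where f = "K (F x)" and g = F, OF K_deriv_t[OF Fx01] F_deriv])
  have "((\<lambda>y. sqrt (\<rho> y) * (sqrt (\<rho> x) * K (F x) (F y))) has_real_derivative
      sqrt_deriv y * (sqrt (\<rho> x) * K (F x) (F y)) + sqrt (\<rho> x) * (Kt (F x) (F y) * \<rho> y) * sqrt (\<rho> y)) (at y)"
    by (intro DERIV_mult sqrt_rho_deriv DERIV_cmult k)
  then show ?thesis by (simp add: \<psi>_def Gy_def mult_ac)
qed

lemma K_F_meas [measurable]:
  assumes [measurable]: "f \<in> borel_measurable M" "g \<in> borel_measurable M"
  shows "(\<lambda>z. K (f z) (g z)) \<in> borel_measurable M" "(\<lambda>z. Kt (f z) (g z)) \<in> borel_measurable M"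
    "(\<lambda>z. Ks (f z) (g z)) \<in> borel_measurable M"
  using measurable_compose[OF measurable_Pair[OF assms] K_meas(1)]
    measurable_compose[OF measurable_Pair[OF assms] K_meas(2)]
    measurable_compose[OF measurable_Pair[OF assms] K_meas(3)] by simp_all

lemma \<psi>_meas [measurable]: "\<psi> \<in> borel_measurable borel" "Gx \<in> borel_measurable borel" "Gy \<in> borel_measurable borel"
  unfolding \<psi>_def[abs_def] Gx_def[abs_def] Gy_def[abs_def] by measurable

lemma G_meas [measurable]: "G \<in> borel_measurable borel"
  unfolding G_def[abs_def] by measurable

lemma norm_G: "(norm (G z))\<^sup>2 = (Gx z)\<^sup>2 + (Gy z)\<^sup>2"
  by (simp add: G_def norm_Pair)

lemma locally_bounded_parts:
  "locally_bounded \<psi>" "locally_bounded Gx" "locally_bounded Gy"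
proof -
  obtain C where C: "\<And>s t. s \<in> {0..1} \<Longrightarrow> \<bar>K s t\<bar> \<le> C \<and> (Kt s t)\<^sup>2 \<le> C \<and> (Ks s t)\<^sup>2 \<le> C"
    using K_bounded by blast
  have sq: "\<bar>x\<bar> \<le> sqrt C" if "x\<^sup>2 \<le> C" for x :: real
    using real_sqrt_le_mono[OF that] by simp
  have K: "locally_bounded (\<lambda>z. K (F (fst z)) (F (snd z)))"
    "locally_bounded (\<lambda>z. Kt (F (fst z)) (F (snd z)))"
    "locally_bounded (\<lambda>z. Ks (F (fst z)) (F (snd z)))"
    unfolding locally_bounded_def using C[OF Fx01] sq by blast+
  have R: "locally_bounded (\<lambda>z. sqrt (\<rho> (fst z)))" "locally_bounded (\<lambda>z. sqrt (\<rho> (snd z)))"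
    "locally_bounded (\<lambda>z. \<rho> (fst z))" "locally_bounded (\<lambda>z. \<rho> (snd z))"
    "locally_bounded (\<lambda>z. sqrt_deriv (fst z))" "locally_bounded (\<lambda>z. sqrt_deriv (snd z))"
    by (intro locally_bounded_continuous continuous_intros continuous_on_compose2[OF rho_cont_on[of UNIV]]
        continuous_on_compose2[OF sqrt_deriv_cont]; simp)+
  show "locally_bounded \<psi>" "locally_bounded Gx" "locally_bounded Gy"
    unfolding \<psi>_def[abs_def] Gx_def[abs_def] Gy_def[abs_def]
    by (intro locally_bounded_add locally_bounded_mult K R)+
qed

section \<open>Normalisation and marginals of the trial functions\<close>

lemma nn_integral_K_F:
  "(\<integral>\<^sup>+y. ennreal (\<rho> y) * ennreal ((K (F x) (F y))\<^sup>2) \<partial>lborel) = 1"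
  "(\<integral>\<^sup>+x. ennreal (\<rho> x) * ennreal ((K (F x) (F y))\<^sup>2) \<partial>lborel) = 1"
proof -
  have "(\<integral>\<^sup>+y. ennreal (\<rho> y) * ennreal ((K (F x) (F y))\<^sup>2) \<partial>lborel)
      = (\<integral>\<^sup>+t. ennreal ((K (F x) t)\<^sup>2) * indicator {0..<1} t \<partial>lborel)"
    by (rule nn_integral_F) measurable
  then show "(\<integral>\<^sup>+y. ennreal (\<rho> y) * ennreal ((K (F x) (F y))\<^sup>2) \<partial>lborel) = 1"
    using nn_integral_K_t[of "F x"] by (simp add: less_imp_le)
  have "(\<integral>\<^sup>+x. ennreal (\<rho> x) * ennreal ((K (F x) (F y))\<^sup>2) \<partial>lborel)
      = (\<integral>\<^sup>+s. ennreal ((K s (F y))\<^sup>2) * indicator {0..<1} s \<partial>lborel)"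
    by (rule nn_integral_F[where h = "\<lambda>s. ennreal ((K s (F y))\<^sup>2)"]) measurable
  then show "(\<integral>\<^sup>+x. ennreal (\<rho> x) * ennreal ((K (F x) (F y))\<^sup>2) \<partial>lborel) = 1"
    using nn_integral_K_s[of "F y"] by (simp add: less_imp_le)
qed

lemma nn_integral_marginal:
  fixes k :: "real \<Rightarrow> ennreal"
  assumes [measurable]: "k \<in> borel_measurable borel"
  shows "(\<integral>\<^sup>+z. k (fst z) * (ennreal (\<rho> (snd z)) * ennreal ((K (F (fst z)) (F (snd z)))\<^sup>2)) \<partial>lborel) = (\<integral>\<^sup>+x. k x \<partial>lborel)"
    "(\<integral>\<^sup>+z. k (snd z) * (ennreal (\<rho> (fst z)) * ennreal ((K (F (fst z)) (F (snd z)))\<^sup>2)) \<partial>lborel) = (\<integral>\<^sup>+y. k y \<partial>lborel)"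
proof -
  show "(\<integral>\<^sup>+z. k (fst z) * (ennreal (\<rho> (snd z)) * ennreal ((K (F (fst z)) (F (snd z)))\<^sup>2)) \<partial>lborel) = (\<integral>\<^sup>+x. k x \<partial>lborel)"
    by (subst real_pair_integral(1)) (auto simp: nn_integral_cmult nn_integral_K_F(1))
  show "(\<integral>\<^sup>+z. k (snd z) * (ennreal (\<rho> (fst z)) * ennreal ((K (F (fst z)) (F (snd z)))\<^sup>2)) \<partial>lborel) = (\<integral>\<^sup>+y. k y \<partial>lborel)"
    by (subst real_pair_integral(2)) (auto simp: nn_integral_cmult nn_integral_K_F(2))
qed

lemma \<psi>_sq: "(\<psi> z)\<^sup>2 = \<rho> (fst z) * \<rho> (snd z) * (K (F (fst z)) (F (snd z)))\<^sup>2"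
  by (simp add: \<psi>_def power_mult_distrib)

lemma ennreal_\<psi>_sq:
  "ennreal ((\<psi> z)\<^sup>2) = ennreal (\<rho> (fst z)) * (ennreal (\<rho> (snd z)) * ennreal ((K (F (fst z)) (F (snd z)))\<^sup>2))"
  "ennreal ((\<psi> z)\<^sup>2) = ennreal (\<rho> (snd z)) * (ennreal (\<rho> (fst z)) * ennreal ((K (F (fst z)) (F (snd z)))\<^sup>2))"
  unfolding \<psi>_sq by (simp_all add: ennreal_mult mult_ac)

lemma \<psi>_norm: "(\<integral>\<^sup>+z. ennreal ((\<psi> z)\<^sup>2) \<partial>lborel) = 1"
  unfolding ennreal_\<psi>_sq(1) by (subst nn_integral_marginal(1)) (auto simp: nn_rho)

lemma \<psi>_integrable: "integrable lborel (\<lambda>z. (\<psi> z)\<^sup>2)"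
  by (rule integrableI_nonneg) (auto simp: \<psi>_norm)

lemma \<psi>_integral: "(LINT z|lborel. (\<psi> z)\<^sup>2) = 1"
  using nn_integral_eq_integral[OF \<psi>_integrable] \<psi>_norm by (simp add: ennreal_eq_1)

lemma \<psi>_marginals:
  "distr (density_measure (\<lambda>z. (\<psi> z)\<^sup>2)) borel fst = density_measure \<rho>"
  "distr (density_measure (\<lambda>z. (\<psi> z)\<^sup>2)) borel snd = density_measure \<rho>"
proof -
  have e: "emeasure (distr (density_measure (\<lambda>z. (\<psi> z)\<^sup>2)) borel f) A = (\<integral>\<^sup>+z. ennreal ((\<psi> z)\<^sup>2) * indicator A (f z) \<partial>lborel)"
    if [measurable]: "f \<in> borel_measurable borel" "A \<in> sets borel" for f :: "real \<times> real \<Rightarrow> real" and A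
  proof -
    have "f -` A \<in> sets borel" using measurable_sets[OF that] by simp
    then show ?thesis
      by (subst emeasure_distr) (auto simp: density_measure_def emeasure_density indicator_def intro!: nn_integral_cong)
  qed
  show "distr (density_measure (\<lambda>z. (\<psi> z)\<^sup>2)) borel fst = density_measure \<rho>"
  proof (rule measure_eqI)
    fix A assume "A \<in> sets (distr (density_measure (\<lambda>z. (\<psi> z)\<^sup>2)) borel fst)"
    then have A [measurable]: "A \<in> sets borel" by simp
    have "emeasure (distr (density_measure (\<lambda>z. (\<psi> z)\<^sup>2)) borel fst) A
      = (\<integral>\<^sup>+z. (ennreal (\<rho> (fst z)) * indicator A (fst z)) * (ennreal (\<rho> (snd z)) * ennreal ((K (F (fst z)) (F (snd z)))\<^sup>2)) \<partial>lborel)"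
      by (subst e) (auto intro!: nn_integral_cong simp: ennreal_\<psi>_sq(1) mult_ac)
    also have "\<dots> = emeasure (density_measure \<rho>) A"
      by (subst nn_integral_marginal(1)) (auto simp: emeasure_density_rho)
    finally show "emeasure (distr (density_measure (\<lambda>z. (\<psi> z)\<^sup>2)) borel fst) A = emeasure (density_measure \<rho>) A" .
  qed simp
  show "distr (density_measure (\<lambda>z. (\<psi> z)\<^sup>2)) borel snd = density_measure \<rho>"
  proof (rule measure_eqI)
    fix A assume "A \<in> sets (distr (density_measure (\<lambda>z. (\<psi> z)\<^sup>2)) borel snd)"
    then have A [measurable]: "A \<in> sets borel" by simp
    have "emeasure (distr (density_measure (\<lambda>z. (\<psi> z)\<^sup>2)) borel snd) A
      = (\<integral>\<^sup>+z. (ennreal (\<rho> (snd z)) * indicator A (snd z)) * (ennreal (\<rho> (fst z)) * ennreal ((K (F (fst z)) (F (snd z)))\<^sup>2)) \<partial>lborel)"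
      by (subst e) (auto intro!: nn_integral_cong simp: ennreal_\<psi>_sq(2) mult_ac)
    also have "\<dots> = emeasure (density_measure \<rho>) A"
      by (subst nn_integral_marginal(2)) (auto simp: emeasure_density_rho)
    finally show "emeasure (distr (density_measure (\<lambda>z. (\<psi> z)\<^sup>2)) borel snd) A = emeasure (density_measure \<rho>) A" .
  qed simp
qed

abbreviation k2 :: "real \<times> real \<Rightarrow> real" where "k2 z \<equiv> (K (F (fst z)) (F (snd z)))\<^sup>2"

text \<open>The part of the squared gradient in which the derivative falls on sqrt \<rho>; in
  \<open>prin\<close> it falls on the kernel.\<close>

definition err :: "real \<times> real \<Rightarrow> real" where
  "err z = (sqrt_deriv (fst z))\<^sup>2 * (\<rho> (snd z) * k2 z) + (sqrt_deriv (snd z))\<^sup>2 * (\<rho> (fst z) * k2 z)"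

definition prin :: "real \<times> real \<Rightarrow> real" where
  "prin z = \<rho> (fst z) * (\<rho> (snd z) * ((\<rho> (fst z))\<^sup>2 * (Ks (F (fst z)) (F (snd z)))\<^sup>2 + (\<rho> (snd z))\<^sup>2 * (Kt (F (fst z)) (F (snd z)))\<^sup>2))"

text \<open>The kernel square integrates to 1 against \<rho> in either variable, so this integral
  does not depend on \<delta>, and its prefactor \<delta>^2 + \<delta> makes it negligible.\<close>

lemma err_integral: "(\<integral>\<^sup>+z. ennreal (err z) \<partial>lborel) = 2 * (\<integral>\<^sup>+x. ennreal ((sqrt_deriv x)\<^sup>2) \<partial>lborel)"
proof -
  have "(\<integral>\<^sup>+z. ennreal (err z) \<partial>lborel) = (\<integral>\<^sup>+z. ennreal ((sqrt_deriv (fst z))\<^sup>2) * (ennreal (\<rho> (snd z)) * ennreal (k2 z))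
      + ennreal ((sqrt_deriv (snd z))\<^sup>2) * (ennreal (\<rho> (fst z)) * ennreal (k2 z)) \<partial>lborel)"
    unfolding err_def by (intro nn_integral_cong) (simp add: ennreal_plus ennreal_mult)
  also have "\<dots> = (\<integral>\<^sup>+x. ennreal ((sqrt_deriv x)\<^sup>2) \<partial>lborel) + (\<integral>\<^sup>+x. ennreal ((sqrt_deriv x)\<^sup>2) \<partial>lborel)"
    by (subst nn_integral_add) (auto simp: nn_integral_marginal[where k = "\<lambda>x. ennreal ((sqrt_deriv x)\<^sup>2)"])
  finally show ?thesis by (simp add: mult_2)
qed

lemma G_sq_le:
  assumes d: "d > 0"
  shows "d\<^sup>2 * (norm (G z))\<^sup>2 \<le> (d\<^sup>2 + d) * err z + (1 + d) * d\<^sup>2 * prin z"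
proof -
  have x: "d\<^sup>2 * (Gx z)\<^sup>2 \<le> (d\<^sup>2 + d) * (sqrt_deriv (fst z) * (sqrt (\<rho> (snd z)) * K (F (fst z)) (F (snd z))))\<^sup>2
     + (1 + d) * d\<^sup>2 * (sqrt (\<rho> (fst z)) * (sqrt (\<rho> (snd z)) * (Ks (F (fst z)) (F (snd z)) * \<rho> (fst z))))\<^sup>2"
    unfolding Gx_def by (rule sq_add_le[OF d])
  have y: "d\<^sup>2 * (Gy z)\<^sup>2 \<le> (d\<^sup>2 + d) * (sqrt_deriv (snd z) * (sqrt (\<rho> (fst z)) * K (F (fst z)) (F (snd z))))\<^sup>2
     + (1 + d) * d\<^sup>2 * (sqrt (\<rho> (snd z)) * (sqrt (\<rho> (fst z)) * (Kt (F (fst z)) (F (snd z)) * \<rho> (snd z))))\<^sup>2"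
    unfolding Gy_def by (rule sq_add_le[OF d])
  have "d\<^sup>2 * (norm (G z))\<^sup>2 = d\<^sup>2 * (Gx z)\<^sup>2 + d\<^sup>2 * (Gy z)\<^sup>2" by (simp add: norm_G distrib_left)
  also note add_mono[OF x y]
  finally show ?thesis
    unfolding err_def prin_def by (simp add: power_mult_distrib algebra_simps)
qed

text \<open>A crude bound, only for membership in the Sobolev space; the sharp estimate of this term
  is in \<open>energy_pointwise\<close>.\<close>

lemma prin_finite: "(\<integral>\<^sup>+z. ennreal (prin z) \<partial>lborel) < \<infinity>"
proof -
  obtain C where C: "\<And>s t. s \<in> {0..1} \<Longrightarrow> \<bar>K s t\<bar> \<le> C \<and> (Kt s t)\<^sup>2 \<le> C \<and> (Ks s t)\<^sup>2 \<le> C"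
    using K_bounded by blast
  have C0: "0 \<le> C" using C[of 0 0] by auto
  have le: "prin z \<le> \<rho> (fst z) * (\<rho> (snd z) * (2 * (rmax\<^sup>2 * C)))" for z
  proof -
    have "(\<rho> x)\<^sup>2 * c \<le> rmax\<^sup>2 * C" if "c \<le> C" "0 \<le> c" for x c
      using rmax(2)[of x] that by (intro mult_mono power_mono) auto
    then have "(\<rho> (fst z))\<^sup>2 * (Ks (F (fst z)) (F (snd z)))\<^sup>2 + (\<rho> (snd z))\<^sup>2 * (Kt (F (fst z)) (F (snd z)))\<^sup>2 \<le> rmax\<^sup>2 * C + rmax\<^sup>2 * C"
      using C[OF Fx01] by (intro add_mono) auto
    then show ?thesis unfolding prin_def by (intro mult_left_mono) (simp_all add: mult.commute)
  qed
  have "(\<integral>\<^sup>+z. ennreal (prin z) \<partial>lborel) \<le> (\<integral>\<^sup>+z. ennreal (\<rho> (fst z)) * (ennreal (\<rho> (snd z)) * ennreal (2 * (rmax\<^sup>2 * C))) \<partial>lborel)"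
  proof (rule nn_integral_mono)
    fix z
    have "ennreal (prin z) \<le> ennreal (\<rho> (fst z) * (\<rho> (snd z) * (2 * (rmax\<^sup>2 * C))))" by (rule ennreal_leI[OF le])
    also have "\<dots> = ennreal (\<rho> (fst z)) * (ennreal (\<rho> (snd z)) * ennreal (2 * (rmax\<^sup>2 * C)))"
      using C0 by (simp add: ennreal_mult)
    finally show "ennreal (prin z) \<le> ennreal (\<rho> (fst z)) * (ennreal (\<rho> (snd z)) * ennreal (2 * (rmax\<^sup>2 * C)))" .
  qed
  also have "\<dots> = ennreal (2 * (rmax\<^sup>2 * C))"
    by (subst real_pair_integral(1)) (auto simp: nn_integral_cmult nn_integral_multc nn_rho)
  also have "\<dots> < \<infinity>" by simp
  finally show ?thesis .
qed

lemma prin_meas [measurable]: "prin \<in> borel_measurable borel" "err \<in> borel_measurable borel"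
  unfolding prin_def[abs_def] err_def[abs_def] by measurable

lemma prin_nonneg: "0 \<le> prin z" "0 \<le> err z"
  unfolding prin_def err_def by (auto intro!: mult_nonneg_nonneg add_nonneg_nonneg)

lemma G_integrable: "integrable lborel (\<lambda>z. (norm (G z))\<^sup>2)"
proof (rule integrableI_nonneg)
  have "(norm (G z))\<^sup>2 \<le> 2 * (err z + prin z)" for z
    using G_sq_le[of 1 z] by simp
  then have "(\<integral>\<^sup>+z. ennreal ((norm (G z))\<^sup>2) \<partial>lborel) \<le> (\<integral>\<^sup>+z. 2 * (ennreal (err z) + ennreal (prin z)) \<partial>lborel)"
    using prin_nonneg
    by (intro nn_integral_mono) (simp flip: ennreal_plus ennreal_numeral ennreal_mult)
  also have "\<dots> = 2 * ((\<integral>\<^sup>+z. ennreal (err z) \<partial>lborel) + (\<integral>\<^sup>+z. ennreal (prin z) \<partial>lborel))"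
    by (simp add: nn_integral_cmult nn_integral_add)
  also have "\<dots> < \<infinity>"
    using prin_finite nn_sqrt_deriv_finite by (simp add: err_integral ennreal_mult_less_top)
  finally show "(\<integral>\<^sup>+z. ennreal ((norm (G z))\<^sup>2) \<partial>lborel) < \<infinity>" .
qed (auto simp: norm_G)

lemma \<psi>_H1: "H1_with_gradient \<psi> G"
  unfolding H1_with_gradient_def
proof (intro conjI ballI \<psi>_meas G_meas \<psi>_integrable G_integrable)
  fix b :: "real \<times> real" assume "b \<in> Basis"
  then consider "b = (1, 0)" | "b = (0, 1)" by (auto simp: Basis_prod_def)
  then show "has_weak_partial b \<psi> (\<lambda>x. G x \<bullet> b)"
  proof cases
    case 1
    then show ?thesis
      using has_weak_partial_plane(1)[OF \<psi>_meas locally_bounded_parts \<psi>_deriv_x \<psi>_deriv_y]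
      by (simp add: G_def)
  next
    case 2
    then show ?thesis
      using has_weak_partial_plane(2)[OF \<psi>_meas locally_bounded_parts \<psi>_deriv_x \<psi>_deriv_y]
      by (simp add: G_def)
  qed
qed

lemma \<psi>_support:
  assumes "\<psi> z \<noteq> 0"
  shows "\<bar>F (snd z) - F (fst z) - 1/2\<bar> \<le> \<delta> * \<Omega> \<or> \<bar>F (snd z) - F (fst z) + 1/2\<bar> \<le> \<delta> * \<Omega>"
proof -
  let ?s = "F (fst z)" and ?t = "F (snd z)"
  have w: "0 < w ?s" "w ?s \<le> \<delta> * \<Omega>" using w_bounds[OF Fx01] by auto
  have "K ?s ?t \<noteq> 0" using assms by (auto simp: \<psi>_def)
  then have "\<bar>\<xi>p ?s ?t\<bar> < 1 \<or> \<bar>\<xi>m ?s ?t\<bar> < 1" using K_eq_0 by (meson not_less)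
  then show ?thesis
    unfolding \<xi>p_def \<xi>m_def abs_divide using w by (auto simp: pos_divide_less_eq)
qed

text \<open>As w = \<delta> p, the product of \<delta>^2 with the factor 1 / w^3 of the squared
  kernel derivatives is (1 / w) (1 / p^2): one 1 / w is kept for the substitution in the profile
  variable, and 1 / p^2 stays in \<open>dens\<close>.\<close>

lemma energy_pointwise:
  "\<delta>\<^sup>2 * ((norm (G z))\<^sup>2 / 2) + 1 / \<delta>\<^sup>2 * (potential_V u z * (\<psi> z)\<^sup>2)
    \<le> (\<delta>\<^sup>2 + \<delta>) / 2 * err z + \<rho> (fst z) * (\<rho> (snd z) * (1 / w (F (fst z)) *
      (dens p \<Omega> \<delta> (fst z) (snd z) (\<xi>p (F (fst z)) (F (snd z))) + dens p \<Omega> \<delta> (fst z) (snd z) (\<xi>m (F (fst z)) (F (snd z))))))"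
proof -
  define x where "x = fst z"
  define y where "y = snd z"
  define s where "s = F x"
  define t where "t = F y"
  have s: "s \<in> {0..1}" using Fx01 by (simp add: s_def)
  have w: "0 < w s" using w_bounds[OF s] by simp
  let ?e = "(env (\<delta> * \<Omega>) (\<xi>p s t))\<^sup>2 + (env (\<delta> * \<Omega>) (\<xi>m s t))\<^sup>2"
  let ?th = "(\<theta> (\<xi>p s t))\<^sup>2 * (1 + \<xi>p s t * b s) + (\<theta> (\<xi>m s t))\<^sup>2 * (1 + \<xi>m s t * b s)"
  have g: "\<delta>\<^sup>2 * ((norm (G z))\<^sup>2 / 2) \<le> (\<delta>\<^sup>2 + \<delta>) / 2 * err z + (1 + \<delta>) / 2 * \<delta>\<^sup>2 * prin z"
    using G_sq_le[OF \<delta>_pos, of z] by simp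
  have "prin z \<le> \<rho> x * (\<rho> y * (((\<rho> x)\<^sup>2 + (\<rho> y)\<^sup>2) * (1 / (w s) ^ 3 * ?e)))"
    unfolding prin_def x_def[symmetric] y_def[symmetric] s_def[symmetric] t_def[symmetric] distrib_right
    by (intro mult_left_mono add_mono Ks_sq Kt_sq s) auto
  then have "(1 + \<delta>) / 2 * \<delta>\<^sup>2 * prin z \<le> (1 + \<delta>) / 2 * \<delta>\<^sup>2 * (\<rho> x * (\<rho> y * (((\<rho> x)\<^sup>2 + (\<rho> y)\<^sup>2) * (1 / (w s) ^ 3 * ?e))))"
    using \<delta>_pos by (intro mult_left_mono) auto
  also have "\<dots> = \<rho> x * (\<rho> y * (1 / w s * ((1 + \<delta>) / 2 * ((\<rho> x)\<^sup>2 + (\<rho> y)\<^sup>2) * ?e * (\<delta>\<^sup>2 / (w s)\<^sup>2))))"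
    using w by (simp add: power2_eq_square power3_eq_cube mult_ac)
  also have "\<delta>\<^sup>2 / (w s)\<^sup>2 = 1 / (poly p s)\<^sup>2" using \<delta>_pos by (simp add: w_def power_mult_distrib)
  finally have 1: "(1 + \<delta>) / 2 * \<delta>\<^sup>2 * prin z \<le> \<rho> x * (\<rho> y * (1 / w s * ((1 + \<delta>) / 2 * ((\<rho> x)\<^sup>2 + (\<rho> y)\<^sup>2) * ?e * (1 / (poly p s)\<^sup>2))))" .
  have 2: "1 / \<delta>\<^sup>2 * (potential_V u z * (\<psi> z)\<^sup>2) = \<rho> x * (\<rho> y * (1 / w s * (1 / \<delta>\<^sup>2 * potential_V u (x, y) * ?th)))"
    unfolding \<psi>_sq x_def[symmetric] y_def[symmetric] s_def[symmetric] t_def[symmetric] K_sq[OF s]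
    by (simp add: x_def y_def mult_ac)
  have 3: "dens p \<Omega> \<delta> x y (\<xi>p s t) + dens p \<Omega> \<delta> x y (\<xi>m s t)
      = (1 + \<delta>) / 2 * ((\<rho> x)\<^sup>2 + (\<rho> y)\<^sup>2) * ?e * (1 / (poly p s)\<^sup>2) + 1 / \<delta>\<^sup>2 * potential_V u (x, y) * ?th"
    unfolding dens_def s_def[symmetric] b_def by (simp add: add_divide_distrib distrib_left)
  have "\<delta>\<^sup>2 * ((norm (G z))\<^sup>2 / 2) + 1 / \<delta>\<^sup>2 * (potential_V u z * (\<psi> z)\<^sup>2)
     \<le> (\<delta>\<^sup>2 + \<delta>) / 2 * err z + \<rho> x * (\<rho> y * (1 / w s * (dens p \<Omega> \<delta> x y (\<xi>p s t) + dens p \<Omega> \<delta> x y (\<xi>m s t))))"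
    unfolding 3 distrib_left[of "1 / w s"] distrib_left[of "\<rho> y"] distrib_left[of "\<rho> x"] using g 1 2 by linarith
  then show ?thesis by (simp add: x_def y_def s_def t_def)
qed

text \<open>In the inner integral, t = F y absorbs the factor \<rho> y, and
  \<open>nn_integral_circle\<close> turns 1 / w times the sum over the branches into an integral
  over \<xi>.\<close>

lemma energy_le: "(\<integral>\<^sup>+z. ennreal (\<delta>\<^sup>2 * ((norm (G z))\<^sup>2 / 2) + 1 / \<delta>\<^sup>2 * (potential_V u z * (\<psi> z)\<^sup>2)) \<partial>lborel)
    \<le> error_energy \<delta> + main_energy p \<Omega> \<delta>"
proof -
  let ?D = "\<lambda>z. ennreal (1 / w (F (fst z))) * (ennreal (dens p \<Omega> \<delta> (fst z) (snd z) (\<xi>p (F (fst z)) (F (snd z))))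
      + ennreal (dens p \<Omega> \<delta> (fst z) (snd z) (\<xi>m (F (fst z)) (F (snd z)))))"
  have \<xi>_meas [measurable]: "(\<lambda>z. \<xi>p (f z) (g z)) \<in> borel_measurable M" "(\<lambda>z. \<xi>m (f z) (g z)) \<in> borel_measurable M"
    if [measurable]: "f \<in> borel_measurable M" "g \<in> borel_measurable M" for f g :: "'a \<Rightarrow> real" and M
    unfolding \<xi>p_def \<xi>m_def by measurable
  have "(\<integral>\<^sup>+z. ennreal (\<delta>\<^sup>2 * ((norm (G z))\<^sup>2 / 2) + 1 / \<delta>\<^sup>2 * (potential_V u z * (\<psi> z)\<^sup>2)) \<partial>lborel)
    \<le> (\<integral>\<^sup>+z. ennreal ((\<delta>\<^sup>2 + \<delta>) / 2) * ennreal (err z) + ennreal (\<rho> (fst z)) * (ennreal (\<rho> (snd z)) * ?D z) \<partial>lborel)"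
  proof (rule nn_integral_mono)
    fix z :: "real \<times> real"
    have w: "0 < w (F (fst z))" using w_bounds[OF Fx01] by simp
    show "ennreal (\<delta>\<^sup>2 * ((norm (G z))\<^sup>2 / 2) + 1 / \<delta>\<^sup>2 * (potential_V u z * (\<psi> z)\<^sup>2))
      \<le> ennreal ((\<delta>\<^sup>2 + \<delta>) / 2) * ennreal (err z) + ennreal (\<rho> (fst z)) * (ennreal (\<rho> (snd z)) * ?D z)"
    proof (rule order_trans[OF ennreal_leI[OF energy_pointwise]], rule order_trans[OF ennreal_add_le], rule add_mono)
      show "ennreal ((\<delta>\<^sup>2 + \<delta>) / 2 * err z) \<le> ennreal ((\<delta>\<^sup>2 + \<delta>) / 2) * ennreal (err z)"
        using \<delta>_pos by (subst ennreal_mult') auto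
    qed (use w in \<open>intro ennreal_mult_add_le, auto\<close>)
  qed
  also have "\<dots> = ennreal ((\<delta>\<^sup>2 + \<delta>) / 2) * (\<integral>\<^sup>+z. ennreal (err z) \<partial>lborel)
      + (\<integral>\<^sup>+z. ennreal (\<rho> (fst z)) * (ennreal (\<rho> (snd z)) * ?D z) \<partial>lborel)"
    by (subst nn_integral_add) (auto simp: nn_integral_cmult)
  also have "ennreal ((\<delta>\<^sup>2 + \<delta>) / 2) * (\<integral>\<^sup>+z. ennreal (err z) \<partial>lborel) = error_energy \<delta>"
  proof -
    have "ennreal ((\<delta>\<^sup>2 + \<delta>) / 2) * 2 = ennreal (\<delta>\<^sup>2 + \<delta>)"
      using \<delta>_pos by (subst ennreal_numeral[symmetric], subst ennreal_mult[symmetric]) (auto simp del: ennreal_plus)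
    then show ?thesis by (simp add: err_integral error_energy_def mult.assoc[symmetric])
  qed
  also have "(\<integral>\<^sup>+z. ennreal (\<rho> (fst z)) * (ennreal (\<rho> (snd z)) * ?D z) \<partial>lborel)
      = (\<integral>\<^sup>+x. ennreal (\<rho> x) * (\<integral>\<^sup>+y. ennreal (\<rho> y) * ?D (x, y) \<partial>lborel) \<partial>lborel)"
    by (subst real_pair_integral(1)) (auto simp: nn_integral_cmult)
  also have "\<dots> = main_energy p \<Omega> \<delta>"
    unfolding main_energy_def
  proof (rule nn_integral_cong)
    fix x :: real
    let ?h = "\<lambda>t \<xi>. ennreal (dens p \<Omega> \<delta> x (Q t) \<xi>)"
    note w = w_bounds[OF Fx01, of x]
    have "(\<integral>\<^sup>+y. ennreal (\<rho> y) * ?D (x, y) \<partial>lborel)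
      = (\<integral>\<^sup>+y. ennreal (\<rho> y) * (\<lambda>t. ennreal (1 / w (F x)) * (?h t (\<xi>p (F x) t) + ?h t (\<xi>m (F x) t))) (F y) \<partial>lborel)"
      by simp
    also have "\<dots> = (\<integral>\<^sup>+t. ennreal (1 / w (F x)) * (?h t (\<xi>p (F x) t) + ?h t (\<xi>m (F x) t)) * indicator {0..<1} t \<partial>lborel)"
      by (rule nn_integral_F) measurable
    also have "\<dots> = (\<integral>\<^sup>+\<xi>. ?h (frac (F x + 1/2 + w (F x) * \<xi>)) \<xi> \<partial>lborel)"
      unfolding \<xi>p_def \<xi>m_def
    proof (rule nn_integral_circle)
      show "(\<lambda>(t, \<xi>). ?h t \<xi>) \<in> borel_measurable (borel \<Otimes>\<^sub>M borel)" by measurable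
      show "?h t \<xi> = 0" if "1 \<le> \<bar>\<xi>\<bar>" for t \<xi> using that by (simp add: dens_def env_0 \<theta>_0)
    qed (use w in \<open>auto simp: less_imp_le\<close>)
    also have "\<dots> = (\<integral>\<^sup>+\<xi>. ennreal (dens p \<Omega> \<delta> x (partner p \<delta> x \<xi>) \<xi>) \<partial>lborel)"
      by (simp add: partner_def w_def)
    finally show "ennreal (\<rho> x) * (\<integral>\<^sup>+y. ennreal (\<rho> y) * ?D (x, y) \<partial>lborel)
        = ennreal (\<rho> x) * (\<integral>\<^sup>+\<xi>. ennreal (dens p \<Omega> \<delta> x (partner p \<delta> x \<xi>) \<xi>) \<partial>lborel)" by simp
  qed
  finally show ?thesis .
qed

end

section \<open>The limit of the energy\<close>

text \<open>These are the profile values for which the partner is useless: at fractional part 0 the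
  function \<open>Q\<close> has only its default value, and at 1/2 the partner is the median. They
  form a null set.\<close>

lemma countable_frac_half:
  fixes a k :: real
  assumes "k \<noteq> 0"
  shows "countable {\<xi>. frac (a + k * \<xi>) = 0 \<or> frac (a + k * \<xi>) = 1/2}"
proof -
  have "{\<xi>. frac (a + k * \<xi>) = 0 \<or> frac (a + k * \<xi>) = 1/2}
    \<subseteq> range (\<lambda>n::int. (of_int n - a) / k) \<union> range (\<lambda>n::int. (of_int n + 1/2 - a) / k)"
  proof
    fix \<xi> assume "\<xi> \<in> {\<xi>. frac (a + k * \<xi>) = 0 \<or> frac (a + k * \<xi>) = 1/2}"
    then consider "a + k * \<xi> = of_int \<lfloor>a + k * \<xi>\<rfloor>" | "a + k * \<xi> = of_int \<lfloor>a + k * \<xi>\<rfloor> + 1/2"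
      by (auto simp: frac_def)
    then show "\<xi> \<in> range (\<lambda>n::int. (of_int n - a) / k) \<union> range (\<lambda>n::int. (of_int n + 1/2 - a) / k)"
    proof cases
      case 1
      then have "\<xi> = (of_int \<lfloor>a + k * \<xi>\<rfloor> - a) / k" using assms by (simp add: field_simps)
      then show ?thesis by blast
    next
      case 2
      then have "\<xi> = (of_int \<lfloor>a + k * \<xi>\<rfloor> + 1/2 - a) / k" using assms by (simp add: field_simps)
      then show ?thesis by blast
    qed
  qed
  then show ?thesis by (rule countable_subset) simp
qed

context potential_profile
begin

definition cK :: real where "cK = integral {-1..1} (\<lambda>x. (\<theta>' x)\<^sup>2)"
definition cV :: real where "cV = integral {-1..1} (\<lambda>x. x\<^sup>2 * (\<theta> x)\<^sup>2)"

definition lim_dens :: "real poly \<Rightarrow> real \<Rightarrow> real \<Rightarrow> real" where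
  "lim_dens p x \<xi> = 1/2 * ((\<rho> x)\<^sup>2 + (\<rho> (T x))\<^sup>2) * (\<theta>' \<xi>)\<^sup>2 / (poly p (F x))\<^sup>2
     + B x * (poly p (F x) * \<xi>)\<^sup>2 * (\<theta> \<xi>)\<^sup>2"

lemma dens_tendsto:
  fixes d :: "nat \<Rightarrow> real"
  assumes x: "x \<noteq> m" and p: "poly p (F x) \<noteq> 0" and d: "\<And>i. 0 < d i" "d \<longlonglongrightarrow> 0"
  shows "(\<lambda>i. dens p \<Omega> (d i) x (partner p (d i) x \<xi>) \<xi>) \<longlonglongrightarrow> lim_dens p x \<xi>"
proof -
  define k where "k = poly p (F x) * \<xi>"
  have r: "0 < opp (F x)" "opp (F x) < 1" using opp_range[of "F x"] F_half_iff(2)[of x] x by auto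
  have \<tau>: "(\<lambda>i. d i * k) \<longlonglongrightarrow> 0" using tendsto_mult_left_zero[OF d(2)] .
  have o: "(\<lambda>i. opp (F x) + d i * k) \<longlonglongrightarrow> opp (F x)" using tendsto_add[OF tendsto_const \<tau>] by simp
  have "eventually (\<lambda>i. 0 < opp (F x) + d i * k) sequentially" "eventually (\<lambda>i. opp (F x) + d i * k < 1) sequentially"
    using order_tendstoD[OF o] r by auto
  \<comment> \<open>The half turn of F x is interior to (0, 1), so for small displacements the
    fractional part is just \<open>opp\<close> plus the displacement.\<close>
  then have part: "eventually (\<lambda>i. partner p (d i) x \<xi> = Q (opp (F x) + d i * k)) sequentially"
  proof eventually_elim
    fix i assume a: "0 < opp (F x) + d i * k" "opp (F x) + d i * k < 1"
    have "F x + 1/2 + d i * k = opp (F x) + d i * k \<or> F x + 1/2 + d i * k = (opp (F x) + d i * k) + 1"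
      by (auto simp: opp_def)
    then have "frac (F x + 1/2 + d i * k) = frac (opp (F x) + d i * k)"
      using frac_1_eq by metis
    also have "\<dots> = opp (F x) + d i * k" using a by (simp add: frac_eq)
    finally show "partner p (d i) x \<xi> = Q (opp (F x) + d i * k)" by (simp add: partner_def k_def mult.assoc)
  qed
  have Ql: "(\<lambda>i. Q (opp (F x) + d i * k)) \<longlonglongrightarrow> T x"
    unfolding T_eq[OF x] by (rule isCont_tendsto_compose[OF Q_cont[OF r] o])
  have \<rho>l: "(\<lambda>i. \<rho> (Q (opp (F x) + d i * k))) \<longlonglongrightarrow> \<rho> (T x)"
    by (rule isCont_tendsto_compose[OF rho_cont Ql])
  have env: "(\<lambda>i. env (d i * \<Omega>) \<xi>) \<longlonglongrightarrow> \<bar>\<theta>' \<xi>\<bar>"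
  proof (cases "\<bar>\<xi>\<bar> < 1")
    case True
    have "(\<lambda>i. \<bar>\<theta>' \<xi>\<bar> + 6 * M\<theta> * (d i * \<Omega>)) \<longlonglongrightarrow> \<bar>\<theta>' \<xi>\<bar> + 6 * M\<theta> * (0 * \<Omega>)"
      by (intro tendsto_intros d)
    then show ?thesis using True by (simp add: env_def)
  qed (simp add: env_def \<theta>'_0)
  \<comment> \<open>\<open>V_limit\<close> speaks of nonzero displacements only; for k = 0 the
    potential term vanishes identically.\<close>
  have Vl: "(\<lambda>i. 1 / (d i)\<^sup>2 * potential_V u (x, Q (opp (F x) + d i * k))) \<longlonglongrightarrow> B x * k\<^sup>2"
  proof (cases "k = 0")
    case True
    then show ?thesis using V_T[OF x] by (simp add: T_eq[OF x, symmetric])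
  next
    case False
    have "filterlim (\<lambda>i. d i * k) (at 0) sequentially"
      using \<tau> d(1) False by (auto simp: filterlim_at less_imp_neq[symmetric])
    then have "(\<lambda>i. potential_V u (x, Q (opp (F x) + d i * k)) / (d i * k)\<^sup>2) \<longlonglongrightarrow> B x"
      by (rule filterlim_compose[OF V_limit[OF x]])
    then have "(\<lambda>i. potential_V u (x, Q (opp (F x) + d i * k)) / (d i * k)\<^sup>2 * k\<^sup>2) \<longlonglongrightarrow> B x * k\<^sup>2"
      by (intro tendsto_intros)
    then show ?thesis using False by (simp add: power_mult_distrib mult.commute)
  qed
  have "(\<lambda>i. (1 + d i) / 2 * ((\<rho> x)\<^sup>2 + (\<rho> (Q (opp (F x) + d i * k)))\<^sup>2) * (env (d i * \<Omega>) \<xi>)\<^sup>2 / (poly p (F x))\<^sup>2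
     + 1 / (d i)\<^sup>2 * potential_V u (x, Q (opp (F x) + d i * k)) * ((\<theta> \<xi>)\<^sup>2 * (1 + \<xi> * (d i * poly (pderiv p) (F x)))))
     \<longlonglongrightarrow> (1 + 0) / 2 * ((\<rho> x)\<^sup>2 + (\<rho> (T x))\<^sup>2) * \<bar>\<theta>' \<xi>\<bar>\<^sup>2 / (poly p (F x))\<^sup>2
     + B x * k\<^sup>2 * ((\<theta> \<xi>)\<^sup>2 * (1 + \<xi> * (0 * poly (pderiv p) (F x))))"
    by (intro tendsto_intros Vl \<rho>l env d) (use p in auto)
  also have "(1 + 0) / 2 * ((\<rho> x)\<^sup>2 + (\<rho> (T x))\<^sup>2) * \<bar>\<theta>' \<xi>\<bar>\<^sup>2 / (poly p (F x))\<^sup>2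
     + B x * k\<^sup>2 * ((\<theta> \<xi>)\<^sup>2 * (1 + \<xi> * (0 * poly (pderiv p) (F x)))) = lim_dens p x \<xi>"
    by (simp add: lim_dens_def k_def)
  finally show ?thesis
    by (rule Lim_transform_eventually) (use part in \<open>eventually_elim, simp add: dens_def\<close>)
qed

text \<open>The displacement is at most \<delta> \<Omega>, so \<open>V_le_tau_sqr\<close> cancels
  the factor 1 / \<delta>^2, uniformly in x. A one-sided bound suffices, as the integrands pass
  through \<open>ennreal\<close>.\<close>

lemma dens_bound:
  assumes pp: "\<And>s. s \<in> {0..1} \<Longrightarrow> 0 < poly p s" "\<And>s. s \<in> {0..1} \<Longrightarrow> poly p s \<le> \<Omega>"
    "\<And>s. s \<in> {0..1} \<Longrightarrow> \<bar>poly (pderiv p) s\<bar> \<le> \<Omega>"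
  obtains D where "D \<ge> 0" "\<And>\<delta> x \<xi>. 0 < \<delta> \<Longrightarrow> \<delta> \<le> 1 \<Longrightarrow> \<delta> * \<Omega> \<le> 1/16 \<Longrightarrow> x \<noteq> m \<Longrightarrow>
     frac (F x + 1/2 + \<delta> * poly p (F x) * \<xi>) \<noteq> 0 \<Longrightarrow> frac (F x + 1/2 + \<delta> * poly p (F x) * \<xi>) \<noteq> 1/2 \<Longrightarrow>
     dens p \<Omega> \<delta> x (partner p \<delta> x \<xi>) \<xi> \<le> D * indicator {-1..1} \<xi>"
proof -
  obtain CV where CV: "\<And>x y \<tau>. x \<noteq> m \<Longrightarrow> y \<noteq> m \<Longrightarrow> \<bar>\<tau>\<bar> \<le> 1/16 \<Longrightarrow>
    F y = F x + 1/2 + \<tau> \<or> F y = F x - 1/2 + \<tau> \<Longrightarrow> potential_V u (x, y) \<le> CV * \<tau>\<^sup>2"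
    using V_le_tau_sqr by blast
  have \<Omega>: "\<Omega> > 0" using pp(1,2)[of 0] by simp
  have "compact (poly p ` {0..1})" "poly p ` {0..1} \<noteq> {}"
    by (auto intro!: compact_continuous_image continuous_on_poly continuous_on_id)
  then obtain p0 where p0: "p0 \<in> poly p ` {0..1}" "\<And>y. y \<in> poly p ` {0..1} \<Longrightarrow> p0 \<le> y"
    using compact_attains_inf by metis
  have p0p: "p0 > 0" using p0(1) pp(1) by auto
  define D1 where "D1 = 2 * rmax\<^sup>2 * (2 * M\<theta>)\<^sup>2 / p0\<^sup>2"
  define D2 where "D2 = \<bar>CV\<bar> * \<Omega>\<^sup>2 * (M\<theta>\<^sup>2 * 2)"
  have D: "D1 \<ge> 0" "D2 \<ge> 0" by (auto simp: D1_def D2_def)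
  show ?thesis
  proof (rule that[of "D1 + D2"])
    show "D1 + D2 \<ge> 0" using D by simp
    fix \<delta> x \<xi> :: real
    assume \<delta>: "0 < \<delta>" "\<delta> \<le> 1" "\<delta> * \<Omega> \<le> 1/16" and x: "x \<noteq> m"
      and f: "frac (F x + 1/2 + \<delta> * poly p (F x) * \<xi>) \<noteq> 0" "frac (F x + 1/2 + \<delta> * poly p (F x) * \<xi>) \<noteq> 1/2"
    define y where "y = partner p \<delta> x \<xi>"
    show "dens p \<Omega> \<delta> x (partner p \<delta> x \<xi>) \<xi> \<le> (D1 + D2) * indicator {-1..1} \<xi>"
    proof (cases "\<bar>\<xi>\<bar> < 1")
      case False
      then show ?thesis using D by (simp add: dens_def env_0 \<theta>_0)
    next
      case True
      define s where "s = F x"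
      have s: "s \<in> {0..1}" "0 < s" "s < 1" using F_range[of x] by (auto simp: s_def intro: less_imp_le)
      have ps: "p0 \<le> poly p s" "0 < poly p s" "poly p s \<le> \<Omega>" using p0(2) pp s(1) by auto
      define \<tau> where "\<tau> = \<delta> * poly p s * \<xi>"
      have "\<bar>\<delta> * poly p s * \<xi>\<bar> \<le> \<delta> * \<Omega> * 1"
        unfolding abs_mult using True ps \<delta> \<Omega> by (intro mult_mono) auto
      then have \<tau>1: "\<bar>\<tau>\<bar> \<le> \<delta> * \<Omega>" by (simp add: \<tau>_def)
      then have \<tau>: "\<bar>\<tau>\<bar> \<le> 1/16" using \<delta>(3) by linarith
      define t where "t = frac (s + 1/2 + \<tau>)"
      have t01: "0 < t" "t < 1" "t \<noteq> 1/2"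
        using f frac_lt_1[of "s + 1/2 + \<tau>"] frac_ge_0[of "s + 1/2 + \<tau>"] by (auto simp: t_def s_def \<tau>_def)
      have z: "0 \<le> s + 1/2 + \<tau>" "s + 1/2 + \<tau> < 2" using s(2,3) \<tau> by linarith+
      have t: "t = s + 1/2 + \<tau> \<or> t = s - 1/2 + \<tau>"
      proof (cases "s + 1/2 + \<tau> < 1")
        case True
        then show ?thesis using z by (simp add: t_def frac_eq)
      next
        case False
        have "s + 1/2 + \<tau> = (s - 1/2 + \<tau>) + 1" by simp
        then have "t = frac (s - 1/2 + \<tau>)" unfolding t_def by (simp only: frac_1_eq)
        also have "\<dots> = s - 1/2 + \<tau>" using False z by (simp add: frac_eq)
        finally show ?thesis by simp
      qed
      have Fy: "F y = t" using t01 by (simp add: y_def partner_def t_def s_def \<tau>_def)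
      have ym: "y \<noteq> m" using Fy t01 by auto
      have V: "potential_V u (x, y) \<le> \<bar>CV\<bar> * (\<delta> * \<Omega>)\<^sup>2"
      proof -
        have "potential_V u (x, y) \<le> CV * \<tau>\<^sup>2"
          using t by (intro CV x ym \<tau>) (simp add: Fy s_def)
        also have "\<dots> \<le> \<bar>CV\<bar> * \<tau>\<^sup>2" by (intro mult_right_mono) auto
        also have "\<dots> \<le> \<bar>CV\<bar> * (\<delta> * \<Omega>)\<^sup>2"
          using \<tau>1 \<delta>(1) \<Omega> by (intro mult_left_mono) (auto simp: abs_le_square_iff[symmetric])
        finally show ?thesis .
      qed
      have b: "\<bar>\<delta> * poly (pderiv p) s\<bar> \<le> \<delta> * \<Omega>" using pp(3)[OF s(1)] \<delta>(1) by (simp add: abs_mult)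
      have fac: "0 \<le> 1 + \<xi> * (\<delta> * poly (pderiv p) s)" "1 + \<xi> * (\<delta> * poly (pderiv p) s) \<le> 2"
      proof -
        have "\<bar>\<xi> * (\<delta> * poly (pderiv p) s)\<bar> \<le> \<delta> * \<Omega>" by (rule xb_bound) (use True b in auto)
        then show "0 \<le> 1 + \<xi> * (\<delta> * poly (pderiv p) s)" "1 + \<xi> * (\<delta> * poly (pderiv p) s) \<le> 2"
          using \<delta>(3) by linarith+
      qed
      have th: "0 \<le> (\<theta> \<xi>)\<^sup>2 * (1 + \<xi> * (\<delta> * poly (pderiv p) s))" "(\<theta> \<xi>)\<^sup>2 * (1 + \<xi> * (\<delta> * poly (pderiv p) s)) \<le> M\<theta>\<^sup>2 * 2"
      proof -
        show "0 \<le> (\<theta> \<xi>)\<^sup>2 * (1 + \<xi> * (\<delta> * poly (pderiv p) s))" using fac by simp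
        have "(\<theta> \<xi>)\<^sup>2 \<le> M\<theta>\<^sup>2" using M\<theta>(1) M\<theta>(2)[of \<xi>] by (simp add: abs_le_square_iff[symmetric])
        then show "(\<theta> \<xi>)\<^sup>2 * (1 + \<xi> * (\<delta> * poly (pderiv p) s)) \<le> M\<theta>\<^sup>2 * 2" using fac by (intro mult_mono) auto
      qed
      have 2: "1 / \<delta>\<^sup>2 * potential_V u (x, y) * ((\<theta> \<xi>)\<^sup>2 * (1 + \<xi> * (\<delta> * poly (pderiv p) s))) \<le> D2"
      proof -
        have "1 / \<delta>\<^sup>2 * potential_V u (x, y) \<le> 1 / \<delta>\<^sup>2 * (\<bar>CV\<bar> * (\<delta> * \<Omega>)\<^sup>2)" by (intro mult_left_mono V) auto
        also have "\<dots> = \<bar>CV\<bar> * \<Omega>\<^sup>2" using \<delta>(1) by (simp add: power_mult_distrib)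
        finally have "1 / \<delta>\<^sup>2 * potential_V u (x, y) * ((\<theta> \<xi>)\<^sup>2 * (1 + \<xi> * (\<delta> * poly (pderiv p) s)))
          \<le> \<bar>CV\<bar> * \<Omega>\<^sup>2 * ((\<theta> \<xi>)\<^sup>2 * (1 + \<xi> * (\<delta> * poly (pderiv p) s)))"
          using th(1) by (rule mult_right_mono)
        also have "\<dots> \<le> \<bar>CV\<bar> * \<Omega>\<^sup>2 * (M\<theta>\<^sup>2 * 2)" by (intro mult_left_mono th) auto
        finally show ?thesis by (simp add: D2_def)
      qed
      have 1: "(1 + \<delta>) / 2 * ((\<rho> x)\<^sup>2 + (\<rho> y)\<^sup>2) * (env (\<delta> * \<Omega>) \<xi>)\<^sup>2 / (poly p s)\<^sup>2 \<le> D1"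
      proof -
        have "(\<rho> z)\<^sup>2 \<le> rmax\<^sup>2" for z using rmax(2)[of z] by (intro power_mono) auto
        then have "(1 + \<delta>) / 2 * ((\<rho> x)\<^sup>2 + (\<rho> y)\<^sup>2) \<le> 1 * (rmax\<^sup>2 + rmax\<^sup>2)"
          using \<delta> by (intro mult_mono add_mono) auto
        then have r: "(1 + \<delta>) / 2 * ((\<rho> x)\<^sup>2 + (\<rho> y)\<^sup>2) \<le> 2 * rmax\<^sup>2" by simp
        have "M\<theta> * (6 * (\<delta> * \<Omega>)) \<le> M\<theta> * 1" using \<delta>(3) M\<theta>(1) by (intro mult_left_mono) auto
        moreover have "6 * M\<theta> * (\<delta> * \<Omega>) = M\<theta> * (6 * (\<delta> * \<Omega>))" by simp
        ultimately have e: "env (\<delta> * \<Omega>) \<xi> \<le> 2 * M\<theta>" using M\<theta>(3)[of \<xi>] True by (simp only: env_def if_True)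
        have "0 \<le> M\<theta> * (\<delta> * \<Omega>)" using M\<theta>(1) \<delta>(1) \<Omega> by simp
        then have e0: "0 \<le> env (\<delta> * \<Omega>) \<xi>" by (auto simp: env_def mult.assoc)
        show ?thesis
          unfolding D1_def using ps p0p by (intro frac_le mult_mono[OF r power_mono[OF e e0]] power_mono[of p0]) auto
      qed
      have "dens p \<Omega> \<delta> x y \<xi> \<le> D1 + D2"
        unfolding dens_def s_def[symmetric] using 1 2 by (rule add_mono)
      moreover have "\<xi> \<in> {-1..1}" using True by auto
      ultimately show ?thesis by (simp add: y_def)
    qed
  qed
qed

lemma frac_meas [measurable]: "(frac :: real \<Rightarrow> real) \<in> borel_measurable borel"
  unfolding frac_def[abs_def] by measurable

lemma partner_meas [measurable]:
  assumes [measurable]: "f \<in> borel_measurable M" "g \<in> borel_measurable M"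
  shows "(\<lambda>z. partner p \<delta> (f z) (g z)) \<in> borel_measurable M"
  unfolding partner_def by measurable

lemma B_meas [measurable]: "B \<in> borel_measurable borel"
  unfolding B_def[abs_def] by measurable

definition lim_energy :: "real poly \<Rightarrow> real \<Rightarrow> real" where
  "lim_energy p x = cK / 2 * ((\<rho> x)\<^sup>2 + (\<rho> (T x))\<^sup>2) / (poly p (F x))\<^sup>2 + cV * B x * (poly p (F x))\<^sup>2"

lemma nn_integral_lim_dens:
  assumes x: "x \<noteq> m"
  shows "(\<integral>\<^sup>+\<xi>. ennreal (lim_dens p x \<xi>) \<partial>lborel) = ennreal (lim_energy p x)"
proof -
  let ?a = "1/2 * ((\<rho> x)\<^sup>2 + (\<rho> (T x))\<^sup>2) / (poly p (F x))\<^sup>2"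
  let ?b = "B x * (poly p (F x))\<^sup>2"
  have e: "lim_dens p x \<xi> = ?a * (\<theta>' \<xi>)\<^sup>2 + ?b * (\<xi>\<^sup>2 * (\<theta> \<xi>)\<^sup>2)" for \<xi>
    by (simp add: lim_dens_def power_mult_distrib)
  have cont: "continuous_on {-1..1} (\<lambda>\<xi>. (\<theta>' \<xi>)\<^sup>2)" "continuous_on {-1..1} (\<lambda>\<xi>. \<xi>\<^sup>2 * (\<theta> \<xi>)\<^sup>2)"
    by (intro continuous_intros \<theta>_cont continuous_on_subset[OF \<theta>'_cont]; simp)+
  have "(\<integral>\<^sup>+\<xi>. ennreal (lim_dens p x \<xi>) \<partial>lborel)
     = (\<integral>\<^sup>+\<xi>. ennreal (?a * (\<theta>' \<xi>)\<^sup>2 + ?b * (\<xi>\<^sup>2 * (\<theta> \<xi>)\<^sup>2)) * indicator {-1..1} \<xi> \<partial>lborel)"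
    unfolding e using \<theta>_0 \<theta>'_0 by (intro nn_integral_cong) (auto simp: indicator_def)
  also have "\<dots> = ennreal (integral {-1..1} (\<lambda>\<xi>. ?a * (\<theta>' \<xi>)\<^sup>2 + ?b * (\<xi>\<^sup>2 * (\<theta> \<xi>)\<^sup>2)))"
  proof (rule nn_integral_Icc)
    show "continuous_on {-1..1} (\<lambda>\<xi>. ?a * (\<theta>' \<xi>)\<^sup>2 + ?b * (\<xi>\<^sup>2 * (\<theta> \<xi>)\<^sup>2))"
      by (intro continuous_on_add continuous_on_mult continuous_on_const cont)
    show "0 \<le> ?a * (\<theta>' \<xi>)\<^sup>2 + ?b * (\<xi>\<^sup>2 * (\<theta> \<xi>)\<^sup>2)" for \<xi> using B_pos[OF x] by simp
  qed
  also have "integral {-1..1} (\<lambda>\<xi>. ?a * (\<theta>' \<xi>)\<^sup>2 + ?b * (\<xi>\<^sup>2 * (\<theta> \<xi>)\<^sup>2)) = ?a * cK + ?b * cV"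
    unfolding cK_def cV_def
    by (intro integral_unique has_integral_add has_integral_mult_right integrable_integral
        integrable_continuous_interval cont)
  finally show ?thesis by (simp add: lim_energy_def mult_ac)
qed

text \<open>Dominated convergence twice along an arbitrary sequence: over \<xi> with the majorant of
  \<open>dens_bound\<close>, supported in [-1, 1], and over x with a constant multiple of
  \<rho>.\<close>

lemma main_energy_tendsto:
  assumes pp: "\<And>s. s \<in> {0..1} \<Longrightarrow> 0 < poly p s" "\<And>s. s \<in> {0..1} \<Longrightarrow> poly p s \<le> \<Omega>"
    "\<And>s. s \<in> {0..1} \<Longrightarrow> \<bar>poly (pderiv p) s\<bar> \<le> \<Omega>"
  shows "(main_energy p \<Omega> \<longlongrightarrow> (\<integral>\<^sup>+x. ennreal (\<rho> x) * ennreal (lim_energy p x) \<partial>lborel)) (at_right 0)"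
proof (rule tendsto_at_right_sequentially[of 0 "min 1 (1 / (16 * \<Omega>))"])
  have \<Omega>: "\<Omega> > 0" using pp(1,2)[of 0] by simp
  then show "0 < min 1 (1 / (16 * \<Omega>))" by simp
  fix d :: "nat \<Rightarrow> real"
  assume d: "\<And>n. 0 < d n" "\<And>n. d n < min 1 (1 / (16 * \<Omega>))" "d \<longlonglongrightarrow> 0"
  have d1: "d n \<le> 1" "d n * \<Omega> \<le> 1/16" for n
    using d(2)[of n] \<Omega> by (auto simp: field_simps)
  obtain D where D: "D \<ge> 0" "\<And>\<delta> x \<xi>. 0 < \<delta> \<Longrightarrow> \<delta> \<le> 1 \<Longrightarrow> \<delta> * \<Omega> \<le> 1/16 \<Longrightarrow> x \<noteq> m \<Longrightarrow>
     frac (F x + 1/2 + \<delta> * poly p (F x) * \<xi>) \<noteq> 0 \<Longrightarrow> frac (F x + 1/2 + \<delta> * poly p (F x) * \<xi>) \<noteq> 1/2 \<Longrightarrow>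
     dens p \<Omega> \<delta> x (partner p \<delta> x \<xi>) \<xi> \<le> D * indicator {-1..1} \<xi>"
    by (rule dens_bound[OF pp]) auto
  let ?I = "\<lambda>n x. \<integral>\<^sup>+\<xi>. ennreal (dens p \<Omega> (d n) x (partner p (d n) x \<xi>) \<xi>) \<partial>lborel"
  have pF: "0 < poly p (F x)" for x using pp(1)[of "F x"] F_range[of x] by (auto intro: less_imp_le)
  have wint: "(\<integral>\<^sup>+\<xi>. ennreal (D * indicator {-1..1::real} \<xi>) \<partial>lborel) = ennreal (2 * D)"
  proof -
    have "(\<integral>\<^sup>+\<xi>. ennreal (D * indicator {-1..1::real} \<xi>) \<partial>lborel) = (\<integral>\<^sup>+\<xi>. ennreal D * indicator {-1..1::real} \<xi> \<partial>lborel)"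
      by (intro nn_integral_cong) (auto simp: indicator_def)
    also have "\<dots> = ennreal (2 * D)"
      using D(1) by (simp add: nn_integral_cmult ennreal_mult mult.commute)
    finally show ?thesis .
  qed
  have AEb: "AE \<xi> in lborel. ennreal (dens p \<Omega> (d n) x (partner p (d n) x \<xi>) \<xi>) \<le> ennreal (D * indicator {-1..1} \<xi>)"
    if x: "x \<noteq> m" for x n
  proof -
    have "countable {\<xi>. frac (F x + 1/2 + (d n * poly p (F x)) * \<xi>) = 0 \<or> frac (F x + 1/2 + (d n * poly p (F x)) * \<xi>) = 1/2}"
      using d(1)[of n] pF[of x] by (intro countable_frac_half) auto
    then have "AE \<xi> in lborel. \<xi> \<notin> {\<xi>. frac (F x + 1/2 + (d n * poly p (F x)) * \<xi>) = 0 \<or> frac (F x + 1/2 + (d n * poly p (F x)) * \<xi>) = 1/2}"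
      by (intro AE_not_in countable_imp_null_set_lborel)
    then show ?thesis
      by eventually_elim (use D(2)[OF d(1) d1 x] in \<open>auto intro!: ennreal_leI\<close>)
  qed
  have inner: "(\<lambda>n. ?I n x) \<longlonglongrightarrow> ennreal (lim_energy p x)" if x: "x \<noteq> m" for x
  proof -
    have "(\<lambda>n. ?I n x) \<longlonglongrightarrow> (\<integral>\<^sup>+\<xi>. ennreal (lim_dens p x \<xi>) \<partial>lborel)"
    proof (rule nn_integral_dominated_convergence[where w = "\<lambda>\<xi>. ennreal (D * indicator {-1..1} \<xi>)"])
      show "(\<lambda>\<xi>. ennreal (lim_dens p x \<xi>)) \<in> borel_measurable lborel" unfolding lim_dens_def by measurable
      show "AE \<xi> in lborel. (\<lambda>n. ennreal (dens p \<Omega> (d n) x (partner p (d n) x \<xi>) \<xi>)) \<longlonglongrightarrow> ennreal (lim_dens p x \<xi>)"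
        using pF[of x] by (intro AE_I2 tendsto_ennrealI dens_tendsto x d) auto
    qed (use AEb[OF x] wint in auto)
    then show ?thesis by (simp add: nn_integral_lim_dens[OF x])
  qed
  have Ib: "?I n x \<le> ennreal (2 * D)" if "x \<noteq> m" for n x
    using nn_integral_mono_AE[OF AEb[OF that]] wint by simp
  have Im: "?I n \<in> borel_measurable borel" for n by measurable
  show "(\<lambda>n. main_energy p \<Omega> (d n)) \<longlonglongrightarrow> (\<integral>\<^sup>+x. ennreal (\<rho> x) * ennreal (lim_energy p x) \<partial>lborel)"
    unfolding main_energy_def
  proof (rule nn_integral_dominated_convergence[where w = "\<lambda>x. ennreal (\<rho> x) * ennreal (2 * D)"])
    show "(\<lambda>x. ennreal (\<rho> x) * ?I n x) \<in> borel_measurable lborel" for n using Im[of n] by measurable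
    show "(\<lambda>x. ennreal (\<rho> x) * ennreal (lim_energy p x)) \<in> borel_measurable lborel"
      unfolding lim_energy_def by measurable
    show "AE x in lborel. ennreal (\<rho> x) * ?I n x \<le> ennreal (\<rho> x) * ennreal (2 * D)" for n
      using AE_neq_m by eventually_elim (intro mult_left_mono Ib, auto)
    show "(\<integral>\<^sup>+x. ennreal (\<rho> x) * ennreal (2 * D) \<partial>lborel) < \<infinity>"
      by (simp add: nn_integral_multc nn_rho)
    show "AE x in lborel. (\<lambda>n. ennreal (\<rho> x) * ?I n x) \<longlonglongrightarrow> ennreal (\<rho> x) * ennreal (lim_energy p x)"
      using AE_neq_m by eventually_elim (intro ennreal_tendsto_cmult inner, auto)
  qed measurable
qed

end

section \<open>The recovery family\<close>

lemma poly_bounded_unit: "\<exists>C. \<forall>s\<in>{0..1}. \<bar>poly q s\<bar> \<le> (C::real)"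
proof -
  have "bounded (poly q ` {0..1})"
    by (intro compact_imp_bounded compact_continuous_image continuous_on_poly continuous_on_id) simp
  then show ?thesis unfolding bounded_iff by (metis imageI real_norm_def)
qed

context coulomb_potential
begin

text \<open>B is the limit of V / \<tau>^2 and inherits the uniform bound of
  \<open>V_le_tau_sqr\<close>, although its formula has \<rho> in the denominator.\<close>

lemma B_bounded: "\<exists>C>0. \<forall>x. x \<noteq> m \<longrightarrow> B x \<le> C"
proof -
  obtain CV where CV: "\<And>x y \<tau>. x \<noteq> m \<Longrightarrow> y \<noteq> m \<Longrightarrow> \<bar>\<tau>\<bar> \<le> 1/16 \<Longrightarrow>
    F y = F x + 1/2 + \<tau> \<or> F y = F x - 1/2 + \<tau> \<Longrightarrow> potential_V u (x, y) \<le> CV * \<tau>\<^sup>2"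
    using V_le_tau_sqr by blast
  have "B x \<le> CV" if x: "x \<noteq> m" for x
  proof (rule tendsto_upperbound[OF V_limit[OF x]])
    have r: "0 < opp (F x)" "opp (F x) < 1" "opp (F x) \<noteq> 1/2"
      using opp_range[of "F x"] F_half_iff(2)[of x] x by auto
    have o: "((\<lambda>\<tau>. opp (F x) + \<tau>) \<longlongrightarrow> opp (F x)) (at 0)" by (auto intro!: tendsto_eq_intros)
    have "eventually (\<lambda>\<tau>. 0 < opp (F x) + \<tau>) (at 0)" "eventually (\<lambda>\<tau>. opp (F x) + \<tau> < 1) (at 0)"
      "eventually (\<lambda>\<tau>. opp (F x) + \<tau> \<noteq> 1/2) (at 0)"
      by (rule order_tendstoD(1)[OF o r(1)], rule order_tendstoD(2)[OF o r(2)], rule tendsto_imp_eventually_ne[OF o r(3)])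
    moreover have "eventually (\<lambda>\<tau>::real. \<bar>\<tau>\<bar> \<le> 1/16 \<and> \<tau> \<noteq> 0) (at 0)"
      unfolding eventually_at by (intro exI[of _ "1/16"]) auto
    ultimately show "eventually (\<lambda>\<tau>. potential_V u (x, Q (opp (F x) + \<tau>)) / \<tau>\<^sup>2 \<le> CV) (at 0)"
    proof eventually_elim
      fix \<tau> assume a: "0 < opp (F x) + \<tau>" "opp (F x) + \<tau> < 1" "opp (F x) + \<tau> \<noteq> 1/2" "\<bar>\<tau>\<bar> \<le> 1/16 \<and> \<tau> \<noteq> 0"
      have Fy: "F (Q (opp (F x) + \<tau>)) = opp (F x) + \<tau>" using a by simp
      have "Q (opp (F x) + \<tau>) \<noteq> m" using Fy a(3) F_m by metis
      then have "potential_V u (x, Q (opp (F x) + \<tau>)) \<le> CV * \<tau>\<^sup>2"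
        using a by (intro CV x) (auto simp: Fy opp_def)
      then show "potential_V u (x, Q (opp (F x) + \<tau>)) / \<tau>\<^sup>2 \<le> CV" using a by (simp add: pos_divide_le_eq)
    qed
  qed simp
  then have "\<forall>x. x \<noteq> m \<longrightarrow> B x \<le> \<bar>CV\<bar> + 1" by force
  then show ?thesis by (intro exI[of _ "\<bar>CV\<bar> + 1"]) auto
qed

text \<open>Nearness is measured in quantile coordinates, where the graph of T becomes the two lines
  t = s + 1/2 and t = s - 1/2. With the exact first marginal this is all that weak convergence
  needs.\<close>

definition near_graph :: "real \<Rightarrow> (real \<times> real \<Rightarrow> real) \<Rightarrow> bool" where
  "near_graph \<eta> \<psi> \<longleftrightarrow> (\<forall>z. \<psi> z \<noteq> 0 \<longrightarrow>
     \<bar>F (snd z) - F (fst z) - 1/2\<bar> \<le> \<eta> \<or> \<bar>F (snd z) - F (fst z) + 1/2\<bar> \<le> \<eta>)"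

lemma near_graph_mono: "near_graph \<eta> \<psi> \<Longrightarrow> \<eta> \<le> \<eta>' \<Longrightarrow> near_graph \<eta>' \<psi>"
  unfolding near_graph_def by force

text \<open>Since the first marginals agree, both integrals can be taken over the same measure,
  comparing f (x, y) with f (x, T x). Uniform continuity in quantile coordinates handles most x; the
  rest has small \<rho>-measure and f is bounded. The resulting \<eta> depends on f and \<kappa>
  only, not on the trial function.\<close>

lemma weak_close:
  fixes f :: "real \<times> real \<Rightarrow> real"
  assumes f: "continuous_on UNIV f" and Cf: "\<And>z. \<bar>f z\<bar> \<le> Cf" and \<kappa>: "\<kappa> > 0"
  obtains \<eta> where "\<eta> > 0" "\<And>\<psi>. \<psi> \<in> borel_measurable borel \<Longrightarrow>
    distr (density_measure (\<lambda>z. (\<psi> z)\<^sup>2)) borel fst = density_measure \<rho> \<Longrightarrow> near_graph \<eta> \<psi> \<Longrightarrow>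
    \<bar>integral\<^sup>L (density_measure (\<lambda>z. (\<psi> z)\<^sup>2)) f - integral\<^sup>L graph_plan f\<bar> \<le> \<kappa>"
proof -
  have Cf0: "Cf \<ge> 0" using Cf[of 0] by linarith
  \<comment> \<open>The exceptional set will have mass at most 4a and contribute at most 2 Cf times
    that; Cf + 1 avoids a division by zero.\<close>
  define a where "a = min (1/8) (\<kappa> / (16 * (Cf + 1)))"
  have a: "0 < a" "a \<le> 1/8"
  proof -
    show "0 < a" using \<kappa> Cf0 by (simp add: a_def)
    show "a \<le> 1/8" unfolding a_def by (rule min.cobounded1)
  qed
  have a2: "8 * Cf * a \<le> \<kappa> / 2"
  proof -
    have "8 * Cf * a \<le> 8 * (Cf + 1) * (\<kappa> / (16 * (Cf + 1)))" using Cf0 a by (intro mult_mono) (auto simp: a_def)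
    also have "8 * (Cf + 1) * (\<kappa> / (16 * (Cf + 1))) = \<kappa> / 2"
    proof -
      have "8 * c * (\<kappa> / (16 * c)) = \<kappa> / 2" if "c \<noteq> 0" for c using that by simp
      from this[of "Cf + 1"] show ?thesis using Cf0 by simp
    qed
    finally show ?thesis .
  qed
  \<comment> \<open>Its margin is half of that of \<open>?S\<close> below, so that a displacement of
    at most a/2 from the half turn of a point of \<open>?S\<close> stays inside.\<close>
  let ?I = "{a/2..1 - a/2}"
  let ?g = "\<lambda>(s, t). f (Q s, Q t)"
  have "continuous_on (?I \<times> ?I) ?g"
    unfolding case_prod_beta
    by (intro continuous_on_compose2[OF f] continuous_intros continuous_on_compose2[OF Q_cont_on[of ?I]])
      (use a in auto)
  then have "uniformly_continuous_on (?I \<times> ?I) ?g"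
    by (intro compact_uniformly_continuous compact_Times compact_Icc)
  then obtain d where d: "d > 0" "\<And>z z'. z \<in> ?I \<times> ?I \<Longrightarrow> z' \<in> ?I \<times> ?I \<Longrightarrow> dist z' z < d \<Longrightarrow> dist (?g z') (?g z) < \<kappa> / 2"
    using \<kappa> unfolding uniformly_continuous_on_def by (metis half_gt_zero)
  define \<eta> where "\<eta> = min (a/2) (d/2)"
  have \<eta>: "\<eta> > 0" "\<eta> \<le> a/2" "\<eta> < d" using a d by (auto simp: \<eta>_def)
  let ?S = "{a..1/2 - a} \<union> {1/2 + a..1 - a}"
  have close: "\<bar>f (x, y) - f (x, T x)\<bar> \<le> \<kappa> / 2"
    if s: "F x \<in> ?S" and t: "\<bar>F y - F x - 1/2\<bar> \<le> \<eta> \<or> \<bar>F y - F x + 1/2\<bar> \<le> \<eta>" for x y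
  proof -
    have xm: "x \<noteq> m" using s a by auto
    \<comment> \<open>Only the branch on the matching side survives: the other one would put F y
      outside (0, 1), because F x has distance at least a from 1/2 and \<eta> \<le> a/2.\<close>
    have o: "\<bar>F y - opp (F x)\<bar> \<le> \<eta> \<and> opp (F x) \<in> {a..1 - a}"
    proof (cases "F x < 1/2")
      case True
      then have "a \<le> F x" "F x \<le> 1/2 - a" using s a by auto
      then show ?thesis using t True \<eta> a F_range[of y] unfolding opp_def by auto
    next
      case False
      then have "1/2 + a \<le> F x" "F x \<le> 1 - a" using s a by auto
      then show ?thesis using t False \<eta> a F_range[of y] unfolding opp_def by auto
    qed
    have "(F x, opp (F x)) \<in> ?I \<times> ?I" using s o a by auto
    moreover have "(F x, F y) \<in> ?I \<times> ?I" using s o a \<eta> by auto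
    moreover have "dist (F x, F y) (F x, opp (F x)) < d" using o \<eta> by (simp add: dist_Pair_Pair dist_real_def)
    ultimately have "dist (?g (F x, F y)) (?g (F x, opp (F x))) < \<kappa> / 2" by (rule d(2))
    then show ?thesis using T_eq[OF xm] by (simp add: dist_real_def)
  qed
  \<comment> \<open>By \<open>distr_F\<close> this is the length of the removed margins: a at 0, 2a
    around 1/2, and a at 1.\<close>
  have tail: "measure (density_measure \<rho>) {x. F x \<notin> ?S} \<le> 4 * a"
  proof -
    have m: "- ?S \<in> sets borel" by (intro borel_comp) auto
    have "emeasure (density_measure \<rho>) {x. F x \<notin> ?S} = emeasure (distr (density_measure \<rho>) borel F) (- ?S)"
      using m by (subst emeasure_distr) (auto simp: vimage_def intro!: arg_cong2[where f = emeasure])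
    also have "\<dots> = emeasure lborel ({0..<1} \<inter> - ?S)"
      unfolding distr_F using m by (subst emeasure_uniform_measure) (auto simp: divide_ennreal_def)
    also have "\<dots> \<le> emeasure lborel ({0..a} \<union> ({1/2 - a..1/2 + a} \<union> {1 - a..1}))"
      by (intro emeasure_mono) auto
    also have "\<dots> \<le> emeasure lborel {0..a} + emeasure lborel ({1/2 - a..1/2 + a} \<union> {1 - a..1})"
      by (rule emeasure_subadditive) auto
    also have "\<dots> \<le> emeasure lborel {0..a} + (emeasure lborel {1/2 - a..1/2 + a} + emeasure lborel {1 - a..1})"
      by (intro add_left_mono emeasure_subadditive) auto
    also have "\<dots> = ennreal (4 * a)" using a by (simp flip: ennreal_plus)
    finally have "emeasure (density_measure \<rho>) {x. F x \<notin> ?S} \<le> ennreal (4 * a)" .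
    then show ?thesis using a unfolding measure_def by (intro enn2real_leI) auto
  qed
  show ?thesis
  proof (rule that[OF \<eta>(1)])
    fix \<psi> :: "real \<times> real \<Rightarrow> real"
    assume \<psi> [measurable]: "\<psi> \<in> borel_measurable borel"
      and marg: "distr (density_measure (\<lambda>z. (\<psi> z)\<^sup>2)) borel fst = density_measure \<rho>" and near: "near_graph \<eta> \<psi>"
    define P where "P = density_measure (\<lambda>z. (\<psi> z)\<^sup>2)"
    have sP: "sets P = sets borel" "space P = UNIV" by (simp_all add: P_def density_measure_def)
    have mP: "measurable P N = measurable borel N" for N :: "'c measure" by (rule measurable_cong_sets) (simp_all add: sP)
    interpret R: prob_space "density_measure \<rho>" by (rule prob)
    interpret P: prob_space P
    proof
      have "emeasure P (space P) = emeasure (distr P borel fst) UNIV"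
        by (subst emeasure_distr) (auto simp: mP sP)
      also have "\<dots> = 1" using R.emeasure_space_1 marg by (simp add: P_def)
      finally show "emeasure P (space P) = 1" .
    qed
    have fm [measurable]: "f \<in> borel_measurable borel" by (rule borel_measurable_continuous_onI[OF f])
    let ?h = "\<lambda>x. f (x, T x)"
    have hm [measurable]: "?h \<in> borel_measurable borel" using measurable_compose[OF graph_meas fm] .
    have ig: "integral\<^sup>L graph_plan f = (LINT z|P. ?h (fst z))"
    proof -
      have "integral\<^sup>L graph_plan f = (LINT x|density_measure \<rho>. ?h x)"
        unfolding graph_plan_def by (subst integral_distr) auto
      also have "\<dots> = (LINT z|P. ?h (fst z))"
        unfolding marg[symmetric] P_def[symmetric] by (subst integral_distr) (auto simp: mP)
      finally show ?thesis .
    qed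
    have i1: "integrable P f" by (rule P.integrable_const_bound[of _ Cf]) (auto simp: Cf mP)
    have hfst: "(\<lambda>z :: real \<times> real. ?h (fst z)) \<in> borel_measurable borel"
      using measurable_compose[OF borel_measurable_fst_snd(1) hm] .
    have i2: "integrable P (\<lambda>z. ?h (fst z))" by (rule P.integrable_const_bound[of _ Cf]) (auto simp: Cf mP hfst)
    let ?A = "{z. F (fst z) \<notin> ?S}"
    have Am: "?A \<in> sets P"
    proof -
      have "(\<lambda>z. F (fst z)) \<in> borel_measurable (borel :: (real \<times> real) measure)"
        using measurable_compose[OF borel_measurable_fst_snd(1) F_meas] .
      from measurable_sets[OF this, of "- ?S"] show ?thesis by (simp add: sP vimage_def)
    qed
    have PA: "measure P ?A \<le> 4 * a"
    proof -
      have "{x. F x \<notin> ?S} \<in> sets borel" using measurable_sets[OF F_meas, of "- ?S"] by (simp add: vimage_def)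
      then have "measure (distr P borel fst) {x. F x \<notin> ?S} = measure P ?A"
        by (subst measure_distr) (auto simp: mP sP vimage_def)
      then show ?thesis using tail marg by (simp add: P_def)
    qed
    have i3: "integrable P (\<lambda>z. \<kappa> / 2 + 2 * Cf * indicator ?A z)"
      using Am by (intro Bochner_Integration.integrable_add integrable_mult_right integrable_real_indicator) (auto simp: P.emeasure_eq_measure)
    have "\<bar>LINT z|P. f z - ?h (fst z)\<bar> \<le> (LINT z|P. \<bar>f z - ?h (fst z)\<bar>)"
      by (rule integral_abs_bound)
    also have "\<dots> \<le> (LINT z|P. \<kappa> / 2 + 2 * Cf * indicator ?A z)"
    proof (rule integral_mono_AE)
      show "integrable P (\<lambda>z. \<bar>f z - ?h (fst z)\<bar>)" using i1 i2 by simp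
      show "AE z in P. \<bar>f z - ?h (fst z)\<bar> \<le> \<kappa> / 2 + 2 * Cf * indicator ?A z"
        unfolding P_def density_measure_def
      proof (subst AE_density)
        show "AE z in lborel. 0 < ennreal ((\<psi> z)\<^sup>2) \<longrightarrow> \<bar>f z - ?h (fst z)\<bar> \<le> \<kappa> / 2 + 2 * Cf * indicator ?A z"
        proof (intro AE_I2 impI)
          fix z assume "0 < ennreal ((\<psi> z)\<^sup>2)"
          then have "\<psi> z \<noteq> 0" by auto
          then have t: "\<bar>F (snd z) - F (fst z) - 1/2\<bar> \<le> \<eta> \<or> \<bar>F (snd z) - F (fst z) + 1/2\<bar> \<le> \<eta>"
            using near by (auto simp: near_graph_def)
          show "\<bar>f z - ?h (fst z)\<bar> \<le> \<kappa> / 2 + 2 * Cf * indicator ?A z"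
          proof (cases "F (fst z) \<in> ?S")
            case True
            then show ?thesis using close[OF True t] by simp
          next
            case False
            have "\<bar>f z - ?h (fst z)\<bar> \<le> Cf + Cf" using Cf[of z] Cf[of "(fst z, T (fst z))"] by linarith
            then show ?thesis using False \<kappa> by simp
          qed
        qed
      qed simp
    qed (rule i3)
    also have "\<dots> = \<kappa> / 2 + 2 * Cf * measure P ?A"
      using Am by (subst Bochner_Integration.integral_add) (auto simp: P.emeasure_eq_measure P.prob_space)
    also have "\<dots> \<le> \<kappa> / 2 + 2 * Cf * (4 * a)" using PA Cf0 by (intro add_left_mono mult_left_mono) auto
    also have "\<dots> \<le> \<kappa>" using a2 by simp
    finally show "\<bar>integral\<^sup>L (density_measure (\<lambda>z. (\<psi> z)\<^sup>2)) f - integral\<^sup>L graph_plan f\<bar> \<le> \<kappa>"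
      using i1 i2 by (simp add: ig P_def)
  qed
qed

section \<open>The target value of the energy\<close>

definition tr :: "real \<Rightarrow> real" where
  "tr x = sqrt (2 * ((\<rho> x)\<^sup>2 + (\<rho> (T x))\<^sup>2) * B x)"

definition bound :: ennreal where
  "bound = (\<integral>\<^sup>+x. ennreal (\<rho> x) * ennreal (tr x / 2) \<partial>lborel)"

lemma tr_meas [measurable]: "tr \<in> borel_measurable borel"
  unfolding tr_def[abs_def] B_def[abs_def] by measurable

text \<open>Allows the target value to be written as a real number, so that the error terms can be
  budgeted additively.\<close>

lemma bound_finite: "bound < \<infinity>"
proof -
  obtain C where C: "C > 0" "\<And>x. x \<noteq> m \<Longrightarrow> B x \<le> C" using B_bounded by blast
  have t: "tr x / 2 \<le> sqrt (2 * (rmax\<^sup>2 + rmax\<^sup>2) * C)" if x: "x \<noteq> m" for x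
  proof -
    have "(\<rho> z)\<^sup>2 \<le> rmax\<^sup>2" for z using rmax(2)[of z] by (intro power_mono) auto
    then have "tr x \<le> sqrt (2 * (rmax\<^sup>2 + rmax\<^sup>2) * C)"
      unfolding tr_def using C(2)[OF x] B_pos[OF x]
      by (intro real_sqrt_le_mono mult_mono add_mono mult_left_mono) auto
    moreover have "0 \<le> tr x" using B_pos[OF x] by (simp add: tr_def)
    ultimately show ?thesis by simp
  qed
  have "bound \<le> (\<integral>\<^sup>+x. ennreal (\<rho> x) * ennreal (sqrt (2 * (rmax\<^sup>2 + rmax\<^sup>2) * C)) \<partial>lborel)"
    unfolding bound_def
    by (rule nn_integral_mono_AE, rule eventually_mono[OF AE_neq_m]) (intro mult_left_mono ennreal_leI t, auto)
  also have "\<dots> < \<infinity>" by (simp add: nn_integral_multc nn_rho)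
  finally show ?thesis .
qed

lemma opp_isCont: "s \<noteq> 1/2 \<Longrightarrow> isCont opp s"
proof -
  assume s: "s \<noteq> 1/2"
  have "eventually (\<lambda>t. opp t = t + (if s < 1/2 then 1/2 else - (1/2))) (nhds s)"
  proof (cases "s < 1/2")
    case True
    then have "eventually (\<lambda>t. t < 1/2) (nhds s)" by (intro eventually_nhds_in_open[of "{..<1/2}", simplified]) auto
    then show ?thesis by eventually_elim (use True in \<open>simp add: opp_def\<close>)
  next
    case False
    then have "eventually (\<lambda>t. t > 1/2) (nhds s)" using s by (intro eventually_nhds_in_open[of "{1/2<..}", simplified]) auto
    then show ?thesis by eventually_elim (use False in \<open>simp add: opp_def\<close>)
  qed
  then show ?thesis by (subst isCont_cong) auto
qed

section \<open>Trial functions of prescribed accuracy\<close>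

definition admissible :: "(real \<times> real \<Rightarrow> real) \<Rightarrow> (real \<times> real \<Rightarrow> real \<times> real) \<Rightarrow> bool" where
  "admissible \<psi> G \<longleftrightarrow> H1_with_gradient \<psi> G \<and> (LINT z|lborel. (\<psi> z)\<^sup>2) = 1 \<and>
     distr (density_measure (\<lambda>z. (\<psi> z)\<^sup>2)) borel fst = density_measure \<rho> \<and>
     distr (density_measure (\<lambda>z. (\<psi> z)\<^sup>2)) borel snd = density_measure \<rho>"

text \<open>The parameters are fixed one after another: the profile up to \<eta>1, then the
  polynomial width, then the bound \<Omega> of the width, and only then \<delta>. Profile, width,
  limit of the main energy and error energy may each cost \<eta>/4.\<close>

lemma trial_exists:
  fixes \<eta> :: real
  assumes \<eta>: "\<eta> > 0"
  shows "\<exists>e0>0. \<forall>\<epsilon>. 0 < \<epsilon> \<and> \<epsilon> < e0 \<longrightarrow>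
    (\<exists>\<psi> G. admissible \<psi> G \<and> near_graph \<eta> \<psi> \<and> energy u \<epsilon> \<psi> G \<le> bound + ennreal \<eta>)"
proof -
  define r where "r = enn2real bound"
  have r: "bound = ennreal r" "r \<ge> 0" using bound_finite by (auto simp: r_def)
  \<comment> \<open>The profile causes a relative error 2 \<eta>1 in the target value r, which is
    thereby at most \<eta>/4; r + 1 keeps the denominator positive.\<close>
  define \<eta>1 where "\<eta>1 = \<eta> / (8 * (r + 1))"
  have \<eta>1: "\<eta>1 > 0" using \<eta> r by (simp add: \<eta>1_def)
  obtain \<theta> \<theta>' :: "real \<Rightarrow> real" where \<theta>:
    "\<And>x. (\<theta> has_real_derivative \<theta>' x) (at x)" "continuous_on UNIV \<theta>'"
    "\<And>x. \<theta> (- x) = \<theta> x" "\<And>x. 1 \<le> \<bar>x\<bar> \<Longrightarrow> \<theta> x = 0" "\<And>x. 1 \<le> \<bar>x\<bar> \<Longrightarrow> \<theta>' x = 0"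
    "integral {-1..1} (\<lambda>x. (\<theta> x)\<^sup>2) = 1"
    "0 < integral {-1..1} (\<lambda>x. (\<theta>' x)\<^sup>2)" "0 < integral {-1..1} (\<lambda>x. x\<^sup>2 * (\<theta> x)\<^sup>2)"
    "integral {-1..1} (\<lambda>x. (\<theta>' x)\<^sup>2) * integral {-1..1} (\<lambda>x. x\<^sup>2 * (\<theta> x)\<^sup>2) \<le> 1/4 + \<eta>1"
    by (rule profile_exists[OF \<eta>1]) auto
  interpret P: potential_profile \<rho> u T m \<theta> \<theta>' by unfold_locales (use \<theta> in auto)
  have cK: "P.cK > 0" and cV: "P.cV > 0" and cKV: "P.cK * P.cV \<le> 1/4 + \<eta>1"
    using \<theta> by (auto simp: P.cK_def P.cV_def)
  \<comment> \<open>Completing the square: 1/4 + \<eta>1 is at most (1/2 + \<eta>1)^2.\<close>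
  have sq: "2 * sqrt (P.cK * P.cV) \<le> 1 + 2 * \<eta>1"
  proof -
    have "(1/2 + \<eta>1)\<^sup>2 = 1/4 + \<eta>1 + \<eta>1\<^sup>2" by (simp add: power2_eq_square algebra_simps)
    then have "P.cK * P.cV \<le> (1/2 + \<eta>1)\<^sup>2" using cKV zero_le_power2[of \<eta>1] by linarith
    then have "sqrt (P.cK * P.cV) \<le> 1/2 + \<eta>1" using \<eta>1 by (intro real_le_lsqrt) auto
    then show ?thesis by simp
  qed
  let ?S = "{0<..<1} - {1/2 :: real}"
  have Qm: "Q s \<noteq> m" if "s \<in> ?S" for s using F_Q[of s] F_m that by (metis DiffE F_m greaterThanLessThan_iff singletonI)
  have TQ: "T (Q s) = Q (opp s)" if "s \<in> ?S" for s using T_eq[OF Qm[OF that]] that by simp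
  define X where "X s = (\<rho> (Q s))\<^sup>2 + (\<rho> (Q (opp s)))\<^sup>2" for s
  \<comment> \<open>With \<open>b\<close>, the coefficients of 1 / p^2 and p^2 in
    \<open>lim_energy\<close>, expressed in the quantile variable.\<close>
  define a where "a s = P.cK / 2 * X s" for s
  define b where "b s = P.cV * B (Q s)" for s
  obtain CB where CB: "CB > 0" "\<And>x. x \<noteq> m \<Longrightarrow> B x \<le> CB" using B_bounded by blast
  have cQ: "continuous_on ?S Q" "continuous_on ?S (\<lambda>s. Q (opp s))"
  proof -
    show "continuous_on ?S Q" by (rule Q_cont_on) auto
    show "continuous_on ?S (\<lambda>s. Q (opp s))"
    proof (intro continuous_at_imp_continuous_on ballI)
      fix s assume "s \<in> ?S"
      then show "isCont (\<lambda>s. Q (opp s)) s"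
        using opp_range[of s] by (intro isCont_o2[OF opp_isCont] Q_cont) auto
    qed
  qed
  have cR: "continuous_on ?S (\<lambda>s. \<rho> (Q s))" "continuous_on ?S (\<lambda>s. \<rho> (Q (opp s)))"
    by (rule continuous_on_compose2[OF rho_cont_on[of UNIV]]; use cQ in auto)+
  have ca: "continuous_on ?S a" unfolding a_def X_def by (intro continuous_intros cR)
  have "continuous_on ?S (\<lambda>s. P.cV * (1 / (\<bar>Q s - Q (opp s)\<bar> ^ 3 * \<rho> (Q s) * \<rho> (Q (opp s)))))"
  proof (intro continuous_intros cR cQ)
    show "\<forall>s\<in>?S. \<bar>Q s - Q (opp s)\<bar> ^ 3 * \<rho> (Q s) * \<rho> (Q (opp s)) \<noteq> 0"
    proof
      fix s assume s: "s \<in> ?S"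
      have "Q s - Q (opp s) \<noteq> 0" using T_neq[OF Qm[OF s]] TQ[OF s] by simp
      then show "\<bar>Q s - Q (opp s)\<bar> ^ 3 * \<rho> (Q s) * \<rho> (Q (opp s)) \<noteq> 0"
        using pos[of "Q s"] pos[of "Q (opp s)"] by simp
    qed
  qed
  then have cb: "continuous_on ?S b"
    by (rule continuous_on_eq) (simp only: b_def B_def TQ)
  have bds: "0 < a s \<and> a s \<le> max (P.cK * rmax\<^sup>2) (P.cV * CB) \<and> 0 < b s \<and> b s \<le> max (P.cK * rmax\<^sup>2) (P.cV * CB)"
    if s: "s \<in> ?S" for s
  proof -
    have X: "0 < X s" unfolding X_def using pos[of "Q s"] by (simp add: add_pos_nonneg)
    have "(\<rho> z)\<^sup>2 \<le> rmax\<^sup>2" for z using rmax(2)[of z] by (intro power_mono) auto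
    then have "X s \<le> rmax\<^sup>2 + rmax\<^sup>2" unfolding X_def by (intro add_mono)
    then have "P.cK / 2 * X s \<le> P.cK / 2 * (rmax\<^sup>2 + rmax\<^sup>2)" using cK by (intro mult_left_mono) auto
    then have "a s \<le> P.cK * rmax\<^sup>2" by (simp add: a_def)
    moreover have "b s \<le> P.cV * CB" unfolding b_def using cV CB(2)[OF Qm[OF s]] by (intro mult_left_mono) auto
    moreover have "0 < a s" "0 < b s" using X cK cV B_pos[OF Qm[OF s]] by (simp_all add: a_def b_def)
    ultimately show ?thesis by (intro conjI) (auto intro: order_trans[OF _ max.cobounded1] order_trans[OF _ max.cobounded2])
  qed
  have \<eta>4: "\<eta> / 4 > 0" using \<eta> by simp
  obtain p :: "real poly" where p: "\<And>s. s \<in> {0..1} \<Longrightarrow> poly p s > 0" "poly p 0 = poly p 1"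
    and pint: "(\<integral>\<^sup>+s. ennreal (a s / (poly p s)\<^sup>2 + b s * (poly p s)\<^sup>2) * indicator ?S s \<partial>lborel)
      \<le> (\<integral>\<^sup>+s. ennreal (2 * sqrt (a s * b s)) * indicator ?S s \<partial>lborel) + ennreal (\<eta> / 4)"
    by (rule weight_exists[OF ca cb bds \<eta>4]) (assumption, blast)
  have [measurable]: "a \<in> borel_measurable borel" "b \<in> borel_measurable borel"
    unfolding a_def[abs_def] b_def[abs_def] X_def[abs_def] by measurable
  have AE_S: "AE s in lborel. indicator {0..<1} s = (indicator ?S s :: ennreal)"
    using AE_lborel_singleton[of 0] AE_lborel_singleton[of "1/2"]
    by eventually_elim (auto simp: indicator_def)
  have lim1: "(\<integral>\<^sup>+x. ennreal (\<rho> x) * ennreal (P.lim_energy p x) \<partial>lborel)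
    = (\<integral>\<^sup>+s. ennreal (a s / (poly p s)\<^sup>2 + b s * (poly p s)\<^sup>2) * indicator ?S s \<partial>lborel)"
  proof -
    have "(\<integral>\<^sup>+x. ennreal (\<rho> x) * ennreal (P.lim_energy p x) \<partial>lborel)
      = (\<integral>\<^sup>+x. ennreal (\<rho> x) * ennreal (a (F x) / (poly p (F x))\<^sup>2 + b (F x) * (poly p (F x))\<^sup>2) \<partial>lborel)"
      by (rule nn_integral_cong_AE, rule eventually_mono[OF AE_neq_m])
        (simp add: P.lim_energy_def a_def b_def X_def T_eq)
    also have "\<dots> = (\<integral>\<^sup>+s. ennreal (a s / (poly p s)\<^sup>2 + b s * (poly p s)\<^sup>2) * indicator {0..<1} s \<partial>lborel)"
      by (rule nn_integral_F[where h = "\<lambda>s. ennreal (a s / (poly p s)\<^sup>2 + b s * (poly p s)\<^sup>2)"]) measurable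
    also have "\<dots> = (\<integral>\<^sup>+s. ennreal (a s / (poly p s)\<^sup>2 + b s * (poly p s)\<^sup>2) * indicator ?S s \<partial>lborel)"
      by (rule nn_integral_cong_AE, rule eventually_mono[OF AE_S]) simp
    finally show ?thesis .
  qed
  have "(\<integral>\<^sup>+s. ennreal (2 * sqrt (a s * b s)) * indicator ?S s \<partial>lborel)
    \<le> (\<integral>\<^sup>+s. ennreal (1 + 2 * \<eta>1) * (ennreal (tr (Q s) / 2) * indicator ?S s) \<partial>lborel)"
  proof (rule nn_integral_mono)
    fix s
    show "ennreal (2 * sqrt (a s * b s)) * indicator ?S s \<le> ennreal (1 + 2 * \<eta>1) * (ennreal (tr (Q s) / 2) * indicator ?S s)"
    proof (cases "s \<in> ?S")
      case True
      \<comment> \<open>The trace is 2 sqrt (Y/2) and a b = cK cV Y/2, so 2 sqrt (a b) is half the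
        trace times 2 sqrt (cK cV), a factor that would be 1 at the Heisenberg constant 1/4.\<close>
      define Y where "Y = X s * B (Q s)"
      have Y: "0 \<le> Y" using B_pos[OF Qm[OF True]] by (simp add: Y_def X_def)
      have "tr (Q s) = sqrt (2 * 2 * (Y / 2))" by (simp add: tr_def TQ[OF True] Y_def X_def mult.assoc)
      then have t: "tr (Q s) = 2 * sqrt (Y / 2)" by (simp only: real_sqrt_mult) simp
      have "a s * b s = (P.cK * P.cV) * (Y / 2)" by (simp add: a_def b_def Y_def)
      then have "2 * sqrt (a s * b s) = 2 * sqrt (P.cK * P.cV) * (tr (Q s) / 2)"
        unfolding t by (simp only: real_sqrt_mult)
      also have "\<dots> \<le> (1 + 2 * \<eta>1) * (tr (Q s) / 2)" using Y by (intro mult_right_mono sq) (simp add: t)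
      finally have "ennreal (2 * sqrt (a s * b s)) \<le> ennreal ((1 + 2 * \<eta>1) * (tr (Q s) / 2))" by (rule ennreal_leI)
      also have "\<dots> = ennreal (1 + 2 * \<eta>1) * ennreal (tr (Q s) / 2)" using \<eta>1 by (intro ennreal_mult') simp
      finally show ?thesis using True by simp
    qed simp
  qed
  also have "\<dots> = ennreal (1 + 2 * \<eta>1) * (\<integral>\<^sup>+s. ennreal (tr (Q s) / 2) * indicator ?S s \<partial>lborel)"
    by (rule nn_integral_cmult) measurable
  also have "(\<integral>\<^sup>+s. ennreal (tr (Q s) / 2) * indicator ?S s \<partial>lborel) = (\<integral>\<^sup>+s. ennreal (tr (Q s) / 2) * indicator {0..<1} s \<partial>lborel)"
    by (rule nn_integral_cong_AE, rule eventually_mono[OF AE_S]) simp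
  also have "\<dots> = bound"
    unfolding bound_def by (subst nn_integral_F[where h = "\<lambda>s. ennreal (tr (Q s) / 2)", symmetric]) auto
  also have "ennreal (1 + 2 * \<eta>1) * bound \<le> bound + ennreal (\<eta> / 4)"
  proof -
    have "2 * \<eta>1 * r \<le> \<eta> / 4"
    proof -
      have "2 * \<eta>1 * r \<le> 2 * \<eta>1 * (r + 1)" using \<eta>1 by (intro mult_left_mono) auto
      also have "\<dots> = \<eta> / 4" using r by (simp add: \<eta>1_def field_simps)
      finally show ?thesis .
    qed
    then have "(1 + 2 * \<eta>1) * r \<le> r + \<eta> / 4" by (simp add: algebra_simps)
    then have "ennreal ((1 + 2 * \<eta>1) * r) \<le> ennreal (r + \<eta> / 4)" by (rule ennreal_leI)
    also have "\<dots> = ennreal r + ennreal (\<eta> / 4)" using r \<eta> by (intro ennreal_plus) auto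
    finally show ?thesis using \<eta>1 r(2) unfolding r(1) by (subst ennreal_mult[symmetric]) auto
  qed
  finally have "(\<integral>\<^sup>+s. ennreal (2 * sqrt (a s * b s)) * indicator ?S s \<partial>lborel) \<le> bound + ennreal (\<eta> / 4)" .
  then have "(\<integral>\<^sup>+x. ennreal (\<rho> x) * ennreal (P.lim_energy p x) \<partial>lborel) \<le> bound + ennreal (\<eta> / 4) + ennreal (\<eta> / 4)"
    unfolding lim1 using pint by (meson add_right_mono order_trans)
  also have "\<dots> = ennreal (r + \<eta> / 2)" using r \<eta> by (simp flip: ennreal_plus)
  \<comment> \<open>A strict bound on the limit, so that the main energy itself obeys it for all
    small \<delta>.\<close>
  also have "\<dots> < ennreal (r + 3 * \<eta> / 4)" using r \<eta> by (intro ennreal_lessI) auto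
  finally have lim_less: "(\<integral>\<^sup>+x. ennreal (\<rho> x) * ennreal (P.lim_energy p x) \<partial>lborel) < ennreal (r + 3 * \<eta> / 4)" .
  obtain C0 C1 C2 where Cs: "\<And>s. s \<in> {0..1} \<Longrightarrow> \<bar>poly p s\<bar> \<le> C0" "\<And>s. s \<in> {0..1} \<Longrightarrow> \<bar>poly (pderiv p) s\<bar> \<le> C1"
    "\<And>s. s \<in> {0..1} \<Longrightarrow> \<bar>poly (pderiv (pderiv p)) s\<bar> \<le> C2"
    using poly_bounded_unit[of p] poly_bounded_unit[of "pderiv p"] poly_bounded_unit[of "pderiv (pderiv p)"] by blast
  define \<Omega> where "\<Omega> = max C0 (max C1 C2)"
  have \<Omega>: "\<And>s. s \<in> {0..1} \<Longrightarrow> poly p s \<le> \<Omega>" "\<And>s. s \<in> {0..1} \<Longrightarrow> \<bar>poly (pderiv p) s\<bar> \<le> \<Omega>"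
    "\<And>s. s \<in> {0..1} \<Longrightarrow> \<bar>poly (pderiv (pderiv p)) s\<bar> \<le> \<Omega>"
    unfolding \<Omega>_def using Cs by (auto simp: le_max_iff_disj intro: order_trans[OF abs_ge_self])
  have ev1: "eventually (\<lambda>\<delta>. P.main_energy p \<Omega> \<delta> < ennreal (r + 3 * \<eta> / 4)) (at_right 0)"
    by (rule order_tendstoD(2)[OF P.main_energy_tendsto[OF p(1) \<Omega>(1,2)] lim_less])
  define e where "e = enn2real (\<integral>\<^sup>+x. ennreal ((sqrt_deriv x)\<^sup>2) \<partial>lborel)"
  have e: "(\<integral>\<^sup>+x. ennreal ((sqrt_deriv x)\<^sup>2) \<partial>lborel) = ennreal e" "e \<ge> 0"
    using nn_sqrt_deriv_finite by (auto simp: e_def)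
  have "((\<lambda>\<delta>::real. (\<delta>\<^sup>2 + \<delta>) * e) \<longlongrightarrow> (0\<^sup>2 + 0) * e) (at_right 0)" by (intro tendsto_intros)
  then have "eventually (\<lambda>\<delta>. (\<delta>\<^sup>2 + \<delta>) * e < \<eta> / 4) (at_right 0)" using \<eta> by (intro order_tendstoD(2)) auto
  moreover have "eventually (\<lambda>\<delta>::real. 0 < \<delta>) (at_right 0)" by (rule eventually_at_right_less)
  moreover have "((\<lambda>\<delta>::real. \<delta> * \<Omega>) \<longlongrightarrow> 0 * \<Omega>) (at_right 0)" by (intro tendsto_intros)
  then have "eventually (\<lambda>\<delta>. \<delta> * \<Omega> < min (1/16) \<eta>) (at_right 0)" using \<eta> by (intro order_tendstoD(2)) auto
  ultimately have "eventually (\<lambda>\<delta>. P.main_energy p \<Omega> \<delta> < ennreal (r + 3 * \<eta> / 4) \<and> (\<delta>\<^sup>2 + \<delta>) * e < \<eta> / 4 \<and> \<delta> * \<Omega> < min (1/16) \<eta>) (at_right 0)"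
    using ev1 by eventually_elim auto
  then obtain d0 where d0: "d0 > 0" "\<And>\<delta>. 0 < \<delta> \<Longrightarrow> \<delta> < d0 \<Longrightarrow>
     P.main_energy p \<Omega> \<delta> < ennreal (r + 3 * \<eta> / 4) \<and> (\<delta>\<^sup>2 + \<delta>) * e < \<eta> / 4 \<and> \<delta> * \<Omega> < min (1/16) \<eta>"
    by (auto simp: eventually_at_right_field)
  show ?thesis
  proof (intro exI[of _ "d0 ^ 4"] conjI allI impI)
    show "0 < d0 ^ 4" using d0 by simp
    fix \<epsilon> :: real assume \<epsilon>: "0 < \<epsilon> \<and> \<epsilon> < d0 ^ 4"
    \<comment> \<open>This makes the two prefactors of the energy equal to \<delta>^2 and 1 /
      \<delta>^2.\<close>
    define \<delta> where "\<delta> = \<epsilon> powr (1/4)"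
    have \<delta>0: "0 < \<delta>" using \<epsilon> by (simp add: \<delta>_def)
    have \<delta>2: "\<epsilon> powr (1/2) = \<delta>\<^sup>2" "\<epsilon> powr (-1/2) = 1 / \<delta>\<^sup>2"
    proof -
      have "\<delta>\<^sup>2 = \<delta> powr 2" using \<delta>0 by simp
      also have "\<dots> = \<epsilon> powr (1/2)" by (simp add: \<delta>_def powr_powr)
      finally show 1: "\<epsilon> powr (1/2) = \<delta>\<^sup>2" by simp
      have "\<epsilon> powr (-1/2) = 1 / \<epsilon> powr (1/2)" using powr_minus_divide[of \<epsilon> "1/2"] by simp
      then show "\<epsilon> powr (-1/2) = 1 / \<delta>\<^sup>2" by (simp only: 1)
    qed
    have "\<delta> < d0"
    proof -
      have "\<delta> ^ 4 = \<epsilon>" using \<epsilon> by (simp add: \<delta>_def powr_power)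
      then have "\<delta> ^ 4 < d0 ^ 4" using \<epsilon> by simp
      then show ?thesis using d0(1) by (auto dest: power_less_imp_less_base)
    qed
    note d = d0(2)[OF \<delta>0 this]
    interpret Tr: trial \<rho> u T m \<theta> \<theta>' p \<delta> \<Omega>
      by unfold_locales (use p \<Omega> \<delta>0 d in auto)
    show "\<exists>\<psi> G. admissible \<psi> G \<and> near_graph \<eta> \<psi> \<and> energy u \<epsilon> \<psi> G \<le> bound + ennreal \<eta>"
    proof (intro exI conjI)
      show "admissible Tr.\<psi> Tr.G"
        unfolding admissible_def using Tr.\<psi>_H1 Tr.\<psi>_integral Tr.\<psi>_marginals by blast
      have "near_graph (\<delta> * \<Omega>) Tr.\<psi>" unfolding near_graph_def using Tr.\<psi>_support by blast
      then show "near_graph \<eta> Tr.\<psi>" using d by (intro near_graph_mono[of "\<delta> * \<Omega>" _ \<eta>]) auto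
      have "energy u \<epsilon> Tr.\<psi> Tr.G \<le> P.error_energy \<delta> + P.main_energy p \<Omega> \<delta>"
        unfolding energy_def \<delta>2 by (rule Tr.energy_le)
      also have "\<dots> \<le> ennreal (\<eta> / 4) + ennreal (r + 3 * \<eta> / 4)"
      proof (rule add_mono)
        have "P.error_energy \<delta> = ennreal ((\<delta>\<^sup>2 + \<delta>) * e)"
          unfolding P.error_energy_def e(1) using \<delta>0 e(2) by (intro ennreal_mult[symmetric]) auto
        also have "\<dots> \<le> ennreal (\<eta> / 4)" using d by (intro ennreal_leI) auto
        finally show "P.error_energy \<delta> \<le> ennreal (\<eta> / 4)" .
        show "P.main_energy p \<Omega> \<delta> \<le> ennreal (r + 3 * \<eta> / 4)" using d by (simp add: less_imp_le)
      qed
      also have "\<dots> = bound + ennreal \<eta>" using r \<eta> by (simp flip: ennreal_plus)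
      finally show "energy u \<epsilon> Tr.\<psi> Tr.G \<le> bound + ennreal \<eta>" .
    qed
  qed
qed

text \<open>The diagonal argument: \<open>H\<close> collects the accuracies attainable at a given
  \<epsilon>, and the pair chosen there is within \<epsilon> of the infimum, which need not be
  attained. For small \<epsilon> the accuracy \<eta>/2 is attainable, so the chosen pair has
  accuracy below \<eta>/2 + \<epsilon> < \<eta>.\<close>

lemma recovery_family:
  obtains \<psi> :: "real \<Rightarrow> real \<times> real \<Rightarrow> real" and G :: "real \<Rightarrow> real \<times> real \<Rightarrow> real \<times> real" where
    "\<And>\<epsilon>. admissible (\<psi> \<epsilon>) (G \<epsilon>)"
    "\<And>\<eta>. \<eta> > 0 \<Longrightarrow> eventually (\<lambda>\<epsilon>. near_graph \<eta> (\<psi> \<epsilon>) \<and> energy u \<epsilon> (\<psi> \<epsilon>) (G \<epsilon>) \<le> bound + ennreal \<eta>) (at_right 0)"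
proof -
  define W where "W \<epsilon> \<eta> \<psi> G \<longleftrightarrow> admissible \<psi> G \<and> near_graph \<eta> \<psi> \<and> energy u \<epsilon> \<psi> G \<le> bound + ennreal \<eta>" for \<epsilon> \<eta> \<psi> G
  define H where "H \<epsilon> = {\<eta>. 0 < \<eta> \<and> (\<exists>\<psi> G. W \<epsilon> \<eta> \<psi> G)}" for \<epsilon>
  have bdd: "bdd_below (H \<epsilon>)" for \<epsilon> by (auto simp: H_def intro!: bdd_belowI[of _ 0])
  have "\<exists>\<psi> G. admissible \<psi> G \<and> (0 < \<epsilon> \<and> H \<epsilon> \<noteq> {} \<longrightarrow> (\<exists>\<eta>. \<eta> < Inf (H \<epsilon>) + \<epsilon> \<and> W \<epsilon> \<eta> \<psi> G))" for \<epsilon>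
  proof (cases "0 < \<epsilon> \<and> H \<epsilon> \<noteq> {}")
    case True
    then obtain \<eta> where "\<eta> \<in> H \<epsilon>" "\<eta> < Inf (H \<epsilon>) + \<epsilon>"
      using cInf_lessD[of "H \<epsilon>" "Inf (H \<epsilon>) + \<epsilon>"] by auto
    then show ?thesis by (auto simp: H_def W_def)
  next
    case False
    \<comment> \<open>Admissibility is demanded for every \<epsilon>, even where no accuracy is
      attainable; any trial function serves as a default.\<close>
    obtain e0 where "e0 > 0" "\<And>\<epsilon>. 0 < \<epsilon> \<and> \<epsilon> < e0 \<longrightarrow> (\<exists>\<psi> G. admissible \<psi> G \<and> near_graph 1 \<psi> \<and> energy u \<epsilon> \<psi> G \<le> bound + ennreal 1)"
      using trial_exists[of 1] by auto
    from this(2)[of "e0/2"] this(1) obtain \<psi> G where "admissible \<psi> G" by auto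
    then show ?thesis using False by blast
  qed
  then obtain \<psi> G where \<psi>G: "\<And>\<epsilon>. admissible (\<psi> \<epsilon>) (G \<epsilon>)"
    "\<And>\<epsilon>. 0 < \<epsilon> \<Longrightarrow> H \<epsilon> \<noteq> {} \<Longrightarrow> \<exists>\<eta>. \<eta> < Inf (H \<epsilon>) + \<epsilon> \<and> W \<epsilon> \<eta> (\<psi> \<epsilon>) (G \<epsilon>)" by metis
  show ?thesis
  proof (rule that[OF \<psi>G(1)])
    fix \<eta> :: real assume \<eta>: "\<eta> > 0"
    obtain e0 where e0: "e0 > 0" "\<And>\<epsilon>. 0 < \<epsilon> \<Longrightarrow> \<epsilon> < e0 \<Longrightarrow> \<eta>/2 \<in> H \<epsilon>"
      using trial_exists[of "\<eta>/2"] \<eta> by (auto simp: H_def W_def)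
    have "eventually (\<lambda>\<epsilon>. 0 < \<epsilon> \<and> \<epsilon> < min e0 (\<eta>/2)) (at_right 0)"
      using e0(1) \<eta> by (auto simp: eventually_at_right_field intro!: exI[of _ "min e0 (\<eta>/2)"])
    then show "eventually (\<lambda>\<epsilon>. near_graph \<eta> (\<psi> \<epsilon>) \<and> energy u \<epsilon> (\<psi> \<epsilon>) (G \<epsilon>) \<le> bound + ennreal \<eta>) (at_right 0)"
    proof eventually_elim
      fix \<epsilon> assume \<epsilon>: "0 < \<epsilon> \<and> \<epsilon> < min e0 (\<eta>/2)"
      then have h: "\<eta>/2 \<in> H \<epsilon>" using e0(2) by simp
      then obtain \<eta>' where \<eta>': "\<eta>' < Inf (H \<epsilon>) + \<epsilon>" "W \<epsilon> \<eta>' (\<psi> \<epsilon>) (G \<epsilon>)" using \<psi>G(2)[of \<epsilon>] \<epsilon> by blast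
      have "Inf (H \<epsilon>) \<le> \<eta>/2" by (rule cInf_lower[OF h bdd])
      then have le: "\<eta>' \<le> \<eta>" using \<eta>'(1) \<epsilon> by auto
      then have "bound + ennreal \<eta>' \<le> bound + ennreal \<eta>" by (intro add_left_mono ennreal_leI)
      then show "near_graph \<eta> (\<psi> \<epsilon>) \<and> energy u \<epsilon> (\<psi> \<epsilon>) (G \<epsilon>) \<le> bound + ennreal \<eta>"
        using \<eta>'(2) le by (auto simp: W_def intro: near_graph_mono order_trans)
    qed
  qed
qed

lemma bound_eq_trace:
  assumes "is_optimal_plan \<rho> \<gamma>"
  shows "bound = ennreal (1/2) * (\<integral>\<^sup>+p. ennreal (trace (psd_sqrt (hessian (potential_V u) p))) \<partial>\<gamma>)"
proof -
  have "bound = (\<integral>\<^sup>+x. ennreal (1/2) * (ennreal (\<rho> x) * ennreal (tr x)) \<partial>lborel)"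
    unfolding bound_def
  proof (intro nn_integral_cong)
    fix x
    have "ennreal (tr x / 2) = ennreal (1/2) * ennreal (tr x)" by (subst ennreal_mult'[symmetric]) auto
    then show "ennreal (\<rho> x) * ennreal (tr x / 2) = ennreal (1/2) * (ennreal (\<rho> x) * ennreal (tr x))"
      by (simp add: mult_ac)
  qed
  also have "\<dots> = ennreal (1/2) * (\<integral>\<^sup>+x. ennreal (\<rho> x) * ennreal (tr x) \<partial>lborel)"
    by (rule nn_integral_cmult) measurable
  finally show ?thesis by (simp add: nn_integral_trace[OF assms] tr_def)
qed

end

theorem theorem1p3:
  fixes \<rho> u T :: "real \<Rightarrow> real" and m :: real and \<gamma> :: "(real \<times> real) measure"
  assumes "\<rho> C1_differentiable_on UNIV"
    and "\<forall>x. \<rho> x > 0"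
    and "prob_space (density_measure \<rho>)"
    and "KE \<rho> < \<infinity>"
    and "is_optimal_plan \<rho> \<gamma>"
    and "is_median \<rho> m"
    and "is_optimal_map \<rho> m T"
    and "is_kantorovich_potential m T u"
    and "second_deriv_Linfty u"
  shows "\<exists>(\<psi> :: real \<Rightarrow> real \<times> real \<Rightarrow> real) (G :: real \<Rightarrow> real \<times> real \<Rightarrow> real \<times> real).
    (\<forall>\<epsilon>>0. H1_with_gradient (\<psi> \<epsilon>) (G \<epsilon>) \<and>
       (LINT p|lborel. (\<psi> \<epsilon> p)\<^sup>2) = 1 \<and>
       distr (density_measure (\<lambda>p. (\<psi> \<epsilon> p)\<^sup>2)) borel fst = distr \<gamma> borel fst \<and>
       distr (density_measure (\<lambda>p. (\<psi> \<epsilon> p)\<^sup>2)) borel snd = distr \<gamma> borel snd) \<and>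
    weakly_converges (\<lambda>\<epsilon>. density_measure (\<lambda>p. (\<psi> \<epsilon> p)\<^sup>2)) \<gamma> (at_right 0) \<and>
    Limsup (at_right 0) (\<lambda>\<epsilon>. energy u \<epsilon> (\<psi> \<epsilon>) (G \<epsilon>))
      \<le> ennreal (1/2) * (\<integral>\<^sup>+p. ennreal (trace (psd_sqrt (hessian (potential_V u) p))) \<partial>\<gamma>)"
proof -
  interpret coulomb_potential \<rho> u T m
    by (intro coulomb_potential.intro positive_density.intro coulomb_potential_axioms.intro assms assms(2)[rule_format])
  obtain \<psi> G where adm: "\<And>\<epsilon>. admissible (\<psi> \<epsilon>) (G \<epsilon>)"
    and ev: "\<And>\<eta>. \<eta> > 0 \<Longrightarrow> eventually (\<lambda>\<epsilon>. near_graph \<eta> (\<psi> \<epsilon>) \<and> energy u \<epsilon> (\<psi> \<epsilon>) (G \<epsilon>) \<le> bound + ennreal \<eta>) (at_right 0)"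
    by (rule recovery_family) blast
  have marg: "distr \<gamma> borel fst = density_measure \<rho>" "distr \<gamma> borel snd = density_measure \<rho>"
    using assms(5) by (auto simp: is_optimal_plan_def is_plan_def)
  have "weakly_converges (\<lambda>\<epsilon>. density_measure (\<lambda>p. (\<psi> \<epsilon> p)\<^sup>2)) \<gamma> (at_right 0)"
    unfolding weakly_converges_def
  proof (intro allI impI, elim conjE)
    fix f :: "real \<times> real \<Rightarrow> real" assume f: "continuous_on UNIV f" "bounded (range f)"
    obtain Cf where Cf: "\<And>z. \<bar>f z\<bar> \<le> Cf" using f(2) by (auto simp: bounded_iff)
    show "((\<lambda>\<epsilon>. integral\<^sup>L (density_measure (\<lambda>p. (\<psi> \<epsilon> p)\<^sup>2)) f) \<longlongrightarrow> integral\<^sup>L \<gamma> f) (at_right 0)"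
    proof (rule tendstoI)
      fix \<kappa> :: real assume \<kappa>: "\<kappa> > 0"
      then have "\<kappa>/2 > 0" by simp
      from weak_close[OF f(1) Cf this]
      obtain \<eta> where \<eta>: "\<eta> > 0" "\<And>\<psi>. \<psi> \<in> borel_measurable borel \<Longrightarrow>
        distr (density_measure (\<lambda>z. (\<psi> z)\<^sup>2)) borel fst = density_measure \<rho> \<Longrightarrow> near_graph \<eta> \<psi> \<Longrightarrow>
        \<bar>integral\<^sup>L (density_measure (\<lambda>z. (\<psi> z)\<^sup>2)) f - integral\<^sup>L graph_plan f\<bar> \<le> \<kappa>/2" by metis
      show "eventually (\<lambda>\<epsilon>. dist (integral\<^sup>L (density_measure (\<lambda>p. (\<psi> \<epsilon> p)\<^sup>2)) f) (integral\<^sup>L \<gamma> f) < \<kappa>) (at_right 0)"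
        using ev[OF \<eta>(1)]
      proof eventually_elim
        fix \<epsilon> assume n: "near_graph \<eta> (\<psi> \<epsilon>) \<and> energy u \<epsilon> (\<psi> \<epsilon>) (G \<epsilon>) \<le> bound + ennreal \<eta>"
        have "\<psi> \<epsilon> \<in> borel_measurable borel" "distr (density_measure (\<lambda>z. (\<psi> \<epsilon> z)\<^sup>2)) borel fst = density_measure \<rho>"
          using adm[of \<epsilon>] by (auto simp: admissible_def H1_with_gradient_def)
        from \<eta>(2)[OF this] n \<kappa> show "dist (integral\<^sup>L (density_measure (\<lambda>p. (\<psi> \<epsilon> p)\<^sup>2)) f) (integral\<^sup>L \<gamma> f) < \<kappa>"
          by (simp add: dist_real_def optimal_plan_eq[OF assms(5)])
      qed
    qed
  qed
  moreover have "Limsup (at_right 0) (\<lambda>\<epsilon>. energy u \<epsilon> (\<psi> \<epsilon>) (G \<epsilon>)) \<le> bound"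
  proof (rule ennreal_le_epsilon)
    fix \<eta> :: real assume "0 < \<eta>"
    from ev[OF this] show "Limsup (at_right 0) (\<lambda>\<epsilon>. energy u \<epsilon> (\<psi> \<epsilon>) (G \<epsilon>)) \<le> bound + ennreal \<eta>"
      by (intro Limsup_bounded) (auto elim: eventually_mono)
  qed
  ultimately show ?thesis
    using adm unfolding admissible_def bound_eq_trace[OF assms(5)] marg by blast
qed

end
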